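(* Let $T$ be a complete NIP theory, let $\pi(x)$ be a partial type and $\kappa$ a cardinal. The following are equivalent: (1) $\mathrm{dlr}(\pi)<\kappa$; (2) for every set $A$ (containing the parameters of $\pi$), every family $(I_i:i<\kappa)$ of sequences mutually stable over $A$ and every $a\models\pi$, there is $i<\kappa$ such that $I_i$ is stable over $Aa$; (3) for every set $A$ (containing the parameters of $\pi$), every cardinal $\lambda$, every family $(I_i:i<\lambda)$ of sequences mutually stable over $A$ and every $a\models\pi$, there is $X\subseteq\lambda$ with $|X|<\kappa$ such that the sequences $(I_i:i\in\lambda\setminus X)$ are mutually stable over $Aa$.
   Context: $\mathcal U$ is a monster model of $T$. $I+J$ denotes concatenation. Sequences $(I_i:i<\alpha)$ are mutually indiscernible over $A$ if each $I_i$ is indiscernible over $A\cup\bigcup_{j\neq i}I_j$. A family $(I_i:i<\alpha)$ of indiscernible sequences is mutually stable over $A$ if there exist infinite sequences $J_i^0,J_i^1$ ($i<\alpha$) such that each $J_i^0+I_i+J_i^1$ is indiscernible and the sequences $(J_i^0+J_i^1:i<\alpha)$ are mutually indiscernible over $A$; a single indiscernible sequence $I$ is stable over $A$ if the family $(I)$ is. Op-dimension: $\mathrm{dlr}(\pi)<\kappa$ means, for some (equivalently any) $B$ over which $\pi$ is defined, there do NOT exist $a\models\pi$, a family $(I_i:i<\kappa)$ of sequences mutually indiscernible over $B$ with $I_i=(b^i_j:j\in\mathcal I_i)$, and formulas $\phi_i(x;y_i)\in L(B)$ such that each set $\{j\in\mathcal I_i:\models\phi_i(a;b^i_j)\}$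 is infinite and co-infinite in $\mathcal I_i$. *)

theory Defs
  imports Main
begin

unbundle cardinal_syntax

section \<open>First-order logic with equality\<close>

record ('f, 'r) lang =
  fsyms :: "'f set"
  farity :: "'f \<Rightarrow> nat"
  rsyms :: "'r set"
  rarity :: "'r \<Rightarrow> nat"

datatype 'f trm = Var nat | App 'f "'f trm list"

datatype ('f, 'r) fm =
    Eq "'f trm" "'f trm"
  | Rel 'r "'f trm list"
  | Neg "('f, 'r) fm"
  | Conj "('f, 'r) fm" "('f, 'r) fm"
  | All nat "('f, 'r) fm"

primrec wf_trm :: "('f, 'r) lang \<Rightarrow> 'f trm \<Rightarrow> bool" where
  "wf_trm L (Var v) \<longleftrightarrow> True"
| "wf_trm L (App f ts) \<longleftrightarrow>
     f \<in> fsyms L \<and> length ts = farity L f \<and> list_all (\<lambda>b. b) (map (wf_trm L) ts)"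

primrec wf_fm :: "('f, 'r) lang \<Rightarrow> ('f, 'r) fm \<Rightarrow> bool" where
  "wf_fm L (Eq s t) \<longleftrightarrow> wf_trm L s \<and> wf_trm L t"
| "wf_fm L (Rel R ts) \<longleftrightarrow> R \<in> rsyms L \<and> length ts = rarity L R \<and> (\<forall>t\<in>set ts. wf_trm L t)"
| "wf_fm L (Neg \<phi>) \<longleftrightarrow> wf_fm L \<phi>"
| "wf_fm L (Conj \<phi> \<psi>) \<longleftrightarrow> wf_fm L \<phi> \<and> wf_fm L \<psi>"
| "wf_fm L (All v \<phi>) \<longleftrightarrow> wf_fm L \<phi>"

primrec fv_trm :: "'f trm \<Rightarrow> nat set" where
  "fv_trm (Var v) = {v}"
| "fv_trm (App f ts) = \<Union> (set (map fv_trm ts))"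

primrec fv :: "('f, 'r) fm \<Rightarrow> nat set" where
  "fv (Eq s t) = fv_trm s \<union> fv_trm t"
| "fv (Rel R ts) = \<Union> (fv_trm ` set ts)"
| "fv (Neg \<phi>) = fv \<phi>"
| "fv (Conj \<phi> \<psi>) = fv \<phi> \<union> fv \<psi>"
| "fv (All v \<phi>) = fv \<phi> - {v}"

text \<open>The \<open>L\<close>-formulas in the variables \<open>v\<^sub>0, \<dots>, v\<^sub>n\<^sub>-\<^sub>1\<close>; sentences are the case \<open>n = 0\<close>.\<close>

definition fmlas :: "('f, 'r) lang \<Rightarrow> nat \<Rightarrow> ('f, 'r) fm set" where
  "fmlas L n = {\<phi>. wf_fm L \<phi> \<and> fv \<phi> \<subseteq> {..<n}}"

record ('f, 'r, 'm) struct =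
  univ :: "'m set"
  fint :: "'f \<Rightarrow> 'm list \<Rightarrow> 'm"
  rint :: "'r \<Rightarrow> 'm list \<Rightarrow> bool"

definition structure_of :: "('f, 'r) lang \<Rightarrow> ('f, 'r, 'm) struct \<Rightarrow> bool" where
  "structure_of L M \<longleftrightarrow> univ M \<noteq> {} \<and>
     (\<forall>f\<in>fsyms L. \<forall>xs\<in>lists (univ M). length xs = farity L f \<longrightarrow> fint M f xs \<in> univ M)"

primrec eval_trm :: "('f, 'r, 'm) struct \<Rightarrow> (nat \<Rightarrow> 'm) \<Rightarrow> 'f trm \<Rightarrow> 'm" where
  "eval_trm M e (Var v) = e v"
| "eval_trm M e (App f ts) = fint M f (map (eval_trm M e) ts)"

primrec sat :: "('f, 'r, 'm) struct \<Rightarrow> (nat \<Rightarrow> 'm) \<Rightarrow> ('f, 'r) fm \<Rightarrow> bool" where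
  "sat M e (Eq s t) \<longleftrightarrow> eval_trm M e s = eval_trm M e t"
| "sat M e (Rel R ts) \<longleftrightarrow> rint M R (map (eval_trm M e) ts)"
| "sat M e (Neg \<phi>) \<longleftrightarrow> \<not> sat M e \<phi>"
| "sat M e (Conj \<phi> \<psi>) \<longleftrightarrow> sat M e \<phi> \<and> sat M e \<psi>"
| "sat M e (All v \<phi>) \<longleftrightarrow> (\<forall>x\<in>univ M. sat M (e(v := x)) \<phi>)"

definition model_of :: "('f, 'r) lang \<Rightarrow> ('f, 'r) fm set \<Rightarrow> ('f, 'r, 'm) struct \<Rightarrow> bool" where
  "model_of L T M \<longleftrightarrow> structure_of L M \<and>
     (\<forall>\<phi>\<in>T. \<forall>e. range e \<subseteq> univ M \<longrightarrow> sat M e \<phi>)"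

text \<open>
  HOL cannot quantify over models of all types inside a definition. Since the type of
  formulas is infinite and has at least as many elements as there are \<open>L\<close>-symbols, it is
  enough, by Loewenheim-Skolem, to consider the models whose universe is a subset of that type.
\<close>

definition entails :: "('f, 'r) lang \<Rightarrow> ('f, 'r) fm set \<Rightarrow> ('f, 'r) fm \<Rightarrow> bool" where
  "entails L T \<phi> \<longleftrightarrow>
     (\<forall>M :: ('f, 'r, ('f, 'r) fm) struct. model_of L T M \<longrightarrow> model_of L {\<phi>} M)"

definition complete_theory :: "('f, 'r) lang \<Rightarrow> ('f, 'r) fm set \<Rightarrow> bool" where
  "complete_theory L T \<longleftrightarrow> T \<subseteq> fmlas L 0 \<and>
     (\<exists>M :: ('f, 'r, ('f, 'r) fm) struct. model_of L T M) \<and>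
     (\<forall>\<phi>\<in>fmlas L 0. entails L T \<phi> \<or> entails L T (Neg \<phi>))"

section \<open>Formulas with parameters and partial types\<close>

text \<open>
  Tuples are finite and represented as lists. A pair \<open>(\<phi>, c)\<close> stands for the formula
  \<open>\<phi>(x; c)\<close> with parameters \<open>c\<close>: the variables of \<open>x = (x\<^sub>0, \<dots>, x\<^sub>n\<^sub>-\<^sub>1)\<close> are
  \<open>v\<^sub>0, \<dots>, v\<^sub>n\<^sub>-\<^sub>1\<close>, and the parameters are substituted for the variables from \<open>v\<^sub>n\<close> on.
\<close>

type_synonym ('f, 'r, 'm) pfm = "('f, 'r) fm \<times> 'm list"

definition pfmlas :: "('f, 'r) lang \<Rightarrow> 'm set \<Rightarrow> nat \<Rightarrow> ('f, 'r, 'm) pfm set" where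
  "pfmlas L B n = {(\<phi>, c). c \<in> lists B \<and> \<phi> \<in> fmlas L (n + length c)}"

definition psat :: "('f, 'r, 'm) struct \<Rightarrow> ('f, 'r, 'm) pfm \<Rightarrow> 'm list \<Rightarrow> bool" where
  "psat M p a \<longleftrightarrow> sat M (\<lambda>i. (a @ snd p) ! i) (fst p)"

definition params :: "('f, 'r, 'm) pfm set \<Rightarrow> 'm set" where
  "params \<pi> = (\<Union>p\<in>\<pi>. set (snd p))"

definition tuples :: "('f, 'r, 'm) struct \<Rightarrow> nat \<Rightarrow> 'm list set" where
  "tuples M n = {a \<in> lists (univ M). length a = n}"

definition realizes :: "('f, 'r, 'm) struct \<Rightarrow> nat \<Rightarrow> ('f, 'r, 'm) pfm set \<Rightarrow> 'm list \<Rightarrow> bool" where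
  "realizes M n \<pi> a \<longleftrightarrow> a \<in> tuples M n \<and> (\<forall>p\<in>\<pi>. psat M p a)"

definition partial_type_over ::
    "('f, 'r) lang \<Rightarrow> ('f, 'r, 'm) struct \<Rightarrow> 'm set \<Rightarrow> nat \<Rightarrow> ('f, 'r, 'm) pfm set \<Rightarrow> bool" where
  "partial_type_over L M B n \<pi> \<longleftrightarrow> \<pi> \<subseteq> pfmlas L B n \<and>
     (\<forall>\<pi>0\<subseteq>\<pi>. finite \<pi>0 \<longrightarrow> (\<exists>a. realizes M n \<pi>0 a))"

section \<open>Monster models\<close>

text \<open>
  The cardinal \<open>kb\<close> measures smallness: subsets of the monster model, index orders of sequences
  and families of sequences are small if they have cardinality less than \<open>kb\<close>. Every small
  linear order or cardinal is isomorphic to one on a subset of the carrier type of \<open>kb\<close>.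
\<close>

definition small_subset :: "('f, 'r, 'm) struct \<Rightarrow> 'k rel \<Rightarrow> 'm set \<Rightarrow> bool" where
  "small_subset M kb A \<longleftrightarrow> A \<subseteq> univ M \<and> |A| <o kb"

definition saturated :: "('f, 'r) lang \<Rightarrow> ('f, 'r, 'm) struct \<Rightarrow> 'k rel \<Rightarrow> bool" where
  "saturated L M kb \<longleftrightarrow>
     (\<forall>A n \<pi>. small_subset M kb A \<and> partial_type_over L M A n \<pi> \<longrightarrow> (\<exists>a. realizes M n \<pi> a))"

definition automorphism :: "('f, 'r) lang \<Rightarrow> ('f, 'r, 'm) struct \<Rightarrow> ('m \<Rightarrow> 'm) \<Rightarrow> bool" where
  "automorphism L M \<sigma> \<longleftrightarrow> bij_betw \<sigma> (univ M) (univ M) \<and>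
     (\<forall>f\<in>fsyms L. \<forall>xs\<in>tuples M (farity L f). \<sigma> (fint M f xs) = fint M f (map \<sigma> xs)) \<and>
     (\<forall>R\<in>rsyms L. \<forall>xs\<in>tuples M (rarity L R). rint M R xs \<longleftrightarrow> rint M R (map \<sigma> xs))"

definition elementary_map ::
    "('f, 'r) lang \<Rightarrow> ('f, 'r, 'm) struct \<Rightarrow> 'm set \<Rightarrow> ('m \<Rightarrow> 'm) \<Rightarrow> bool" where
  "elementary_map L M A g \<longleftrightarrow> g ` A \<subseteq> univ M \<and>
     (\<forall>c\<in>lists A. \<forall>\<phi>\<in>fmlas L (length c).
        sat M (\<lambda>i. c ! i) \<phi> \<longleftrightarrow> sat M (\<lambda>i. map g c ! i) \<phi>)"

definition strongly_homogeneous :: "('f, 'r) lang \<Rightarrow> ('f, 'r, 'm) struct \<Rightarrow> 'k rel \<Rightarrow> bool" where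
  "strongly_homogeneous L M kb \<longleftrightarrow>
     (\<forall>A g. small_subset M kb A \<and> elementary_map L M A g \<longrightarrow>
        (\<exists>\<sigma>. automorphism L M \<sigma> \<and> (\<forall>x\<in>A. \<sigma> x = g x)))"

text \<open>
  The number of \<open>L\<close>-formulas is \<open>|T| = |L| + \<aleph>\<^sub>0\<close>. Regularity of \<open>kb\<close> makes the union
  of a small family of small sets small.
\<close>

definition monster_model ::
    "('f, 'r) lang \<Rightarrow> ('f, 'r) fm set \<Rightarrow> ('f, 'r, 'm) struct \<Rightarrow> 'k rel \<Rightarrow> bool" where
  "monster_model L T U kb \<longleftrightarrow>
     Card_order kb \<and> regularCard kb \<and> |{\<phi> :: ('f, 'r) fm. wf_fm L \<phi>}| <o kb \<and>
     model_of L T U \<and> saturated L U kb \<and> strongly_homogeneous L U kb"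

text \<open>
  A complete theory is NIP if, in its monster model, no formula \<open>\<phi>(x; y)\<close> shatters an infinite
  set of tuples.
\<close>

definition shatters ::
    "('f, 'r, 'm) struct \<Rightarrow> nat \<Rightarrow> ('f, 'r) fm \<Rightarrow> 'm list set \<Rightarrow> bool" where
  "shatters M m \<phi> S \<longleftrightarrow>
     (\<forall>S0\<subseteq>S. \<exists>b\<in>tuples M m. \<forall>a\<in>S. sat M (\<lambda>i. (a @ b) ! i) \<phi> \<longleftrightarrow> a \<in> S0)"

definition NIP :: "('f, 'r) lang \<Rightarrow> ('f, 'r, 'm) struct \<Rightarrow> bool" where
  "NIP L U \<longleftrightarrow>
     (\<forall>n m. \<forall>\<phi>\<in>fmlas L (n + m). \<not> (\<exists>S\<subseteq>tuples U n. infinite S \<and> shatters U m \<phi> S))"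

section \<open>Indiscernible sequences\<close>

text \<open>
  A sequence is a reflexive linear order \<open>r\<close>, whose field is the index set, together with a
  tuple for each index; values outside the index set are irrelevant.
\<close>

type_synonym ('i, 'm) tseq = "'i rel \<times> ('i \<Rightarrow> 'm list)"

abbreviation idx :: "('i, 'm) tseq \<Rightarrow> 'i set" where
  "idx I \<equiv> Field (fst I)"

definition elems :: "('i, 'm) tseq \<Rightarrow> 'm set" where
  "elems I = (\<Union>j\<in>idx I. set (snd I j))"

definition sequence_of :: "('f, 'r, 'm) struct \<Rightarrow> nat \<Rightarrow> ('i, 'm) tseq \<Rightarrow> bool" where
  "sequence_of M m I \<longleftrightarrow> Linear_order (fst I) \<and> snd I ` idx I \<subseteq> tuples M m"

definition seq_append :: "('i, 'm) tseq \<Rightarrow> ('j, 'm) tseq \<Rightarrow> ('i + 'j, 'm) tseq"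
    (infixl \<open>\<oplus>\<^sub>s\<close> 65) where
  "I \<oplus>\<^sub>s J =
     (map_prod Inl Inl ` fst I \<union> map_prod Inr Inr ` fst J \<union> (Inl ` idx I) \<times> (Inr ` idx J),
      case_sum (snd I) (snd J))"

definition increasing :: "'i rel \<Rightarrow> 'i list \<Rightarrow> bool" where
  "increasing r js \<longleftrightarrow> set js \<subseteq> Field r \<and> sorted_wrt (\<lambda>i j. (i, j) \<in> r \<and> i \<noteq> j) js"

definition indiscernible ::
    "('f, 'r) lang \<Rightarrow> ('f, 'r, 'm) struct \<Rightarrow> 'm set \<Rightarrow> ('i, 'm) tseq \<Rightarrow> bool" where
  "indiscernible L M A I \<longleftrightarrow> (\<exists>m. sequence_of M m I \<and>
     (\<forall>is js. increasing (fst I) is \<and> increasing (fst I) js \<and> length is = length js \<longrightarrow>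
        (\<forall>p\<in>pfmlas L A (length is * m).
           psat M p (concat (map (snd I) is)) \<longleftrightarrow> psat M p (concat (map (snd I) js)))))"

definition mutually_indiscernible ::
    "('f, 'r) lang \<Rightarrow> ('f, 'r, 'm) struct \<Rightarrow> 'm set \<Rightarrow> 'x set \<Rightarrow> ('x \<Rightarrow> ('i, 'm) tseq) \<Rightarrow> bool" where
  "mutually_indiscernible L M A X I \<longleftrightarrow>
     (\<forall>i\<in>X. indiscernible L M (A \<union> (\<Union>j\<in>X - {i}. elems (I j))) (I i))"

definition small_seq :: "'k rel \<Rightarrow> ('i, 'm) tseq \<Rightarrow> bool" where
  "small_seq kb I \<longleftrightarrow> |idx I| <o kb"

definition mutually_stable ::
    "('f, 'r) lang \<Rightarrow> ('f, 'r, 'm) struct \<Rightarrow> 'k rel \<Rightarrow> 'm set \<Rightarrow> 'x set \<Rightarrow>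
      ('x \<Rightarrow> ('k, 'm) tseq) \<Rightarrow> bool" where
  "mutually_stable L U kb A X I \<longleftrightarrow>
     (\<forall>i\<in>X. small_seq kb (I i) \<and> indiscernible L U {} (I i)) \<and>
     (\<exists>(J0 :: 'x \<Rightarrow> ('k, 'm) tseq) (J1 :: 'x \<Rightarrow> ('k, 'm) tseq).
        (\<forall>i\<in>X. small_seq kb (J0 i) \<and> small_seq kb (J1 i) \<and>
           infinite (idx (J0 i)) \<and> infinite (idx (J1 i)) \<and>
           indiscernible L U {} (J0 i \<oplus>\<^sub>s I i \<oplus>\<^sub>s J1 i)) \<and>
        mutually_indiscernible L U A X (\<lambda>i. J0 i \<oplus>\<^sub>s J1 i))"

definition stable_over ::
    "('f, 'r) lang \<Rightarrow> ('f, 'r, 'm) struct \<Rightarrow> 'k rel \<Rightarrow> 'm set \<Rightarrow> ('k, 'm) tseq \<Rightarrow> bool" where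
  "stable_over L U kb A I \<longleftrightarrow> mutually_stable L U kb A {()} (\<lambda>_. I)"

section \<open>Op-dimension\<close>

text \<open>
  Cardinals are relations satisfying \<^const>\<open>Card_order\<close>; the ordinals \<open>i < \<kappa>\<close> are the
  elements of \<open>Field \<kappa>\<close>.
\<close>

definition dlr_pattern ::
    "('f, 'r) lang \<Rightarrow> ('f, 'r, 'm) struct \<Rightarrow> 'k rel \<Rightarrow> 'm set \<Rightarrow> nat \<Rightarrow> ('f, 'r, 'm) pfm set \<Rightarrow>
      'k rel \<Rightarrow> bool" where
  "dlr_pattern L U kb B n \<pi> \<kappa> \<longleftrightarrow>
     (\<exists>a (I :: 'k \<Rightarrow> ('k, 'm) tseq) m \<phi>.
        realizes U n \<pi> a \<and>
        mutually_indiscernible L U B (Field \<kappa>) I \<and>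
        (\<forall>i\<in>Field \<kappa>. small_seq kb (I i) \<and> sequence_of U (m i) (I i) \<and>
           \<phi> i \<in> pfmlas L B (n + m i) \<and>
           infinite {j \<in> idx (I i). psat U (\<phi> i) (a @ snd (I i) j)} \<and>
           infinite {j \<in> idx (I i). \<not> psat U (\<phi> i) (a @ snd (I i) j)}))"

definition dlr_less ::
    "('f, 'r) lang \<Rightarrow> ('f, 'r, 'm) struct \<Rightarrow> 'k rel \<Rightarrow> nat \<Rightarrow> ('f, 'r, 'm) pfm set \<Rightarrow>
      'k rel \<Rightarrow> bool" where
  "dlr_less L U kb n \<pi> \<kappa> \<longleftrightarrow>
     (\<exists>B. small_subset U kb B \<and> params \<pi> \<subseteq> B \<and> \<not> dlr_pattern L U kb B n \<pi> \<kappa>)"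

end

theory Submission
  imports Defs Complex_Main "HOL-Library.Ramsey" "HOL-Library.Product_Lexorder" "HOL-Library.Countable_Set"
begin

text \<open>
  (3) implies (2) by taking \<open>\<lambda> = \<kappa>\<close>. For (1) implies (3), choose the outer sequences \<open>J\<^sup>0\<^sub>i\<close> and \<open>J\<^sup>1\<^sub>i\<close> as
  mutually indiscernible over \<open>A\<close>, \<open>a\<close> and all the \<open>I\<^sub>i\<close>. If \<open>J\<^sup>0\<^sub>i + J\<^sup>1\<^sub>i\<close> is not indiscernible over \<open>a\<close> and
  the other sequences, some formula with parameters in \<open>a\<close>, \<open>A\<close> and elements far from the cut is true on
  the end of \<open>J\<^sup>0\<^sub>i\<close> and false on the beginning of \<open>J\<^sup>1\<^sub>i\<close>; \<open>\<kappa>\<close> such indices would form a pattern as in the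
  definition of op-dimension. For (2) implies (1), a pattern is a mutually stable family, and none of
  its members is stable over \<open>Aa\<close>: if \<open>J\<^sup>0 + I + J\<^sup>1\<close> is indiscernible and \<open>J\<^sup>0 + J\<^sup>1\<close> is indiscernible over
  \<open>a\<close>, every formula over \<open>a\<close> is finite or cofinite on \<open>I\<close>.

  The last fact is where NIP enters. Otherwise finite sequences on which \<open>\<phi>(a, y)\<close> is false could be
  inserted in every cut of an \<open>a\<close>-indiscernible sequence on which it is true. Bounded alternation then
  yields finitely many rows with a gap, and in each gap a finite sequence, such that no choice of one
  new element inside each of these sequences can be inserted simultaneously. The rows are removed one
  at a time, since nested copies of the sequence in the last row, each inconsistent with its own tuple in
  the other rows, again lead to a formula that alternates too often.
\<close>

section \<open>Renaming variables\<close>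

lemma finite_fv_trm: "finite (fv_trm t)"
  by (induction t) auto

lemma finite_fv: "finite (fv \<phi>)"
  by (induction \<phi>) (auto simp: finite_fv_trm)

lemma eval_trm_cong: "(\<And>v. v \<in> fv_trm t \<Longrightarrow> e v = e' v) \<Longrightarrow> eval_trm M e t = eval_trm M e' t"
proof (induction t)
  case (App f ts)
  hence "map (eval_trm M e) ts = map (eval_trm M e') ts" by auto
  thus ?case by (metis eval_trm.simps(2))
qed simp

lemma sat_cong: "(\<And>v. v \<in> fv \<phi> \<Longrightarrow> e v = e' v) \<Longrightarrow> sat M e \<phi> = sat M e' \<phi>"
proof (induction \<phi> arbitrary: e e')
  case (Eq s t)
  thus ?case using eval_trm_cong[of s e e' M] eval_trm_cong[of t e e' M] by auto
next
  case (Rel R ts)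
  hence "map (eval_trm M e) ts = map (eval_trm M e') ts"
    by (auto intro!: eval_trm_cong)
  thus ?case by (metis sat.simps(2))
next
  case (Neg \<phi>)
  thus ?case by (metis fv.simps(3) sat.simps(3))
next
  case (Conj \<phi> \<psi>)
  thus ?case by (metis UnI1 UnI2 fv.simps(4) sat.simps(4))
next
  case (All v \<phi>)
  have "sat M (e(v := x)) \<phi> = sat M (e'(v := x)) \<phi>" for x
    by (rule All.IH) (use All.prems in auto)
  thus ?case by simp
qed

primrec rename_trm :: "(nat \<Rightarrow> nat) \<Rightarrow> 'f trm \<Rightarrow> 'f trm" where
  "rename_trm g (Var v) = Var (g v)"
| "rename_trm g (App f ts) = App f (map (rename_trm g) ts)"

lemma wf_rename_trm: "wf_trm L t \<Longrightarrow> wf_trm L (rename_trm g t)"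
  by (induction t) (auto simp: list_all_iff)

lemma fv_rename_trm: "fv_trm (rename_trm g t) = g ` fv_trm t"
  by (induction t) auto

lemma eval_rename_trm: "eval_trm M e (rename_trm g t) = eval_trm M (e \<circ> g) t"
proof (induction t)
  case (App f ts)
  hence "map (eval_trm M e \<circ> rename_trm g) ts = map (eval_trm M (e \<circ> g)) ts"
    by (simp del: comp_apply add: comp_apply[of _ "rename_trm g"])
  thus ?case by (metis eval_trm.simps(2) list.map_comp rename_trm.simps(2))
qed (simp add: comp_def)

lemma ex_renamed_fm:
  "wf_fm L \<phi> \<Longrightarrow>
   \<exists>\<phi>'. wf_fm L \<phi>' \<and> fv \<phi>' \<subseteq> g ` fv \<phi> \<and> (\<forall>e. sat M e \<phi>' \<longleftrightarrow> sat M (e \<circ> g) \<phi>)"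
proof (induction \<phi> arbitrary: g)
  case (Eq s t)
  thus ?case
    by (intro exI[of _ "Eq (rename_trm g s) (rename_trm g t)"])
      (auto simp: wf_rename_trm fv_rename_trm eval_rename_trm comp_def)
next
  case (Rel R ts)
  have "map (eval_trm M e) (map (rename_trm g) ts) = map (eval_trm M (e \<circ> g)) ts" for e
    by (auto simp: eval_rename_trm simp del: comp_apply intro: comp_apply[THEN trans])
  hence "sat M e (Rel R (map (rename_trm g) ts)) = sat M (e \<circ> g) (Rel R ts)" for e
    by (metis sat.simps(2))
  moreover have "fv (Rel R (map (rename_trm g) ts)) \<subseteq> g ` fv (Rel R ts)"
    by (auto simp: fv_rename_trm)
  moreover have "wf_fm L (Rel R (map (rename_trm g) ts))"
    using Rel by (auto simp: wf_rename_trm)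
  ultimately show ?case by blast
next
  case (Neg \<phi>)
  then obtain \<phi>' where "wf_fm L \<phi>'" "fv \<phi>' \<subseteq> g ` fv \<phi>" "\<forall>e. sat M e \<phi>' \<longleftrightarrow> sat M (e \<circ> g) \<phi>"
    by (metis wf_fm.simps(3))
  thus ?case by (intro exI[of _ "Neg \<phi>'"]) (auto simp: comp_def)
next
  case (Conj \<phi> \<psi>)
  then obtain \<phi>' \<psi>' where "wf_fm L \<phi>'" "fv \<phi>' \<subseteq> g ` fv \<phi>" "\<forall>e. sat M e \<phi>' \<longleftrightarrow> sat M (e \<circ> g) \<phi>"
    "wf_fm L \<psi>'" "fv \<psi>' \<subseteq> g ` fv \<psi>" "\<forall>e. sat M e \<psi>' \<longleftrightarrow> sat M (e \<circ> g) \<psi>"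
    by (metis wf_fm.simps(4))
  thus ?case by (intro exI[of _ "Conj \<phi>' \<psi>'"]) (auto simp: comp_def)
next
  case (All v \<phi>)
  obtain w where w: "w \<notin> g ` fv \<phi>"
    using finite_fv[of \<phi>] ex_new_if_finite[of "g ` fv \<phi>"] by auto
  obtain \<phi>' where \<phi>': "wf_fm L \<phi>'" "fv \<phi>' \<subseteq> g(v := w) ` fv \<phi>"
      "\<And>e. sat M e \<phi>' \<longleftrightarrow> sat M (e \<circ> g(v := w)) \<phi>"
    using All.IH[of "g(v := w)"] All.prems by (metis wf_fm.simps(5))
  have "sat M (e(w := x)) \<phi>' \<longleftrightarrow> sat M ((e \<circ> g)(v := x)) \<phi>" for e x
    unfolding \<phi>'(3) using w by (intro sat_cong) auto
  hence "sat M e (All w \<phi>') = sat M (e \<circ> g) (All v \<phi>)" for e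
    unfolding sat.simps by simp
  moreover have "fv (All w \<phi>') \<subseteq> g ` fv (All v \<phi>)" using \<phi>'(2) by (auto split: if_splits)
  ultimately show ?case using \<phi>'(1) by (metis wf_fm.simps(5))
qed

text \<open>Underspecified for elements that do not occur in the list.\<close>

definition index_of :: "'a list \<Rightarrow> 'a \<Rightarrow> nat" where
  "index_of xs x = (SOME i. i < length xs \<and> xs ! i = x)"

lemma index_of:
  assumes "x \<in> set xs"
  shows "index_of xs x < length xs" "xs ! index_of xs x = x"
  using someI_ex[OF assms[unfolded in_set_conv_nth]] by (simp_all add: index_of_def)

section \<open>Definable predicates on environments\<close>

locale struct_env =
  fixes L :: "('f, 'r) lang" and U :: "('f, 'r, 'm) struct"
  assumes univ_nonempty: "univ U \<noteq> {}"
begin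

definition envs :: "('v \<Rightarrow> 'm) set" where
  "envs = {h. range h \<subseteq> univ U}"

text \<open>
  On environments in \<open>U\<close>, the predicate \<open>P\<close> is given by the formula \<open>\<phi>\<close> with parameters in \<open>A\<close>,
  whose free variables are read off at elements of \<open>S\<close>: \<open>f\<close> maps a variable to its place in \<open>S\<close>
  or to the parameter substituted for it.
\<close>

definition defined_by ::
    "'m set \<Rightarrow> 'v set \<Rightarrow> (('v \<Rightarrow> 'm) \<Rightarrow> bool) \<Rightarrow> ('f, 'r) fm \<Rightarrow> (nat \<Rightarrow> 'v + 'm) \<Rightarrow> bool" where
  "defined_by A S P \<phi> f \<longleftrightarrow> wf_fm L \<phi> \<and> (\<forall>i\<in>fv \<phi>. f i \<in> Inl ` S \<union> Inr ` A) \<and>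
     (\<forall>h\<in>envs. P h \<longleftrightarrow> sat U (\<lambda>i. case_sum h id (f i)) \<phi>)"

definition definable :: "'m set \<Rightarrow> 'v set \<Rightarrow> (('v \<Rightarrow> 'm) \<Rightarrow> bool) \<Rightarrow> bool" where
  "definable A S P \<longleftrightarrow> (\<exists>\<phi> f. defined_by A S P \<phi> f)"

definition tp_eq :: "'m set \<Rightarrow> 'v set \<Rightarrow> ('v \<Rightarrow> 'm) \<Rightarrow> ('v \<Rightarrow> 'm) \<Rightarrow> bool" where
  "tp_eq A S h h' \<longleftrightarrow> (\<forall>P. definable A S P \<longrightarrow> (P h \<longleftrightarrow> P h'))"

lemma envsI: "(\<And>v. h v \<in> univ U) \<Longrightarrow> h \<in> envs"
  by (auto simp: envs_def)

lemma envsD: "h \<in> envs \<Longrightarrow> h v \<in> univ U"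
  by (auto simp: envs_def)

lemma envs_comp: "h \<in> envs \<Longrightarrow> h \<circ> g \<in> envs"
  by (auto simp: envs_def)

lemma envs_upd: "h \<in> envs \<Longrightarrow> x \<in> univ U \<Longrightarrow> h(v := x) \<in> envs"
  by (auto simp: envs_def)

lemma envs_merge: "h \<in> envs \<Longrightarrow> h' \<in> envs \<Longrightarrow> (\<lambda>v. if Q v then h v else h' v) \<in> envs"
  by (auto simp: envs_def)

lemma envs_case_sum: "h \<in> envs \<Longrightarrow> h' \<in> envs \<Longrightarrow> case_sum h h' \<in> envs"
  by (rule envsI) (auto split: sum.splits intro: envsD)

lemma defined_byD:
  assumes "defined_by A S P \<phi> f"
  shows "wf_fm L \<phi>" "\<forall>i\<in>fv \<phi>. f i \<in> Inl ` S \<union> Inr ` A"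
    "\<forall>h\<in>envs. P h \<longleftrightarrow> sat U (\<lambda>i. case_sum h id (f i)) \<phi>"
  using assms by (auto simp: defined_by_def)

lemma definableI:
  assumes "wf_fm L \<phi>" "\<And>i. i \<in> fv \<phi> \<Longrightarrow> f i \<in> Inl ` S \<union> Inr ` A"
    "\<And>h. h \<in> envs \<Longrightarrow> P h \<longleftrightarrow> sat U (\<lambda>i. case_sum h id (f i)) \<phi>"
  shows "definable A S P"
  unfolding definable_def defined_by_def using assms by blast

lemma definable_mono:
  assumes "definable A S P" "A \<subseteq> A'" "S \<subseteq> S'"
  shows "definable A' S' P"
proof -
  obtain \<phi> f where "defined_by A S P \<phi> f" using assms(1) unfolding definable_def by blast
  note f = defined_byD[OF this]
  have "f i \<in> Inl ` S' \<union> Inr ` A'" if "i \<in> fv \<phi>" for i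
    using f(2) that assms(2,3) by blast
  thus ?thesis using definableI[of \<phi> f S' A' P] f(1,3) by simp
qed

lemma definable_cong:
  assumes "definable A S P" "\<And>h. h \<in> envs \<Longrightarrow> P h \<longleftrightarrow> Q h"
  shows "definable A S Q"
  using assms unfolding definable_def defined_by_def by simp

lemma definable_finite_support:
  assumes "definable A S P"
  shows "\<exists>S0. finite S0 \<and> S0 \<subseteq> S \<and> definable A S0 P"
proof -
  obtain \<phi> f where "defined_by A S P \<phi> f" using assms unfolding definable_def by blast
  note f = defined_byD[OF this]
  define S0 where "S0 = {v\<in>S. Inl v \<in> f ` fv \<phi>}"
  have "finite (Inl ` S0 :: ('a + 'm) set)"
    by (rule finite_subset[of _ "f ` fv \<phi>"]) (auto simp: S0_def finite_fv)
  hence "finite S0" by (rule finite_imageD) simp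
  moreover have "definable A S0 P"
    by (rule definableI[OF f(1)]) (use f(2,3) in \<open>force simp: S0_def\<close>)+
  ultimately show ?thesis by (intro exI[of _ S0]) (auto simp: S0_def)
qed

lemma definable_local:
  assumes "definable A S P" "h \<in> envs" "h' \<in> envs" "\<And>v. v \<in> S \<Longrightarrow> h v = h' v"
  shows "P h = P h'"
proof -
  obtain \<phi> f where "defined_by A S P \<phi> f" using assms(1) unfolding definable_def by blast
  note f = defined_byD[OF this]
  have "sat U (\<lambda>i. case_sum h id (f i)) \<phi> \<longleftrightarrow> sat U (\<lambda>i. case_sum h' id (f i)) \<phi>"
    by (rule sat_cong) (use f(2) assms(4) in force)
  with f assms show ?thesis by auto
qed

lemma definable_subst:
  assumes "definable A S P" "\<And>v c. g v = Inr c \<Longrightarrow> c \<in> univ U"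
    and "\<And>v. v \<in> S \<Longrightarrow> g v \<in> Inl ` S' \<union> Inr ` A'" "A \<subseteq> A'"
  shows "definable A' S' (\<lambda>h. P (\<lambda>v. case_sum h id (g v)))"
proof -
  obtain \<phi> f where "defined_by A S P \<phi> f" using assms(1) unfolding definable_def by blast
  note f = defined_byD[OF this]
  define f' where "f' i = (case f i of Inl v \<Rightarrow> g v | Inr c \<Rightarrow> Inr c)" for i
  show ?thesis
  proof (rule definableI[OF f(1)])
    show "f' i \<in> Inl ` S' \<union> Inr ` A'" if "i \<in> fv \<phi>" for i
      unfolding f'_def using assms(3,4) f(2) that by (fastforce split: sum.splits)
    fix h :: "'b \<Rightarrow> 'm" assume "h \<in> envs"
    hence "(\<lambda>v. case_sum h id (g v)) \<in> envs"
      using assms(2) by (intro envsI) (auto split: sum.splits simp: envsD)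
    moreover have "(\<lambda>i. case_sum (\<lambda>v. case_sum h id (g v)) id (f i)) = (\<lambda>i. case_sum h id (f' i))"
      by (rule ext) (auto simp: f'_def split: sum.splits)
    ultimately show "P (\<lambda>v. case_sum h id (g v)) \<longleftrightarrow> sat U (\<lambda>i. case_sum h id (f' i)) \<phi>"
      using f(3) by auto
  qed
qed

lemma definable_reindex:
  assumes "definable A S P" "g ` S \<subseteq> S'"
  shows "definable A S' (\<lambda>h. P (h \<circ> g))"
proof -
  have "definable A S' (\<lambda>h. P (\<lambda>v. case_sum h id (Inl (g v))))"
    by (rule definable_subst[OF assms(1)]) (use assms(2) in auto)
  thus ?thesis by (simp add: comp_def)
qed

lemma definable_fix:
  assumes "definable A S P" "c \<in> envs" "A \<subseteq> A'" "c ` (S \<inter> T) \<subseteq> A'" "S - T \<subseteq> S'"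
  shows "definable A' S' (\<lambda>h. P (\<lambda>v. if v \<in> T then c v else h v))"
proof -
  have "definable A' S' (\<lambda>h. P (\<lambda>v. case_sum h id (if v \<in> T then Inr (c v) else Inl v)))"
    by (rule definable_subst[OF assms(1)]) (use assms envsD in \<open>auto split: if_splits\<close>)
  thus ?thesis by (rule definable_cong) (rule arg_cong[of _ _ P], auto)
qed

lemma definable_unfix:
  assumes "definable (A \<union> c ` T) S P"
  shows "\<exists>Q. definable A (S \<union> T) Q \<and> (\<forall>h\<in>envs. (\<forall>v\<in>T. h v = c v) \<longrightarrow> (Q h \<longleftrightarrow> P h))"
proof -
  obtain \<phi> f where "defined_by (A \<union> c ` T) S P \<phi> f" using assms unfolding definable_def by blast
  note f = defined_byD[OF this]
  define f' where "f' i = (case f i of Inl v \<Rightarrow> Inl v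
      | Inr d \<Rightarrow> if d \<in> A then Inr d else Inl (inv_into T c d))" for i
  have cases: "(\<exists>v\<in>S. f i = Inl v) \<or> (\<exists>d\<in>A. f i = Inr d) \<or> (\<exists>d\<in>c ` T - A. f i = Inr d)"
    if "i \<in> fv \<phi>" for i using f(2) that by blast
  have "definable A (S \<union> T) (\<lambda>h. sat U (\<lambda>i. case_sum h id (f' i)) \<phi>)"
  proof (rule definableI[OF f(1)])
    show "f' i \<in> Inl ` (S \<union> T) \<union> Inr ` A" if "i \<in> fv \<phi>" for i
      using cases[OF that] by (auto simp: f'_def inv_into_into)
  qed simp
  moreover have "sat U (\<lambda>i. case_sum h id (f' i)) \<phi> \<longleftrightarrow> P h"
    if h: "h \<in> envs" "\<forall>v\<in>T. h v = c v" for h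
  proof -
    have "sat U (\<lambda>i. case_sum h id (f' i)) \<phi> \<longleftrightarrow> sat U (\<lambda>i. case_sum h id (f i)) \<phi>"
    proof (rule sat_cong)
      have inv: "h (inv_into T c d) = d" if "d \<in> c ` T" for d
        using h(2) inv_into_into[OF that] f_inv_into_f[OF that] by simp
      fix i assume "i \<in> fv \<phi>"
      from cases[OF this] show "case_sum h id (f' i) = case_sum h id (f i)"
        by (auto simp: f'_def inv)
    qed
    thus ?thesis using f(3) h(1) by blast
  qed
  ultimately show ?thesis by blast
qed

lemma definable_Neg:
  assumes "definable A S P"
  shows "definable A S (\<lambda>h. \<not> P h)"
proof -
  obtain \<phi> f where "defined_by A S P \<phi> f" using assms unfolding definable_def by blast
  note f = defined_byD[OF this]
  show ?thesis by (rule definableI[of "Neg \<phi>" f]) (use f in auto)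
qed

lemma definable_Conj:
  assumes "definable A S P" "definable A S Q"
  shows "definable A S (\<lambda>h. P h \<and> Q h)"
proof -
  obtain \<phi> f where "defined_by A S P \<phi> f" using assms(1) unfolding definable_def by blast
  note f = defined_byD[OF this]
  obtain \<psi> g where "defined_by A S Q \<psi> g" using assms(2) unfolding definable_def by blast
  note g = defined_byD[OF this]
  obtain \<phi>' where \<phi>': "wf_fm L \<phi>'" "fv \<phi>' \<subseteq> (\<lambda>i. 2 * i) ` fv \<phi>"
    "\<And>e. sat U e \<phi>' \<longleftrightarrow> sat U (e \<circ> (\<lambda>i. 2 * i)) \<phi>"
    using ex_renamed_fm[OF f(1), of "\<lambda>i. 2 * i" U] by blast
  obtain \<psi>' where \<psi>': "wf_fm L \<psi>'" "fv \<psi>' \<subseteq> (\<lambda>i. Suc (2 * i)) ` fv \<psi>"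
    "\<And>e. sat U e \<psi>' \<longleftrightarrow> sat U (e \<circ> (\<lambda>i. Suc (2 * i))) \<psi>"
    using ex_renamed_fm[OF g(1), of "\<lambda>i. Suc (2 * i)" U] by blast
  define k where "k i = (if even i then f (i div 2) else g (i div 2))" for i :: nat
  have k: "k (2 * i) = f i" "k (Suc (2 * i)) = g i" for i
    by (auto simp: k_def)
  show ?thesis
  proof (rule definableI[of "Conj \<phi>' \<psi>'" k])
    show "wf_fm L (Conj \<phi>' \<psi>')" using \<phi>' \<psi>' by simp
    fix i assume "i \<in> fv (Conj \<phi>' \<psi>')"
    hence "i \<in> (\<lambda>i. 2 * i) ` fv \<phi> \<or> i \<in> (\<lambda>i. Suc (2 * i)) ` fv \<psi>"
      using \<phi>'(2) \<psi>'(2) by auto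
    thus "k i \<in> Inl ` S \<union> Inr ` A" using f(2) g(2) k by auto
  qed (use f(3) g(3) in \<open>simp add: \<phi>'(3) \<psi>'(3) comp_def k\<close>)
qed

lemma definable_const: "definable A S (\<lambda>h. b)"
proof -
  have "definable A S (\<lambda>h. True)"
    by (rule definableI[of "All 0 (Eq (Var 0) (Var 0))"]) auto
  thus ?thesis using definable_Neg[of A S "\<lambda>h. True"] by (cases b) auto
qed

lemma definable_Ball:
  assumes "finite \<Sigma>" "\<And>p. p \<in> \<Sigma> \<Longrightarrow> definable A S (F p)"
  shows "definable A S (\<lambda>h. \<forall>p\<in>\<Sigma>. F p h)"
  using assms
proof (induction \<Sigma>)
  case (insert p \<Sigma>)
  thus ?case using definable_Conj[of A S "F p" "\<lambda>h. \<forall>p\<in>\<Sigma>. F p h"] by simp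
qed (simp add: definable_const)

lemma definable_iff:
  assumes "definable A S P" "definable A S Q"
  shows "definable A S (\<lambda>h. P h \<longleftrightarrow> Q h)"
  by (rule definable_cong[OF definable_Conj[OF
        definable_Neg[OF definable_Conj[OF assms(1) definable_Neg[OF assms(2)]]]
        definable_Neg[OF definable_Conj[OF assms(2) definable_Neg[OF assms(1)]]]]]) auto

lemma definable_eq_const: "v \<in> S \<Longrightarrow> c \<in> A \<Longrightarrow> definable A S (\<lambda>h. h v = c)"
  by (rule definableI[of "Eq (Var 0) (Var 1)" "\<lambda>i. if i = 0 then Inl v else Inr c"]) auto

lemma definable_Ex1:
  assumes "definable A S P"
  shows "definable A (S - {v}) (\<lambda>h. \<exists>x\<in>univ U. P (h(v := x)))"
proof -
  obtain \<phi> f where "defined_by A S P \<phi> f" using assms(1) unfolding definable_def by blast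
  note f = defined_byD[OF this]
  define g where "g i = (if f i = Inl v then 0 else Suc i)" for i
  obtain \<phi>' where \<phi>': "wf_fm L \<phi>'" "fv \<phi>' \<subseteq> g ` fv \<phi>" "\<And>e. sat U e \<phi>' \<longleftrightarrow> sat U (e \<circ> g) \<phi>"
    using ex_renamed_fm[OF f(1), of g U] by blast
  define f' where "f' i = (case i of 0 \<Rightarrow> Inl v | Suc j \<Rightarrow> f j)" for i
  have sat_upd: "sat U ((\<lambda>i. case_sum h id (f' i))(0 := x)) \<phi>' \<longleftrightarrow> P (h(v := x))"
    if "h \<in> envs" "x \<in> univ U" for h x
  proof -
    have "((\<lambda>i. case_sum h id (f' i))(0 := x) \<circ> g) = (\<lambda>i. case_sum (h(v := x)) id (f i))"
      by (rule ext) (auto simp: g_def f'_def split: sum.splits)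
    thus ?thesis using f(3) that by (simp add: \<phi>'(3) envs_upd)
  qed
  show ?thesis
  proof (rule definableI[of "Neg (All 0 (Neg \<phi>'))" f'])
    show "f' i \<in> Inl ` (S - {v}) \<union> Inr ` A" if "i \<in> fv (Neg (All 0 (Neg \<phi>')))" for i
      using that \<phi>'(2) f(2) by (force simp: g_def f'_def split: if_splits)
  qed (use \<phi>' sat_upd in auto)
qed

lemma definable_Ex_finite:
  assumes "finite F" "definable A S P"
  shows "definable A (S - F) (\<lambda>h. \<exists>h'\<in>envs. (\<forall>v. v \<notin> F \<longrightarrow> h' v = h v) \<and> P h')"
  using assms
proof (induction F)
  case empty
  have "(\<exists>h'\<in>envs. (\<forall>v. h' v = h v) \<and> P h') \<longleftrightarrow> P h" if "h \<in> envs" for h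
    using that by (metis ext)
  thus ?case using empty by (auto intro: definable_cong)
next
  case (insert v F)
  have "definable A (S - F - {v})
     (\<lambda>h. \<exists>x\<in>univ U. \<exists>h'\<in>envs. (\<forall>w. w \<notin> F \<longrightarrow> h' w = (h(v := x)) w) \<and> P h')"
    using definable_Ex1[OF insert.IH[OF insert.prems]] .
  moreover have "S - F - {v} = S - insert v F" by auto
  moreover have "(\<exists>x\<in>univ U. \<exists>h'\<in>envs. (\<forall>w. w \<notin> F \<longrightarrow> h' w = (h(v := x)) w) \<and> P h') \<longleftrightarrow>
      (\<exists>h'\<in>envs. (\<forall>w. w \<notin> insert v F \<longrightarrow> h' w = h w) \<and> P h')" (is "?left \<longleftrightarrow> ?right") for h
  proof
    assume ?right
    then obtain h' where "h' \<in> envs" "\<And>w. w \<notin> insert v F \<Longrightarrow> h' w = h w" "P h'" by auto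
    thus ?left by (intro bexI[of _ "h' v"] bexI[of _ h']) (auto simp: envsD)
  next
    assume ?left
    then obtain x h' where "h' \<in> envs" "\<forall>w. w \<notin> F \<longrightarrow> h' w = (h(v := x)) w" "P h'" by blast
    thus ?right by (intro bexI[of _ h']) auto
  qed
  ultimately show ?case by (auto intro: definable_cong)
qed

lemma definable_Ex:
  assumes "definable A S P"
  shows "definable A (S \<inter> T) (\<lambda>h. \<exists>h'\<in>envs. (\<forall>v\<in>T. h' v = h v) \<and> P h')"
proof -
  obtain S0 where S0: "finite S0" "S0 \<subseteq> S" "definable A S0 P"
    using definable_finite_support[OF assms] by blast
  have "definable A (S0 - (S0 - T)) (\<lambda>h. \<exists>h'\<in>envs. (\<forall>v. v \<notin> S0 - T \<longrightarrow> h' v = h v) \<and> P h')"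
    by (rule definable_Ex_finite) (use S0 in auto)
  hence "definable A (S \<inter> T) (\<lambda>h. \<exists>h'\<in>envs. (\<forall>v. v \<notin> S0 - T \<longrightarrow> h' v = h v) \<and> P h')"
    by (rule definable_mono) (use S0 in auto)
  thus ?thesis
  proof (rule definable_cong, intro iffI)
    fix h :: "'a \<Rightarrow> 'm"
    assume h: "h \<in> envs" and "\<exists>h'\<in>envs. (\<forall>v\<in>T. h' v = h v) \<and> P h'"
    then obtain h' where h': "h' \<in> envs" "\<And>v. v \<in> T \<Longrightarrow> h' v = h v" "P h'" by auto
    define k where "k v = (if v \<in> S0 then h' v else h v)" for v
    have "k \<in> envs" using h h' by (auto simp: k_def[abs_def] intro: envs_merge)
    moreover have "P k" using definable_local[OF S0(3) \<open>k \<in> envs\<close> h'(1)] h'(3) by (auto simp: k_def)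
    ultimately show "\<exists>h'\<in>envs. (\<forall>v. v \<notin> S0 - T \<longrightarrow> h' v = h v) \<and> P h'"
      using h'(2) by (intro bexI[of _ k]) (auto simp: k_def)
  qed auto
qed

subsection \<open>Formulas with parameters and definable predicates\<close>

lemma definable_imp_pfm:
  assumes "definable B S Q" "S \<subseteq> set xs"
  shows "\<exists>p\<in>pfmlas L B (length xs). \<forall>h\<in>envs. psat U p (map h xs) \<longleftrightarrow> Q h"
proof -
  obtain \<phi> f where "defined_by B S Q \<phi> f" using assms(1) unfolding definable_def by blast
  note f = defined_byD[OF this]
  have "finite (Inr ` {a\<in>B. Inr a \<in> f ` fv \<phi>} :: ('a + 'm) set)"
    by (rule finite_subset[of _ "f ` fv \<phi>"]) (auto simp: finite_fv)
  hence "finite {a\<in>B. Inr a \<in> f ` fv \<phi>}"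
    by (rule finite_imageD) simp
  then obtain cs where cs: "set cs = {a\<in>B. Inr a \<in> f ` fv \<phi>}"
    by (meson finite_list)
  define g where "g i = (case f i of Inl v \<Rightarrow> index_of xs v | Inr c \<Rightarrow> length xs + index_of cs c)" for i
  obtain \<phi>' where \<phi>': "wf_fm L \<phi>'" "fv \<phi>' \<subseteq> g ` fv \<phi>" "\<And>e. sat U e \<phi>' \<longleftrightarrow> sat U (e \<circ> g) \<phi>"
    using ex_renamed_fm[OF f(1), of g U] by blast
  have g: "(\<exists>v\<in>S. f i = Inl v \<and> g i < length xs \<and> xs ! g i = v) \<or>
      (\<exists>c\<in>B. f i = Inr c \<and> length xs \<le> g i \<and> g i < length xs + length cs \<and> cs ! (g i - length xs) = c)"
    if i: "i \<in> fv \<phi>" for i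
  proof -
    consider v where "v \<in> S" "f i = Inl v" | c where "c \<in> B" "f i = Inr c" using f(2) i by blast
    thus ?thesis
    proof cases
      case (1 v)
      hence "v \<in> set xs" using assms(2) by blast
      thus ?thesis using index_of[of v xs] 1 by (simp add: g_def)
    next
      case (2 c)
      hence "c \<in> set cs" using i by (force simp: cs)
      thus ?thesis using index_of[of c cs] 2 by (simp add: g_def)
    qed
  qed
  have "fv \<phi>' \<subseteq> {..<length xs + length cs}" using \<phi>'(2) g by fastforce
  hence "(\<phi>', cs) \<in> pfmlas L B (length xs)"
    using \<phi>'(1) by (auto simp: pfmlas_def fmlas_def cs)
  moreover have "psat U (\<phi>', cs) (map h xs) = Q h" if "h \<in> envs" for h
  proof -
    have "sat U ((\<lambda>i. (map h xs @ cs) ! i) \<circ> g) \<phi> \<longleftrightarrow> sat U (\<lambda>i. case_sum h id (f i)) \<phi>"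
      by (rule sat_cong) (use g in \<open>fastforce simp: nth_append\<close>)
    thus ?thesis using f(3) that by (simp add: psat_def \<phi>'(3))
  qed
  ultimately show ?thesis by blast
qed

lemma pfm_imp_definable:
  assumes "p \<in> pfmlas L B (length xs)"
  shows "definable B (set xs) (\<lambda>h. psat U p (map h xs))"
proof -
  obtain \<phi> cs where p: "p = (\<phi>, cs)" by (cases p)
  have wf: "wf_fm L \<phi>" "fv \<phi> \<subseteq> {..<length xs + length cs}" "set cs \<subseteq> B"
    using assms by (auto simp: p pfmlas_def fmlas_def)
  let ?f = "\<lambda>i. if i < length xs then Inl (xs ! i) else Inr (cs ! (i - length xs))"
  show ?thesis
  proof (rule definableI[OF wf(1), of ?f])
    show "?f i \<in> Inl ` set xs \<union> Inr ` B" if "i \<in> fv \<phi>" for i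
    proof (cases "i < length xs")
      case False
      hence "i - length xs < length cs" using that wf(2) by fastforce
      thus ?thesis using False wf(3) nth_mem by fastforce
    qed auto
    show "psat U p (map h xs) \<longleftrightarrow> sat U (\<lambda>i. case_sum h id (?f i)) \<phi>" for h
      unfolding psat_def p by (simp, rule sat_cong) (use wf(2) in \<open>force simp: nth_append\<close>)
  qed
qed

subsection \<open>Equality of types\<close>

lemma tp_eqD: "tp_eq A S h h' \<Longrightarrow> definable A S P \<Longrightarrow> P h \<longleftrightarrow> P h'"
  by (auto simp: tp_eq_def)

lemma tp_eqI_complete:
  assumes "\<And>P. definable A S P \<Longrightarrow> P h' \<Longrightarrow> P h"
  shows "tp_eq A S h h'"
  unfolding tp_eq_def using assms definable_Neg by blast

lemma tp_eq_refl: "tp_eq A S h h" by (simp add: tp_eq_def)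

lemma tp_eq_sym: "tp_eq A S h h' \<Longrightarrow> tp_eq A S h' h" unfolding tp_eq_def by blast

lemma tp_eq_trans: "tp_eq A S h h' \<Longrightarrow> tp_eq A S h' h'' \<Longrightarrow> tp_eq A S h h''" unfolding tp_eq_def by blast

lemma tp_eq_mono: "tp_eq A' S' h h' \<Longrightarrow> A \<subseteq> A' \<Longrightarrow> S \<subseteq> S' \<Longrightarrow> tp_eq A S h h'"
  unfolding tp_eq_def using definable_mono[of A S _ A' S'] by blast

lemma tp_eq_agree: "h \<in> envs \<Longrightarrow> h' \<in> envs \<Longrightarrow> (\<And>v. v \<in> S \<Longrightarrow> h v = h' v) \<Longrightarrow> tp_eq A S h h'"
  unfolding tp_eq_def using definable_local[of A S _ h h'] by blast

lemma tp_eq_reindex: "tp_eq A S' h h' \<Longrightarrow> g ` S \<subseteq> S' \<Longrightarrow> tp_eq A S (h \<circ> g) (h' \<circ> g)"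
  unfolding tp_eq_def using definable_reindex[of A S _ g S'] by blast

lemma tp_eq_finiteI:
  assumes "\<And>S0. finite S0 \<Longrightarrow> S0 \<subseteq> S \<Longrightarrow> tp_eq A S0 h h'"
  shows "tp_eq A S h h'"
  unfolding tp_eq_def
proof (intro allI impI)
  fix P :: "('a \<Rightarrow> 'm) \<Rightarrow> bool" assume "definable A S P"
  from definable_finite_support[OF this]
  obtain S0 where "finite S0" "S0 \<subseteq> S" "definable A S0 P" by blast
  thus "P h = P h'" using tp_eqD[OF assms] by blast
qed

end

section \<open>Realizing types in saturated models\<close>

locale monster = struct_env L U
  for L :: "('f, 'r) lang" and U :: "('f, 'r, 'm) struct" +
  fixes kb :: "'k rel"
  assumes kb_card: "Card_order kb" and kb_regular: "regularCard kb" and kb_unc: "natLeq <o kb"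
    and kb_sat: "saturated L U kb"
begin

lemma kb_inf: "\<not> finite (Field kb)"
proof
  assume "finite (Field kb)"
  hence "|Field kb| <o natLeq" by (simp add: finite_iff_ordLess_natLeq)
  hence "|Field kb| <o kb" using kb_unc ordLess_transitive by blast
  thus False using card_of_Field_ordIso[OF kb_card] not_ordLess_ordIso by blast
qed

lemma kb_Cinf: "Cinfinite kb"
  using kb_inf kb_card by (simp add: cinfinite_def)

lemma small_countable: "countable S \<Longrightarrow> |S| <o kb"
  using kb_unc ordLeq_ordLess_trans card_of_nat ordLeq_ordIso_trans
  by (metis UNIV_I card_of_ordLeqI countableE)

lemma small_subset_mono: "|T| <o kb \<Longrightarrow> S \<subseteq> T \<Longrightarrow> |S| <o kb"
  by (meson card_of_mono1 ordLeq_ordLess_trans)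

lemma small_image: "|S| <o kb \<Longrightarrow> |f ` S| <o kb"
  by (meson card_of_image ordLeq_ordLess_trans)

lemma small_Un: "|S| <o kb \<Longrightarrow> |T| <o kb \<Longrightarrow> |S \<union> T| <o kb"
  using card_of_Un_ordLess_infinite_Field kb_inf kb_card by blast

lemma small_UN: "|I| <o kb \<Longrightarrow> (\<And>i. i \<in> I \<Longrightarrow> |F i| <o kb) \<Longrightarrow> |\<Union>i\<in>I. F i| <o kb"
  using regularCard_UNION_bound[OF kb_Cinf kb_regular] by blast

lemma small_finite: "finite S \<Longrightarrow> |S| <o kb"
  by (simp add: small_countable countable_finite)

lemma small_Sigma: "|I| <o kb \<Longrightarrow> (\<And>i. i \<in> I \<Longrightarrow> |F i| <o kb) \<Longrightarrow> |Sigma I F| <o kb"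
  unfolding Sigma_def by (intro small_UN) (auto intro: small_finite)

lemma saturated_one_variable:
  fixes v :: 'v
  assumes B: "|B| <o kb" "B \<subseteq> univ U" and \<Sigma>: "\<And>P. P \<in> \<Sigma> \<Longrightarrow> definable B {v} P"
    and fin: "\<And>\<Sigma>0. finite \<Sigma>0 \<Longrightarrow> \<Sigma>0 \<subseteq> \<Sigma> \<Longrightarrow> \<exists>h\<in>envs. \<forall>P\<in>\<Sigma>0. P h"
  shows "\<exists>h\<in>envs. \<forall>P\<in>\<Sigma>. P h"
proof -
  have "\<exists>p\<in>pfmlas L B 1. \<forall>h\<in>envs. psat U p [h v] \<longleftrightarrow> P h" if "P \<in> \<Sigma>" for P
    using definable_imp_pfm[OF \<Sigma>[OF that], of "[v]"] by simp
  then obtain p where p: "\<And>P. P \<in> \<Sigma> \<Longrightarrow> p P \<in> pfmlas L B 1"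
    "\<And>P h. P \<in> \<Sigma> \<Longrightarrow> h \<in> envs \<Longrightarrow> psat U (p P) [h v] \<longleftrightarrow> P h" by metis
  have "\<exists>a. realizes U 1 \<pi>0 a" if \<pi>0: "\<pi>0 \<subseteq> p ` \<Sigma>" "finite \<pi>0" for \<pi>0
  proof -
    obtain \<Sigma>0 where \<Sigma>0: "\<Sigma>0 \<subseteq> \<Sigma>" "finite \<Sigma>0" "\<pi>0 = p ` \<Sigma>0"
      using \<pi>0 by (meson finite_subset_image)
    obtain h where "h \<in> envs" "\<forall>P\<in>\<Sigma>0. P h" using fin[OF \<Sigma>0(2,1)] by blast
    hence "realizes U 1 \<pi>0 [h v]"
      using p(2) \<Sigma>0 by (auto simp: realizes_def tuples_def envsD)
    thus ?thesis by blast
  qed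
  hence "partial_type_over L U B 1 (p ` \<Sigma>)"
    unfolding partial_type_over_def using p(1) by auto
  then obtain a where a: "realizes U 1 (p ` \<Sigma>) a"
    using kb_sat B unfolding saturated_def small_subset_def by blast
  then obtain x where x: "a = [x]" "x \<in> univ U"
    by (auto simp: realizes_def tuples_def length_Suc_conv)
  hence "(\<lambda>_. x) \<in> envs" by (auto simp: envs_def)
  thus ?thesis using a p(2)[of _ "\<lambda>_. x"] by (intro bexI[of _ "\<lambda>_. x"]) (auto simp: realizes_def x)
qed

definition finitely_realizable :: "(('v \<Rightarrow> 'm) \<Rightarrow> bool) set \<Rightarrow> ('v \<times> 'm) set \<Rightarrow> bool" where
  "finitely_realizable \<Sigma> G \<longleftrightarrow> (\<forall>\<Sigma>0 G0. finite \<Sigma>0 \<and> \<Sigma>0 \<subseteq> \<Sigma> \<and> finite G0 \<and> G0 \<subseteq> G \<longrightarrow>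
    (\<exists>h\<in>envs. (\<forall>q\<in>G0. h (fst q) = snd q) \<and> (\<forall>P\<in>\<Sigma>0. P h)))"

lemma finitely_realizableD:
  assumes "finitely_realizable \<Sigma> G" "finite \<Sigma>0" "\<Sigma>0 \<subseteq> \<Sigma>" "finite G0" "G0 \<subseteq> G"
  shows "\<exists>h\<in>envs. (\<forall>q\<in>G0. h (fst q) = snd q) \<and> (\<forall>P\<in>\<Sigma>0. P h)"
  using assms unfolding finitely_realizable_def by simp

lemma finitely_realizable_functional:
  assumes "finitely_realizable \<Sigma> G" "(v, x) \<in> G" "(v, y) \<in> G"
  shows "x = y"
  using finitely_realizableD[OF assms(1), of "{}" "{(v, x), (v, y)}"] assms(2,3) by auto

lemma finitely_realizable_Union_chain:
  assumes "\<C> \<noteq> {}" "subset.chain \<G> \<C>" "\<And>G. G \<in> \<C> \<Longrightarrow> finitely_realizable \<Sigma> G"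
  shows "finitely_realizable \<Sigma> (\<Union>\<C>)"
  unfolding finitely_realizable_def
proof (intro allI impI, elim conjE)
  fix \<Sigma>0 G0 assume \<Sigma>0: "finite \<Sigma>0" "\<Sigma>0 \<subseteq> \<Sigma>" and G0: "finite G0" "G0 \<subseteq> \<Union>\<C>"
  obtain G where "G \<in> \<C>" "G0 \<subseteq> G"
    using finite_subset_Union_chain[OF G0 assms(1,2)] by blast
  thus "\<exists>h\<in>envs. (\<forall>q\<in>G0. h (fst q) = snd q) \<and> (\<forall>P\<in>\<Sigma>0. P h)"
    using finitely_realizableD[OF assms(3) \<Sigma>0 G0(1)] by blast
qed

lemma finitely_realizable_insert:
  assumes fr: "finitely_realizable \<Sigma> G" and G: "G \<subseteq> V \<times> B" and B: "|B| <o kb" "B \<subseteq> univ U"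
    and \<Sigma>: "\<And>P. P \<in> \<Sigma> \<Longrightarrow> definable B V P" and v: "v \<in> V"
  shows "\<exists>x\<in>univ U. finitely_realizable \<Sigma> (insert (v, x) G)"
proof -
  define I where "I = {(\<Sigma>0, G0). finite \<Sigma>0 \<and> \<Sigma>0 \<subseteq> \<Sigma> \<and> finite G0 \<and> G0 \<subseteq> G}"
  define Q where "Q i h \<longleftrightarrow> (\<exists>h'\<in>envs. (\<forall>w\<in>{v}. h' w = h w) \<and>
      (\<forall>q\<in>snd i. h' (fst q) = snd q) \<and> (\<forall>P\<in>fst i. P h'))" for i h
  have "\<exists>h\<in>envs. \<forall>P\<in>Q ` I. P h"
  proof (rule saturated_one_variable[OF B])
    fix P assume "P \<in> Q ` I"
    then obtain i where P: "P = Q i" and i: "finite (fst i)" "fst i \<subseteq> \<Sigma>" "finite (snd i)" "snd i \<subseteq> G"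
      by (auto simp: I_def)
    have "definable B V (\<lambda>h. \<forall>q\<in>snd i. h (fst q) = snd q)"
      by (rule definable_Ball[OF i(3)], rule definable_eq_const) (use i(4) G in auto)
    moreover have "definable B V (\<lambda>h. \<forall>P\<in>fst i. P h)"
      by (rule definable_Ball[OF i(1)]) (use i(2) \<Sigma> in auto)
    ultimately have "definable B (V \<inter> {v}) (Q i)"
      unfolding Q_def[abs_def] by (intro definable_Ex definable_Conj)
    thus "definable B {v} P" using v by (simp add: P)
  next
    fix \<Sigma>0 assume "finite \<Sigma>0" "\<Sigma>0 \<subseteq> Q ` I"
    then obtain I0 where I0: "I0 \<subseteq> I" "finite I0" "\<Sigma>0 = Q ` I0" by (meson finite_subset_image)
    hence "\<forall>i\<in>I0. finite (fst i) \<and> fst i \<subseteq> \<Sigma> \<and> finite (snd i) \<and> snd i \<subseteq> G"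
      unfolding I_def by fastforce
    hence "finite (\<Union>(fst ` I0))" "\<Union>(fst ` I0) \<subseteq> \<Sigma>" "finite (\<Union>(snd ` I0))" "\<Union>(snd ` I0) \<subseteq> G"
      using I0(2) by blast+
    from finitely_realizableD[OF fr this] show "\<exists>h\<in>envs. \<forall>P\<in>\<Sigma>0. P h"
      unfolding I0(3) Q_def by fastforce
  qed
  then obtain h where h: "h \<in> envs" "\<And>i. i \<in> I \<Longrightarrow> Q i h" by blast
  have "finitely_realizable \<Sigma> (insert (v, h v) G)"
    unfolding finitely_realizable_def
  proof (intro allI impI, elim conjE)
    fix \<Sigma>0 G0 assume "finite \<Sigma>0" "\<Sigma>0 \<subseteq> \<Sigma>" "finite G0" "G0 \<subseteq> insert (v, h v) G"
    hence "(\<Sigma>0, G0 - {(v, h v)}) \<in> I" by (auto simp: I_def)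
    from h(2)[OF this] obtain h' where "h' \<in> envs" "h' v = h v"
      "\<forall>q\<in>G0 - {(v, h v)}. h' (fst q) = snd q" "\<forall>P\<in>\<Sigma>0. P h'" unfolding Q_def by auto
    thus "\<exists>h\<in>envs. (\<forall>q\<in>G0. h (fst q) = snd q) \<and> (\<forall>P\<in>\<Sigma>0. P h)"
      by (intro bexI[of _ h'] conjI) auto
  qed
  thus ?thesis using envsD[OF h(1)] by blast
qed

lemma finitely_realizable_total_extension:
  assumes fr: "finitely_realizable \<Sigma> G0" and G0: "G0 \<subseteq> V \<times> univ U" and V: "|V| <o kb"
    and A: "|A| <o kb" "A \<subseteq> univ U" and \<Sigma>: "\<forall>P\<in>\<Sigma>. definable A V P"
  shows "\<exists>G. G0 \<subseteq> G \<and> G \<subseteq> V \<times> univ U \<and> V \<subseteq> fst ` G \<and> finitely_realizable \<Sigma> G"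
proof -
  define \<G> where "\<G> = {G. G0 \<subseteq> G \<and> G \<subseteq> V \<times> univ U \<and> finitely_realizable \<Sigma> G}"
  have "G0 \<in> \<G>" using fr G0 by (simp add: \<G>_def)
  moreover have "\<Union>\<C> \<in> \<G>" if "\<C> \<noteq> {}" "subset.chain \<G> \<C>" for \<C>
  proof -
    have "\<C> \<subseteq> \<G>" using that by (simp add: subset_chain_def)
    thus ?thesis
      using finitely_realizable_Union_chain[OF that] that(1) unfolding \<G>_def by blast
  qed
  ultimately obtain G where G: "G \<in> \<G>" "\<And>G'. G' \<in> \<G> \<Longrightarrow> G \<subseteq> G' \<Longrightarrow> G' = G"
    using subset_Zorn_nonempty[of \<G>] by blast
  have frG: "finitely_realizable \<Sigma> G" and GV: "G \<subseteq> V \<times> univ U" "G0 \<subseteq> G" using G(1) by (auto simp: \<G>_def)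
  have "inj_on fst G" using finitely_realizable_functional[OF frG] by (auto intro!: inj_onI)
  hence "|G| \<le>o |V|" using GV(1) by (intro card_of_ordLeqI[of fst]) auto
  hence "|snd ` G| <o kb" using V ordLeq_ordLess_trans small_image by blast
  hence B: "|A \<union> snd ` G| <o kb" "A \<union> snd ` G \<subseteq> univ U"
    using small_Un[OF A(1)] A(2) GV by auto
  have "v \<in> fst ` G" if v: "v \<in> V" for v
  proof -
    have "definable (A \<union> snd ` G) V P" if "P \<in> \<Sigma>" for P
      using definable_mono[OF bspec[OF \<Sigma> that]] by blast
    moreover have "G \<subseteq> V \<times> (A \<union> snd ` G)" using GV(1) by force
    ultimately obtain x where "x \<in> univ U" "finitely_realizable \<Sigma> (insert (v, x) G)"
      using finitely_realizable_insert[OF frG _ B] v by blast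
    hence "insert (v, x) G \<in> \<G>" using GV v by (auto simp: \<G>_def)
    thus ?thesis using G(2)[of "insert (v, x) G"] by force
  qed
  thus ?thesis using frG GV by blast
qed

theorem realize:
  assumes V: "|V| <o kb" "F \<subseteq> V" and A: "|A| <o kb" "A \<subseteq> univ U" and K: "K \<in> envs"
    and \<Sigma>: "\<And>P. P \<in> \<Sigma> \<Longrightarrow> definable A V P"
    and fin: "\<And>\<Sigma>0 F0. finite \<Sigma>0 \<Longrightarrow> \<Sigma>0 \<subseteq> \<Sigma> \<Longrightarrow> finite F0 \<Longrightarrow> F0 \<subseteq> F \<Longrightarrow>
      \<exists>h\<in>envs. (\<forall>v\<in>F0. h v = K v) \<and> (\<forall>P\<in>\<Sigma>0. P h)"
  shows "\<exists>h\<in>envs. (\<forall>v\<in>F. h v = K v) \<and> (\<forall>P\<in>\<Sigma>. P h)"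
proof -
  have fr: "finitely_realizable \<Sigma> ((\<lambda>v. (v, K v)) ` F)"
    unfolding finitely_realizable_def
  proof (intro allI impI, elim conjE)
    fix \<Sigma>0 G0 assume \<Sigma>0: "finite \<Sigma>0" "\<Sigma>0 \<subseteq> \<Sigma>" and G0: "finite G0" "G0 \<subseteq> (\<lambda>v. (v, K v)) ` F"
    have "fst ` G0 \<subseteq> F" "\<forall>q\<in>G0. snd q = K (fst q)" using G0(2) by auto
    thus "\<exists>h\<in>envs. (\<forall>q\<in>G0. h (fst q) = snd q) \<and> (\<forall>P\<in>\<Sigma>0. P h)"
      using fin[OF \<Sigma>0, of "fst ` G0"] G0(1) by simp
  qed
  have "(\<lambda>v. (v, K v)) ` F \<subseteq> V \<times> univ U" using V(2) envsD[OF K] by auto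
  moreover have "\<forall>P\<in>\<Sigma>. definable A V P" using \<Sigma> by blast
  ultimately have "\<exists>G. (\<lambda>v. (v, K v)) ` F \<subseteq> G \<and> G \<subseteq> V \<times> univ U \<and> V \<subseteq> fst ` G \<and> finitely_realizable \<Sigma> G"
    by (rule finitely_realizable_total_extension[OF fr _ V(1) A])
  then
  obtain G where G: "(\<lambda>v. (v, K v)) ` F \<subseteq> G" "G \<subseteq> V \<times> univ U" "V \<subseteq> fst ` G"
    "finitely_realizable \<Sigma> G" by (elim exE conjE)
  have "\<forall>v\<in>V. \<exists>x. (v, x) \<in> G" using G(3) by force
  then obtain k where k: "\<And>v. v \<in> V \<Longrightarrow> (v, k v) \<in> G" by metis
  define h where "h v = (if v \<in> V then k v else K v)" for v
  have h: "h \<in> envs" using k G(2) envsD[OF K] by (intro envsI) (auto simp: h_def)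
  have "h v = K v" if "v \<in> F" for v
    using finitely_realizable_functional[OF G(4), of v "k v" "K v"] k[of v] G(1) V(2) that
    by (auto simp: h_def)
  moreover have "P h" if P: "P \<in> \<Sigma>" for P
  proof -
    obtain S0 where S0: "finite S0" "S0 \<subseteq> V" "definable A S0 P"
      using definable_finite_support[OF \<Sigma>[OF P]] by blast
    obtain h' where h': "h' \<in> envs" "\<forall>q\<in>(\<lambda>v. (v, k v)) ` S0. h' (fst q) = snd q" "P h'"
      using finitely_realizableD[OF G(4), of "{P}" "(\<lambda>v. (v, k v)) ` S0"] P S0(1,2) k by auto
    have "h v = h' v" if "v \<in> S0" for v using that S0(2) h'(2) by (auto simp: h_def)
    thus ?thesis using definable_local[OF S0(3) h h'(1)] h'(3) by blast
  qed
  ultimately show ?thesis using h by blast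
qed

lemma extend_type:
  assumes small: "|W| <o kb" "|A| <o kb" "A \<subseteq> univ U" and h: "h \<in> envs" "h' \<in> envs"
    and S: "S \<subseteq> W" and eq: "tp_eq A S h h'"
  shows "\<exists>k\<in>envs. (\<forall>v\<in>S. k v = h' v) \<and> tp_eq A W k h"
proof -
  have "\<exists>k\<in>envs. (\<forall>v\<in>S. k v = h' v) \<and> (\<forall>P\<in>{P. definable A W P \<and> P h}. P k)"
  proof (rule realize[OF small(1) S small(2,3) h(2)])
    fix \<Sigma>0 S0 assume \<Sigma>0: "finite \<Sigma>0" "\<Sigma>0 \<subseteq> {P. definable A W P \<and> P h}" and S0: "S0 \<subseteq> S"
    define E where "E k \<longleftrightarrow> (\<exists>k'\<in>envs. (\<forall>v\<in>S. k' v = k v) \<and> (\<forall>P\<in>\<Sigma>0. P k'))" for k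
    have "definable A W (\<lambda>h. \<forall>P\<in>\<Sigma>0. P h)" by (rule definable_Ball) (use \<Sigma>0 in auto)
    hence "definable A (W \<inter> S) E" unfolding E_def[abs_def] by (rule definable_Ex)
    moreover have "W \<inter> S = S" using S by auto
    moreover have "E h" unfolding E_def using h(1) \<Sigma>0(2) by (intro bexI[of _ h]) auto
    ultimately have "E h'" using tp_eqD[OF eq, of E] by simp
    thus "\<exists>k\<in>envs. (\<forall>v\<in>S0. k v = h' v) \<and> (\<forall>P\<in>\<Sigma>0. P k)" unfolding E_def using S0 by blast
  qed simp
  thus ?thesis using tp_eqI_complete[of A W h] by blast
qed

theorem realize_types:
  fixes K :: "'v \<Rightarrow> 'm" and h :: "'x \<Rightarrow> 'u \<Rightarrow> 'm" and g :: "'x \<Rightarrow> 'u \<Rightarrow> 'v"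
  assumes W: "|W| <o kb" and A: "|A| <o kb" "A \<subseteq> univ U"
    and F: "F \<subseteq> W" and g: "\<And>i. i \<in> I \<Longrightarrow> g i ` T i \<subseteq> W" and K: "K \<in> envs"
    and fin: "\<And>P. (\<And>i. i \<in> I \<Longrightarrow> definable A (T i) (P i)) \<Longrightarrow> (\<And>i. i \<in> I \<Longrightarrow> P i (h i)) \<Longrightarrow>
      \<exists>z\<in>envs. (\<forall>v\<in>F. z v = K v) \<and> (\<forall>i\<in>I. P i (z \<circ> g i))"
  shows "\<exists>z\<in>envs. (\<forall>v\<in>F. z v = K v) \<and> (\<forall>i\<in>I. tp_eq A (T i) (z \<circ> g i) (h i))"
proof -
  define tp where "tp i = {P. definable A (T i) P \<and> P (h i)}" for i
  define pull where "pull i P z \<longleftrightarrow> P (z \<circ> g i)" for i P and z :: "'v \<Rightarrow> 'm"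
  have "\<exists>z\<in>envs. (\<forall>v\<in>F. z v = K v) \<and> (\<forall>R\<in>\<Union>i\<in>I. pull i ` tp i. R z)"
  proof (rule realize[OF W F A K])
    fix R assume "R \<in> (\<Union>i\<in>I. pull i ` tp i)"
    then obtain i P where "i \<in> I" "P \<in> tp i" "R = pull i P" by blast
    thus "definable A W R"
      using definable_reindex[OF _ g[of i], of A P] by (simp add: tp_def pull_def[abs_def])
  next
    fix \<Sigma>0 F0 assume \<Sigma>0: "finite \<Sigma>0" "\<Sigma>0 \<subseteq> (\<Union>i\<in>I. pull i ` tp i)" and F0: "F0 \<subseteq> F"
    have "\<exists>Q. Q \<subseteq> tp i \<and> finite Q \<and> \<Sigma>0 \<inter> pull i ` tp i = pull i ` Q" for i
      using finite_subset_image[of "\<Sigma>0 \<inter> pull i ` tp i" "pull i" "tp i"] \<Sigma>0(1) by blast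
    then obtain Q where Q: "\<And>i. Q i \<subseteq> tp i" "\<And>i. finite (Q i)" "\<And>i. \<Sigma>0 \<inter> pull i ` tp i = pull i ` Q i"
      by metis
    have "\<exists>z\<in>envs. (\<forall>v\<in>F. z v = K v) \<and> (\<forall>i\<in>I. \<forall>P\<in>Q i. P (z \<circ> g i))"
    proof (rule fin)
      show "definable A (T i) (\<lambda>u. \<forall>P\<in>Q i. P u)" for i
        by (rule definable_Ball[OF Q(2)]) (use Q(1) in \<open>auto simp: tp_def\<close>)
      show "\<forall>P\<in>Q i. P (h i)" for i using Q(1) by (auto simp: tp_def)
    qed
    then obtain z where z: "z \<in> envs" "\<forall>v\<in>F. z v = K v" "\<forall>i\<in>I. \<forall>P\<in>Q i. P (z \<circ> g i)" by blast
    have "R z" if R: "R \<in> \<Sigma>0" for R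
    proof -
      obtain i where i: "i \<in> I" "R \<in> pull i ` Q i" using R \<Sigma>0(2) Q(3) by blast
      then obtain P where "P \<in> Q i" "R = pull i P" by blast
      thus ?thesis using bspec[OF bspec[OF z(3) i(1)]] by (simp add: pull_def)
    qed
    thus "\<exists>z\<in>envs. (\<forall>v\<in>F0. z v = K v) \<and> (\<forall>R\<in>\<Sigma>0. R z)" using z(1,2) F0 by blast
  qed
  then obtain z where z: "z \<in> envs" "\<forall>v\<in>F. z v = K v" "\<forall>R\<in>\<Union>i\<in>I. pull i ` tp i. R z" by blast
  have "tp_eq A (T i) (z \<circ> g i) (h i)" if "i \<in> I" for i
  proof (rule tp_eqI_complete)
    fix P assume "definable A (T i) P" "P (h i)"
    hence "pull i P z" using z(3) that by (auto simp: tp_def)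
    thus "P (z \<circ> g i)" by (simp add: pull_def)
  qed
  thus ?thesis using z(1,2) by blast
qed

end

section \<open>Mutually indiscernible families\<close>

definition row_mono :: "('x \<Rightarrow> 'i rel) \<Rightarrow> ('x \<Rightarrow> 'j rel) \<Rightarrow> ('x \<times> 'i) set \<Rightarrow> ('x \<times> 'i \<Rightarrow> 'x \<times> 'j) \<Rightarrow> bool" where
  "row_mono r r' S \<sigma> \<longleftrightarrow> (\<forall>p\<in>S. fst (\<sigma> p) = fst p \<and> snd (\<sigma> p) \<in> Field (r' (fst p))) \<and>
     (\<forall>p\<in>S. \<forall>q\<in>S. fst p = fst q \<and> (snd p, snd q) \<in> r (fst p) \<and> snd p \<noteq> snd q \<longrightarrow>
        (snd (\<sigma> p), snd (\<sigma> q)) \<in> r' (fst p) \<and> snd (\<sigma> p) \<noteq> snd (\<sigma> q))"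

definition coords :: "('x \<Rightarrow> nat) \<Rightarrow> ('x \<times> 'i) set \<Rightarrow> (('x \<times> 'i) \<times> nat) set" where
  "coords m S = {(p, c). p \<in> S \<and> c < m (fst p)}"

abbreviation lift :: "('a \<Rightarrow> 'b) \<Rightarrow> 'a \<times> nat \<Rightarrow> 'b \<times> nat" where
  "lift \<sigma> \<equiv> map_prod \<sigma> id"

abbreviation positions :: "'x set \<Rightarrow> ('x \<Rightarrow> 'i rel) \<Rightarrow> ('x \<times> 'i) set" where
  "positions X r \<equiv> Sigma X (\<lambda>i. Field (r i))"

lemma row_monoD:
  assumes "row_mono r r' S \<sigma>" "p \<in> S"
  shows "fst (\<sigma> p) = fst p" "snd (\<sigma> p) \<in> Field (r' (fst p))"
    and "q \<in> S \<Longrightarrow> fst p = fst q \<Longrightarrow> (snd p, snd q) \<in> r (fst p) \<Longrightarrow> snd p \<noteq> snd q \<Longrightarrow>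
      (snd (\<sigma> p), snd (\<sigma> q)) \<in> r' (fst p) \<and> snd (\<sigma> p) \<noteq> snd (\<sigma> q)"
  using assms unfolding row_mono_def by blast+

lemma row_monoI:
  assumes "\<And>p. p \<in> S \<Longrightarrow> fst (\<sigma> p) = fst p" "\<And>p. p \<in> S \<Longrightarrow> snd (\<sigma> p) \<in> Field (r' (fst p))"
    and "\<And>p q. p \<in> S \<Longrightarrow> q \<in> S \<Longrightarrow> fst p = fst q \<Longrightarrow> (snd p, snd q) \<in> r (fst p) \<Longrightarrow> snd p \<noteq> snd q \<Longrightarrow>
      (snd (\<sigma> p), snd (\<sigma> q)) \<in> r' (fst p) \<and> snd (\<sigma> p) \<noteq> snd (\<sigma> q)"
  shows "row_mono r r' S \<sigma>"
  using assms unfolding row_mono_def by blast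

lemma row_mono_subset: "row_mono r r' S \<sigma> \<Longrightarrow> T \<subseteq> S \<Longrightarrow> row_mono r r' T \<sigma>"
  unfolding row_mono_def by blast

lemma row_mono_id: "S \<subseteq> positions X r \<Longrightarrow> row_mono r r S id"
  unfolding row_mono_def by auto

lemma row_mono_image: "row_mono r r' S \<sigma> \<Longrightarrow> S \<subseteq> positions X r \<Longrightarrow> \<sigma> ` S \<subseteq> positions X r'"
  unfolding row_mono_def by (force simp: prod_eq_iff mem_Sigma_iff)

lemma row_mono_comp:
  assumes "row_mono r r' S \<sigma>" "row_mono r' r'' (\<sigma> ` S) \<tau>"
  shows "row_mono r r'' S (\<tau> \<circ> \<sigma>)"
proof (rule row_monoI)
  fix p assume p: "p \<in> S"
  show "fst ((\<tau> \<circ> \<sigma>) p) = fst p" "snd ((\<tau> \<circ> \<sigma>) p) \<in> Field (r'' (fst p))"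
    using row_monoD(1,2)[OF assms(1) p] row_monoD(1,2)[OF assms(2), of "\<sigma> p"] p by auto
next
  fix p q assume pq: "p \<in> S" "q \<in> S" "fst p = fst q" "(snd p, snd q) \<in> r (fst p)" "snd p \<noteq> snd q"
  show "(snd ((\<tau> \<circ> \<sigma>) p), snd ((\<tau> \<circ> \<sigma>) q)) \<in> r'' (fst p) \<and> snd ((\<tau> \<circ> \<sigma>) p) \<noteq> snd ((\<tau> \<circ> \<sigma>) q)"
    using row_monoD(3)[OF assms(1) pq] row_monoD(1)[OF assms(1) pq(1)] row_monoD(1)[OF assms(1) pq(2)]
      row_monoD(3)[OF assms(2), of "\<sigma> p" "\<sigma> q"] pq by simp
qed

lemma positionsD: "S \<subseteq> positions X r \<Longrightarrow> p \<in> S \<Longrightarrow> fst p \<in> X \<and> snd p \<in> Field (r (fst p))"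
  by (metis mem_Sigma_iff prod.collapse subsetD)

lemma coords_mono: "S \<subseteq> T \<Longrightarrow> coords m S \<subseteq> coords m T"
  by (auto simp: coords_def)

lemma lift_coords: "(\<And>p. p \<in> S \<Longrightarrow> fst (\<sigma> p) = fst p) \<Longrightarrow> \<sigma> ` S \<subseteq> T \<Longrightarrow> lift \<sigma> ` coords m S \<subseteq> coords m T"
  by (fastforce simp: coords_def)

lemma Linear_orderD:
  assumes "Linear_order r"
  shows "trans r" "antisym r" "x \<in> Field r \<Longrightarrow> y \<in> Field r \<Longrightarrow> (x, y) \<in> r \<or> (y, x) \<in> r"
proof -
  show "trans r" "antisym r"
    using assms by (simp_all add: order_on_defs)
  show "x \<in> Field r \<Longrightarrow> y \<in> Field r \<Longrightarrow> (x, y) \<in> r \<or> (y, x) \<in> r"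
    using assms by (cases "x = y") (auto simp: order_on_defs total_on_def refl_on_def)
qed

lemma row_mono_inj:
  assumes "row_mono r r' S \<sigma>" "S \<subseteq> positions X r" "\<And>i. i \<in> X \<Longrightarrow> Linear_order (r i)"
  shows "inj_on \<sigma> S"
proof (rule inj_onI, rule ccontr)
  fix p q assume pq: "p \<in> S" "q \<in> S" "\<sigma> p = \<sigma> q" "p \<noteq> q"
  hence f: "fst p = fst q" using row_monoD(1)[OF assms(1)] by metis
  hence s: "snd p \<noteq> snd q" using pq by (auto simp: prod_eq_iff)
  have "(snd p, snd q) \<in> r (fst p) \<or> (snd q, snd p) \<in> r (fst p)"
    using Linear_orderD(3)[OF assms(3), of "fst p"] pq f positionsD[OF assms(2)] by metis
  thus False using row_monoD(3)[OF assms(1)] pq f s by metis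
qed

lemma Linear_orderI:
  assumes "\<And>x. x \<in> Field r \<Longrightarrow> (x, x) \<in> r" "\<And>x y z. (x, y) \<in> r \<Longrightarrow> (y, z) \<in> r \<Longrightarrow> (x, z) \<in> r"
    "\<And>x y. (x, y) \<in> r \<Longrightarrow> (y, x) \<in> r \<Longrightarrow> x = y"
    "\<And>x y. x \<in> Field r \<Longrightarrow> y \<in> Field r \<Longrightarrow> (x, y) \<in> r \<or> (y, x) \<in> r"
  shows "Linear_order r"
  using assms unfolding order_on_defs refl_on_def trans_def antisym_def total_on_def
  by (auto intro: FieldI1 FieldI2)

lemma Linear_orderE:
  assumes "Linear_order r"
  shows "x \<in> Field r \<Longrightarrow> (x, x) \<in> r" "(x, y) \<in> r \<Longrightarrow> (y, z) \<in> r \<Longrightarrow> (x, z) \<in> r"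
    "(x, y) \<in> r \<Longrightarrow> (y, x) \<in> r \<Longrightarrow> x = y"
    "x \<in> Field r \<Longrightarrow> y \<in> Field r \<Longrightarrow> (x, y) \<in> r \<or> (y, x) \<in> r"
  using assms Linear_orderD[OF assms] by (auto dest: transD antisymD)

definition le_rel :: "'a::linorder rel" where
  "le_rel = {(x, y). x \<le> y}"

lemma Field_le_rel [simp]: "Field le_rel = UNIV"
  by (auto simp: le_rel_def Field_def)

lemma Linear_order_le_rel [simp]: "Linear_order le_rel"
  by (rule Linear_orderI) (auto simp: le_rel_def)

lemma linear_order_le_rel [simp]: "linear_order le_rel"
  using Linear_order_le_rel by simp

lemma le_rel_iff [simp]: "(x, y) \<in> le_rel \<longleftrightarrow> x \<le> y"
  by (simp add: le_rel_def)

abbreviation le_rows :: "'x \<Rightarrow> 'a::linorder rel" where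
  "le_rows \<equiv> \<lambda>_. le_rel"

lemma row_mono_le_rowsD:
  assumes "row_mono le_rows le_rows S \<tau>" "(i, s) \<in> S" "(i, s') \<in> S" "s < s'"
  shows "snd (\<tau> (i, s)) < snd (\<tau> (i, s'))"
  using row_monoD(3)[OF assms(1,2,3)] assms(4) by (auto simp: less_le simp del: less_prod_simp)

lemma row_mono_le_rowsI:
  assumes "\<And>p. p \<in> S \<Longrightarrow> fst (\<tau> p) = fst p"
    "\<And>i s s'. (i, s) \<in> S \<Longrightarrow> (i, s') \<in> S \<Longrightarrow> s < s' \<Longrightarrow> snd (\<tau> (i, s)) < snd (\<tau> (i, s'))"
  shows "row_mono le_rows le_rows S \<tau>"
proof (rule row_monoI)
  fix p q assume pq: "p \<in> S" "q \<in> S" "fst p = fst q" "(snd p, snd q) \<in> le_rel" "snd p \<noteq> snd q"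
  hence "snd p < snd q" by simp
  moreover have eta: "(fst p, snd p) = p" "(fst p, snd q) = q" using pq(3) by (simp_all add: prod_eq_iff)
  ultimately have "snd (\<tau> p) < snd (\<tau> q)"
    using assms(2)[of "fst p" "snd p" "snd q", unfolded eta] pq(1,2) by blast
  thus "(snd (\<tau> p), snd (\<tau> q)) \<in> le_rel \<and> snd (\<tau> p) \<noteq> snd (\<tau> q)" by (simp add: less_imp_le less_imp_neq)
qed (use assms(1) in simp_all)

definition monotone_seq :: "'i rel \<Rightarrow> bool \<Rightarrow> (nat \<Rightarrow> 'i) \<Rightarrow> bool" where
  "monotone_seq r b f \<longleftrightarrow> range f \<subseteq> Field r \<and>
     (\<forall>x y. x < y \<longrightarrow> f x \<noteq> f y \<and> (if b then (f x, f y) \<in> r else (f y, f x) \<in> r))"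

lemma ex_monotone_seq:
  fixes r :: "'i rel"
  assumes "Linear_order r" "infinite (Field r)"
  shows "\<exists>b f. monotone_seq r b f"
proof -
  obtain g :: "nat \<Rightarrow> 'i" where g: "inj g" "range g \<subseteq> Field r"
    using assms(2) infinite_countable_subset by blast
  define col where "col u = (if (g (Min u), g (Max u)) \<in> r then 1 else 0 :: nat)" for u
  have "\<exists>Y t. Y \<subseteq> UNIV \<and> infinite Y \<and> t < 2 \<and> (\<forall>x\<in>Y. \<forall>y\<in>Y. x \<noteq> y \<longrightarrow> col {x, y} = t)"
    by (rule Ramsey2) (auto simp: col_def)
  then obtain Y t where Y: "infinite Y" "\<And>x y. x \<in> Y \<Longrightarrow> y \<in> Y \<Longrightarrow> x \<noteq> y \<Longrightarrow> col {x, y} = t"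
    by metis
  define f where "f = g \<circ> enumerate Y"
  have range: "range f \<subseteq> Field r" using g by (auto simp: f_def)
  have "f x \<noteq> f y \<and> (if t = 1 then (f x, f y) \<in> r else (f y, f x) \<in> r)" if "x < y" for x y
  proof
    have less: "enumerate Y x < enumerate Y y" using Y(1) that by (auto simp: enumerate_mono)
    thus "f x \<noteq> f y" using g(1) by (auto simp: f_def dest: injD)
    have "col {enumerate Y x, enumerate Y y} = t"
      using Y(2) less enumerate_in_set[OF Y(1)] by (metis less_irrefl)
    moreover have "Min {enumerate Y x, enumerate Y y} = enumerate Y x"
      "Max {enumerate Y x, enumerate Y y} = enumerate Y y"
      using less by auto
    ultimately have "(f x, f y) \<in> r \<longleftrightarrow> t = 1" by (auto simp: col_def f_def split: if_splits)
    moreover have "(f x, f y) \<in> r \<or> (f y, f x) \<in> r"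
      using Linear_orderD(3)[OF assms(1), of "f x" "f y"] range by auto
    ultimately show "if t = 1 then (f x, f y) \<in> r else (f y, f x) \<in> r" by auto
  qed
  hence "monotone_seq r (t = 1) f" unfolding monotone_seq_def using range by simp
  thus ?thesis by blast
qed

subsection \<open>Ramsey's theorem for monotone maps\<close>

definition rel_mono :: "('p \<Rightarrow> 'p \<Rightarrow> bool) \<Rightarrow> 'p set \<Rightarrow> ('p \<Rightarrow> nat) \<Rightarrow> bool" where
  "rel_mono G S \<rho> \<longleftrightarrow> (\<forall>p\<in>S. \<forall>q\<in>S. G p q \<longrightarrow> \<rho> p < \<rho> q)"

lemma rel_mono_unique:
  assumes S: "finite S" "\<And>p q. p \<in> S \<Longrightarrow> q \<in> S \<Longrightarrow> p \<noteq> q \<Longrightarrow> G p q \<or> G q p"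
    and "rel_mono G S \<rho>" "rel_mono G S \<rho>'" "\<rho> ` S = \<rho>' ` S" "p \<in> S"
  shows "\<rho> p = \<rho>' p"
proof -
  have eq: "{x \<in> \<rho> ` S. x < \<rho> p} = \<rho> ` {q \<in> S. G q p}" if "rel_mono G S \<rho>" for \<rho>
    using that S(2) \<open>p \<in> S\<close> unfolding rel_mono_def
    by (auto intro!: imageI) (metis less_asym less_irrefl)
  have inj: "inj_on \<rho> S" if "rel_mono G S \<rho>" for \<rho>
    using that S(2) unfolding rel_mono_def inj_on_def by (metis less_irrefl)
  have c: "card {x \<in> \<rho> ` S. x < \<rho> p} = card {q \<in> S. G q p}" if "rel_mono G S \<rho>" for \<rho>
    unfolding eq[OF that] by (rule card_image) (rule inj_on_subset[OF inj[OF that]], auto)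
  have "\<not> \<rho>1 p < \<rho>2 p" if g: "rel_mono G S \<rho>1" "rel_mono G S \<rho>2" "\<rho>1 ` S = \<rho>2 ` S" for \<rho>1 \<rho>2
  proof
    assume l: "\<rho>1 p < \<rho>2 p"
    have "{x \<in> \<rho>1 ` S. x < \<rho>1 p} \<subset> {x \<in> \<rho>2 ` S. x < \<rho>2 p}"
      using l \<open>p \<in> S\<close> g(3) by (auto intro: less_trans)
    hence "card {x \<in> \<rho>1 ` S. x < \<rho>1 p} < card {x \<in> \<rho>2 ` S. x < \<rho>2 p}"
      by (intro psubset_card_mono) (use S in auto)
    thus False using c[OF g(1)] c[OF g(2)] by linarith
  qed
  thus ?thesis using assms(3-5) by (metis linorder_neqE_nat)
qed

definition homogeneous :: "('p \<Rightarrow> 'p \<Rightarrow> bool) \<Rightarrow> 'p set \<Rightarrow> (('p \<Rightarrow> nat) \<Rightarrow> bool) \<Rightarrow> nat set \<Rightarrow> bool" where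
  "homogeneous G S Q Y \<longleftrightarrow> (\<forall>\<rho> \<rho>'. rel_mono G S \<rho> \<and> rel_mono G S \<rho>' \<and> \<rho> ` S \<subseteq> Y \<and> \<rho>' ` S \<subseteq> Y \<longrightarrow>
     (Q \<rho> \<longleftrightarrow> Q \<rho>'))"

lemma homogeneousD:
  "homogeneous G S Q Y \<Longrightarrow> rel_mono G S \<rho> \<Longrightarrow> rel_mono G S \<rho>' \<Longrightarrow> \<rho> ` S \<subseteq> Y \<Longrightarrow> \<rho>' ` S \<subseteq> Y \<Longrightarrow>
    Q \<rho> \<longleftrightarrow> Q \<rho>'"
  unfolding homogeneous_def by blast

lemma homogeneous_subset: "homogeneous G S Q Y \<Longrightarrow> Y' \<subseteq> Y \<Longrightarrow> homogeneous G S Q Y'"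
  unfolding homogeneous_def by (meson order_trans)

lemma Ramsey_rel_mono:
  assumes S: "finite S" "\<And>p q. p \<in> S \<Longrightarrow> q \<in> S \<Longrightarrow> p \<noteq> q \<Longrightarrow> G p q \<or> G q p"
    and Q: "\<And>\<rho> \<rho>'. (\<And>p. p \<in> S \<Longrightarrow> \<rho> p = \<rho>' p) \<Longrightarrow> Q \<rho> \<longleftrightarrow> Q \<rho>'" and Y0: "infinite Y0"
  shows "\<exists>Y\<subseteq>Y0. infinite Y \<and> homogeneous G S Q Y"
proof -
  define col where "col u = (if \<exists>\<rho>. rel_mono G S \<rho> \<and> \<rho> ` S = u \<and> Q \<rho> then 1 else 0 :: nat)" for u
  have "\<exists>Y t. Y \<subseteq> Y0 \<and> infinite Y \<and> t < 2 \<and>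
     (\<forall>X. X \<subseteq> Y \<and> finite X \<and> card X = card S \<longrightarrow> col X = t)"
    by (rule Ramsey) (use Y0 in \<open>auto simp: col_def\<close>)
  then obtain Y t where Y: "Y \<subseteq> Y0" "infinite Y"
    "\<forall>X. X \<subseteq> Y \<and> finite X \<and> card X = card S \<longrightarrow> col X = t"
    by blast
  have "Q \<rho> \<longleftrightarrow> t = 1" if \<rho>: "rel_mono G S \<rho>" "\<rho> ` S \<subseteq> Y" for \<rho>
  proof -
    have "inj_on \<rho> S"
      using \<rho>(1) S(2) unfolding rel_mono_def inj_on_def by (metis less_irrefl)
    hence "col (\<rho> ` S) = t" using Y(3) \<rho>(2) S(1) by (simp add: card_image)
    moreover have "Q \<rho>' = Q \<rho>" if "rel_mono G S \<rho>'" "\<rho>' ` S = \<rho> ` S" for \<rho>'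
      using Q rel_mono_unique[OF S that(1) \<rho>(1) that(2)] by blast
    ultimately show ?thesis using \<rho>(1) unfolding col_def by (metis zero_neq_one)
  qed
  hence "homogeneous G S Q Y" unfolding homogeneous_def by simp
  with Y(1,2) show ?thesis by blast
qed

lemma Ramsey_rel_mono_family:
  assumes "finite I"
    and "\<And>i. i \<in> I \<Longrightarrow> finite (S i)"
    and "\<And>i p q. i \<in> I \<Longrightarrow> p \<in> S i \<Longrightarrow> q \<in> S i \<Longrightarrow> p \<noteq> q \<Longrightarrow> G p q \<or> G q p"
    and "\<And>i \<rho> \<rho>'. i \<in> I \<Longrightarrow> (\<And>p. p \<in> S i \<Longrightarrow> \<rho> p = \<rho>' p) \<Longrightarrow> Q i \<rho> \<longleftrightarrow> Q i \<rho>'"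
  shows "\<exists>Y. infinite Y \<and> (\<forall>i\<in>I. homogeneous G (S i) (Q i) Y)"
  using assms
proof (induction I)
  case empty
  show ?case by (intro exI[of _ UNIV]) auto
next
  case (insert i I)
  have "\<exists>Y. infinite Y \<and> (\<forall>j\<in>I. homogeneous G (S j) (Q j) Y)"
    by (rule insert.IH) (use insert.prems in \<open>blast+\<close>)
  then obtain Y0 where Y0: "infinite Y0" "\<forall>j\<in>I. homogeneous G (S j) (Q j) Y0" by blast
  have "\<exists>Y\<subseteq>Y0. infinite Y \<and> homogeneous G (S i) (Q i) Y"
    by (rule Ramsey_rel_mono[OF _ _ _ Y0(1)]) (use insert.prems[of i] in blast)+
  then obtain Y where "Y \<subseteq> Y0" "infinite Y" "homogeneous G (S i) (Q i) Y" by blast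
  thus ?case using Y0(2) by (intro exI[of _ Y]) (auto intro: homogeneous_subset)
qed

lemma rel_mono_exists:
  assumes "finite S" "\<And>p q r. p \<in> S \<Longrightarrow> q \<in> S \<Longrightarrow> r \<in> S \<Longrightarrow> G p q \<Longrightarrow> G q r \<Longrightarrow> G p r"
    "\<And>p. p \<in> S \<Longrightarrow> \<not> G p p" "infinite (Y :: nat set)"
  obtains \<rho> where "rel_mono G S \<rho>" "range \<rho> \<subseteq> Y"
proof -
  define \<rho> where "\<rho> p = enumerate Y (card {q \<in> S. G q p})" for p
  have "rel_mono G S \<rho>"
    unfolding rel_mono_def
  proof (intro ballI impI)
    fix p q assume pq: "p \<in> S" "q \<in> S" "G p q"
    have "{x \<in> S. G x p} \<subset> {x \<in> S. G x q}" using pq assms(2,3) by blast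
    hence "card {x \<in> S. G x p} < card {x \<in> S. G x q}" by (intro psubset_card_mono) (use assms in auto)
    thus "\<rho> p < \<rho> q" unfolding \<rho>_def using assms(4) by (rule enumerate_mono)
  qed
  moreover have "range \<rho> \<subseteq> Y" using assms(4) by (auto simp: \<rho>_def enumerate_in_set)
  ultimately show thesis by (rule that)
qed

lemma finite_subset_Un_images:
  assumes "finite C" "C \<subseteq> f ` A \<union> g ` B"
  shows "\<exists>A0 B0. finite A0 \<and> A0 \<subseteq> A \<and> finite B0 \<and> B0 \<subseteq> B \<and> C = f ` A0 \<union> g ` B0"
proof -
  obtain A0 where "finite A0" "A0 \<subseteq> A" "C \<inter> f ` A = f ` A0"
    using finite_subset_image[of "C \<inter> f ` A" f A] assms(1) by blast
  moreover obtain B0 where "finite B0" "B0 \<subseteq> B" "C \<inter> g ` B = g ` B0"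
    using finite_subset_image[of "C \<inter> g ` B" g B] assms(1) by blast
  moreover have "C = C \<inter> f ` A \<union> C \<inter> g ` B" using assms(2) by blast
  ultimately show ?thesis by metis
qed

text \<open>
  The auxiliary order for Ramsey's theorem: rows are compared by their numbers \<open>num\<close>, and row \<open>i\<close> is
  reversed unless \<open>b i\<close>.
\<close>

definition row_order ::
    "('x \<Rightarrow> nat) \<Rightarrow> ('x \<Rightarrow> bool) \<Rightarrow> ('x \<Rightarrow> 'i rel) \<Rightarrow> 'x \<times> 'i \<Rightarrow> 'x \<times> 'i \<Rightarrow> bool" where
  "row_order num b r p q \<longleftrightarrow> num (fst p) < num (fst q) \<or> (fst p = fst q \<and> snd p \<noteq> snd q \<and>
     (if b (fst p) then (snd p, snd q) \<in> r (fst p) else (snd q, snd p) \<in> r (fst p)))"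

lemma row_order_irrefl: "\<not> row_order num b r p p"
  by (simp add: row_order_def)

lemma row_order_total:
  assumes lin: "\<And>i. i \<in> X \<Longrightarrow> Linear_order (r i)" and T: "T \<subseteq> positions X r" "inj_on num (fst ` T)"
    and pq: "p \<in> T" "q \<in> T" "p \<noteq> q"
  shows "row_order num b r p q \<or> row_order num b r q p"
proof (cases "fst p = fst q")
  case True
  have "fst p \<in> X" "snd p \<in> Field (r (fst p))" "snd q \<in> Field (r (fst p))"
    using positionsD[OF T(1), of p] positionsD[OF T(1), of q] pq True by auto
  hence "(snd p, snd q) \<in> r (fst p) \<or> (snd q, snd p) \<in> r (fst p)"
    using Linear_orderD(3)[OF lin] by blast
  moreover have "snd p \<noteq> snd q" using True pq by (auto simp: prod_eq_iff)
  ultimately show ?thesis using True unfolding row_order_def by auto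
next
  case False
  hence "num (fst p) \<noteq> num (fst q)" using T(2) pq by (auto dest: inj_onD)
  thus ?thesis unfolding row_order_def by auto
qed

lemma row_order_trans:
  assumes lin: "Linear_order (r (fst p))" and "row_order num b r p q" "row_order num b r q s"
  shows "row_order num b r p s"
proof (cases "fst p = fst q \<and> fst q = fst s")
  case True
  thus ?thesis
    using assms(2,3) Linear_orderD(1,2)[OF lin] unfolding row_order_def
    by (auto split: if_splits dest: transD antisymD)
next
  case False
  thus ?thesis using assms(2,3) unfolding row_order_def by auto
qed

lemma row_order_row_mono:
  assumes \<tau>: "row_mono r r S \<tau>" and p: "p \<in> S" "q \<in> S" "row_order num b r p q"
  shows "row_order num b r (\<tau> p) (\<tau> q)"
  using p(3) row_monoD(1)[OF \<tau> p(1)] row_monoD(1)[OF \<tau> p(2)] row_monoD(3)[OF \<tau> p(1,2)]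
    row_monoD(3)[OF \<tau> p(2,1)]
  unfolding row_order_def by (auto split: if_splits)

lemma row_mono_monotone_seq:
  assumes f: "\<And>i. i \<in> X \<Longrightarrow> monotone_seq (r i) (b i) (f i)" and T: "T \<subseteq> positions X r'"
    and \<rho>: "rel_mono (row_order num b r') T \<rho>"
  shows "row_mono r' r T (\<lambda>p. (fst p, f (fst p) (\<rho> p)))"
proof (rule row_monoI)
  fix p assume "p \<in> T"
  hence "fst p \<in> X" using positionsD[OF T, of p] by auto
  thus "snd (fst p, f (fst p) (\<rho> p)) \<in> Field (r (fst p))"
    using f unfolding monotone_seq_def by auto
next
  fix p q assume pq: "p \<in> T" "q \<in> T" "fst p = fst q" "(snd p, snd q) \<in> r' (fst p)" "snd p \<noteq> snd q"
  have "if b (fst p) then row_order num b r' p q else row_order num b r' q p"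
    using pq unfolding row_order_def by auto
  hence "if b (fst p) then \<rho> p < \<rho> q else \<rho> q < \<rho> p" using \<rho> pq unfolding rel_mono_def by auto
  moreover have "monotone_seq (r (fst p)) (b (fst p)) (f (fst p))"
    using f positionsD[OF T pq(1)] by blast
  ultimately show "(snd (fst p, f (fst p) (\<rho> p)), snd (fst q, f (fst q) (\<rho> q))) \<in> r (fst p) \<and>
      snd (fst p, f (fst p) (\<rho> p)) \<noteq> snd (fst q, f (fst q) (\<rho> q))"
    using pq(3) unfolding monotone_seq_def by (force split: if_splits)
qed simp

lemma row_mono_inv_into:
  assumes \<sigma>: "row_mono r' r S \<sigma>1" "row_mono r' r S \<sigma>2" and S: "S \<subseteq> positions X r'"
    and lin: "\<And>i. i \<in> X \<Longrightarrow> Linear_order (r i)" "\<And>i. i \<in> X \<Longrightarrow> Linear_order (r' i)"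
  shows "row_mono r r (\<sigma>1 ` S) (\<sigma>2 \<circ> inv_into S \<sigma>1)"
proof (rule row_monoI)
  have inj: "inj_on \<sigma>1 S" by (rule row_mono_inj[OF \<sigma>(1) S lin(2)])
  note inv = inv_into_f_f[OF inj]
  fix p assume "p \<in> \<sigma>1 ` S"
  thus "fst ((\<sigma>2 \<circ> inv_into S \<sigma>1) p) = fst p" "snd ((\<sigma>2 \<circ> inv_into S \<sigma>1) p) \<in> Field (r (fst p))"
    using inv row_monoD(1,2)[OF \<sigma>(1)] row_monoD(1,2)[OF \<sigma>(2)] by auto
  fix q assume "q \<in> \<sigma>1 ` S" and pq: "fst p = fst q" "(snd p, snd q) \<in> r (fst p)" "snd p \<noteq> snd q"
  then obtain s t where st: "s \<in> S" "t \<in> S" "p = \<sigma>1 s" "q = \<sigma>1 t" using \<open>p \<in> \<sigma>1 ` S\<close> by blast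
  have row: "fst s = fst t" "fst p = fst s" "fst q = fst s" using pq(1) st row_monoD(1)[OF \<sigma>(1)] by auto
  have X: "fst s \<in> X" "snd s \<in> Field (r' (fst s))" "snd t \<in> Field (r' (fst s))"
    using st row positionsD[OF S, of s] positionsD[OF S, of t] by auto
  have ne: "snd s \<noteq> snd t" using row(1) pq(3) st(3,4) by (metis prod.collapse)
  have "(snd t, snd s) \<notin> r' (fst s)"
  proof
    assume "(snd t, snd s) \<in> r' (fst s)"
    hence "(snd q, snd p) \<in> r (fst s)" using row_monoD(3)[OF \<sigma>(1) st(2,1)] row ne st by auto
    thus False using Linear_orderD(2)[OF lin(1)[OF X(1)]] pq row by (auto dest: antisymD)
  qed
  hence "(snd s, snd t) \<in> r' (fst s)" using Linear_orderD(3)[OF lin(2)[OF X(1)] X(2,3)] by blast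
  thus "(snd ((\<sigma>2 \<circ> inv_into S \<sigma>1) p), snd ((\<sigma>2 \<circ> inv_into S \<sigma>1) q)) \<in> r (fst p) \<and>
      snd ((\<sigma>2 \<circ> inv_into S \<sigma>1) p) \<noteq> snd ((\<sigma>2 \<circ> inv_into S \<sigma>1) q)"
    using row_monoD(3)[OF \<sigma>(2) st(1,2)] row ne st inv by auto
qed

context monster
begin

definition mut_indisc :: "'m set \<Rightarrow> 'x set \<Rightarrow> ('x \<Rightarrow> 'i rel) \<Rightarrow> ('x \<Rightarrow> nat) \<Rightarrow> (('x \<times> 'i) \<times> nat \<Rightarrow> 'm) \<Rightarrow> bool" where
  "mut_indisc A X r m h \<longleftrightarrow> (\<forall>S \<tau>. finite S \<and> S \<subseteq> positions X r \<and> row_mono r r S \<tau> \<longrightarrow>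
     tp_eq A (coords m S) h (h \<circ> lift \<tau>))"

lemma tp_eq_coordsI:
  assumes "\<And>F. finite F \<Longrightarrow> F \<subseteq> S \<Longrightarrow> tp_eq A (coords m F) h h'"
  shows "tp_eq A (coords m S) h h'"
proof (rule tp_eq_finiteI)
  fix V assume V: "finite V" "V \<subseteq> coords m S"
  have "tp_eq A (coords m (fst ` V)) h h'" by (rule assms) (use V in \<open>auto simp: coords_def\<close>)
  thus "tp_eq A V h h'" by (rule tp_eq_mono) (use V(2) in \<open>force simp: coords_def\<close>)+
qed

lemma mut_indisc_row_mono:
  assumes mi: "mut_indisc A X r m h" and h: "h \<in> envs" and lin: "\<And>i. i \<in> X \<Longrightarrow> Linear_order (r i)"
    "\<And>i. i \<in> X \<Longrightarrow> Linear_order (r' i)"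
    and S: "S \<subseteq> positions X r'" and \<sigma>: "row_mono r' r S \<sigma>1" "row_mono r' r S \<sigma>2"
  shows "tp_eq A (coords m S) (h \<circ> lift \<sigma>1) (h \<circ> lift \<sigma>2)"
proof (rule tp_eq_coordsI)
  fix F assume F: "finite F" "F \<subseteq> S"
  have \<sigma>F: "row_mono r' r F \<sigma>1" "row_mono r' r F \<sigma>2" using \<sigma> F(2) row_mono_subset by blast+
  have FX: "F \<subseteq> positions X r'" using F(2) S by blast
  let ?\<tau> = "\<sigma>2 \<circ> inv_into F \<sigma>1"
  have \<tau>: "\<sigma>2 (inv_into F \<sigma>1 (\<sigma>1 p)) = \<sigma>2 p" if "p \<in> F" for p
    using inv_into_f_f[OF row_mono_inj[OF \<sigma>F(1) FX lin(2)] that] by simp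
  have "tp_eq A (coords m (\<sigma>1 ` F)) h (h \<circ> lift ?\<tau>)"
    using mi row_mono_image[OF \<sigma>F(1) FX] F(1) row_mono_inv_into[OF \<sigma>F FX lin]
    unfolding mut_indisc_def by blast
  hence "tp_eq A (coords m F) (h \<circ> lift \<sigma>1) (h \<circ> lift ?\<tau> \<circ> lift \<sigma>1)"
    by (rule tp_eq_reindex) (rule lift_coords, use row_monoD(1)[OF \<sigma>F(1)] in auto)
  moreover have "tp_eq A (coords m F) (h \<circ> lift ?\<tau> \<circ> lift \<sigma>1) (h \<circ> lift \<sigma>2)"
    by (rule tp_eq_agree) (use h \<tau> in \<open>auto intro!: envs_comp simp: coords_def\<close>)
  ultimately show "tp_eq A (coords m F) (h \<circ> lift \<sigma>1) (h \<circ> lift \<sigma>2)" by (rule tp_eq_trans)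
qed

lemma mut_indiscI:
  assumes "\<And>S \<tau>. finite S \<Longrightarrow> S \<subseteq> positions X r \<Longrightarrow> row_mono r r S \<tau> \<Longrightarrow> tp_eq A (coords m S) h (h \<circ> lift \<tau>)"
  shows "mut_indisc A X r m h"
  using assms unfolding mut_indisc_def by blast

lemma mut_indisc_reindex:
  assumes mut_indisc: "mut_indisc A X r m h" and h: "h \<in> envs" and lin: "\<And>i. i \<in> X \<Longrightarrow> Linear_order (r i)"
    "\<And>i. i \<in> X \<Longrightarrow> Linear_order (r' i)" and \<sigma>: "row_mono r' r (positions X r') \<sigma>"
  shows "mut_indisc A X r' m (h \<circ> lift \<sigma>)"
proof (rule mut_indiscI)
  fix S :: "('a \<times> 'c) set" and \<tau> assume S: "finite S" "S \<subseteq> positions X r'" "row_mono r' r' S \<tau>"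
  have "\<tau> ` S \<subseteq> positions X r'" by (rule row_mono_image[OF S(3,2)])
  hence "row_mono r' r S (\<sigma> \<circ> \<tau>)" using row_mono_comp[OF S(3)] row_mono_subset[OF \<sigma>] by blast
  hence "tp_eq A (coords m S) (h \<circ> lift \<sigma>) (h \<circ> lift (\<sigma> \<circ> \<tau>))"
    using mut_indisc_row_mono[OF mut_indisc h lin S(2)] row_mono_subset[OF \<sigma> S(2)] by blast
  thus "tp_eq A (coords m S) (h \<circ> lift \<sigma>) (h \<circ> lift \<sigma> \<circ> lift \<tau>)"
    by (simp add: comp_assoc map_prod_compose[symmetric] del: map_prod_compose)
qed

lemma small_coords:
  assumes "|X| <o kb" "\<And>i. i \<in> X \<Longrightarrow> |Field (r i)| <o kb"
  shows "|coords m (positions X r)| <o kb"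
proof (rule small_subset_mono)
  show "|positions X r \<times> (UNIV :: nat set)| <o kb"
    by (intro small_Sigma assms small_countable) auto
  show "coords m (positions X r) \<subseteq> positions X r \<times> UNIV" by (auto simp: coords_def)
qed

lemma mut_indisc_mono: "mut_indisc A X r m h \<Longrightarrow> A' \<subseteq> A \<Longrightarrow> X' \<subseteq> X \<Longrightarrow> mut_indisc A' X' r m h"
  unfolding mut_indisc_def by (meson Sigma_mono order_refl order_trans tp_eq_mono)

lemma mut_indisc_tp_eq:
  assumes mi: "mut_indisc A X r m h" and k: "tp_eq A (coords m (positions X r)) k h"
  shows "mut_indisc A X r m k"
proof (rule mut_indiscI)
  fix S \<tau> assume S: "finite S" "S \<subseteq> positions X r" and \<tau>: "row_mono r r S \<tau>"
  have "tp_eq A (coords m S) k h" by (rule tp_eq_mono[OF k order_refl coords_mono[OF S(2)]])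
  moreover have "tp_eq A (coords m S) h (h \<circ> lift \<tau>)" using mi S \<tau> unfolding mut_indisc_def by blast
  moreover have "tp_eq A (coords m S) (k \<circ> lift \<tau>) (h \<circ> lift \<tau>)"
    by (rule tp_eq_reindex[OF k lift_coords[OF row_monoD(1)[OF \<tau>] row_mono_image[OF \<tau> S(2)]]])
  ultimately show "tp_eq A (coords m S) k (k \<circ> lift \<tau>)" by (meson tp_eq_trans tp_eq_sym)
qed

subsection \<open>Extracting mutually indiscernible families\<close>

definition realizes_EM_type ::
    "'m set \<Rightarrow> 'x set \<Rightarrow> ('x \<Rightarrow> nat) \<Rightarrow> ('x \<Rightarrow> 'i rel) \<Rightarrow> (('x \<times> 'i) \<times> nat \<Rightarrow> 'm) \<Rightarrow>
      ('x \<Rightarrow> 'j rel) \<Rightarrow> (('x \<times> 'j) \<times> nat \<Rightarrow> 'm) \<Rightarrow> bool" where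
  "realizes_EM_type A X m r h r' h' \<longleftrightarrow>
     (\<forall>S P. finite S \<and> S \<subseteq> positions X r' \<and> definable A (coords m S) P \<and>
        (\<forall>\<sigma>. row_mono r' r S \<sigma> \<longrightarrow> P (h \<circ> lift \<sigma>)) \<longrightarrow> P h')"

lemma realizes_EM_typeD:
  assumes "realizes_EM_type A X m r h r' h'" "finite S" "S \<subseteq> positions X r'" "definable A (coords m S) P"
    "\<And>\<sigma>. row_mono r' r S \<sigma> \<Longrightarrow> P (h \<circ> lift \<sigma>)"
  shows "P h'"
  using assms unfolding realizes_EM_type_def by blast

lemma Ramsey_row_mono:
  fixes M :: "(((('x \<times> 'j) \<times> nat \<Rightarrow> 'm) \<Rightarrow> bool) \<times> ('x \<times> 'j) set \<times> ('x \<times> 'j \<Rightarrow> 'x \<times> 'j)) set"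
  assumes h: "h \<in> envs"
    and r: "\<And>i. i \<in> X \<Longrightarrow> Linear_order (r i)" "\<And>i. i \<in> X \<Longrightarrow> infinite (Field (r i))"
    and r': "\<And>i. i \<in> X \<Longrightarrow> Linear_order (r' i)" and T: "finite T" "T \<subseteq> positions X r'" and M: "finite M"
    "\<And>P S \<tau>. (P, S, \<tau>) \<in> M \<Longrightarrow> S \<subseteq> T \<and> \<tau> ` S \<subseteq> T \<and> row_mono r' r' S \<tau> \<and> definable A (coords m S) P"
  shows "\<exists>\<sigma>. row_mono r' r T \<sigma> \<and> (\<forall>(P, S, \<tau>)\<in>M. P (h \<circ> lift \<sigma>) \<longleftrightarrow> P (h \<circ> lift \<sigma> \<circ> lift \<tau>))"
proof -
  have "\<forall>i\<in>X. \<exists>b f. monotone_seq (r i) b f" using ex_monotone_seq r by blast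
  then obtain b f where f: "\<And>i. i \<in> X \<Longrightarrow> monotone_seq (r i) (b i) (f i)" by metis
  obtain num :: "'x \<Rightarrow> nat" where num: "inj_on num (fst ` T)"
    using finite_imp_inj_to_nat_seg[of "fst ` T"] T(1) by blast
  let ?G = "row_order num b r'"
  define \<theta> where "\<theta> \<rho> p = (fst p, f (fst p) (\<rho> p))" for \<rho> :: "'x \<times> 'j \<Rightarrow> nat" and p
  have "\<exists>Y. infinite Y \<and> (\<forall>q\<in>M. homogeneous ?G (fst (snd q)) (\<lambda>\<rho>. fst q (h \<circ> lift (\<theta> \<rho>))) Y)"
  proof (rule Ramsey_rel_mono_family[OF M(1)])
    fix q assume "q \<in> M"
    then obtain P S \<tau> where q: "q = (P, S, \<tau>)" "S \<subseteq> T" "definable A (coords m S) P"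
      using M(2) by (metis prod_cases3)
    show "finite (fst (snd q))" using q(1,2) T(1) finite_subset by auto
    show "?G p p' \<or> ?G p' p" if "p \<in> fst (snd q)" "p' \<in> fst (snd q)" "p \<noteq> p'" for p p'
      by (rule row_order_total[OF r' T(2) num]) (use that q(1,2) in auto)
    show "fst q (h \<circ> lift (\<theta> \<rho>)) = fst q (h \<circ> lift (\<theta> \<rho>'))" if "\<And>p. p \<in> fst (snd q) \<Longrightarrow> \<rho> p = \<rho>' p" for \<rho> \<rho>'
      unfolding q(1) fst_conv
      by (rule definable_local[OF q(3)]) (use h q(1) that in \<open>auto intro!: envs_comp simp: coords_def \<theta>_def\<close>)
  qed
  then obtain Y where Y: "infinite Y"
    "\<And>q. q \<in> M \<Longrightarrow> homogeneous ?G (fst (snd q)) (\<lambda>\<rho>. fst q (h \<circ> lift (\<theta> \<rho>))) Y" by blast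
  have "?G p s" if "p \<in> T" "q \<in> T" "?G p q" "?G q s" for p q s
    using row_order_trans[OF r' that(3,4)] positionsD[OF T(2) that(1)] by blast
  then obtain \<rho> where \<rho>: "rel_mono ?G T \<rho>" "range \<rho> \<subseteq> Y"
    using rel_mono_exists[of T ?G Y] T(1) row_order_irrefl Y(1) by blast
  have "P (h \<circ> lift (\<theta> \<rho>)) \<longleftrightarrow> P (h \<circ> lift (\<theta> \<rho>) \<circ> lift \<tau>)" if PS\<tau>: "(P, S, \<tau>) \<in> M" for P S \<tau>
  proof -
    have S: "S \<subseteq> T" "\<tau> ` S \<subseteq> T" and \<tau>: "row_mono r' r' S \<tau>" and P: "definable A (coords m S) P"
      using M(2)[OF PS\<tau>] by auto
    have "rel_mono ?G S \<rho>" "rel_mono ?G S (\<rho> \<circ> \<tau>)"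
      using \<rho>(1) S row_order_row_mono[OF \<tau>] unfolding rel_mono_def by (auto simp: image_subset_iff)
    hence "P (h \<circ> lift (\<theta> \<rho>)) = P (h \<circ> lift (\<theta> (\<rho> \<circ> \<tau>)))"
      using homogeneousD[OF Y(2)[OF PS\<tau>], of \<rho> "\<rho> \<circ> \<tau>"] \<rho>(2) by auto
    also have "\<dots> = P (h \<circ> lift (\<theta> \<rho>) \<circ> lift \<tau>)"
      by (rule definable_local[OF P]) (use h row_monoD(1)[OF \<tau>] in \<open>auto intro!: envs_comp simp: coords_def \<theta>_def\<close>)
    finally show ?thesis .
  qed
  moreover have "row_mono r' r T (\<theta> \<rho>)" unfolding \<theta>_def by (rule row_mono_monotone_seq[OF f T(2) \<rho>(1)])
  ultimately show ?thesis by blast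
qed

lemma extraction_finite:
  fixes M :: "(((('x \<times> 'j) \<times> nat \<Rightarrow> 'm) \<Rightarrow> bool) \<times> ('x \<times> 'j) set \<times> ('x \<times> 'j \<Rightarrow> 'x \<times> 'j)) set"
  assumes h: "h \<in> envs"
    and r: "\<And>i. i \<in> X \<Longrightarrow> Linear_order (r i)" "\<And>i. i \<in> X \<Longrightarrow> infinite (Field (r i))"
    and r': "\<And>i. i \<in> X \<Longrightarrow> Linear_order (r' i)" and fin: "finite E" "finite M"
    and E: "\<And>P S. (P, S) \<in> E \<Longrightarrow> finite S \<and> S \<subseteq> positions X r' \<and> (\<forall>\<sigma>. row_mono r' r S \<sigma> \<longrightarrow> P (h \<circ> lift \<sigma>))"
    and M: "\<And>P S \<tau>. (P, S, \<tau>) \<in> M \<Longrightarrow>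
      finite S \<and> S \<subseteq> positions X r' \<and> row_mono r' r' S \<tau> \<and> definable A (coords m S) P"
  shows "\<exists>k\<in>envs. (\<forall>(P, S)\<in>E. P k) \<and> (\<forall>(P, S, \<tau>)\<in>M. P k \<longleftrightarrow> P (k \<circ> lift \<tau>))"
proof -
  define T where "T = (\<Union>q\<in>E. snd q) \<union> (\<Union>(P, S, \<tau>)\<in>M. S \<union> \<tau> ` S)"
  have "finite T" unfolding T_def using fin E M by auto
  moreover have "T \<subseteq> positions X r'"
    unfolding T_def
  proof (intro Un_least UN_least)
    show "snd q \<subseteq> positions X r'" if "q \<in> E" for q using E[of "fst q" "snd q"] that by simp
    show "(case q of (P, S, \<tau>) \<Rightarrow> S \<union> \<tau> ` S) \<subseteq> positions X r'" if "q \<in> M" for q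
      using M[of "fst q" "fst (snd q)" "snd (snd q)"] row_mono_image[of r' r'] that
      by (simp add: split_beta)
  qed
  ultimately have T: "finite T" "T \<subseteq> positions X r'" .
  have "\<exists>\<sigma>. row_mono r' r T \<sigma> \<and> (\<forall>(P, S, \<tau>)\<in>M. P (h \<circ> lift \<sigma>) \<longleftrightarrow> P (h \<circ> lift \<sigma> \<circ> lift \<tau>))"
  proof (rule Ramsey_row_mono[OF h r r' T fin(2)])
    show "S \<subseteq> T \<and> \<tau> ` S \<subseteq> T \<and> row_mono r' r' S \<tau> \<and> definable A (coords m S) P" if "(P, S, \<tau>) \<in> M" for P S \<tau>
      using M[OF that] that unfolding T_def by auto
  qed
  then obtain \<sigma> where \<sigma>: "row_mono r' r T \<sigma>" "\<forall>(P, S, \<tau>)\<in>M. P (h \<circ> lift \<sigma>) \<longleftrightarrow> P (h \<circ> lift \<sigma> \<circ> lift \<tau>)" by blast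
  have "P (h \<circ> lift \<sigma>)" if "(P, S) \<in> E" for P S
  proof -
    have "S \<subseteq> T" using that unfolding T_def by auto
    thus ?thesis using E[OF that] row_mono_subset[OF \<sigma>(1)] by blast
  qed
  thus ?thesis using \<sigma>(2) envs_comp[OF h] by blast
qed

definition EM_conditions ::
    "'m set \<Rightarrow> 'x set \<Rightarrow> ('x \<Rightarrow> nat) \<Rightarrow> ('x \<Rightarrow> 'i rel) \<Rightarrow> (('x \<times> 'i) \<times> nat \<Rightarrow> 'm) \<Rightarrow> ('x \<Rightarrow> 'j rel) \<Rightarrow>
      (((('x \<times> 'j) \<times> nat \<Rightarrow> 'm) \<Rightarrow> bool) \<times> ('x \<times> 'j) set) set" where
  "EM_conditions A X m r h r' = {(P, S). finite S \<and> S \<subseteq> positions X r' \<and> definable A (coords m S) P \<and>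
     (\<forall>\<sigma>. row_mono r' r S \<sigma> \<longrightarrow> P (h \<circ> lift \<sigma>))}"

definition shifts ::
    "'m set \<Rightarrow> 'x set \<Rightarrow> ('x \<Rightarrow> nat) \<Rightarrow> ('x \<Rightarrow> 'j rel) \<Rightarrow>
      (((('x \<times> 'j) \<times> nat \<Rightarrow> 'm) \<Rightarrow> bool) \<times> ('x \<times> 'j) set \<times> ('x \<times> 'j \<Rightarrow> 'x \<times> 'j)) set" where
  "shifts A X m r' = {(P, S, \<tau>). finite S \<and> S \<subseteq> positions X r' \<and> row_mono r' r' S \<tau> \<and> definable A (coords m S) P}"

definition shift_invariant ::
    "((('p \<times> nat \<Rightarrow> 'm) \<Rightarrow> bool) \<times> 'p set \<times> ('p \<Rightarrow> 'p)) \<Rightarrow> ('p \<times> nat \<Rightarrow> 'm) \<Rightarrow> bool" where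
  "shift_invariant = (\<lambda>(P, S, \<tau>) k. P k \<longleftrightarrow> P (k \<circ> lift \<tau>))"

lemma definable_shift_invariant:
  assumes "q \<in> shifts A X m r'"
  shows "definable A (coords m (positions X r')) (shift_invariant q)"
proof -
  obtain P S \<tau> where q: "q = (P, S, \<tau>)" "S \<subseteq> positions X r'" "row_mono r' r' S \<tau>" "definable A (coords m S) P"
    using assms by (auto simp: shifts_def)
  have "definable A (coords m (positions X r')) (\<lambda>k. P (k \<circ> lift \<tau>))"
    by (rule definable_reindex[OF q(4) lift_coords[OF row_monoD(1)[OF q(3)] row_mono_image[OF q(3,2)]]])
  thus ?thesis using definable_mono[OF q(4) order_refl coords_mono[OF q(2)]]
    by (simp add: q(1) shift_invariant_def definable_iff)
qed

lemma mut_indisc_if_shift_invariant: "\<forall>q\<in>shifts A X m r'. shift_invariant q k \<Longrightarrow> mut_indisc A X r' m k"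
  by (rule mut_indiscI) (auto simp: tp_eq_def shifts_def shift_invariant_def)

lemma realizes_EM_type_if_EM_conditions:
  assumes "\<forall>q\<in>EM_conditions A X m r h r'. fst q k"
  shows "realizes_EM_type A X m r h r' k"
  unfolding realizes_EM_type_def
proof (intro allI impI)
  fix S P assume "finite S \<and> S \<subseteq> positions X r' \<and> definable A (coords m S) P \<and>
    (\<forall>\<sigma>. row_mono r' r S \<sigma> \<longrightarrow> P (h \<circ> lift \<sigma>))"
  hence "(P, S) \<in> EM_conditions A X m r h r'" by (simp add: EM_conditions_def)
  from bspec[OF assms this] show "P k" by simp
qed

theorem extraction:
  fixes h :: "('x \<times> 'i) \<times> nat \<Rightarrow> 'm" and r :: "'x \<Rightarrow> 'i rel" and r' :: "'x \<Rightarrow> 'j rel"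
  assumes h: "h \<in> envs" and A: "|A| <o kb" "A \<subseteq> univ U" and X: "|X| <o kb"
    and r: "\<And>i. i \<in> X \<Longrightarrow> Linear_order (r i)" "\<And>i. i \<in> X \<Longrightarrow> infinite (Field (r i))"
    and r': "\<And>i. i \<in> X \<Longrightarrow> Linear_order (r' i)" "\<And>i. i \<in> X \<Longrightarrow> |Field (r' i)| <o kb"
  shows "\<exists>h'\<in>envs. mut_indisc A X r' m h' \<and> realizes_EM_type A X m r h r' h'"
proof -
  let ?em = "EM_conditions A X m r h r'" and ?sh = "shifts A X m r'"
  let ?base = "\<lambda>_. SOME x. x \<in> univ U"
  have "\<exists>k\<in>envs. (\<forall>v\<in>{}. k v = ?base v) \<and> (\<forall>P\<in>fst ` ?em \<union> shift_invariant ` ?sh. P k)"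
  proof (rule realize)
    show "|coords m (positions X r')| <o kb" using small_coords X r'(2) by blast
    show "?base \<in> envs" using univ_nonempty by (simp add: envsI some_in_eq)
    show "definable A (coords m (positions X r')) R" if "R \<in> fst ` ?em \<union> shift_invariant ` ?sh" for R
      using that definable_shift_invariant definable_mono[OF _ order_refl coords_mono]
      by (auto simp: EM_conditions_def)
    fix \<Sigma>0 and F0 :: "(('x \<times> 'j) \<times> nat) set"
    assume "finite \<Sigma>0" "\<Sigma>0 \<subseteq> fst ` ?em \<union> shift_invariant ` ?sh" and F0: "F0 \<subseteq> {}"
    then obtain E M where E: "finite E" "E \<subseteq> ?em" and M: "finite M" "M \<subseteq> ?sh"
      and \<Sigma>0: "\<Sigma>0 = fst ` E \<union> shift_invariant ` M"
      using finite_subset_Un_images by metis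
    have "\<exists>k\<in>envs. (\<forall>(P, S)\<in>E. P k) \<and> (\<forall>(P, S, \<tau>)\<in>M. P k \<longleftrightarrow> P (k \<circ> lift \<tau>))"
      by (rule extraction_finite[OF h r r'(1) E(1) M(1), where m = m and A = A])
        (use E(2) M(2) in \<open>auto simp: EM_conditions_def shifts_def\<close>)
    then obtain k where k: "k \<in> envs" "\<forall>(P, S)\<in>E. P k" "\<forall>(P, S, \<tau>)\<in>M. P k \<longleftrightarrow> P (k \<circ> lift \<tau>)" by blast
    have "\<forall>P\<in>fst ` E. P k" using k(2) by auto
    moreover have "\<forall>R\<in>shift_invariant ` M. R k" using k(3) by (auto simp: shift_invariant_def)
    ultimately show "\<exists>k\<in>envs. (\<forall>v\<in>F0. k v = ?base v) \<and> (\<forall>P\<in>\<Sigma>0. P k)"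
      using k(1) F0 unfolding \<Sigma>0 by blast
  qed (use A in auto)
  then obtain k where k: "k \<in> envs" "\<forall>P\<in>fst ` ?em \<union> shift_invariant ` ?sh. P k" by (elim bexE conjE)
  have "\<forall>q\<in>?em. fst q k" using k(2) by (simp add: ball_Un)
  moreover have "\<forall>q\<in>?sh. shift_invariant q k" using k(2) by (simp add: ball_Un)
  ultimately show ?thesis
    by (intro bexI[OF _ k(1)] conjI mut_indisc_if_shift_invariant realizes_EM_type_if_EM_conditions)
qed

theorem mut_indisc_stretch:
  fixes h :: "('x \<times> 'i) \<times> nat \<Rightarrow> 'm" and r' :: "'x \<Rightarrow> 'j rel"
  assumes mi: "mut_indisc A X r m h" and h: "h \<in> envs" and AB: "A \<subseteq> B"
    and B: "|B| <o kb" "B \<subseteq> univ U" and X: "|X| <o kb"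
    and r: "\<And>i. i \<in> X \<Longrightarrow> Linear_order (r i)" "\<And>i. i \<in> X \<Longrightarrow> infinite (Field (r i))"
    and r': "\<And>i. i \<in> X \<Longrightarrow> Linear_order (r' i)" "\<And>i. i \<in> X \<Longrightarrow> |Field (r' i)| <o kb"
  shows "\<exists>h'\<in>envs. mut_indisc B X r' m h' \<and>
    (\<forall>S \<sigma>. S \<subseteq> positions X r' \<longrightarrow> row_mono r' r S \<sigma> \<longrightarrow> tp_eq A (coords m S) h' (h \<circ> lift \<sigma>))"
proof -
  have "\<exists>h'\<in>envs. mut_indisc B X r' m h' \<and> realizes_EM_type B X m r h r' h'"
    by (rule extraction[OF h B X r r'])
  then obtain h' where h': "h' \<in> envs" "mut_indisc B X r' m h'" "realizes_EM_type B X m r h r' h'"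
    by blast
  have finite_eq: "tp_eq A (coords m S) h' (h \<circ> lift \<sigma>)"
    if S: "finite S" "S \<subseteq> positions X r'" and \<sigma>: "row_mono r' r S \<sigma>" for S \<sigma>
    unfolding tp_eq_def
  proof (intro allI impI)
    fix P assume P: "definable A (coords m S) P"
    show "P h' = P (h \<circ> lift \<sigma>)"
    proof (rule realizes_EM_typeD[OF h'(3) S, of "\<lambda>k. P k \<longleftrightarrow> P (h \<circ> lift \<sigma>)"])
      show "definable B (coords m S) (\<lambda>k. P k \<longleftrightarrow> P (h \<circ> lift \<sigma>))"
        by (rule definable_iff[OF definable_mono[OF P AB order_refl] definable_const])
      fix \<sigma>' assume "row_mono r' r S \<sigma>'"
      hence "tp_eq A (coords m S) (h \<circ> lift \<sigma>') (h \<circ> lift \<sigma>)"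
        by (intro mut_indisc_row_mono[OF mi h r(1) r'(1) S(2) _ \<sigma>])
      thus "P (h \<circ> lift \<sigma>') = P (h \<circ> lift \<sigma>)" by (rule tp_eqD[OF _ P])
    qed
  qed
  have "tp_eq A (coords m S) h' (h \<circ> lift \<sigma>)" if "S \<subseteq> positions X r'" "row_mono r' r S \<sigma>" for S \<sigma>
    by (rule tp_eq_coordsI, rule finite_eq) (use that row_mono_subset in blast)+
  with h'(1,2) show ?thesis by (intro bexI[of _ h']) simp_all
qed

end

section \<open>Sequences and environments\<close>

lemma ex_increasing:
  assumes "finite F" "F \<subseteq> Field r" "Linear_order r"
  shows "\<exists>xs. set xs = F \<and> increasing r xs"
  using assms(1,2)
proof (induction F)
  case empty
  thus ?case by (intro exI[of _ "[]"]) (auto simp: increasing_def)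
next
  case (insert x F)
  then obtain xs where xs: "set xs = F" "increasing r xs" by auto
  have tr: "trans r" "antisym r" using Linear_orderD(1,2)[OF assms(3)] .
  have tot: "(y, x) \<in> r \<or> (x, y) \<in> r" if "y \<in> F" for y
    using Linear_orderD(3)[OF assms(3), of y x] insert.prems that by auto
  let ?ys = "filter (\<lambda>y. (y, x) \<in> r) xs @ x # filter (\<lambda>y. (y, x) \<notin> r) xs"
  have "set ?ys = insert x F" using xs by auto
  moreover have "increasing r ?ys"
    unfolding increasing_def sorted_wrt_append sorted_wrt.simps(2)
  proof (intro conjI ballI)
    show "set ?ys \<subseteq> Field r" using xs insert.prems by auto
    show "sorted_wrt (\<lambda>i j. (i, j) \<in> r \<and> i \<noteq> j) (filter (\<lambda>y. (y, x) \<in> r) xs)"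
      "sorted_wrt (\<lambda>i j. (i, j) \<in> r \<and> i \<noteq> j) (filter (\<lambda>y. (y, x) \<notin> r) xs)"
      using xs(2) by (auto simp: increasing_def intro: sorted_wrt_filter)
    fix z assume z: "z \<in> set (filter (\<lambda>y. (y, x) \<notin> r) xs)"
    thus "(x, z) \<in> r" "x \<noteq> z" using tot xs insert.hyps by auto
  next
    fix y z assume y: "y \<in> set (filter (\<lambda>y. (y, x) \<in> r) xs)" and z: "z \<in> set (x # filter (\<lambda>y. (y, x) \<notin> r) xs)"
    have "(x, z) \<in> r" using z tot xs insert.prems tot[of x] assms(3)
      by (auto simp: order_on_defs refl_on_def)
    thus "(y, z) \<in> r" using y transD[OF tr(1)] by auto
    show "y \<noteq> z" using y z xs insert.hyps by auto
  qed
  ultimately show ?case by blast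
qed

lemma increasing_nth:
  assumes "increasing r xs" "a < b" "b < length xs"
  shows "(xs ! a, xs ! b) \<in> r" "xs ! a \<noteq> xs ! b"
  using assms sorted_wrt_nth_less[of "\<lambda>i j. (i, j) \<in> r \<and> i \<noteq> j" xs a b] by (auto simp: increasing_def)

lemma increasing_map:
  assumes "increasing r xs" "f ` set xs \<subseteq> Field r'"
    "\<And>x y. x \<in> set xs \<Longrightarrow> y \<in> set xs \<Longrightarrow> (x, y) \<in> r \<Longrightarrow> x \<noteq> y \<Longrightarrow> (f x, f y) \<in> r' \<and> f x \<noteq> f y"
  shows "increasing r' (map f xs)"
proof -
  have "sorted_wrt (\<lambda>i j. (f i, f j) \<in> r' \<and> f i \<noteq> f j) xs"
  proof (rule sorted_wrt_mono_rel)
    show "sorted_wrt (\<lambda>i j. (i, j) \<in> r \<and> i \<noteq> j) xs" using assms(1) by (simp add: increasing_def)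
    show "(f x, f y) \<in> r' \<and> f x \<noteq> f y" if "x \<in> set xs" "y \<in> set xs" "(x, y) \<in> r \<and> x \<noteq> y" for x y
      using assms(3)[of x y] that by simp
  qed
  thus ?thesis using assms(2) by (auto simp: increasing_def sorted_wrt_map)
qed

lemma ex_increasing_map:
  fixes r :: "'i rel"
  assumes lin: "Linear_order r" and ts: "increasing r ts" and js: "increasing r js"
    and len: "length ts = length js"
  shows "\<exists>f. map f ts = js \<and>
    (\<forall>x\<in>set ts. \<forall>y\<in>set ts. (x, y) \<in> r \<and> x \<noteq> y \<longrightarrow> (f x, f y) \<in> r \<and> f x \<noteq> f y)"
proof (intro exI conjI ballI impI)
  let ?f = "\<lambda>t. js ! index_of ts t"
  have "index_of ts (ts ! a) = a" if "a < length ts" for a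
    using index_of[of "ts ! a" ts] that increasing_nth(2)[OF ts, of a "index_of ts (ts ! a)"]
      increasing_nth(2)[OF ts, of "index_of ts (ts ! a)" a]
    by (metis linorder_neqE_nat nth_mem)
  thus "map ?f ts = js" by (intro nth_equalityI) (simp_all add: len)
  fix x y assume xy: "x \<in> set ts" "y \<in> set ts" "(x, y) \<in> r \<and> x \<noteq> y"
  have "\<not> index_of ts y < index_of ts x"
    using increasing_nth(1)[OF ts, of "index_of ts y" "index_of ts x"] index_of[OF xy(1)] index_of[OF xy(2)]
      xy(3) Linear_orderE(3)[OF lin] by metis
  moreover have "index_of ts x \<noteq> index_of ts y" using index_of[OF xy(1)] index_of[OF xy(2)] xy(3) by metis
  ultimately have "index_of ts x < index_of ts y" by simp
  from increasing_nth[OF js this] show "(?f x, ?f y) \<in> r" "?f x \<noteq> ?f y"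
    using index_of(1)[OF xy(2)] len by auto
qed

subsection \<open>Concatenation\<close>

lemma seq_append_simps [simp]:
  "(Inl a, Inl b) \<in> fst (I \<oplus>\<^sub>s J) \<longleftrightarrow> (a, b) \<in> fst I"
  "(Inr c, Inr d) \<in> fst (I \<oplus>\<^sub>s J) \<longleftrightarrow> (c, d) \<in> fst J"
  "(Inl a, Inr d) \<in> fst (I \<oplus>\<^sub>s J) \<longleftrightarrow> a \<in> idx I \<and> d \<in> idx J"
  "(Inr c, Inl b) \<notin> fst (I \<oplus>\<^sub>s J)"
  "snd (I \<oplus>\<^sub>s J) (Inl a) = snd I a" "snd (I \<oplus>\<^sub>s J) (Inr c) = snd J c"
  by (auto simp: seq_append_def)

lemma idx_seq_append [simp]: "idx (I \<oplus>\<^sub>s J) = Inl ` idx I \<union> Inr ` idx J"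
proof (intro set_eqI iffI)
  fix x assume "x \<in> idx (I \<oplus>\<^sub>s J)"
  then obtain y where "(x, y) \<in> fst (I \<oplus>\<^sub>s J) \<or> (y, x) \<in> fst (I \<oplus>\<^sub>s J)" by (auto simp: Field_def)
  thus "x \<in> Inl ` idx I \<union> Inr ` idx J"
    by (cases x; cases y) (auto intro: FieldI1 FieldI2)
next
  fix x assume x: "x \<in> Inl ` idx I \<union> Inr ` idx J"
  then consider a b where "x = Inl a" "(a, b) \<in> fst I \<or> (b, a) \<in> fst I"
    | a b where "x = Inr a" "(a, b) \<in> fst J \<or> (b, a) \<in> fst J" by (auto simp: Field_def)
  thus "x \<in> idx (I \<oplus>\<^sub>s J)"
  proof cases
    case 1
    hence "(Inl a, Inl b) \<in> fst (I \<oplus>\<^sub>s J) \<or> (Inl b, Inl a) \<in> fst (I \<oplus>\<^sub>s J)" by simp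
    thus ?thesis using 1(1) by (metis FieldI1 FieldI2)
  next
    case 2
    hence "(Inr a, Inr b) \<in> fst (I \<oplus>\<^sub>s J) \<or> (Inr b, Inr a) \<in> fst (I \<oplus>\<^sub>s J)" by simp
    thus ?thesis using 2(1) by (metis FieldI1 FieldI2)
  qed
qed

lemma Linear_order_seq_append:
  assumes "Linear_order (fst I)" "Linear_order (fst J)"
  shows "Linear_order (fst (I \<oplus>\<^sub>s J))"
proof (rule Linear_orderI)
  fix x y z
  note E = Linear_orderE[OF assms(1)] Linear_orderE[OF assms(2)]
  show "(x, x) \<in> fst (I \<oplus>\<^sub>s J)" if "x \<in> idx (I \<oplus>\<^sub>s J)"
    using that E(1,5) by auto
  show "(x, z) \<in> fst (I \<oplus>\<^sub>s J)" if "(x, y) \<in> fst (I \<oplus>\<^sub>s J)" "(y, z) \<in> fst (I \<oplus>\<^sub>s J)"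
    using that by (cases x; cases y; cases z) (auto intro: E(2,6) FieldI1 FieldI2)
  show "x = y" if "(x, y) \<in> fst (I \<oplus>\<^sub>s J)" "(y, x) \<in> fst (I \<oplus>\<^sub>s J)"
    using that by (cases x; cases y) (auto intro: E(3,7))
  show "(x, y) \<in> fst (I \<oplus>\<^sub>s J) \<or> (y, x) \<in> fst (I \<oplus>\<^sub>s J)" if "x \<in> idx (I \<oplus>\<^sub>s J)" "y \<in> idx (I \<oplus>\<^sub>s J)"
    using that E(4)[of "projl x" "projl y"] E(8)[of "projr x" "projr y"] by auto
qed

lemma Linear_order_seq_appendD:
  assumes "Linear_order (fst (I \<oplus>\<^sub>s J))"
  shows "Linear_order (fst I)" "Linear_order (fst J)"
proof -
  note E = Linear_orderE[OF assms]
  show "Linear_order (fst I)"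
  proof (rule Linear_orderI)
    fix x y z
    show "(x, x) \<in> fst I" if "x \<in> idx I" using E(1)[of "Inl x"] that by simp
    show "(x, z) \<in> fst I" if "(x, y) \<in> fst I" "(y, z) \<in> fst I"
      using E(2)[of "Inl x" "Inl y" "Inl z"] that by simp
    show "x = y" if "(x, y) \<in> fst I" "(y, x) \<in> fst I" using E(3)[of "Inl x" "Inl y"] that by simp
    show "(x, y) \<in> fst I \<or> (y, x) \<in> fst I" if "x \<in> idx I" "y \<in> idx I"
      using E(4)[of "Inl x" "Inl y"] that by simp
  qed
  show "Linear_order (fst J)"
  proof (rule Linear_orderI)
    fix x y z
    show "(x, x) \<in> fst J" if "x \<in> idx J" using E(1)[of "Inr x"] that by simp
    show "(x, z) \<in> fst J" if "(x, y) \<in> fst J" "(y, z) \<in> fst J"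
      using E(2)[of "Inr x" "Inr y" "Inr z"] that by simp
    show "x = y" if "(x, y) \<in> fst J" "(y, x) \<in> fst J" using E(3)[of "Inr x" "Inr y"] that by simp
    show "(x, y) \<in> fst J \<or> (y, x) \<in> fst J" if "x \<in> idx J" "y \<in> idx J"
      using E(4)[of "Inr x" "Inr y"] that by simp
  qed
qed

lemma sequence_of_append: "sequence_of M m (I \<oplus>\<^sub>s J) \<longleftrightarrow> sequence_of M m I \<and> sequence_of M m J"
proof -
  have "Linear_order (fst (I \<oplus>\<^sub>s J)) \<longleftrightarrow> Linear_order (fst I) \<and> Linear_order (fst J)"
    using Linear_order_seq_append Linear_order_seq_appendD by blast
  moreover have "snd (I \<oplus>\<^sub>s J) ` idx (I \<oplus>\<^sub>s J) = snd I ` idx I \<union> snd J ` idx J"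
    by (simp add: image_Un image_image)
  ultimately show ?thesis unfolding sequence_of_def by auto
qed

lemma sequence_of_length: "sequence_of M m I \<Longrightarrow> t \<in> idx I \<Longrightarrow> length (snd I t) = m"
  by (auto simp: sequence_of_def tuples_def)

lemma sequence_of_unique: "sequence_of M m I \<Longrightarrow> sequence_of M m' I \<Longrightarrow> t \<in> idx I \<Longrightarrow> m = m'"
  using sequence_of_length by metis

subsection \<open>Mutual indiscernibility row by row\<close>

definition move_rows :: "('x \<times> 'i \<Rightarrow> 'x \<times> 'i) \<Rightarrow> 'x set \<Rightarrow> 'x \<times> 'i \<Rightarrow> 'x \<times> 'i" where
  "move_rows \<tau> R p = (if fst p \<in> R then \<tau> p else p)"

lemma move_rows_empty: "move_rows \<tau> {} = id"
  by (rule ext) (simp add: move_rows_def)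

lemma fst_move_rows: "row_mono r r S \<tau> \<Longrightarrow> p \<in> S \<Longrightarrow> fst (move_rows \<tau> R p) = fst p"
  by (simp add: move_rows_def row_monoD(1))

lemma move_rows_positions:
  assumes "S \<subseteq> positions X r" "row_mono r r S \<tau>"
  shows "move_rows \<tau> R ` S \<subseteq> positions X r"
proof -
  have "p \<in> positions X r" "\<tau> p \<in> positions X r" if "p \<in> S" for p
    using that assms(1) row_mono_image[OF assms(2,1)] by blast+
  thus ?thesis unfolding move_rows_def image_subset_iff by metis
qed

lemma row_mono_move_rows:
  assumes S: "S \<subseteq> positions X r" and \<tau>: "row_mono r r S \<tau>" and i: "i \<notin> R"
  shows "row_mono r r (move_rows \<tau> R ` S) (move_rows \<tau> {i})"
proof -
  have fixed: "p \<in> S" if p: "p \<in> move_rows \<tau> R ` S" "fst p = i" for p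
  proof -
    obtain q where q: "q \<in> S" "p = move_rows \<tau> R q" using p(1) by blast
    hence "fst q = i" using fst_move_rows[OF \<tau>] p(2) by metis
    thus ?thesis using q i by (simp add: move_rows_def)
  qed
  show ?thesis
  proof (rule row_monoI)
    fix p assume p: "p \<in> move_rows \<tau> R ` S"
    thus "fst (move_rows \<tau> {i} p) = fst p"
      using fixed[OF p] row_monoD(1)[OF \<tau>] by (simp add: move_rows_def)
    show "snd (move_rows \<tau> {i} p) \<in> Field (r (fst p))"
      using row_monoD(2)[OF \<tau> fixed[OF p]] positionsD[OF move_rows_positions[OF S \<tau>] p]
      by (cases "fst p = i") (simp_all add: move_rows_def)
  next
    fix p q assume p: "p \<in> move_rows \<tau> R ` S" and q: "q \<in> move_rows \<tau> R ` S"
      and pq: "fst p = fst q" "(snd p, snd q) \<in> r (fst p)" "snd p \<noteq> snd q"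
    show "(snd (move_rows \<tau> {i} p), snd (move_rows \<tau> {i} q)) \<in> r (fst p) \<and>
        snd (move_rows \<tau> {i} p) \<noteq> snd (move_rows \<tau> {i} q)"
    proof (cases "fst p = i")
      case True
      thus ?thesis using row_monoD(3)[OF \<tau> fixed[OF p] fixed[OF q]] pq by (simp add: move_rows_def)
    qed (use pq in \<open>simp add: move_rows_def\<close>)
  qed
qed

context monster
begin

lemma mut_indisc_row_by_row:
  assumes h: "h \<in> envs" and ZY: "Z \<subseteq> Y"
    and row: "\<And>i S \<tau>. i \<in> Z \<Longrightarrow> finite S \<Longrightarrow> S \<subseteq> positions Y r \<Longrightarrow> row_mono r r S \<tau> \<Longrightarrow>
      (\<And>p. p \<in> S \<Longrightarrow> fst p \<noteq> i \<Longrightarrow> \<tau> p = p) \<Longrightarrow> tp_eq A (coords m S) h (h \<circ> lift \<tau>)"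
  shows "mut_indisc A Z r m h"
proof (rule mut_indiscI)
  fix S \<tau> assume S: "finite S" "S \<subseteq> positions Z r" and \<tau>: "row_mono r r S \<tau>"
  note move_pos = move_rows_positions[OF S(2) \<tau>] and move_fst = fst_move_rows[OF \<tau>]
  have ZY_pos: "positions Z r \<subseteq> positions Y r" using ZY by auto
  have "tp_eq A (coords m S) h (h \<circ> lift (move_rows \<tau> R))" if "finite R" "R \<subseteq> Z" for R
    using that
  proof (induction R)
    case empty
    show ?case by (simp add: move_rows_empty map_prod.id tp_eq_refl)
  next
    case (insert i R)
    have "tp_eq A (coords m (move_rows \<tau> R ` S)) h (h \<circ> lift (move_rows \<tau> {i}))"
      using insert.prems S(1) order_trans[OF move_pos ZY_pos]
        row_mono_move_rows[OF S(2) \<tau> insert.hyps(2)]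
      by (intro row[of i]) (auto simp: move_rows_def)
    hence "tp_eq A (coords m S) (h \<circ> lift (move_rows \<tau> R)) (h \<circ> lift (move_rows \<tau> {i}) \<circ> lift (move_rows \<tau> R))"
      by (rule tp_eq_reindex) (rule lift_coords, use move_fst in auto)
    moreover have "tp_eq A (coords m S) (h \<circ> lift (move_rows \<tau> {i}) \<circ> lift (move_rows \<tau> R)) (h \<circ> lift (move_rows \<tau> (insert i R)))"
    proof (rule tp_eq_agree)
      fix v assume "v \<in> coords m S"
      then obtain p c where v: "v = (p, c)" "p \<in> S" by (auto simp: coords_def)
      have "move_rows \<tau> {i} (move_rows \<tau> R p) = move_rows \<tau> (insert i R) p"
        using move_fst[OF v(2)] insert.hyps(2) by (auto simp: move_rows_def)
      thus "(h \<circ> lift (move_rows \<tau> {i}) \<circ> lift (move_rows \<tau> R)) v = (h \<circ> lift (move_rows \<tau> (insert i R))) v"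
        using v(1) by simp
    qed (intro envs_comp h)+
    ultimately show ?case using insert.IH insert.prems by (meson insert_subset tp_eq_trans)
  qed
  moreover have "fst ` S \<subseteq> Z" using S(2) by auto
  ultimately have "tp_eq A (coords m S) h (h \<circ> lift (move_rows \<tau> (fst ` S)))" using S(1) by simp
  moreover have "tp_eq A (coords m S) (h \<circ> lift (move_rows \<tau> (fst ` S))) (h \<circ> lift \<tau>)"
    by (rule tp_eq_agree) (use h in \<open>force intro!: envs_comp simp: coords_def move_rows_def image_iff\<close>)+
  ultimately show "tp_eq A (coords m S) h (h \<circ> lift \<tau>)" by (rule tp_eq_trans)
qed

lemma mut_indisc_absorb_positions:
  assumes mi: "mut_indisc A X r m h" and h: "h \<in> envs" and lin: "\<And>i. i \<in> X \<Longrightarrow> Linear_order (r i)"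
    and C: "C \<subseteq> positions X r" and Y: "positions Y r' \<subseteq> positions X r - C"
    and ext: "\<And>S \<tau>. S \<subseteq> positions Y r' \<Longrightarrow> row_mono r' r' S \<tau> \<Longrightarrow>
      row_mono r r (S \<union> C) (\<lambda>p. if p \<in> S then \<tau> p else p)"
  shows "mut_indisc (A \<union> h ` coords m C) Y r' m h"
proof (rule mut_indiscI)
  fix S \<tau> assume S: "S \<subseteq> positions Y r'" and \<tau>: "row_mono r' r' S \<tau>"
  define \<tau>' where "\<tau>' p = (if p \<in> S then \<tau> p else p)" for p
  have SC: "S \<union> C \<subseteq> positions X r" "S \<inter> C = {}" using S C Y by blast+
  have "tp_eq A (coords m (S \<union> C)) (h \<circ> lift id) (h \<circ> lift \<tau>')"
    unfolding \<tau>'_def by (rule mut_indisc_row_mono[OF mi h lin lin SC(1) row_mono_id[OF SC(1)] ext[OF S \<tau>]])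
  hence eq: "tp_eq A (coords m (S \<union> C)) h (h \<circ> lift \<tau>')" by (simp add: map_prod.id)
  show "tp_eq (A \<union> h ` coords m C) (coords m S) h (h \<circ> lift \<tau>)"
    unfolding tp_eq_def
  proof (intro allI impI)
    fix P assume P: "definable (A \<union> h ` coords m C) (coords m S) P"
    obtain Q where Q: "definable A (coords m S \<union> coords m C) Q"
      "\<forall>k\<in>envs. (\<forall>v\<in>coords m C. k v = h v) \<longrightarrow> (Q k \<longleftrightarrow> P k)"
      using definable_unfix[OF P] by blast
    have "coords m S \<union> coords m C = coords m (S \<union> C)" by (auto simp: coords_def)
    hence "Q h = Q (h \<circ> lift \<tau>')" using tp_eqD[OF eq] Q(1) by simp
    moreover have "Q h = P h" using Q(2) h by simp
    moreover have "Q (h \<circ> lift \<tau>') = P (h \<circ> lift \<tau>')"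
    proof (rule Q(2)[rule_format, OF envs_comp[OF h]])
      fix v assume "v \<in> coords m C"
      hence "fst v \<notin> S" using SC(2) by (auto simp: coords_def)
      thus "(h \<circ> lift \<tau>') v = h v" by (cases v) (simp add: \<tau>'_def)
    qed
    moreover have "P (h \<circ> lift \<tau>') = P (h \<circ> lift \<tau>)"
      by (rule definable_local[OF P envs_comp[OF h] envs_comp[OF h]]) (auto simp: coords_def \<tau>'_def)
    ultimately show "P h = P (h \<circ> lift \<tau>)" by simp
  qed
qed

lemma mut_indisc_move_row:
  assumes mi: "mut_indisc (A \<union> h ` coords m (positions (X - {i}) r)) {i} r m h" and h: "h \<in> envs"
    and S: "finite S" "S \<subseteq> positions X r" and \<tau>: "row_mono r r S \<tau>" "\<And>p. p \<in> S \<Longrightarrow> fst p \<noteq> i \<Longrightarrow> \<tau> p = p"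
  shows "tp_eq A (coords m S) h (h \<circ> lift \<tau>)"
  unfolding tp_eq_def
proof (intro allI impI)
  fix P assume P: "definable A (coords m S) P"
  let ?A = "A \<union> h ` coords m (positions (X - {i}) r)"
  define S_i where "S_i = {p \<in> S. fst p = i}"
  define T where "T = {v :: ('a \<times> 'b) \<times> nat. fst (fst v) \<noteq> i}"
  have "definable ?A (coords m S_i) (\<lambda>k. P (\<lambda>v. if v \<in> T then h v else k v))"
  proof (rule definable_fix[OF P h])
    show "h ` (coords m S \<inter> T) \<subseteq> ?A" using S(2) by (fastforce simp: coords_def T_def)
    show "coords m S - T \<subseteq> coords m S_i" by (auto simp: coords_def T_def S_i_def)
  qed simp
  moreover have "tp_eq ?A (coords m S_i) h (h \<circ> lift \<tau>)"
  proof -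
    have "finite S_i" "S_i \<subseteq> positions {i} r" "row_mono r r S_i \<tau>"
      using S row_mono_subset[OF \<tau>(1)] by (auto simp: S_i_def)
    thus ?thesis using mi unfolding mut_indisc_def by blast
  qed
  ultimately have "P (\<lambda>v. if v \<in> T then h v else h v) = P (\<lambda>v. if v \<in> T then h v else (h \<circ> lift \<tau>) v)"
    using tp_eqD by blast
  also have "\<dots> = P (h \<circ> lift \<tau>)"
    by (rule definable_local[OF P envs_merge[OF h envs_comp[OF h]] envs_comp[OF h]])
      (use \<tau>(2) in \<open>auto simp: coords_def T_def\<close>)
  finally show "P h = P (h \<circ> lift \<tau>)" by simp
qed

subsection \<open>Mutually indiscernible sequences as environments\<close>

definition base_elem :: 'm where "base_elem = (SOME x. x \<in> univ U)"

lemma base_elem: "base_elem \<in> univ U"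
  unfolding base_elem_def using univ_nonempty by (simp add: some_in_eq)

definition represents :: "'x set \<Rightarrow> ('x \<Rightarrow> nat) \<Rightarrow> ('x \<Rightarrow> ('i, 'm) tseq) \<Rightarrow> (('x \<times> 'i) \<times> nat \<Rightarrow> 'm) \<Rightarrow> bool" where
  "represents X m I h \<longleftrightarrow> h \<in> envs \<and> (\<forall>i\<in>X. sequence_of U (m i) (I i) \<and>
     (\<forall>t\<in>idx (I i). \<forall>c<m i. h ((i, t), c) = snd (I i) t ! c))"

definition seq_env :: "'x set \<Rightarrow> ('x \<Rightarrow> nat) \<Rightarrow> ('x \<Rightarrow> ('i, 'm) tseq) \<Rightarrow> ('x \<times> 'i) \<times> nat \<Rightarrow> 'm" where
  "seq_env X m I = (\<lambda>((i, t), c). if i \<in> X \<and> t \<in> idx (I i) \<and> c < m i then snd (I i) t ! c else base_elem)"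

lemma representsD:
  assumes "represents X m I h"
  shows "h \<in> envs" "i \<in> X \<Longrightarrow> sequence_of U (m i) (I i)"
    "i \<in> X \<Longrightarrow> t \<in> idx (I i) \<Longrightarrow> c < m i \<Longrightarrow> h ((i, t), c) = snd (I i) t ! c"
    "i \<in> X \<Longrightarrow> t \<in> idx (I i) \<Longrightarrow> length (snd (I i) t) = m i"
    "i \<in> X \<Longrightarrow> Linear_order (fst (I i))"
  using assms by (auto simp: represents_def sequence_of_def tuples_def)

lemma represents_subset: "represents X m I h \<Longrightarrow> Y \<subseteq> X \<Longrightarrow> represents Y m I h"
  unfolding represents_def by blast

lemma represents_seq_env:
  assumes "\<And>i. i \<in> X \<Longrightarrow> sequence_of U (m i) (I i)"
  shows "represents X m I (seq_env X m I)"
proof -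
  have "seq_env X m I ((i, t), c) \<in> univ U" for i t c
  proof (cases "i \<in> X \<and> t \<in> idx (I i) \<and> c < m i")
    case True
    hence "snd (I i) t \<in> tuples U (m i)" using assms[of i] by (auto simp: sequence_of_def)
    thus ?thesis using True by (auto simp: seq_env_def tuples_def in_lists_conv_set)
  qed (auto simp: seq_env_def base_elem)
  hence "seq_env X m I \<in> envs" by (intro envsI) (metis prod.exhaust)
  thus ?thesis using assms by (simp add: represents_def seq_env_def)
qed

lemma UN_elems:
  assumes rep: "represents X m I h" and "Y \<subseteq> X"
  shows "(\<Union>j\<in>Y. elems (I j)) = h ` coords m (positions Y (\<lambda>j. fst (I j)))"
proof (intro set_eqI iffI)
  fix x assume "x \<in> (\<Union>j\<in>Y. elems (I j))"
  then obtain j t where t: "j \<in> Y" "t \<in> idx (I j)" "x \<in> set (snd (I j) t)" by (auto simp: elems_def)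
  then obtain c where "c < m j" "x = h ((j, t), c)"
    using representsD(3,4)[OF rep, of j t] assms(2) by (auto simp: in_set_conv_nth)
  thus "x \<in> h ` coords m (positions Y (\<lambda>j. fst (I j)))" using t by (auto simp: coords_def)
next
  fix x assume "x \<in> h ` coords m (positions Y (\<lambda>j. fst (I j)))"
  then obtain j t c where t: "j \<in> Y" "t \<in> idx (I j)" "c < m j" "x = h ((j, t), c)" by (auto simp: coords_def)
  have "x \<in> set (snd (I j) t)" using representsD(3,4)[OF rep, of j t] assms(2) t by auto
  thus "x \<in> (\<Union>j\<in>Y. elems (I j))" using t(1,2) unfolding elems_def by blast
qed

definition tuple_coords :: "'x \<Rightarrow> nat \<Rightarrow> 'i list \<Rightarrow> (('x \<times> 'i) \<times> nat) list" where
  "tuple_coords i m ts = concat (map (\<lambda>t. map (\<lambda>c. ((i, t), c)) [0..<m]) ts)"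

lemma set_tuple_coords: "set (tuple_coords i (m i) ts) = coords m ({i} \<times> set ts)"
  by (auto simp: tuple_coords_def coords_def)

lemma length_tuple_coords: "length (tuple_coords i m ts) = length ts * m"
  unfolding tuple_coords_def by (induction ts) auto

lemma map_tuple_coords:
  assumes rep: "represents X m I h" and i: "i \<in> X"
    and f: "\<And>t. t \<in> set ts \<Longrightarrow> \<sigma> (i, t) = (i, f t) \<and> f t \<in> idx (I i)"
  shows "map (h \<circ> lift \<sigma>) (tuple_coords i (m i) ts) = concat (map (snd (I i)) (map f ts))"
proof -
  have "map (h \<circ> lift \<sigma>) (map (\<lambda>c. ((i, t), c)) [0..<m i]) = snd (I i) (f t)" if "t \<in> set ts" for t
    using f[OF that] representsD(3,4)[OF rep i] by (intro nth_equalityI) auto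
  thus ?thesis unfolding tuple_coords_def map_concat by (auto intro!: arg_cong[of _ _ concat])
qed

lemma indiscernibleD:
  assumes ind: "indiscernible L U A I" and seq: "sequence_of U m I"
    and ts: "increasing (fst I) ts" "increasing (fst I) js" "length ts = length js"
    and p: "p \<in> pfmlas L A (length ts * m)"
  shows "psat U p (concat (map (snd I) ts)) \<longleftrightarrow> psat U p (concat (map (snd I) js))"
proof (cases "ts = []")
  case False
  obtain m' where m': "sequence_of U m' I"
    "\<forall>is js. increasing (fst I) is \<and> increasing (fst I) js \<and> length is = length js \<longrightarrow>
      (\<forall>p\<in>pfmlas L A (length is * m'). psat U p (concat (map (snd I) is)) \<longleftrightarrow> psat U p (concat (map (snd I) js)))"
    using ind unfolding indiscernible_def by blast
  have "hd ts \<in> idx I" using ts(1) False by (auto simp: increasing_def)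
  hence "m' = m" using sequence_of_unique[OF m'(1) seq] by blast
  thus ?thesis using m'(2) ts p by blast
qed (use ts(3) in simp)

lemma indiscernible_imp_mut_indisc:
  assumes ind: "indiscernible L U A (I i)" and rep: "represents {i} m I h"
  shows "mut_indisc A {i} (\<lambda>i. fst (I i)) m h"
proof (rule mut_indiscI)
  let ?r = "\<lambda>i. fst (I i)"
  fix S \<tau> assume S: "finite S" "S \<subseteq> positions {i} ?r" and \<tau>: "row_mono ?r ?r S \<tau>"
  obtain ts where ts: "set ts = snd ` S" "increasing (?r i) ts"
    using ex_increasing[of "snd ` S" "?r i"] S representsD(5)[OF rep, of i] by fastforce
  have S_eq: "S = {i} \<times> set ts" unfolding ts(1) using S(2) by force
  define f where "f t = snd (\<tau> (i, t))" for t
  have \<tau>f: "\<tau> (i, t) = (i, f t) \<and> f t \<in> idx (I i)" if "t \<in> set ts" for t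
    using row_monoD(1,2)[OF \<tau>, of "(i, t)"] that S_eq by (auto simp: f_def prod_eq_iff)
  have js: "increasing (?r i) (map f ts)"
  proof (rule increasing_map[OF ts(2)])
    fix x y assume "x \<in> set ts" "y \<in> set ts" "(x, y) \<in> ?r i" "x \<noteq> y"
    thus "(f x, f y) \<in> ?r i \<and> f x \<noteq> f y"
      using row_monoD(3)[OF \<tau>, of "(i, x)" "(i, y)"] S_eq by (auto simp: f_def)
  qed (use \<tau>f in auto)
  let ?xs = "tuple_coords i (m i) ts"
  show "tp_eq A (coords m S) h (h \<circ> lift \<tau>)"
    unfolding tp_eq_def
  proof (intro allI impI)
    fix P assume P: "definable A (coords m S) P"
    obtain p where p: "p \<in> pfmlas L A (length ?xs)" "\<forall>k\<in>envs. psat U p (map k ?xs) \<longleftrightarrow> P k"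
      using definable_imp_pfm[OF P, of ?xs] by (auto simp: set_tuple_coords S_eq)
    have "psat U p (concat (map (snd (I i)) ts)) \<longleftrightarrow> psat U p (concat (map (snd (I i)) (map f ts)))"
      by (rule indiscernibleD[OF ind representsD(2)[OF rep] ts(2) js])
        (use p(1) in \<open>simp_all add: length_tuple_coords\<close>)
    moreover have "map (h \<circ> lift id) ?xs = concat (map (snd (I i)) (map id ts))"
      by (rule map_tuple_coords[OF rep]) (use ts(2) in \<open>auto simp: increasing_def\<close>)
    moreover have "map (h \<circ> lift \<tau>) ?xs = concat (map (snd (I i)) (map f ts))"
      by (rule map_tuple_coords[OF rep singletonI]) (rule \<tau>f)
    ultimately show "P h = P (h \<circ> lift \<tau>)"
      using bspec[OF p(2) representsD(1)[OF rep]]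
        bspec[OF p(2) envs_comp[OF representsD(1)[OF rep], of "lift \<tau>"]]
      by (simp add: map_prod.id)
  qed
qed

lemma mut_indisc_imp_indiscernible:
  assumes mi: "mut_indisc A {i} (\<lambda>i. fst (I i)) m h" and rep: "represents {i} m I h"
  shows "indiscernible L U A (I i)"
  unfolding indiscernible_def
proof (intro exI[of _ "m i"] conjI allI impI ballI, rule representsD(2)[OF rep singletonI], elim conjE)
  let ?r = "\<lambda>i. fst (I i)"
  fix ts js p assume ts: "increasing (?r i) ts" and js: "increasing (?r i) js" and len: "length ts = length js"
    and p: "p \<in> pfmlas L A (length ts * m i)"
  obtain f where f: "map f ts = js"
    "\<forall>x\<in>set ts. \<forall>y\<in>set ts. (x, y) \<in> ?r i \<and> x \<noteq> y \<longrightarrow> (f x, f y) \<in> ?r i \<and> f x \<noteq> f y"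
    using ex_increasing_map[OF representsD(5)[OF rep] ts js len] by blast
  have f_idx: "f t \<in> idx (I i)" if "t \<in> set ts" for t
    using js that unfolding f(1)[symmetric] increasing_def by auto
  have ts_idx: "set ts \<subseteq> idx (I i)" using ts by (simp add: increasing_def)
  define \<tau> where "\<tau> p = (fst p, f (snd p))" for p :: "'a \<times> 'b"
  have "row_mono ?r ?r ({i} \<times> set ts) \<tau>"
    by (rule row_monoI) (use f(2) f_idx in \<open>auto simp: \<tau>_def\<close>)
  moreover have "{i} \<times> set ts \<subseteq> positions {i} ?r" using ts_idx by auto
  ultimately have "tp_eq A (coords m ({i} \<times> set ts)) h (h \<circ> lift \<tau>)"
    using mi unfolding mut_indisc_def by simp
  let ?xs = "tuple_coords i (m i) ts"
  have "definable A (coords m ({i} \<times> set ts)) (\<lambda>k. psat U p (map k ?xs))"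
    using pfm_imp_definable[of p A ?xs] p by (simp add: length_tuple_coords set_tuple_coords)
  from tp_eqD[OF \<open>tp_eq A _ h _\<close> this] have "psat U p (map h ?xs) \<longleftrightarrow> psat U p (map (h \<circ> lift \<tau>) ?xs)" .
  moreover have "map (h \<circ> lift id) ?xs = concat (map (snd (I i)) (map id ts))"
    by (rule map_tuple_coords[OF rep]) (use ts_idx in auto)
  moreover have "map (h \<circ> lift \<tau>) ?xs = concat (map (snd (I i)) (map f ts))"
    by (rule map_tuple_coords[OF rep]) (use f_idx in \<open>auto simp: \<tau>_def\<close>)
  ultimately show "psat U p (concat (map (snd (I i)) ts)) = psat U p (concat (map (snd (I i)) js))"
    using f(1) by (simp add: map_prod.id)
qed

theorem mutually_indiscernible_iff:
  assumes rep: "represents X m I h"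
  shows "mutually_indiscernible L U A X I \<longleftrightarrow> mut_indisc A X (\<lambda>i. fst (I i)) m h"
proof -
  let ?r = "\<lambda>i. fst (I i)" and ?rest = "\<lambda>i. h ` coords m (positions (X - {i}) (\<lambda>i. fst (I i)))"
  have elems: "(\<Union>j\<in>X - {i}. elems (I j)) = ?rest i" for i by (rule UN_elems[OF rep]) auto
  note h = representsD(1)[OF rep] and lin = representsD(5)[OF rep]
  show ?thesis
  proof
    assume mut: "mutually_indiscernible L U A X I"
    show "mut_indisc A X ?r m h"
    proof (rule mut_indisc_row_by_row[OF h order_refl])
      fix i S \<tau> assume i: "i \<in> X" and \<tau>: "finite S" "S \<subseteq> positions X ?r" "row_mono ?r ?r S \<tau>"
        "\<And>p. p \<in> S \<Longrightarrow> fst p \<noteq> i \<Longrightarrow> \<tau> p = p"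
      have "indiscernible L U (A \<union> ?rest i) (I i)"
        using mut i unfolding mutually_indiscernible_def elems by blast
      from mut_indisc_move_row[OF indiscernible_imp_mut_indisc[OF this represents_subset[OF rep]] h \<tau>] i
      show "tp_eq A (coords m S) h (h \<circ> lift \<tau>)" by simp
    qed
  next
    assume mi: "mut_indisc A X ?r m h"
    have "indiscernible L U (A \<union> ?rest i) (I i)" if i: "i \<in> X" for i
    proof (rule mut_indisc_imp_indiscernible[OF _ represents_subset[OF rep]])
      show "mut_indisc (A \<union> ?rest i) {i} ?r m h"
      proof (rule mut_indisc_absorb_positions[OF mi h lin])
        fix S \<tau> assume S: "S \<subseteq> positions {i} ?r" and \<tau>: "row_mono ?r ?r S \<tau>"
        have S_iff: "p \<in> S \<longleftrightarrow> fst p = i" if "p \<in> S \<union> positions (X - {i}) ?r" for p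
          using that S by auto
        show "row_mono ?r ?r (S \<union> positions (X - {i}) ?r) (\<lambda>p. if p \<in> S then \<tau> p else p)"
        proof (rule row_monoI)
          fix p q assume pq: "p \<in> S \<union> positions (X - {i}) ?r" "q \<in> S \<union> positions (X - {i}) ?r"
            "fst p = fst q" "(snd p, snd q) \<in> ?r (fst p)" "snd p \<noteq> snd q"
          hence "p \<in> S \<longleftrightarrow> q \<in> S" using S_iff by metis
          thus "(snd (if p \<in> S then \<tau> p else p), snd (if q \<in> S then \<tau> q else q)) \<in> ?r (fst p) \<and>
            snd (if p \<in> S then \<tau> p else p) \<noteq> snd (if q \<in> S then \<tau> q else q)"
            using pq row_monoD(3)[OF \<tau>] by auto
        qed (use row_monoD(1,2)[OF \<tau>] in auto)
      qed (use i in auto)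
    qed (use i in simp)
    thus "mutually_indiscernible L U A X I" unfolding mutually_indiscernible_def elems by blast
  qed
qed

end

section \<open>Bounded alternation\<close>

locale nip_monster = monster L U kb
  for L :: "('f, 'r) lang" and U :: "('f, 'r, 'm) struct" and kb :: "'k rel" +
  assumes nip: "NIP L U"

definition alternates :: "nat \<Rightarrow> (nat \<Rightarrow> bool) \<Rightarrow> bool" where
  "alternates N Q \<longleftrightarrow> (\<forall>i<2 * N. Q i \<longleftrightarrow> even i)"

context monster
begin

lemma definable_Ex_case_sum:
  fixes P :: "('s + 't \<Rightarrow> 'm) \<Rightarrow> bool"
  assumes "definable A (Inl ` S \<union> Inr ` T) P"
  shows "definable A S (\<lambda>v. \<exists>c\<in>envs. P (case_sum v c))"
proof -
  define E where "E k \<longleftrightarrow> (\<exists>k'\<in>envs. (\<forall>y\<in>range Inl. k' y = k y) \<and> P k')" for k :: "'s + 't \<Rightarrow> 'm"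
  have "definable A ((Inl ` S \<union> Inr ` T) \<inter> range Inl) E"
    unfolding E_def[abs_def] by (rule definable_Ex[OF assms])
  hence "definable A (Inl ` S) E" by (rule definable_mono) auto
  hence "definable A S (\<lambda>v. E (\<lambda>y. case_sum v id (case y of Inl s \<Rightarrow> Inl s | Inr _ \<Rightarrow> Inr base_elem)))"
    by (rule definable_subst) (use base_elem in \<open>auto split: sum.splits\<close>)
  hence "definable A S (\<lambda>v. E (case_sum v (\<lambda>_. base_elem)))"
  proof (rule definable_cong)
    fix v :: "'s \<Rightarrow> 'm"
    have "(\<lambda>y :: 's + 't. case_sum v id (case y of Inl s \<Rightarrow> Inl s | Inr _ \<Rightarrow> Inr base_elem)) =
        case_sum v (\<lambda>_. base_elem)"
      by (rule ext) (auto split: sum.splits)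
    thus "E (\<lambda>y. case_sum v id (case y of Inl s \<Rightarrow> Inl s | Inr _ \<Rightarrow> Inr base_elem)) \<longleftrightarrow>
        E (case_sum v (\<lambda>_. base_elem))" by (simp only:)
  qed
  thus ?thesis
  proof (rule definable_cong)
    fix v :: "'s \<Rightarrow> 'm" assume v: "v \<in> envs"
    show "E (case_sum v (\<lambda>_. base_elem)) \<longleftrightarrow> (\<exists>c\<in>envs. P (case_sum v c))"
    proof
      assume "E (case_sum v (\<lambda>_. base_elem))"
      then obtain k where k: "k \<in> envs" "\<And>s. k (Inl s) = v s" "P k" unfolding E_def by auto
      hence "k = case_sum v (k \<circ> Inr)" by (intro ext) (auto split: sum.splits)
      thus "\<exists>c\<in>envs. P (case_sum v c)" using k(3) envs_comp[OF k(1)] by metis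
    next
      assume "\<exists>c\<in>envs. P (case_sum v c)"
      then obtain c where "c \<in> envs" "P (case_sum v c)" by blast
      thus "E (case_sum v (\<lambda>_. base_elem))"
        unfolding E_def using envs_case_sum[OF v] by (intro bexI[of _ "case_sum v c"]) auto
    qed
  qed
qed

lemma definable_ex_pattern:
  fixes \<theta> :: "('c + 'p \<Rightarrow> 'm) \<Rightarrow> bool" and \<eta> :: "nat set"
  assumes \<theta>: "definable {} (Inl ` C \<union> Inr ` Ps) \<theta>"
  shows "definable {} ({..<N} \<times> C) (\<lambda>v. \<exists>c\<in>envs. \<forall>i<N. \<theta> (case_sum (\<lambda>x. v (i, x)) c) \<longleftrightarrow> i \<in> \<eta>)"
proof -
  define g where "g i y = (case y of Inl x \<Rightarrow> Inl (i, x) | Inr p \<Rightarrow> Inr p)" for i :: nat and y :: "'c + 'p"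
  have "definable {} (Inl ` ({..<N} \<times> C) \<union> Inr ` Ps) (\<lambda>k. \<forall>i\<in>{..<N}. \<theta> (k \<circ> g i) \<longleftrightarrow> i \<in> \<eta>)"
  proof (rule definable_Ball, simp)
    fix i assume "i \<in> {..<N}"
    hence "definable {} (Inl ` ({..<N} \<times> C) \<union> Inr ` Ps) (\<lambda>k. \<theta> (k \<circ> g i))"
      by (intro definable_reindex[OF \<theta>]) (auto simp: g_def)
    thus "definable {} (Inl ` ({..<N} \<times> C) \<union> Inr ` Ps) (\<lambda>k. \<theta> (k \<circ> g i) \<longleftrightarrow> i \<in> \<eta>)"
      by (rule definable_iff[OF _ definable_const])
  qed
  note ex = definable_Ex_case_sum[OF this]
  have eq: "case_sum v c \<circ> g i = case_sum (\<lambda>x. v (i, x)) c" for v :: "nat \<times> 'c \<Rightarrow> 'm" and c i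
    by (rule ext) (simp add: g_def split: sum.splits)
  show ?thesis by (rule definable_cong[OF ex]) (simp only: eq Ball_def lessThan_iff)
qed

lemma alternation_imp_pattern:
  fixes w :: "nat \<times> 'c \<Rightarrow> 'm" and \<theta> :: "('c + 'p \<Rightarrow> 'm) \<Rightarrow> bool"
  assumes w: "w \<in> envs" and \<theta>: "definable {} (Inl ` C \<union> Inr ` Ps) \<theta>"
    and ind: "\<And>S \<tau>. strict_mono_on S \<tau> \<Longrightarrow> tp_eq {} (S \<times> C) w (w \<circ> map_prod \<tau> id)"
    and alt: "w' \<in> envs" "c \<in> envs" "tp_eq {} ({..<2 * N'} \<times> C) w' w"
      "alternates N' (\<lambda>i. \<theta> (case_sum (\<lambda>x. w' (i, x)) c))" and N: "N \<le> N'"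
  shows "\<exists>c\<in>envs. \<forall>i<N. \<theta> (case_sum (\<lambda>x. w (i, x)) c) \<longleftrightarrow> i \<in> \<eta>"
proof -
  define \<tau> where "\<tau> i = 2 * i + (if i \<in> \<eta> then 0 else 1)" for i :: nat
  have \<tau>: "strict_mono_on {..<N} \<tau>" by (rule strict_mono_onI) (auto simp: \<tau>_def)
  have \<tau>N: "\<tau> i < 2 * N'" "even (\<tau> i) \<longleftrightarrow> i \<in> \<eta>" if "i < N" for i using that N by (auto simp: \<tau>_def)
  have "tp_eq {} ({..<N} \<times> C) (w' \<circ> map_prod \<tau> id) (w \<circ> map_prod \<tau> id)"
    by (rule tp_eq_reindex[OF alt(3)]) (use \<tau>N(1) in auto)
  hence eq: "tp_eq {} ({..<N} \<times> C) (w' \<circ> map_prod \<tau> id) w"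
    using tp_eq_trans tp_eq_sym[OF ind[OF \<tau>]] by blast
  have "\<exists>c\<in>envs. \<forall>i<N. \<theta> (case_sum (\<lambda>x. (w' \<circ> map_prod \<tau> id) (i, x)) c) \<longleftrightarrow> i \<in> \<eta>"
    using alt(2,4) \<tau>N by (intro bexI[of _ c]) (auto simp: alternates_def)
  thus ?thesis using tp_eqD[OF eq definable_ex_pattern[OF \<theta>]] by blast
qed

lemma finite_patterns_imp_pattern:
  fixes w :: "nat \<times> 'c \<Rightarrow> 'm" and \<theta> :: "('c + 'p \<Rightarrow> 'm) \<Rightarrow> bool"
  assumes w: "w \<in> envs" and fin: "finite C" "finite Ps" and \<theta>: "definable {} (Inl ` C \<union> Inr ` Ps) \<theta>"
    and patterns: "\<And>N. \<exists>c\<in>envs. \<forall>i<N. \<theta> (case_sum (\<lambda>x. w (i, x)) c) \<longleftrightarrow> i \<in> \<eta>"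
  shows "\<exists>c\<in>envs. \<forall>i. \<theta> (case_sum (\<lambda>x. w (i, x)) c) \<longleftrightarrow> i \<in> \<eta>"
proof -
  define F where "F i c \<longleftrightarrow> (\<theta> (case_sum (\<lambda>x. w (i, x)) c) \<longleftrightarrow> i \<in> \<eta>)" for i and c :: "'p \<Rightarrow> 'm"
  have "\<exists>c\<in>envs. (\<forall>p\<in>{}. c p = base_elem) \<and> (\<forall>P\<in>range F. P c)"
  proof (rule realize)
    show "|Ps| <o kb" using fin(2) by (rule small_finite)
    show "|w ` (UNIV \<times> C)| <o kb"
      by (rule small_countable) (use fin(1) in \<open>auto intro: countable_finite\<close>)
    show "w ` (UNIV \<times> C) \<subseteq> univ U" using w by (auto simp: envs_def)
    show "(\<lambda>_. base_elem) \<in> envs" by (simp add: envsI base_elem)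
    fix P assume "P \<in> range F"
    then obtain i where P: "P = F i" by blast
    let ?g = "\<lambda>y. case y of Inl x \<Rightarrow> Inr (w (i, x)) | Inr p \<Rightarrow> Inl p"
    have "definable (w ` (UNIV \<times> C)) Ps (\<lambda>c. \<theta> (\<lambda>y. case_sum c id (?g y)))"
      by (rule definable_subst[OF \<theta>]) (use envsD[OF w] in \<open>auto split: sum.splits\<close>)
    hence "definable (w ` (UNIV \<times> C)) Ps (\<lambda>c. \<theta> (case_sum (\<lambda>x. w (i, x)) c))"
    proof (rule definable_cong)
      fix c :: "'p \<Rightarrow> 'm"
      have "(\<lambda>y. case_sum c id (?g y)) = case_sum (\<lambda>x. w (i, x)) c"
        by (rule ext) (auto split: sum.splits)
      thus "\<theta> (\<lambda>y. case_sum c id (?g y)) \<longleftrightarrow> \<theta> (case_sum (\<lambda>x. w (i, x)) c)" by (simp only:)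
    qed
    from definable_iff[OF this definable_const] show "definable (w ` (UNIV \<times> C)) Ps P"
      unfolding P F_def[abs_def] .
  next
    fix \<Sigma>0 and F0 :: "'p set" assume "finite \<Sigma>0" "\<Sigma>0 \<subseteq> range F" and F0: "F0 \<subseteq> {}"
    then obtain I where I: "finite I" "\<Sigma>0 = F ` I" by (meson finite_subset_image)
    then obtain N where N: "\<forall>i\<in>I. i < N" using finite_nat_set_iff_bounded by blast
    obtain c where "c \<in> envs" "\<forall>i<N. \<theta> (case_sum (\<lambda>x. w (i, x)) c) \<longleftrightarrow> i \<in> \<eta>" using patterns by blast
    thus "\<exists>c\<in>envs. (\<forall>p\<in>F0. c p = base_elem) \<and> (\<forall>P\<in>\<Sigma>0. P c)"
      using N I(2) F0 by (intro bexI[of _ c]) (auto simp: F_def)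
  qed simp
  thus ?thesis unfolding F_def by auto
qed

end

context nip_monster
begin

lemma some_pattern_missing:
  fixes w :: "nat \<times> 'c \<Rightarrow> 'm" and \<theta> :: "('c + 'p \<Rightarrow> 'm) \<Rightarrow> bool"
  assumes w: "w \<in> envs" and fin: "finite C" "finite Ps" and \<theta>: "definable {} (Inl ` C \<union> Inr ` Ps) \<theta>"
  shows "\<exists>\<eta>. \<not> (\<exists>c\<in>envs. \<forall>i. \<theta> (case_sum (\<lambda>x. w (i, x)) c) \<longleftrightarrow> i \<in> \<eta>)"
proof (rule ccontr)
  assume "\<not> ?thesis"
  hence pattern: "\<exists>c\<in>envs. \<forall>i. \<theta> (case_sum (\<lambda>x. w (i, x)) c) \<longleftrightarrow> i \<in> \<eta>" for \<eta> by blast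
  obtain cs ps where cs: "set cs = C" and ps: "set ps = Ps" using finite_list fin by metis
  let ?xs = "map Inl cs @ map Inr ps :: ('c + 'p) list"
  obtain p where p: "p \<in> pfmlas L {} (length ?xs)" "\<forall>h\<in>envs. psat U p (map h ?xs) \<longleftrightarrow> \<theta> h"
    using definable_imp_pfm[OF \<theta>, of ?xs] cs ps by auto
  obtain \<phi> where \<phi>: "p = (\<phi>, [])" "\<phi> \<in> fmlas L (length cs + length ps)"
    using p(1) by (cases p) (auto simp: pfmlas_def)
  define tup where "tup i = map (\<lambda>x. w (i, x)) cs" for i
  have sat: "sat U (\<lambda>a. (tup i @ map c ps) ! a) \<phi> \<longleftrightarrow> \<theta> (case_sum (\<lambda>x. w (i, x)) c)" if "c \<in> envs" for i c
  proof -
    have "case_sum (\<lambda>x. w (i, x)) c \<in> envs"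
      by (rule envs_case_sum[OF envsI that]) (rule envsD[OF w])
    from bspec[OF p(2) this] show ?thesis by (simp add: psat_def \<phi> tup_def comp_def)
  qed
  have "shatters U (length ps) \<phi> (range tup)"
    unfolding shatters_def
  proof (intro allI impI)
    fix S0 assume "S0 \<subseteq> range tup"
    obtain c where c: "c \<in> envs" "\<forall>i. \<theta> (case_sum (\<lambda>x. w (i, x)) c) \<longleftrightarrow> i \<in> {i. tup i \<in> S0}"
      using pattern by blast
    have "\<forall>a\<in>range tup. sat U (\<lambda>i. (a @ map c ps) ! i) \<phi> \<longleftrightarrow> a \<in> S0"
      using sat[OF c(1)] c(2) by auto
    moreover have "map c ps \<in> tuples U (length ps)" using envsD[OF c(1)] by (auto simp: tuples_def)
    ultimately show "\<exists>b\<in>tuples U (length ps). \<forall>a\<in>range tup. sat U (\<lambda>i. (a @ b) ! i) \<phi> \<longleftrightarrow> a \<in> S0" by blast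
  qed
  moreover have "inj tup"
  proof (rule injI)
    fix i j assume eq: "tup i = tup j"
    obtain c where c: "c \<in> envs" "\<forall>l. \<theta> (case_sum (\<lambda>x. w (l, x)) c) \<longleftrightarrow> l \<in> {i}" using pattern by blast
    have "\<theta> (case_sum (\<lambda>x. w (i, x)) c) \<longleftrightarrow> \<theta> (case_sum (\<lambda>x. w (j, x)) c)"
      using sat[OF c(1), of i] sat[OF c(1), of j] eq by simp
    thus "i = j" using c(2) by auto
  qed
  hence "infinite (range tup)" by (simp add: finite_image_iff)
  moreover have "range tup \<subseteq> tuples U (length cs)" using envsD[OF w] by (auto simp: tuples_def tup_def)
  ultimately show False using nip \<phi>(2) unfolding NIP_def by blast
qed

theorem nip_bounded_alternation:
  fixes w :: "nat \<times> 'c \<Rightarrow> 'm" and \<theta> :: "('c + 'p \<Rightarrow> 'm) \<Rightarrow> bool"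
  assumes w: "w \<in> envs" and C: "finite C" and \<theta>: "definable {} (Inl ` C \<union> Inr ` Ps) \<theta>"
    and ind: "\<And>S \<tau>. strict_mono_on S \<tau> \<Longrightarrow> tp_eq {} (S \<times> C) w (w \<circ> map_prod \<tau> id)"
  shows "\<exists>b. \<forall>N\<ge>b. \<forall>w'\<in>envs. \<forall>c\<in>envs. tp_eq {} ({..<2 * N} \<times> C) w' w \<longrightarrow>
    \<not> alternates N (\<lambda>i. \<theta> (case_sum (\<lambda>x. w' (i, x)) c))"
proof (rule ccontr)
  assume unbounded: "\<not> ?thesis"
  obtain S0 where S0: "finite S0" "S0 \<subseteq> Inl ` C \<union> Inr ` Ps" "definable {} S0 \<theta>"
    using definable_finite_support[OF \<theta>] by blast
  define P0 where "P0 = {p. Inr p \<in> S0}"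
  have "finite (Inr ` P0 :: ('c + 'p) set)" by (rule finite_subset[OF _ S0(1)]) (auto simp: P0_def)
  hence P0: "finite P0" by (rule finite_imageD) simp
  have \<theta>0: "definable {} (Inl ` C \<union> Inr ` P0) \<theta>"
    by (rule definable_mono[OF S0(3)]) (use S0(2) in \<open>auto simp: P0_def\<close>)
  have "\<exists>c\<in>envs. \<forall>i<N. \<theta> (case_sum (\<lambda>x. w (i, x)) c) \<longleftrightarrow> i \<in> \<eta>" for N \<eta>
  proof -
    obtain N' w' c where "Suc N \<le> N'" "w' \<in> envs" "c \<in> envs" "tp_eq {} ({..<2 * N'} \<times> C) w' w"
      "alternates N' (\<lambda>i. \<theta> (case_sum (\<lambda>x. w' (i, x)) c))"
      using unbounded by metis
    thus ?thesis using alternation_imp_pattern[OF w \<theta> ind] by (meson Suc_leD)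
  qed
  from finite_patterns_imp_pattern[OF w C P0 \<theta>0 this] some_pattern_missing[OF w C P0 \<theta>0]
  show False by blast
qed

corollary nip_bounded_alternation_over:
  fixes w :: "nat \<times> 'c \<Rightarrow> 'm" and P :: "('c \<Rightarrow> 'm) \<Rightarrow> bool"
  assumes w: "w \<in> envs" and C: "finite C" and P: "definable A C P" and A: "A \<subseteq> univ U"
    and ind: "\<And>S \<tau>. strict_mono_on S \<tau> \<Longrightarrow> tp_eq {} (S \<times> C) w (w \<circ> map_prod \<tau> id)"
  shows "\<exists>b. \<forall>N\<ge>b. \<forall>w'\<in>envs. tp_eq {} ({..<2 * N} \<times> C) w' w \<longrightarrow> \<not> alternates N (\<lambda>i. P (\<lambda>x. w' (i, x)))"
proof -
  define c where "c x = (if x \<in> univ U then x else base_elem)" for x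
  have c: "c \<in> envs" by (rule envsI) (simp add: c_def base_elem)
  have "definable ({} \<union> case_sum (\<lambda>_ :: 'c. base_elem) c ` Inr ` A) (Inl ` C) (\<lambda>k. P (k \<circ> Inl))"
    by (rule definable_reindex[OF definable_mono[OF P]]) (use A in \<open>auto simp: c_def image_image subset_iff\<close>)
  from definable_unfix[OF this] obtain \<theta> where \<theta>: "definable {} (Inl ` C \<union> Inr ` A) \<theta>"
    "\<forall>k\<in>envs. (\<forall>v\<in>Inr ` A. k v = case_sum (\<lambda>_. base_elem) c v) \<longrightarrow> (\<theta> k \<longleftrightarrow> P (k \<circ> Inl))"
    by (elim exE conjE)
  have eq: "\<theta> (case_sum w' c) \<longleftrightarrow> P w'" if "w' \<in> envs" for w'
    using bspec[OF \<theta>(2) envs_case_sum[OF that c]] by (simp add: comp_def)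
  have "\<exists>b. \<forall>N\<ge>b. \<forall>w'\<in>envs. \<forall>k\<in>envs. tp_eq {} ({..<2 * N} \<times> C) w' w \<longrightarrow>
      \<not> alternates N (\<lambda>i. \<theta> (case_sum (\<lambda>x. w' (i, x)) k))"
    by (rule nip_bounded_alternation[OF w C \<theta>(1) ind])
  then obtain b where b: "\<forall>N\<ge>b. \<forall>w'\<in>envs. \<forall>k\<in>envs. tp_eq {} ({..<2 * N} \<times> C) w' w \<longrightarrow>
      \<not> alternates N (\<lambda>i. \<theta> (case_sum (\<lambda>x. w' (i, x)) k))" by (elim exE)
  have "\<not> alternates N (\<lambda>i. P (\<lambda>x. w' (i, x)))"
    if w': "b \<le> N" "w' \<in> envs" "tp_eq {} ({..<2 * N} \<times> C) w' w" for N w'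
  proof -
    have "\<theta> (case_sum (\<lambda>x. w' (i, x)) c) \<longleftrightarrow> P (\<lambda>x. w' (i, x))" for i
      by (rule eq[OF envsI]) (rule envsD[OF w'(2)])
    thus ?thesis using b w' c by fastforce
  qed
  thus ?thesis by blast
qed

end

section \<open>Arrays of indiscernible sequences with gaps\<close>

lemma strict_mono_If_le:
  fixes f g :: "'a::linorder \<Rightarrow> 'b::order"
  assumes f: "strict_mono f" and g: "strict_mono g" and c: "f c = g c"
  shows "strict_mono (\<lambda>x. if x \<le> c then f x else g x)"
proof (rule strict_monoI)
  fix x y :: 'a assume xy: "x < y"
  show "(if x \<le> c then f x else g x) < (if y \<le> c then f y else g y)"
  proof (cases "x \<le> c \<and> c < y")
    case True
    hence "f x \<le> f c" "g c < g y" using strict_mono_less_eq[OF f] strict_monoD[OF g] by auto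
    thus ?thesis using True c by auto
  qed (use xy strict_monoD[OF f xy] strict_monoD[OF g xy] in auto)
qed

definition line :: "rat \<Rightarrow> rat \<Rightarrow> rat \<Rightarrow> rat \<Rightarrow> rat \<Rightarrow> rat" where
  "line x1 y1 x2 y2 x = y1 + (x - x1) * ((y2 - y1) / (x2 - x1))"

lemma line_ends [simp]: "line x1 y1 x2 y2 x1 = y1" "x1 < x2 \<Longrightarrow> line x1 y1 x2 y2 x2 = y2"
  by (simp_all add: line_def)

lemma strict_mono_line:
  assumes "x1 < x2" "y1 < y2"
  shows "strict_mono (line x1 y1 x2 y2)"
proof (rule strict_monoI)
  fix x y :: rat assume "x < y"
  hence "(x - x1) * ((y2 - y1) / (x2 - x1)) < (y - x1) * ((y2 - y1) / (x2 - x1))"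
    using assms by (intro mult_strict_right_mono) auto
  thus "line x1 y1 x2 y2 x < line x1 y1 x2 y2 y" by (simp add: line_def)
qed

definition affine :: "rat \<Rightarrow> rat \<Rightarrow> rat \<Rightarrow> rat" where
  "affine p d x = p + d * x"

lemma affine_0 [simp]: "affine p d 0 = p" by (simp add: affine_def)

lemma affine_bound: "0 < d \<Longrightarrow> \<bar>x\<bar> \<le> 1 \<Longrightarrow> \<bar>affine p d x - p\<bar> \<le> d"
  using mult_left_mono[of "\<bar>x\<bar>" 1 d] by (simp add: affine_def abs_mult)

lemma affine_less: "0 < d \<Longrightarrow> affine p d x < affine p d y \<longleftrightarrow> x < y" by (simp add: affine_def)

lemma affine_inv: "0 < d \<Longrightarrow> (affine p d x - p) / d = x" by (simp add: affine_def)

lemma ex_strict_mono_moving_interval: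
  assumes d: "0 < d" "d < b" and d': "0 < d'" "\<bar>p' - p\<bar> + d' < b"
  shows "\<exists>f. strict_mono f \<and> (\<forall>q. b \<le> \<bar>q - p\<bar> \<longrightarrow> f q = q) \<and>
    (\<forall>x. \<bar>x\<bar> \<le> 1 \<longrightarrow> f (affine p' d' x) = affine p d x)"
proof -
  have order: "p - b < p' - d'" "p' + d' < p + b" using d'(2) by (auto simp: abs_if split: if_splits)
  define f where "f q = (if q \<le> p - b then q else if q \<le> p' - d' then line (p - b) (p - b) (p' - d') (p - d) q
    else if q \<le> p' + d' then line (p' - d') (p - d) (p' + d') (p + d) q
    else if q \<le> p + b then line (p' + d') (p + d) (p + b) (p + b) q else q)" for q
  have "strict_mono f"
    unfolding f_def[abs_def]
    by (intro strict_mono_If_le strict_mono_line) (use order d d' in \<open>auto simp: strict_mono_def\<close>)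
  moreover have "f q = q" if "b \<le> \<bar>q - p\<bar>" for q
  proof -
    have "q \<le> p - b \<or> q = p + b \<or> p + b < q" using that by (auto simp: abs_if split: if_splits)
    thus ?thesis using order d d' by (auto simp: f_def)
  qed
  moreover have "f (affine p' d' x) = affine p d x" if "\<bar>x\<bar> \<le> 1" for x
  proof -
    have "\<bar>affine p' d' x - p'\<bar> \<le> d'" by (rule affine_bound[OF d'(1) that])
    hence "p' - d' \<le> affine p' d' x" "affine p' d' x \<le> p' + d'" by (auto simp: abs_le_iff)
    hence "f (affine p' d' x) = line (p' - d') (p - d) (p' + d') (p + d) (affine p' d' x)"
      using order d d' by (auto simp: f_def)
    also have "\<dots> = affine p d x" using d'(1) by (simp add: line_def affine_def field_simps)
    finally show ?thesis .
  qed
  ultimately show ?thesis by blast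
qed

text \<open>
  \<^term>\<open>rescale C p d p' d'\<close> fixes the positions in \<open>C\<close> and carries the interval of radius \<open>d\<close> about \<open>p\<close> in
  row \<open>k\<close> onto the interval of radius \<open>d' k\<close> about \<open>p' k\<close>.
\<close>

definition rescale :: "(nat \<times> rat) set \<Rightarrow> rat \<Rightarrow> rat \<Rightarrow> (nat \<Rightarrow> rat) \<Rightarrow> (nat \<Rightarrow> rat) \<Rightarrow> nat \<times> rat \<Rightarrow> nat \<times> rat" where
  "rescale C p d p' d' q = (if q \<in> C then q else (fst q, affine (p' (fst q)) (d' (fst q)) ((snd q - p) / d)))"

lemma rescale_fixed: "q \<in> C \<Longrightarrow> rescale C p d p' d' q = q"
  by (simp add: rescale_def)

lemma rescale_affine:
  "0 < d \<Longrightarrow> (k, affine p d x) \<notin> C \<Longrightarrow> rescale C p d p' d' (k, affine p d x) = (k, affine (p' k) (d' k) x)"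
  by (simp add: rescale_def affine_inv)

lemma row_mono_rescale:
  assumes d: "0 < d" "\<And>k. k \<in> R \<Longrightarrow> 0 < d' k"
    and side: "\<And>k q x. (k, q) \<in> C \<Longrightarrow> k \<in> R \<Longrightarrow> x \<in> X \<Longrightarrow> (q < affine p d x \<longrightarrow> q < affine (p' k) (d' k) x) \<and>
      (affine p d x < q \<longrightarrow> affine (p' k) (d' k) x < q)"
  shows "row_mono le_rows le_rows (C \<union> R \<times> affine p d ` X) (rescale C p d p' d')"
proof (rule row_mono_le_rowsI)
  show "fst (rescale C p d p' d' q) = fst q" for q by (simp add: rescale_def)
  fix k s s' assume s: "(k, s) \<in> C \<union> R \<times> affine p d ` X" "(k, s') \<in> C \<union> R \<times> affine p d ` X" and "s < s'"
  have pos: "(k, t) \<in> C \<and> rescale C p d p' d' (k, t) = (k, t) \<or> (k \<in> R \<and> (k, t) \<notin> C \<and> (\<exists>x\<in>X. t = affine p d x \<and>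
      rescale C p d p' d' (k, t) = (k, affine (p' k) (d' k) x)))"
    if t: "(k, t) \<in> C \<union> R \<times> affine p d ` X" for t
  proof (cases "(k, t) \<in> C")
    case False
    then obtain x where "k \<in> R" "x \<in> X" "t = affine p d x" using t by auto
    thus ?thesis using False rescale_affine[OF d(1)] by blast
  qed (simp add: rescale_fixed)
  show "snd (rescale C p d p' d' (k, s)) < snd (rescale C p d p' d' (k, s'))"
    using pos[OF s(1)] pos[OF s(2)] \<open>s < s'\<close> side[of k] d(2)[of k] by (auto simp: affine_less d(1))
qed

locale ref_array = nip_monster L U kb
  for L :: "('f, 'r) lang" and U :: "('f, 'r, 'm) struct" and kb :: "'k rel" +
  fixes e :: "(nat \<times> rat) \<times> nat \<Rightarrow> 'm" and m :: nat
  assumes e_env: "e \<in> envs"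
    and e_ind: "\<And>S \<tau>. row_mono le_rows le_rows S \<tau> \<Longrightarrow> tp_eq {} (S \<times> {..<m}) e (e \<circ> lift \<tau>)"
begin

definition copy_on :: "(nat \<times> rat) set \<Rightarrow> ((nat \<times> rat) \<times> nat \<Rightarrow> 'm) \<Rightarrow> bool" where
  "copy_on D s \<longleftrightarrow> s \<in> envs \<and> tp_eq {} (D \<times> {..<m}) s e"

definition agree :: "(nat \<times> rat) set \<Rightarrow> ((nat \<times> rat) \<times> nat \<Rightarrow> 'm) \<Rightarrow> ((nat \<times> rat) \<times> nat \<Rightarrow> 'm) \<Rightarrow> bool" where
  "agree D s s' \<longleftrightarrow> (\<forall>q\<in>D. \<forall>c<m. s (q, c) = s' (q, c))"

lemma agreeI: "(\<And>q c. q \<in> D \<Longrightarrow> c < m \<Longrightarrow> s (q, c) = s' (q, c)) \<Longrightarrow> agree D s s'"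
  by (simp add: agree_def)

lemma agreeD: "agree D s s' \<Longrightarrow> q \<in> D \<Longrightarrow> c < m \<Longrightarrow> s (q, c) = s' (q, c)"
  by (simp add: agree_def)

lemma agree_iff: "agree D s s' \<longleftrightarrow> (\<forall>v\<in>D \<times> {..<m}. s v = s' v)"
  by (auto simp: agree_def)

lemma agree_mono: "agree D s s' \<Longrightarrow> D' \<subseteq> D \<Longrightarrow> agree D' s s'"
  by (auto simp: agree_def)

lemma agree_trans: "agree D s s' \<Longrightarrow> agree D s' s'' \<Longrightarrow> agree D s s''"
  by (simp add: agree_def)

lemma lift_times: "(\<And>q. q \<in> S \<Longrightarrow> f q \<in> T) \<Longrightarrow> lift f ` (S \<times> N) \<subseteq> T \<times> N"
  by force

lemma definable_agree:
  assumes "definable {} (D \<times> {..<m}) P" "s \<in> envs" "s' \<in> envs" "agree D s s'"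
  shows "P s \<longleftrightarrow> P s'"
  using definable_local[OF assms(1-3)] assms(4) by (auto simp: agree_iff)

lemma copy_on_env: "copy_on D s \<Longrightarrow> s \<in> envs" by (simp add: copy_on_def)

lemma copy_on_mono: "copy_on D s \<Longrightarrow> D' \<subseteq> D \<Longrightarrow> copy_on D' s"
  unfolding copy_on_def by (meson Sigma_mono order_refl tp_eq_mono)

lemma copy_onD: "copy_on D s \<Longrightarrow> definable {} (D \<times> {..<m}) P \<Longrightarrow> P s \<longleftrightarrow> P e"
  unfolding copy_on_def using tp_eqD[of "{}" "D \<times> {..<m}" s e P] by blast

lemma copy_on_tp_eq: "copy_on D s \<Longrightarrow> s' \<in> envs \<Longrightarrow> tp_eq {} (D \<times> {..<m}) s' s \<Longrightarrow> copy_on D s'"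
  unfolding copy_on_def using tp_eq_trans by blast

lemma tp_eq_agree_on: "s \<in> envs \<Longrightarrow> s' \<in> envs \<Longrightarrow> agree D s s' \<Longrightarrow> tp_eq {} (D \<times> {..<m}) s s'"
  by (rule tp_eq_agree) (auto simp: agree_def)

lemma copy_on_agree: "copy_on D s \<Longrightarrow> s' \<in> envs \<Longrightarrow> agree D s' s \<Longrightarrow> copy_on D s'"
  using copy_on_tp_eq tp_eq_agree_on copy_on_env by blast

lemma copy_on_reindex:
  assumes "copy_on D s" "row_mono le_rows le_rows D' \<tau>" "\<tau> ` D' \<subseteq> D"
  shows "copy_on D' (s \<circ> lift \<tau>)"
proof -
  have "tp_eq {} (D' \<times> {..<m}) (s \<circ> lift \<tau>) (e \<circ> lift \<tau>)"
    by (rule tp_eq_reindex[of _ "D \<times> {..<m}"]) (use assms in \<open>auto simp: copy_on_def\<close>)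
  thus ?thesis
    using tp_eq_trans[OF _ tp_eq_sym[OF e_ind[OF assms(2)]]] envs_comp assms(1) unfolding copy_on_def by blast
qed

lemma small_positions: "|(W :: (nat \<times> rat) set) \<times> {..<m}| <o kb"
  by (rule small_countable) simp

lemma extend_positions:
  assumes "h \<in> envs" "h' \<in> envs" "S \<subseteq> W" "tp_eq {} (S \<times> {..<m}) h h'"
  shows "\<exists>k\<in>envs. agree S k h' \<and> tp_eq {} (W \<times> {..<m}) k h"
  unfolding agree_iff by (rule extend_type) (use assms small_positions small_finite in auto)

lemma copy_on_extend:
  assumes "copy_on D s" "D \<subseteq> D'"
  shows "\<exists>s'. agree D s' s \<and> copy_on D' s'"
proof -
  have "\<exists>k\<in>envs. agree D k s \<and> tp_eq {} (D' \<times> {..<m}) k e"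
    by (rule extend_positions[OF e_env _ assms(2)]) (use assms(1) tp_eq_sym in \<open>auto simp: copy_on_def\<close>)
  thus ?thesis unfolding copy_on_def by blast
qed

lemma realize_array_types:
  fixes h :: "'i \<Rightarrow> (nat \<times> rat) \<times> nat \<Rightarrow> 'm" and g :: "'i \<Rightarrow> (nat \<times> rat) \<times> nat \<Rightarrow> (nat \<times> rat) \<times> nat"
  assumes I: "finite I" and K: "K \<in> envs"
    and fin: "\<And>C P. finite C \<Longrightarrow> C \<subseteq> D \<Longrightarrow> (\<And>i. i \<in> I \<Longrightarrow> definable {} ((T i - (D - C)) \<times> {..<m}) (P i)) \<Longrightarrow>
      (\<And>i. i \<in> I \<Longrightarrow> P i (h i)) \<Longrightarrow> \<exists>z\<in>envs. agree F z K \<and> (\<forall>i\<in>I. P i (z \<circ> g i))"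
  shows "\<exists>z\<in>envs. agree F z K \<and> (\<forall>i\<in>I. tp_eq {} (T i \<times> {..<m}) (z \<circ> g i) (h i))"
  unfolding agree_iff
proof (rule realize_types[where W = UNIV and A = "{}"])
  show "|UNIV :: ((nat \<times> rat) \<times> nat) set| <o kb" by (rule small_countable) simp
  show "|{} :: 'm set| <o kb" by (rule small_finite) simp
  fix P assume P: "\<And>i. i \<in> I \<Longrightarrow> definable {} (T i \<times> {..<m}) (P i)" "\<And>i. i \<in> I \<Longrightarrow> P i (h i)"
  have "\<exists>S0. finite S0 \<and> S0 \<subseteq> T i \<times> {..<m} \<and> definable {} S0 (P i)" if "i \<in> I" for i
    by (rule definable_finite_support[OF P(1)[OF that]])
  then obtain S where S: "\<And>i. i \<in> I \<Longrightarrow> finite (S i)" "\<And>i. i \<in> I \<Longrightarrow> S i \<subseteq> T i \<times> {..<m}"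
    "\<And>i. i \<in> I \<Longrightarrow> definable {} (S i) (P i)"
    by metis
  define C where "C = fst ` (\<Union>i\<in>I. S i) \<inter> D"
  have "definable {} ((T i - (D - C)) \<times> {..<m}) (P i)" if "i \<in> I" for i
  proof (rule definable_mono[OF S(3)[OF that] order_refl])
    show "S i \<subseteq> (T i - (D - C)) \<times> {..<m}" using S(2)[OF that] that unfolding C_def by force
  qed
  moreover have "finite C" "C \<subseteq> D" using I S(1) by (auto simp: C_def)
  ultimately show "\<exists>z\<in>envs. (\<forall>v\<in>F \<times> {..<m}. z v = K v) \<and> (\<forall>i\<in>I. P i (z \<circ> g i))"
    using fin[of C P] P(2) unfolding agree_iff by blast
qed (use I K in auto)

definition has_gap :: "nat \<Rightarrow> rat \<Rightarrow> rat \<Rightarrow> rat \<Rightarrow> (nat \<times> rat) set \<Rightarrow> bool" where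
  "has_gap M p d \<epsilon> D \<longleftrightarrow> 0 < d \<and> 0 < \<epsilon> \<and>
     (\<forall>k<M. \<forall>q. \<bar>q - p\<bar> \<le> d \<longrightarrow> (k, q) \<notin> D) \<and>
     (\<forall>k<M. \<forall>q. d < \<bar>q - p\<bar> \<and> \<bar>q - p\<bar> < d + \<epsilon> \<longrightarrow> (k, q) \<in> D)"

definition inserts_rowwise ::
    "nat \<Rightarrow> rat \<Rightarrow> (nat \<times> rat) set \<Rightarrow> rat set \<Rightarrow> ((nat \<times> rat) \<times> nat \<Rightarrow> 'm) \<Rightarrow> ((nat \<times> rat) \<times> nat \<Rightarrow> 'm) \<Rightarrow> bool" where
  "inserts_rowwise M p D Y K z \<longleftrightarrow>
     agree (D \<union> {..<M} \<times> Y) z K \<and> (\<forall>k<M. copy_on (D \<union> {k} \<times> insert p Y) z)"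

text \<open>
  In an obstructed array each of the first \<open>M\<close> rows has a gap about \<open>p\<close>, and in each gap a finite sequence at
  the positions \<open>affine p d ` X\<close> that can be inserted in its own row, but it is impossible to insert
  simultaneously in all gaps new elements at \<open>p\<close> that lie inside these finite sequences.
\<close>

definition obstructed :: "nat \<Rightarrow> bool" where
  "obstructed M \<longleftrightarrow> (\<exists>p d \<epsilon> D X K. has_gap M p d \<epsilon> D \<and> finite X \<and> X \<subseteq> {-1..1} - {0} \<and> copy_on D K \<and>
     (\<forall>k<M. copy_on (D \<union> {k} \<times> affine p d ` X) K) \<and>
     \<not> (\<exists>z. inserts_rowwise M p D (affine p d ` X) K z \<and> copy_on (D \<union> {..<M} \<times> {p}) z))"

lemma not_obstructed_0: "\<not> obstructed 0"
  by (auto simp: obstructed_def inserts_rowwise_def agree_def)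

lemma ex_formula_excluding_insertion:
  assumes K: "K \<in> envs" and p: "\<And>k. k < M \<Longrightarrow> (k, p) \<notin> D"
    and no: "\<not> (\<exists>z. inserts_rowwise M p D X K z \<and> copy_on (D \<union> {..<M} \<times> {p}) z)"
  shows "\<exists>C \<beta>. finite C \<and> C \<subseteq> D \<and> definable {} ((C \<union> {..<M} \<times> {p}) \<times> {..<m}) \<beta> \<and> \<beta> e \<and>
    (\<forall>z\<in>envs. inserts_rowwise M p C X K z \<longrightarrow> \<not> \<beta> z)"
proof (rule ccontr)
  assume "\<not> ?thesis"
  hence satisfiable: "\<exists>z\<in>envs. inserts_rowwise M p C X K z \<and> \<beta> z"
    if "finite C" "C \<subseteq> D" "definable {} ((C \<union> {..<M} \<times> {p}) \<times> {..<m}) \<beta>" "\<beta> e" for C \<beta>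
    using that by blast
  define T where "T i = (case i of None \<Rightarrow> D \<union> {..<M} \<times> {p} | Some k \<Rightarrow> D \<union> {k} \<times> insert p X)" for i
  have "\<exists>z\<in>envs. agree (D \<union> {..<M} \<times> X) z K \<and> (\<forall>i\<in>insert None (Some ` {..<M}). tp_eq {} (T i \<times> {..<m}) (z \<circ> id) e)"
  proof (rule realize_array_types[OF _ K])
    fix C P assume C: "finite C" "C \<subseteq> D"
      and P: "\<And>i. i \<in> insert None (Some ` {..<M}) \<Longrightarrow> definable {} ((T i - (D - C)) \<times> {..<m}) (P i)"
        "\<And>i. i \<in> insert None (Some ` {..<M}) \<Longrightarrow> P i e"
    have row: "definable {} ((C \<union> {k} \<times> insert p X) \<times> {..<m}) (P (Some k))" if "k < M" for k
      by (rule definable_mono[OF P(1)]) (use that in \<open>auto simp: T_def\<close>)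
    have column: "definable {} ((C \<union> {..<M} \<times> {p}) \<times> {..<m}) (P None)"
      by (rule definable_mono[OF P(1)]) (auto simp: T_def)
    obtain z where z: "z \<in> envs" "inserts_rowwise M p C X K z" "P None z"
      using satisfiable[OF C column] P(2) by blast
    define z' where "z' v = (if fst v \<in> C \<union> {..<M} \<times> insert p X then z v else K v)" for v
    have z': "z' \<in> envs" unfolding z'_def[abs_def] by (rule envs_merge[OF z(1) K])
    have z'z: "agree (C \<union> {..<M} \<times> insert p X) z' z" by (simp add: agree_def z'_def)
    have "P None z'"
      using definable_agree[OF column z' z(1) agree_mono[OF z'z]] z(3) by blast
    moreover have "P (Some k) z'" if "k < M" for k
    proof -
      have "P (Some k) z"
        using copy_onD[OF _ row[OF that]] z(2) P(2) that by (auto simp: inserts_rowwise_def)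
      moreover have "agree (C \<union> {k} \<times> insert p X) z' z" by (rule agree_mono[OF z'z]) (use that in auto)
      ultimately show ?thesis using definable_agree[OF row[OF that] z' z(1)] by blast
    qed
    moreover have "agree (D \<union> {..<M} \<times> X) z' K"
    proof (rule agreeI)
      fix q c assume q: "q \<in> D \<union> {..<M} \<times> X" and c: "c < m"
      consider "q \<in> C \<union> {..<M} \<times> X" | "q \<notin> C \<union> {..<M} \<times> insert p X" using q p by blast
      thus "z' (q, c) = K (q, c)"
        using z(2) c by cases (auto simp: z'_def inserts_rowwise_def agree_def)
    qed
    ultimately show "\<exists>z\<in>envs. agree (D \<union> {..<M} \<times> X) z K \<and> (\<forall>i\<in>insert None (Some ` {..<M}). P i (z \<circ> id))"
      using z' by (intro bexI[of _ z']) auto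
  qed simp
  then obtain z where "z \<in> envs" "agree (D \<union> {..<M} \<times> X) z K"
    "\<forall>i\<in>insert None (Some ` {..<M}). tp_eq {} (T i \<times> {..<m}) z e" by auto
  hence "inserts_rowwise M p D X K z" "copy_on (D \<union> {..<M} \<times> {p}) z"
    by (auto simp: inserts_rowwise_def copy_on_def T_def)
  thus False using no by blast
qed

lemma ex_row_map_into_gap:
  assumes gap: "has_gap M p d \<epsilon> D" and CD: "C \<subseteq> D" and b: "d < b" "b \<le> d + \<epsilon>"
    and Cb: "\<And>k q. (k, q) \<in> C \<Longrightarrow> k < M \<Longrightarrow> b \<le> \<bar>q - p\<bar>"
    and D': "\<And>k q. (k, q) \<in> D' - C \<Longrightarrow> k < M \<and> \<bar>q - p\<bar> < b"
    and d': "\<And>k. k < M \<Longrightarrow> 0 < d' k" "\<And>k. k < M \<Longrightarrow> \<bar>p' k - p\<bar> + d' k < b"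
      "\<And>k q. k < M \<Longrightarrow> \<bar>q - p' k\<bar> \<le> d' k \<Longrightarrow> (k, q) \<notin> D'"
  shows "\<exists>\<tau>. row_mono le_rows le_rows UNIV \<tau> \<and> (\<forall>q\<in>C. \<tau> q = q) \<and> \<tau> ` D' \<subseteq> D \<and>
    (\<forall>k<M. \<forall>x. \<bar>x\<bar> \<le> 1 \<longrightarrow> \<tau> (k, affine (p' k) (d' k) x) = (k, affine p d x))"
proof -
  have d: "0 < d" using gap by (simp add: has_gap_def)
  have "\<exists>f. strict_mono f \<and> (\<forall>q. b \<le> \<bar>q - p\<bar> \<longrightarrow> f q = q) \<and>
      (\<forall>x. \<bar>x\<bar> \<le> 1 \<longrightarrow> f (affine (p' k) (d' k) x) = affine p d x)" if "k < M" for k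
    by (rule ex_strict_mono_moving_interval) (use d b d' that in auto)
  then obtain f where f: "\<And>k. k < M \<Longrightarrow> strict_mono (f k)" "\<And>k q. k < M \<Longrightarrow> b \<le> \<bar>q - p\<bar> \<Longrightarrow> f k q = q"
    "\<And>k x. k < M \<Longrightarrow> \<bar>x\<bar> \<le> 1 \<Longrightarrow> f k (affine (p' k) (d' k) x) = affine p d x"
    by metis
  define \<tau> where "\<tau> q = (if fst q < M then (fst q, f (fst q) (snd q)) else q)" for q
  have fixed: "\<tau> q = q" if "q \<in> C" for q
    using f(2) Cb that by (cases q) (auto simp: \<tau>_def)
  have "\<tau> (k, q) \<in> D" if q: "(k, q) \<in> D'" "(k, q) \<notin> C" for k q
  proof -
    have k: "k < M" "\<bar>q - p\<bar> < b" using D' q by auto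
    have "\<not> \<bar>q - p' k\<bar> \<le> d' k" using d'(3)[OF k(1)] q(1) by blast
    then consider "p - b < q" "q < affine (p' k) (d' k) (- 1)" | "affine (p' k) (d' k) 1 < q" "q < p + b"
      using k(2) by (auto simp: affine_def abs_if split: if_splits)
    hence "d < \<bar>f k q - p\<bar> \<and> \<bar>f k q - p\<bar> < b"
    proof cases
      case 1
      hence "p - b < f k q" "f k q < p - d"
        using strict_monoD[OF f(1)[OF k(1)]] f(2)[OF k(1), of "p - b"] f(3)[OF k(1), of "- 1"] b d
        by (fastforce simp: affine_def)+
      thus ?thesis using d by (simp add: abs_if)
    next
      case 2
      hence "f k q < p + b" "p + d < f k q"
        using strict_monoD[OF f(1)[OF k(1)]] f(2)[OF k(1), of "p + b"] f(3)[OF k(1), of 1] b d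
        by (fastforce simp: affine_def)+
      thus ?thesis using d by (simp add: abs_if)
    qed
    thus ?thesis using gap k(1) b(2) by (simp add: \<tau>_def has_gap_def)
  qed
  hence "\<tau> ` D' \<subseteq> D" using fixed CD by fastforce
  moreover have "row_mono le_rows le_rows UNIV \<tau>"
    by (rule row_mono_le_rowsI) (use strict_monoD[OF f(1)] in \<open>auto simp: \<tau>_def\<close>)
  ultimately show ?thesis using fixed f(3) by (intro exI[of _ \<tau>]) (auto simp: \<tau>_def)
qed

lemma gap_transfer:
  assumes gap: "has_gap M p d \<epsilon> D" and CD: "C \<subseteq> D" and X: "X \<subseteq> {-1..1}"
    and b: "d < b" "b \<le> d + \<epsilon>" and Cb: "\<And>k q. (k, q) \<in> C \<Longrightarrow> k < M \<Longrightarrow> b \<le> \<bar>q - p\<bar>"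
    and K: "copy_on D K" "\<And>k. k < M \<Longrightarrow> copy_on (D \<union> {k} \<times> affine p d ` X) K"
    and D': "C \<subseteq> D'" "\<And>k q. (k, q) \<in> D' - C \<Longrightarrow> k < M \<and> \<bar>q - p\<bar> < b" and s: "copy_on D' s"
    and d': "\<And>k. k < M \<Longrightarrow> 0 < d' k" "\<And>k. k < M \<Longrightarrow> \<bar>p' k - p\<bar> + d' k < b"
      "\<And>k q. k < M \<Longrightarrow> \<bar>q - p' k\<bar> \<le> d' k \<Longrightarrow> (k, q) \<notin> D'"
  shows "\<exists>K'\<in>envs. agree D' K' s \<and> (\<forall>k<M. copy_on (D' \<union> {k} \<times> affine (p' k) (d' k) ` X) K') \<and>
    tp_eq {} ((C \<union> {..<M} \<times> affine p d ` X) \<times> {..<m}) (K' \<circ> lift (rescale C p d p' d')) K"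
proof -
  have d: "0 < d" using gap by (simp add: has_gap_def)
  have X1: "\<bar>x\<bar> \<le> 1" if "x \<in> X" for x using X that by (auto simp: abs_le_iff)
  have "\<exists>\<tau>. row_mono le_rows le_rows UNIV \<tau> \<and> (\<forall>q\<in>C. \<tau> q = q) \<and> \<tau> ` D' \<subseteq> D \<and>
    (\<forall>k<M. \<forall>x. \<bar>x\<bar> \<le> 1 \<longrightarrow> \<tau> (k, affine (p' k) (d' k) x) = (k, affine p d x))"
    by (rule ex_row_map_into_gap[OF gap CD b]) (fact Cb D'(2) d')+
  then obtain \<tau> where \<tau>: "row_mono le_rows le_rows UNIV \<tau>" "\<forall>q\<in>C. \<tau> q = q" "\<tau> ` D' \<subseteq> D"
    and "\<forall>k<M. \<forall>x. \<bar>x\<bar> \<le> 1 \<longrightarrow> \<tau> (k, affine (p' k) (d' k) x) = (k, affine p d x)"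
    by (elim exE conjE)
  hence \<tau>X: "\<tau> (k, affine (p' k) (d' k) x) = (k, affine p d x)" if "k < M" "\<bar>x\<bar> \<le> 1" for k x
    using that by blast
  note mono = row_mono_subset[OF \<tau>(1) subset_UNIV]
  let ?X' = "\<lambda>k. affine (p' k) (d' k) ` X"
  let ?W = "D' \<union> Sigma {..<M} ?X'"
  have K\<tau>: "K \<circ> lift \<tau> \<in> envs" by (rule envs_comp[OF copy_on_env[OF K(1)]])
  have "tp_eq {} (D' \<times> {..<m}) (K \<circ> lift \<tau>) s"
    using copy_on_reindex[OF K(1) mono \<tau>(3)] s tp_eq_trans tp_eq_sym unfolding copy_on_def by blast
  then obtain K' where K': "K' \<in> envs" "agree D' K' s" "tp_eq {} (?W \<times> {..<m}) K' (K \<circ> lift \<tau>)"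
    using extend_positions[OF K\<tau> copy_on_env[OF s], of D' ?W] by blast
  have "copy_on (D' \<union> {k} \<times> ?X' k) K'" if k: "k < M" for k
  proof (rule copy_on_tp_eq[OF copy_on_reindex[OF K(2)[OF k] mono] K'(1)])
    show "\<tau> ` (D' \<union> {k} \<times> ?X' k) \<subseteq> D \<union> {k} \<times> affine p d ` X"
      using \<tau>(3) \<tau>X[OF k] X1 by (auto simp: image_Un)
    show "tp_eq {} ((D' \<union> {k} \<times> ?X' k) \<times> {..<m}) K' (K \<circ> lift \<tau>)"
      by (rule tp_eq_mono[OF K'(3)]) (use k in auto)
  qed
  moreover
  let ?T = "C \<union> {..<M} \<times> affine p d ` X"
  have rescale: "rescale C p d p' d' q \<in> ?W \<and> \<tau> (rescale C p d p' d' q) = q" if q: "q \<in> ?T" for q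
  proof (cases "q \<in> C")
    case False
    then obtain k x where "q = (k, affine p d x)" "k < M" "x \<in> X" using q by auto
    thus ?thesis using rescale_affine[OF d] False \<tau>X X1 by auto
  qed (use \<tau>(2) D'(1) in \<open>auto simp: rescale_fixed\<close>)
  have "tp_eq {} (?T \<times> {..<m}) (K' \<circ> lift (rescale C p d p' d')) (K \<circ> lift \<tau> \<circ> lift (rescale C p d p' d'))"
    by (rule tp_eq_reindex[OF K'(3) lift_times]) (use rescale in blast)
  moreover have "tp_eq {} (?T \<times> {..<m}) (K \<circ> lift \<tau> \<circ> lift (rescale C p d p' d')) K"
    by (rule tp_eq_agree) (use rescale copy_on_env[OF K(1)] in \<open>auto intro!: envs_comp\<close>)
  ultimately show ?thesis using K' tp_eq_trans by blast
qed

subsection \<open>Alternation along arrays\<close>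

lemma tp_eq_same_row_order:
  assumes f: "\<And>a. a \<in> S \<Longrightarrow> fst (f1 a) = fst (f2 a)"
    "\<And>a b. a \<in> S \<Longrightarrow> b \<in> S \<Longrightarrow> fst (f1 a) = fst (f1 b) \<Longrightarrow> snd (f1 a) < snd (f1 b) \<longleftrightarrow> snd (f2 a) < snd (f2 b)"
  shows "tp_eq {} (S \<times> {..<m}) (e \<circ> lift f1) (e \<circ> lift f2)"
proof -
  define \<tau> where "\<tau> q = f2 (inv_into S f1 q)" for q
  have \<tau>: "\<tau> (f1 a) = f2 a" if "a \<in> S" for a
  proof -
    define b where "b = inv_into S f1 (f1 a)"
    have b: "b \<in> S" "f1 b = f1 a" using that by (auto simp: b_def inv_into_into f_inv_into_f)
    have "fst (f2 b) = fst (f2 a)" using f(1)[OF b(1)] f(1)[OF that] b(2) by simp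
    moreover have "snd (f2 b) = snd (f2 a)"
      using f(2)[OF b(1) that] f(2)[OF that b(1)] b(2) by simp
    ultimately show ?thesis by (simp add: \<tau>_def b_def[symmetric] prod_eq_iff)
  qed
  have "row_mono le_rows le_rows (f1 ` S) \<tau>"
  proof (rule row_monoI)
    fix p q assume "p \<in> f1 ` S" "q \<in> f1 ` S" and pq: "fst p = fst q" "(snd p, snd q) \<in> le_rel" "snd p \<noteq> snd q"
    then obtain a b where "a \<in> S" "p = f1 a" "b \<in> S" "q = f1 b" by blast
    moreover from this have "snd (f2 a) < snd (f2 b)" using pq f(2)[of a b] by simp
    ultimately show "(snd (\<tau> p), snd (\<tau> q)) \<in> le_rel \<and> snd (\<tau> p) \<noteq> snd (\<tau> q)" using \<tau> by simp
  qed (use \<tau> f(1) in auto)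
  hence "tp_eq {} (f1 ` S \<times> {..<m}) e (e \<circ> lift \<tau>)" by (rule e_ind)
  hence "tp_eq {} (S \<times> {..<m}) (e \<circ> lift f1) (e \<circ> lift \<tau> \<circ> lift f1)"
    by (rule tp_eq_reindex) (rule lift_times, simp)
  moreover have "tp_eq {} (S \<times> {..<m}) (e \<circ> lift \<tau> \<circ> lift f1) (e \<circ> lift f2)"
    by (rule tp_eq_agree) (use \<tau> e_env in \<open>auto intro!: envs_comp\<close>)
  ultimately show ?thesis by (rule tp_eq_trans)
qed

text \<open>
  The blocks \<open>f i ` X\<close> of positions follow each other in every row they meet, and each of them has the same
  shape: \<open>ro x\<close> is the row of the position \<open>f i x\<close>, and \<open>lt\<close> is the order within a row.
\<close>

definition row_blocks :: "('x \<Rightarrow> nat) \<Rightarrow> ('x \<Rightarrow> 'x \<Rightarrow> bool) \<Rightarrow> nat set \<Rightarrow> 'x set \<Rightarrow> (nat \<Rightarrow> 'x \<Rightarrow> nat \<times> rat) \<Rightarrow> bool" where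
  "row_blocks ro lt S X f \<longleftrightarrow> (\<forall>i\<in>S. \<forall>x\<in>X. fst (f i x) = ro x) \<and>
     (\<forall>i\<in>S. \<forall>j\<in>S. i < j \<longrightarrow> (\<forall>x\<in>X. \<forall>y\<in>X. ro x = ro y \<longrightarrow> snd (f i x) < snd (f j y))) \<and>
     (\<forall>i\<in>S. \<forall>x\<in>X. \<forall>y\<in>X. ro x = ro y \<longrightarrow> (snd (f i x) < snd (f i y) \<longleftrightarrow> lt x y))"

lemma row_blocksI:
  assumes "\<And>i x. i \<in> S \<Longrightarrow> x \<in> X \<Longrightarrow> fst (f i x) = ro x"
    "\<And>i j x y. i \<in> S \<Longrightarrow> j \<in> S \<Longrightarrow> i < j \<Longrightarrow> x \<in> X \<Longrightarrow> y \<in> X \<Longrightarrow> ro x = ro y \<Longrightarrow> snd (f i x) < snd (f j y)"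
    "\<And>i x y. i \<in> S \<Longrightarrow> x \<in> X \<Longrightarrow> y \<in> X \<Longrightarrow> ro x = ro y \<Longrightarrow> snd (f i x) < snd (f i y) \<longleftrightarrow> lt x y"
  shows "row_blocks ro lt S X f"
  using assms unfolding row_blocks_def by blast

lemma row_blocksD:
  assumes "row_blocks ro lt S X f" "i \<in> S" "x \<in> X"
  shows "fst (f i x) = ro x"
    "j \<in> S \<Longrightarrow> y \<in> X \<Longrightarrow> ro x = ro y \<Longrightarrow> snd (f i x) < snd (f j y) \<longleftrightarrow> i < j \<or> (i = j \<and> lt x y)"
  using assms less_asym unfolding row_blocks_def by (blast, metis linorder_neqE_nat)

lemma tp_eq_row_blocks:
  assumes s: "copy_on D s" "\<And>i x. i \<in> S \<Longrightarrow> x \<in> X \<Longrightarrow> f i x \<in> D" and f: "row_blocks ro lt S X f"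
    and f': "row_blocks ro lt UNIV X f'" and \<tau>: "strict_mono_on S \<tau>"
  shows "tp_eq {} (S \<times> X \<times> {..<m}) (\<lambda>(i, x, c). s (f i x, c)) (\<lambda>(i, x, c). e (f' (\<tau> i) x, c))"
proof -
  define g where "g z = f (fst z) (snd z)" for z
  define g' where "g' z = f' (\<tau> (fst z)) (snd z)" for z
  define assoc where "assoc y = ((fst y, fst (snd y)), snd (snd y))" for y :: "nat \<times> 'a \<times> nat"
  have "tp_eq {} ((S \<times> X) \<times> {..<m}) (s \<circ> lift g) (e \<circ> lift g)"
    by (rule tp_eq_reindex[of _ "D \<times> {..<m}"]) (use s in \<open>auto simp: copy_on_def g_def\<close>)
  moreover have "tp_eq {} ((S \<times> X) \<times> {..<m}) (e \<circ> lift g) (e \<circ> lift g')"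
  proof (rule tp_eq_same_row_order)
    show row: "fst (g a) = fst (g' a)" if "a \<in> S \<times> X" for a
      using row_blocksD(1)[OF f] row_blocksD(1)[OF f'] that by (auto simp: g_def g'_def)
    fix a b assume a: "a \<in> S \<times> X" and b: "b \<in> S \<times> X" and "fst (g a) = fst (g b)"
    hence "ro (snd a) = ro (snd b)" using row_blocksD(1)[OF f] by (auto simp: g_def)
    moreover have "fst a < fst b \<longleftrightarrow> \<tau> (fst a) < \<tau> (fst b)" "fst a = fst b \<longleftrightarrow> \<tau> (fst a) = \<tau> (fst b)"
      using strict_mono_on_less[OF \<tau>] strict_mono_on_eq[OF \<tau>] a b by auto
    ultimately show "snd (g a) < snd (g b) \<longleftrightarrow> snd (g' a) < snd (g' b)"
      using row_blocksD(2)[OF f] row_blocksD(2)[OF f'] a b by (auto simp: g_def g'_def)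
  qed
  ultimately have "tp_eq {} (S \<times> X \<times> {..<m}) (s \<circ> lift g \<circ> assoc) (e \<circ> lift g' \<circ> assoc)"
    by (intro tp_eq_reindex[OF tp_eq_trans]) (auto simp: assoc_def)
  moreover have "s \<circ> lift g \<circ> assoc = (\<lambda>(i, x, c). s (f i x, c))" "e \<circ> lift g' \<circ> assoc = (\<lambda>(i, x, c). e (f' (\<tau> i) x, c))"
    by (auto simp: g_def g'_def assoc_def)
  ultimately show ?thesis by simp
qed

definition alternation_bound ::
    "('x \<Rightarrow> nat) \<Rightarrow> ('x \<Rightarrow> 'x \<Rightarrow> bool) \<Rightarrow> 'x set \<Rightarrow> (('x \<times> nat + 'p \<Rightarrow> 'm) \<Rightarrow> bool) \<Rightarrow> nat \<Rightarrow> bool" where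
  "alternation_bound ro lt X \<theta> b \<longleftrightarrow> (\<forall>N\<ge>b. \<forall>D s f. \<forall>c\<in>envs. copy_on D s \<and> row_blocks ro lt {..<2 * N} X f \<and>
     (\<forall>i<2 * N. \<forall>x\<in>X. f i x \<in> D) \<longrightarrow> \<not> alternates N (\<lambda>i. \<theta> (case_sum (\<lambda>(x, l). s (f i x, l)) c)))"

lemma alternation_boundD:
  assumes "alternation_bound ro lt X \<theta> b" "b \<le> N" "copy_on D s" "row_blocks ro lt {..<2 * N} X f"
    "\<And>i x. i < 2 * N \<Longrightarrow> x \<in> X \<Longrightarrow> f i x \<in> D" "c \<in> envs"
  shows "\<not> alternates N (\<lambda>i. \<theta> (case_sum (\<lambda>(x, l). s (f i x, l)) c))"
  using assms unfolding alternation_bound_def by blast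

theorem ex_alternation_bound:
  fixes \<theta> :: "('x \<times> nat + 'p \<Rightarrow> 'm) \<Rightarrow> bool"
  assumes X: "finite X" and \<theta>: "definable {} (Inl ` (X \<times> {..<m}) \<union> Inr ` Ps) \<theta>" and f: "row_blocks ro lt UNIV X f"
  shows "\<exists>b. alternation_bound ro lt X \<theta> b"
proof -
  define w where "w = (\<lambda>(i, x, c). e (f i x, c))"
  have e: "copy_on UNIV e" by (simp add: copy_on_def e_env tp_eq_refl)
  have "\<exists>b. \<forall>N\<ge>b. \<forall>w'\<in>envs. \<forall>c\<in>envs. tp_eq {} ({..<2 * N} \<times> X \<times> {..<m}) w' w \<longrightarrow>
    \<not> alternates N (\<lambda>i. \<theta> (case_sum (\<lambda>x. w' (i, x)) c))"
  proof (rule nip_bounded_alternation[OF _ _ \<theta>])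
    show "w \<in> envs" by (rule envsI) (simp add: w_def envsD[OF e_env] split: prod.splits)
    show "finite (X \<times> {..<m})" using X by simp
    fix S and \<tau> :: "nat \<Rightarrow> nat" assume "strict_mono_on S \<tau>"
    moreover have "row_blocks ro lt S X f" using f by (simp add: row_blocks_def)
    moreover have "w \<circ> map_prod \<tau> id = (\<lambda>(i, x, c). e (f (\<tau> i) x, c))" by (auto simp: w_def)
    ultimately show "tp_eq {} (S \<times> X \<times> {..<m}) w (w \<circ> map_prod \<tau> id)"
      using tp_eq_row_blocks[OF e _ _ f] unfolding w_def by auto
  qed
  then obtain b where b: "\<And>N w' c. b \<le> N \<Longrightarrow> w' \<in> envs \<Longrightarrow> c \<in> envs \<Longrightarrow> tp_eq {} ({..<2 * N} \<times> X \<times> {..<m}) w' w \<Longrightarrow>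
    \<not> alternates N (\<lambda>i. \<theta> (case_sum (\<lambda>x. w' (i, x)) c))" by blast
  have "\<not> alternates N (\<lambda>i. \<theta> (case_sum (\<lambda>(x, l). s (f' i x, l)) c))"
    if "b \<le> N" "c \<in> envs" "copy_on D s" "row_blocks ro lt {..<2 * N} X f'" "\<forall>i<2 * N. \<forall>x\<in>X. f' i x \<in> D" for N D s f' c
  proof -
    have "tp_eq {} ({..<2 * N} \<times> X \<times> {..<m}) (\<lambda>(i, x, c). s (f' i x, c)) w"
      unfolding w_def using tp_eq_row_blocks[OF that(3) _ that(4) f, of id] that(5)
      by (simp add: strict_mono_on_def)
    moreover have "(\<lambda>(i, x, c). s (f' i x, c)) \<in> envs"
      using envsD[OF copy_on_env[OF that(3)]] by (intro envsI) (simp split: prod.splits)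
    moreover have "(\<lambda>x. (case (i, x) of (i, x, c) \<Rightarrow> s (f' i x, c))) = (\<lambda>(x, l). s (f' i x, l))" for i
      by auto
    ultimately show ?thesis using b[OF that(1) _ that(2), of "\<lambda>(i, x, c). s (f' i x, c)"] by simp
  qed
  thus ?thesis unfolding alternation_bound_def by blast
qed

end

subsection \<open>Removing a row\<close>

lemma ex_separated_blocks:
  fixes u g :: rat and n :: nat
  assumes "u < g"
  shows "\<exists>r h. 0 < h \<and> (\<forall>t t'. t < t' \<longrightarrow> r t + h < r t' - h) \<and> (\<forall>t<n. u < r t - h \<and> r t + h < g)"
proof -
  define s where "s = (g - u) / (of_nat n + 1)"
  define r where "r t = u + (of_nat t + 1 / 2) * s" for t :: nat
  have n: "(of_nat n + 1 :: rat) > 0" by (simp add: add_nonneg_pos)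
  have s: "0 < s" "s * (of_nat n + 1) = g - u" unfolding s_def using assms n by auto
  have "r t + s / 4 < r t' - s / 4" if "t < t'" for t t'
  proof -
    have "of_nat t + 1 \<le> (of_nat t' :: rat)" using that by (metis Suc_leI add.commute of_nat_Suc of_nat_mono)
    hence "(of_nat t + 1 + 1 / 2) * s \<le> (of_nat t' + 1 / 2) * s" using s(1) by (intro mult_right_mono) auto
    thus ?thesis unfolding r_def using s(1) by (simp add: algebra_simps)
  qed
  moreover have "u < r t - s / 4 \<and> r t + s / 4 < g" if "t < n" for t
  proof -
    have "of_nat t + 1 \<le> (of_nat n :: rat)" using that by (metis Suc_leI add.commute of_nat_Suc of_nat_mono)
    hence "(of_nat t + 1) * s \<le> of_nat n * s" using s(1) by (intro mult_right_mono) auto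
    moreover have "0 \<le> of_nat t * s" using s(1) by simp
    moreover have "r t = u + of_nat t * s + s / 2" "(of_nat t + 1) * s = of_nat t * s + s"
      "g = u + of_nat n * s + s"
      using s(2) by (simp_all add: r_def algebra_simps)
    ultimately show ?thesis using s(1) by linarith
  qed
  ultimately show ?thesis using s(1) by (intro exI[of _ r] exI[of _ "s / 4"]) auto
qed

lemma ex_increasing_fibre:
  fixes \<kappa> :: "nat \<Rightarrow> nat"
  assumes "M * B < N" "\<And>s. s < N \<Longrightarrow> \<kappa> s < M"
  shows "\<exists>k<M. \<exists>\<iota>. strict_mono_on {..<B} \<iota> \<and> (\<forall>a<B. \<iota> a < N \<and> \<kappa> (\<iota> a) = k)"
proof -
  have "0 < M" using assms(2)[of 0] assms(1) by auto
  hence "\<exists>k\<in>{..<M}. card {..<N} \<le> card (\<kappa> -` {k} \<inter> {..<N}) * card {..<M}"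
    by (intro pigeonhole_card) (use assms(2) in auto)
  then obtain k where k: "k < M" "N \<le> card (\<kappa> -` {k} \<inter> {..<N}) * M" by auto
  define T where "T = \<kappa> -` {k} \<inter> {..<N}"
  have "M * B < M * card T" using less_le_trans[OF assms(1) k(2)] by (simp only: T_def mult.commute)
  hence B: "B \<le> card T" by (meson less_or_eq_imp_le nat_mult_less_cancel_disj)
  define \<iota> where "\<iota> a = sorted_list_of_set T ! a" for a
  have "\<iota> a \<in> T" if "a < B" for a
    using nth_mem[of a "sorted_list_of_set T"] B that by (simp add: \<iota>_def T_def)
  moreover have "strict_mono_on {..<B} \<iota>"
    using sorted_wrt_nth_less[OF strict_sorted_list_of_set[of T]] less_le_trans[OF _ B]
    by (intro strict_mono_onI) (simp add: \<iota>_def)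
  ultimately show ?thesis using k(1) by (intro exI[of _ k] conjI exI[of _ \<iota>]) (auto simp: T_def)
qed

lemma strict_mono_on_interleave:
  fixes \<iota> :: "nat \<Rightarrow> nat"
  assumes "strict_mono_on {..<B} \<iota>"
  shows "strict_mono_on {..<2 * B} (\<lambda>i. 2 * \<iota> (i div 2) + i mod 2)"
proof (rule strict_mono_onI)
  fix i i' :: nat assume i: "i \<in> {..<2 * B}" "i' \<in> {..<2 * B}" "i < i'"
  show "2 * \<iota> (i div 2) + i mod 2 < 2 * \<iota> (i' div 2) + i' mod 2"
  proof (cases "i div 2 = i' div 2")
    case True
    hence "i mod 2 < i' mod 2" using i(3) div_mult_mod_eq[of i 2] div_mult_mod_eq[of i' 2] by linarith
    thus ?thesis by (simp add: True)
  next
    case False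
    hence "i div 2 < i' div 2" using div_le_mono[of i i' 2] i(3) by simp
    hence "\<iota> (i div 2) < \<iota> (i' div 2)" using strict_mono_onD[OF assms] i(2) by simp
    moreover have "i mod 2 < 2" by simp
    ultimately show ?thesis by linarith
  qed
qed

locale row_removal = ref_array L U kb e m
  for L :: "('f, 'r) lang" and U :: "('f, 'r, 'm) struct" and kb :: "'k rel"
    and e :: "(nat \<times> rat) \<times> nat \<Rightarrow> 'm" and m :: nat +
  fixes M :: nat and p d \<epsilon> :: rat and D :: "(nat \<times> rat) set" and X :: "rat set"
    and K :: "(nat \<times> rat) \<times> nat \<Rightarrow> 'm" and C :: "(nat \<times> rat) set" and b :: rat and n :: nat
  assumes gap: "has_gap (Suc M) p d \<epsilon> D" and X: "finite X" "X \<subseteq> {-1..1} - {0}"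
    and K: "copy_on D K" "\<And>k. k < Suc M \<Longrightarrow> copy_on (D \<union> {k} \<times> affine p d ` X) K"
    and C: "C \<subseteq> D" and b: "d < b" "b \<le> d + \<epsilon>"
    and C_far: "\<And>k q. (k, q) \<in> C \<Longrightarrow> k < Suc M \<Longrightarrow> b \<le> \<bar>q - p\<bar>"
begin

abbreviation frame :: "(nat \<times> rat) set" where "frame \<equiv> C \<union> {..<Suc M} \<times> affine p d ` X"

definition width :: rat where "width = b / (2 * (of_nat n + 1))"

definition center :: "nat \<Rightarrow> rat" where "center j = p - b + 4 * width * of_nat j"

definition outside :: "(nat \<times> rat) set" where
  "outside = C \<union> {(k, q). k < M \<and> \<bar>q - p\<bar> < b \<and> (\<forall>j\<in>{1..n}. width < \<bar>q - center j\<bar>)}"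

definition centers :: "nat \<Rightarrow> (nat \<times> rat) set" where "centers j = {..<M} \<times> center ` {1..j}"

abbreviation window :: "nat \<Rightarrow> rat set" where "window j \<equiv> affine (center (Suc j)) width ` X"

definition radius :: "nat \<Rightarrow> rat" where "radius j = (Min (insert 1 (abs ` X)) / 2) ^ j * d"

definition nested :: "nat \<Rightarrow> (nat \<times> rat) set" where "nested j = {M} \<times> affine p (radius j) ` X"

definition nested_upto :: "nat \<Rightarrow> (nat \<times> rat) set" where "nested_upto j = (\<Union>i\<in>{1..j}. nested i)"

definition shrink :: "nat \<Rightarrow> nat \<times> rat \<Rightarrow> nat \<times> rat" where
  "shrink j = rescale C p d (\<lambda>k. if k < M then center (Suc j) else p) (\<lambda>k. if k < M then width else radius (Suc j))"

lemma d_pos: "0 < d" using gap by (simp add: has_gap_def)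

lemma b_pos: "0 < b" using b(1) d_pos by simp

lemma width_pos: "0 < width" unfolding width_def using b_pos by (intro divide_pos_pos mult_pos_pos) auto

lemma X_abs: "x \<in> X \<Longrightarrow> \<bar>x\<bar> \<le> 1" using X(2) by (auto simp: abs_le_iff)

lemma center_0: "center 0 = p - b" by (simp add: center_def)

lemma center_Suc: "center (Suc j) = center j + 4 * width" by (simp add: center_def algebra_simps)

lemma center_mono: "i \<le> j \<Longrightarrow> center i \<le> center j" using width_pos by (simp add: center_def)

lemma center_less: "i < j \<Longrightarrow> center i + 4 * width \<le> center j"
  using center_mono[of "Suc i" j] center_Suc[of i] by simp

lemma center_last: "center (Suc n) = p + b"
proof -
  have "(of_nat n + 1 :: rat) \<noteq> 0" by (metis of_nat_Suc of_nat_neq_0 add.commute)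
  hence "4 * width * (of_nat n + 1) = 2 * b" by (simp add: width_def field_simps)
  thus ?thesis by (simp add: center_def algebra_simps)
qed

lemma center_lower: "p - b \<le> center j" using center_mono[of 0 j] center_0 by simp

lemma center_upper: "j \<le> n \<Longrightarrow> center j + 4 * width \<le> p + b" using center_less[of j "Suc n"] center_last by simp

lemma center_bound: "1 \<le> j \<Longrightarrow> j \<le> n \<Longrightarrow> \<bar>center j - p\<bar> + width < b"
  using center_upper[of j] center_less[of 0 j] center_0 width_pos by (auto simp: abs_if)

lemma C_subset_outside: "C \<subseteq> outside" by (auto simp: outside_def)

lemma outside_between:
  assumes "k < M" "j \<le> n" "center j + width < q" "q < center (Suc j) - width"
  shows "(k, q) \<in> outside"
proof -
  have "p - b < q" using center_lower[of j] assms(3) width_pos by simp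
  moreover have "q < p + b" using center_upper[OF assms(2)] center_Suc[of j] assms(4) width_pos by simp
  moreover have "width < \<bar>q - center i\<bar>" if "i \<in> {1..n}" for i
  proof (cases "i \<le> j")
    case True
    thus ?thesis using center_mono[of i j] assms(3) by (simp add: abs_if)
  next
    case False
    thus ?thesis using center_mono[of "Suc j" i] assms(4) by (simp add: abs_if)
  qed
  ultimately show ?thesis using assms(1) by (auto simp: outside_def abs_if)
qed

lemma not_outside_near_center:
  assumes j: "j \<in> {1..n}" "\<bar>q - center j\<bar> \<le> width" "k < M"
  shows "(k, q) \<notin> outside"
proof
  assume "(k, q) \<in> outside"
  hence "(k, q) \<in> C" using j by (force simp: outside_def)
  hence "b \<le> \<bar>q - p\<bar>" using C_far j(3) by simp
  moreover have "\<bar>q - p\<bar> \<le> \<bar>q - center j\<bar> + \<bar>center j - p\<bar>" by simp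
  ultimately show False using center_bound[of j] j by auto
qed

lemma outside_not_C: "(k, q) \<in> outside \<Longrightarrow> (k, q) \<notin> C \<Longrightarrow> k < M \<and> \<bar>q - p\<bar> < b"
  by (auto simp: outside_def)

lemma centers_Suc: "centers (Suc j) = centers j \<union> {..<M} \<times> {center (Suc j)}"
  unfolding centers_def by (auto simp: atLeastAtMostSuc_conv)

lemma centers_far:
  assumes "(k, q) \<in> centers j"
  shows "2 * width < \<bar>q - center (Suc j)\<bar>"
proof -
  obtain i where "i \<le> j" "q = center i" using assms by (auto simp: centers_def)
  thus ?thesis using center_less[of i "Suc j"] width_pos by (simp add: abs_if)
qed

lemma window_bound: "q \<in> window j \<Longrightarrow> \<bar>q - center (Suc j)\<bar> \<le> width"
  using affine_bound[OF width_pos] X_abs by auto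

lemma radius_pos: "0 < radius j"
  and radius_le: "radius j \<le> d"
  and radius_antimono: "i \<le> j \<Longrightarrow> radius j \<le> radius i"
  and radius_Suc_less: "x \<in> X \<Longrightarrow> radius (Suc j) < radius j * \<bar>x\<bar>"
proof -
  define \<mu> where "\<mu> = Min (insert 1 (abs ` X)) / 2"
  have radius: "radius j = \<mu> ^ j * d" for j by (simp add: radius_def \<mu>_def)
  have "0 < Min (insert 1 (abs ` X))" using X by (subst Min_gr_iff) auto
  moreover have "Min (insert 1 (abs ` X)) \<le> 1" using X(1) by (intro Min_le) auto
  ultimately have \<mu>: "0 < \<mu>" "\<mu> < 1" by (auto simp: \<mu>_def)
  show pos: "0 < radius j" for j using \<mu>(1) d_pos by (simp add: radius)
  show "radius j \<le> d" using \<mu> d_pos by (simp add: radius power_le_one mult_le_cancel_right1)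
  show "i \<le> j \<Longrightarrow> radius j \<le> radius i"
    unfolding radius using \<mu> d_pos by (intro mult_right_mono power_decreasing) auto
  assume x: "x \<in> X"
  have "Min (insert 1 (abs ` X)) \<le> \<bar>x\<bar>" using x X(1) by (intro Min_le) auto
  hence "\<mu> < \<bar>x\<bar>" using \<mu>(1) by (simp add: \<mu>_def)
  thus "radius (Suc j) < radius j * \<bar>x\<bar>"
    using mult_strict_left_mono[OF _ pos, of \<mu> "\<bar>x\<bar>" j] by (simp add: radius mult_ac)
qed

lemma nested_bound:
  assumes "(k, q) \<in> nested i" "i \<le> j"
  shows "k = M" "radius (Suc j) < \<bar>q - p\<bar>" "\<bar>q - p\<bar> \<le> d"
proof -
  obtain x where x: "k = M" "x \<in> X" "q = affine p (radius i) x" using assms(1) by (auto simp: nested_def)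
  show "k = M" by (rule x(1))
  have "\<bar>q - p\<bar> = radius i * \<bar>x\<bar>" using radius_pos[of i] by (simp add: x(3) affine_def abs_mult)
  thus "radius (Suc j) < \<bar>q - p\<bar>" "\<bar>q - p\<bar> \<le> d"
    using radius_Suc_less[OF x(2), of i] radius_antimono[of "Suc i" "Suc j"] assms(2)
      affine_bound[OF radius_pos X_abs[OF x(2)], of p i] radius_le[of i] by (auto simp: x(3))
qed

lemma nested_upto_Suc: "nested_upto (Suc j) = nested_upto j \<union> nested (Suc j)"
  unfolding nested_upto_def by (auto simp: atLeastAtMostSuc_conv)

lemma nested_upto_bound:
  assumes "(k, q) \<in> nested_upto j"
  shows "k = M" "radius (Suc j) < \<bar>q - p\<bar>" "\<bar>q - p\<bar> \<le> d"
  using assms nested_bound[of k q] unfolding nested_upto_def by auto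

lemma affine_X_not_C:
  assumes x: "x \<in> insert 0 X" and k: "k < Suc M"
  shows "(k, affine p d x) \<notin> C"
proof
  assume "(k, affine p d x) \<in> C"
  hence "b \<le> \<bar>affine p d x - p\<bar>" using k by (intro C_far)
  moreover have "\<bar>affine p d x - p\<bar> \<le> d" using affine_bound[OF d_pos, of x p] x X_abs[of x] by auto
  ultimately show False using b(1) by simp
qed

lemma M_p_not_C: "(M, p) \<notin> C"
  using affine_X_not_C[of 0 M] by simp

lemma shrink_C: "q \<in> C \<Longrightarrow> shrink j q = q" by (simp add: shrink_def rescale_fixed)

lemma shrink_affine:
  "x \<in> insert 0 X \<Longrightarrow> k < M \<Longrightarrow> shrink j (k, affine p d x) = (k, affine (center (Suc j)) width x)"
  "x \<in> insert 0 X \<Longrightarrow> shrink j (M, affine p d x) = (M, affine p (radius (Suc j)) x)"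
  using rescale_affine[OF d_pos affine_X_not_C] by (simp_all add: shrink_def)

lemma shrink_center: "k < M \<Longrightarrow> shrink j (k, p) = (k, center (Suc j))" "shrink j (M, p) = (M, p)"
  using shrink_affine[of 0] by simp_all

lemma shrink_frame:
  assumes "q \<in> frame"
  shows "shrink j q \<in> C \<union> {..<M} \<times> window j \<union> nested (Suc j)"
proof (cases "q \<in> C")
  case False
  then obtain k x where q: "q = (k, affine p d x)" "x \<in> X" "k < M \<or> k = M" using assms by (auto simp: less_Suc_eq)
  thus ?thesis using shrink_affine(1)[of x k j] shrink_affine(2)[of x j] by (auto simp: nested_def)
qed (simp add: shrink_C)

lemma row_mono_shrink:
  assumes "j < n"
  shows "row_mono le_rows le_rows (C \<union> {..<Suc M} \<times> affine p d ` insert 0 X) (shrink j)"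
  unfolding shrink_def
proof (rule row_mono_rescale)
  fix k q x assume q: "(k, q) \<in> C" "k \<in> {..<Suc M}" and "x \<in> insert 0 X"
  hence x: "\<bar>x\<bar> \<le> 1" using X_abs by auto
  let ?c = "if k < M then center (Suc j) else p" and ?d = "if k < M then width else radius (Suc j)"
  have "b \<le> \<bar>q - p\<bar>" using C_far[OF q(1)] q(2) by simp
  moreover have "\<bar>affine p d x - p\<bar> < b" using affine_bound[OF d_pos x, of p] b(1) by simp
  moreover have "\<bar>affine ?c ?d x - p\<bar> < b"
    using affine_bound[OF radius_pos x, of p "Suc j"] radius_le[of "Suc j"] b(1)
      affine_bound[OF width_pos x, of "center (Suc j)"] center_bound[of "Suc j"] assms by auto
  ultimately show "(q < affine p d x \<longrightarrow> q < affine ?c ?d x) \<and> (affine p d x < q \<longrightarrow> affine ?c ?d x < q)"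
    by (auto simp: abs_if split: if_splits)
qed (use d_pos width_pos radius_pos in auto)

lemma window_fresh:
  assumes "j < n" "k < M" "q \<in> window j"
  shows "(k, q) \<notin> outside \<union> nested_upto j \<union> centers j"
  using not_outside_near_center[OF _ window_bound[OF assms(3)] assms(2)] assms(1,2) window_bound[OF assms(3)]
    centers_far[of k q j] nested_upto_bound(1)[of k q j] width_pos by auto

lemma nested_fresh:
  assumes "q \<in> nested (Suc j)"
  shows "q \<notin> outside \<union> nested_upto j \<union> centers j"
proof -
  obtain x where x: "q = (M, affine p (radius (Suc j)) x)" "x \<in> X" using assms by (auto simp: nested_def)
  have bound: "\<bar>affine p (radius (Suc j)) x - p\<bar> \<le> radius (Suc j)" by (rule affine_bound[OF radius_pos X_abs[OF x(2)]])
  hence "q \<notin> C" using C_far radius_le[of "Suc j"] b(1) by (fastforce simp: x(1))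
  hence "q \<notin> outside" using outside_not_C by (auto simp: x(1))
  moreover have "q \<notin> nested_upto j" using nested_upto_bound(2) bound by (fastforce simp: x(1))
  ultimately show ?thesis by (auto simp: x(1) centers_def)
qed

end

text \<open>
  Between the windows about the centers \<^term>\<open>j\<close> and \<^term>\<open>Suc j\<close> no position of \<open>V0\<close> lies in the interval from
  \<open>u\<close> to the second window. It contains \<open>2 * N\<close> disjoint blocks of radius \<open>h\<close> about the points \<open>r t\<close>.
\<close>

locale free_blocks = row_removal L U kb e m M p d \<epsilon> D X K C b n
  for L :: "('f, 'r) lang" and U :: "('f, 'r, 'm) struct" and kb :: "'k rel"
    and e :: "(nat \<times> rat) \<times> nat \<Rightarrow> 'm" and m M and p d \<epsilon> and D X K C and b and n +
  fixes j :: nat and Z :: "(nat \<times> rat) \<times> nat \<Rightarrow> 'm" and V0 :: "(nat \<times> rat) set"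
    and \<theta> :: "nat \<Rightarrow> ((nat \<times> rat) \<times> nat \<Rightarrow> 'm) \<Rightarrow> bool" and u h :: rat and r :: "nat \<Rightarrow> rat" and N :: nat
  assumes Z: "copy_on (outside \<union> nested_upto j) Z" "copy_on (outside \<union> centers j) Z" and j: "j < n"
    and V0: "V0 \<subseteq> outside"
    and \<theta>: "\<And>k. k < M \<Longrightarrow> definable {} ((V0 \<union> centers j \<union> {k} \<times> window j) \<times> {..<m}) (\<theta> k)"
      "\<And>k. k < M \<Longrightarrow> \<theta> k e"
    and slot: "center j + width \<le> u"
      "\<And>k q. (k, q) \<in> V0 \<Longrightarrow> k < M \<Longrightarrow> q < center (Suc j) - width \<Longrightarrow> q \<le> u"
    and blocks: "0 < h" "\<And>t t'. t < t' \<Longrightarrow> r t + h < r t' - h"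
      "\<And>t. t < 2 * N \<Longrightarrow> u < r t - h \<and> r t + h < center (Suc j) - width"
begin

abbreviation block :: "nat \<Rightarrow> rat set" where "block t \<equiv> affine (r t) h ` X"

definition even_blocks :: "(nat \<times> rat) set" where
  "even_blocks = C \<union> V0 \<union> nested_upto j \<union> {..<M} \<times> (\<Union>t<N. block (2 * t))"

definition with_odd_blocks :: "nat \<Rightarrow> (nat \<Rightarrow> nat) \<Rightarrow> (nat \<times> rat) set" where
  "with_odd_blocks t \<kappa> = even_blocks \<union> (\<Union>s<t. {\<kappa> s} \<times> block (2 * s + 1))"

definition split_window :: "nat \<Rightarrow> (nat \<times> rat) \<times> nat \<Rightarrow> rat \<times> nat + (nat \<times> rat) \<times> nat" where
  "split_window k v =
    (if fst v \<in> {k} \<times> window j then Inl ((snd (fst v) - center (Suc j)) / width, snd v) else Inr v)"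

definition put :: "((nat \<times> rat) \<times> nat \<Rightarrow> 'm) \<Rightarrow> nat \<Rightarrow> nat \<Rightarrow> (nat \<times> rat) \<times> nat \<Rightarrow> 'm" where
  "put W k t = case_sum (\<lambda>(x, l). W ((k, affine (r t) h x), l)) Z \<circ> split_window k"

definition new_center :: "nat \<Rightarrow> nat \<Rightarrow> rat" where "new_center t k = (if k < M then r t else p)"

definition new_radius :: "nat \<Rightarrow> rat" where "new_radius k = (if k < M then h else radius (Suc j))"

definition inserted :: "nat \<Rightarrow> (nat \<times> rat) set \<Rightarrow> ((nat \<times> rat) \<times> nat \<Rightarrow> 'm) \<Rightarrow> ((nat \<times> rat) \<times> nat \<Rightarrow> 'm) \<Rightarrow> bool" where
  "inserted t S W K' \<longleftrightarrow> K' \<in> envs \<and> agree S K' W \<and>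
     (\<forall>k<Suc M. copy_on (S \<union> {k} \<times> affine (new_center t k) (new_radius k) ` X) K') \<and>
     tp_eq {} (frame \<times> {..<m}) (K' \<circ> lift (rescale C p d (new_center t) new_radius)) K"

definition solution :: "((nat \<times> rat) \<times> nat \<Rightarrow> 'm) \<Rightarrow> bool" where
  "solution z \<longleftrightarrow> z \<in> envs \<and> agree (outside \<union> nested_upto j \<union> centers j) z Z \<and>
     copy_on (V0 \<union> nested_upto (Suc j)) z \<and> tp_eq {} (frame \<times> {..<m}) (z \<circ> lift (shrink j)) K \<and> (\<forall>k<M. \<theta> k z)"

lemma Z_env: "Z \<in> envs" by (rule copy_on_env[OF Z(1)])

lemma block_bound: "q \<in> block t \<Longrightarrow> \<bar>q - r t\<bar> \<le> h"
  using affine_bound[OF blocks(1)] X_abs by auto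

lemma slot_outside: "k < M \<Longrightarrow> u < q \<Longrightarrow> q < center (Suc j) - width \<Longrightarrow> (k, q) \<in> outside"
  using outside_between[of k j q] j slot(1) by simp

lemma slot_near: "u < q \<Longrightarrow> q < center (Suc j) - width \<Longrightarrow> \<bar>q - p\<bar> < b"
  using center_lower[of j] center_upper[of j] center_Suc[of j] slot(1) j width_pos by (auto simp: abs_if)

lemma near_block: "t < 2 * N \<Longrightarrow> \<bar>q - r t\<bar> \<le> h \<Longrightarrow> u < q \<and> q < center (Suc j) - width"
  using blocks(3)[of t] by (auto simp: abs_le_iff)

lemma block_in_slot: "q \<in> block t \<Longrightarrow> t < 2 * N \<Longrightarrow> u < q \<and> q < center (Suc j) - width"
  using near_block block_bound by blast

lemma blocks_disjoint: "q \<in> block t \<Longrightarrow> t \<noteq> t' \<Longrightarrow> \<not> \<bar>q - r t'\<bar> \<le> h"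
  using block_bound[of q t] blocks(2)[of t t'] blocks(2)[of t' t]
  by (cases "t < t'") (auto simp: abs_le_iff)

lemma even_blocks_subset: "even_blocks \<subseteq> outside \<union> nested_upto j"
proof -
  have "(k, q) \<in> outside" if "k < M" "t < N" "q \<in> block (2 * t)" for k t q
    using slot_outside[OF that(1)] block_in_slot[OF that(3)] that(2) by simp
  thus ?thesis using V0 C_subset_outside unfolding even_blocks_def by blast
qed

lemma put_env: "W \<in> envs \<Longrightarrow> put W k t \<in> envs"
  unfolding put_def using Z_env envsD by (intro envs_comp envs_case_sum envsI) (auto split: prod.splits)

lemma put_window: "x \<in> X \<Longrightarrow> put W k t ((k, affine (center (Suc j)) width x), c) = W ((k, affine (r t) h x), c)"
  by (simp add: put_def split_window_def affine_inv[OF width_pos])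

lemma put_outside: "q \<notin> {k} \<times> window j \<Longrightarrow> put W k t (q, c) = Z (q, c)"
  by (simp add: put_def split_window_def)

lemma put_cong:
  assumes "k < M" "W \<in> envs" "W' \<in> envs" "agree ({k} \<times> block t) W W'"
  shows "\<theta> k (put W k t) \<longleftrightarrow> \<theta> k (put W' k t)"
proof (rule definable_agree[OF \<theta>(1)[OF assms(1)] put_env[OF assms(2)] put_env[OF assms(3)]], rule agreeI)
  fix q c assume "c < m"
  show "put W k t (q, c) = put W' k t (q, c)"
    using agreeD[OF assms(4) _ \<open>c < m\<close>] by (cases "q \<in> {k} \<times> window j") (auto simp: put_window put_outside)
qed

lemma row_mono_window_to_block:
  assumes k: "k < M" and t: "t < 2 * N"
  shows "row_mono le_rows le_rows (V0 \<union> centers j \<union> {k} \<times> window j)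
    (rescale (V0 \<union> centers j) (center (Suc j)) width (\<lambda>_. r t) (\<lambda>_. h))"
proof (rule row_mono_rescale)
  let ?P = "center (Suc j)"
  fix k' q x assume q: "(k', q) \<in> V0 \<union> centers j" "k' \<in> {k}" and x: "x \<in> X"
  have "q \<le> u \<or> ?P + width < q"
  proof (cases "(k, q) \<in> V0")
    case True
    hence "\<not> \<bar>q - ?P\<bar> \<le> width" using not_outside_near_center[of "Suc j" q k] V0 j k by auto
    thus ?thesis using slot(2)[OF True k] by (auto simp: abs_le_iff)
  next
    case False
    then obtain i where "i \<le> j" "q = center i" using q by (auto simp: centers_def)
    thus ?thesis using center_mono[of i j] slot(1) width_pos by simp
  qed
  moreover have "u < affine (r t) h x" "affine (r t) h x < ?P - width"
    using block_in_slot[OF _ t] x by auto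
  moreover have "?P - width \<le> affine ?P width x" "affine ?P width x \<le> ?P + width"
    using affine_bound[OF width_pos X_abs[OF x], of ?P] by (auto simp: abs_le_iff)
  ultimately show "(q < affine ?P width x \<longrightarrow> q < affine (r t) h x) \<and> (affine ?P width x < q \<longrightarrow> affine (r t) h x < q)"
    using width_pos by auto
qed (use width_pos blocks(1) in auto)

lemma put_Z:
  assumes k: "k < M" and t: "t < 2 * N"
  shows "\<theta> k (put Z k t)"
proof -
  let ?F = "V0 \<union> centers j" and ?P = "center (Suc j)"
  define \<tau> where "\<tau> = rescale ?F ?P width (\<lambda>_. r t) (\<lambda>_. h)"
  have window: "(k, affine ?P width x) \<notin> ?F" if "x \<in> X" for x
    using window_fresh[OF j k] V0 that by blast
  have "copy_on (?F \<union> {k} \<times> window j) (Z \<circ> lift \<tau>)"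
  proof (rule copy_on_reindex[OF Z(2) row_mono_window_to_block[OF k t, folded \<tau>_def]])
    have "\<tau> (k, affine ?P width x) \<in> outside" if "x \<in> X" for x
      using slot_outside[OF k] block_in_slot[OF _ t] that rescale_affine[OF width_pos window]
      by (auto simp: \<tau>_def)
    thus "\<tau> ` (?F \<union> {k} \<times> window j) \<subseteq> outside \<union> centers j"
      using V0 by (auto simp: \<tau>_def rescale_fixed)
  qed
  hence "\<theta> k (Z \<circ> lift \<tau>)" using copy_onD[OF _ \<theta>(1)[OF k]] \<theta>(2)[OF k] by blast
  moreover have "agree (?F \<union> {k} \<times> window j) (Z \<circ> lift \<tau>) (put Z k t)"
  proof (rule agreeI)
    fix q c assume "q \<in> ?F \<union> {k} \<times> window j"
    then consider "q \<in> ?F" "q \<notin> {k} \<times> window j" | x where "x \<in> X" "q = (k, affine ?P width x)"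
      using window by auto
    thus "(Z \<circ> lift \<tau>) (q, c) = put Z k t (q, c)"
      by cases (auto simp: \<tau>_def rescale_fixed rescale_affine[OF width_pos window] put_window put_outside)
  qed
  ultimately show ?thesis
    using definable_agree[OF \<theta>(1)[OF k] envs_comp[OF Z_env] put_env[OF Z_env]] by blast
qed

lemma with_odd_blocks_cases:
  assumes "(k, q) \<in> with_odd_blocks t \<kappa>" "\<And>s. s < t \<Longrightarrow> \<kappa> s < M" "t < N"
  obtains "(k, q) \<in> C" | "(k, q) \<in> V0" | "(k, q) \<in> nested_upto j"
    | t' where "k < M" "t' < 2 * N" "t' \<noteq> 2 * t + 1" "q \<in> block t'"
proof -
  from assms(1) consider "(k, q) \<in> C \<union> V0 \<union> nested_upto j"
    | t' where "k < M" "t' < N" "q \<in> block (2 * t')" | s where "s < t" "k = \<kappa> s" "q \<in> block (2 * s + 1)"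
    unfolding with_odd_blocks_def even_blocks_def by blast
  thus thesis
  proof cases
    case 2
    have "2 * t' \<noteq> 2 * t + 1" by presburger
    thus thesis using that(4)[of "2 * t'"] 2 by simp
  next
    case 3
    thus thesis using that(4)[of "2 * s + 1"] assms(2,3) by simp
  qed (use that(1-3) in blast)
qed

lemma with_odd_blocks_near:
  assumes "(k, q) \<in> with_odd_blocks t \<kappa> - C" "\<And>s. s < t \<Longrightarrow> \<kappa> s < M" "t < N"
  shows "k < Suc M \<and> \<bar>q - p\<bar> < b"
proof (rule with_odd_blocks_cases[OF _ assms(2,3)])
  show "(k, q) \<in> with_odd_blocks t \<kappa>" using assms(1) by simp
  assume "(k, q) \<in> V0"
  hence "k < M \<and> \<bar>q - p\<bar> < b" using outside_not_C V0 assms(1) by blast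
  thus ?thesis by simp
next
  assume "(k, q) \<in> nested_upto j"
  thus ?thesis using nested_upto_bound[of k q j] b(1) by simp
next
  fix t' assume "k < M" "t' < 2 * N" "q \<in> block t'"
  thus ?thesis using slot_near block_in_slot by (meson less_SucI)
qed (use assms(1) in auto)

lemma new_blocks_fresh:
  assumes \<kappa>: "\<And>s. s < t \<Longrightarrow> \<kappa> s < M" and t: "t < N"
    and q: "\<bar>q - new_center (2 * t + 1) k\<bar> \<le> new_radius k" and k: "k < Suc M"
  shows "(k, q) \<notin> with_odd_blocks t \<kappa>"
proof (cases "k < M")
  case True
  have near: "\<bar>q - r (2 * t + 1)\<bar> \<le> h" using q True by (simp add: new_center_def new_radius_def)
  have "u < q" "q < center (Suc j) - width" using near_block[OF _ near] t by auto
  show ?thesis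
  proof
    assume "(k, q) \<in> with_odd_blocks t \<kappa>"
    thus False
    proof (rule with_odd_blocks_cases[OF _ \<kappa> t])
      assume "(k, q) \<in> C"
      thus False using C_far[of k q] slot_near[OF \<open>u < q\<close> \<open>q < _\<close>] k by simp
    next
      assume "(k, q) \<in> V0"
      thus False using slot(2)[of k q] \<open>u < q\<close> \<open>q < _\<close> True by simp
    next
      assume "(k, q) \<in> nested_upto j"
      thus False using nested_upto_bound(1) True by auto
    next
      fix t' assume "t' \<noteq> 2 * t + 1" "q \<in> block t'"
      thus False using blocks_disjoint near by blast
    qed
  qed
next
  case False
  hence near: "\<bar>q - p\<bar> \<le> radius (Suc j)" using q by (simp add: new_center_def new_radius_def)
  show ?thesis
  proof
    assume "(k, q) \<in> with_odd_blocks t \<kappa>"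
    thus False
    proof (rule with_odd_blocks_cases[OF _ \<kappa> t])
      assume "(k, q) \<in> V0"
      hence "(k, q) \<in> C" using outside_not_C V0 False by blast
      thus False using C_far[of k q] near radius_le[of "Suc j"] b(1) k by simp
    next
      assume "(k, q) \<in> C"
      thus False using C_far[of k q] near radius_le[of "Suc j"] b(1) k by simp
    next
      assume "(k, q) \<in> nested_upto j"
      thus False using nested_upto_bound(2)[of k q j] near by simp
    next
      assume "k < M"
      thus False using \<open>\<not> k < M\<close> by simp
    qed
  qed
qed

lemma ex_inserted:
  assumes W: "copy_on (with_odd_blocks t \<kappa>) W" and \<kappa>: "\<And>s. s < t \<Longrightarrow> \<kappa> s < M" and t: "t < N"
  shows "\<exists>K'. inserted (2 * t + 1) (with_odd_blocks t \<kappa>) W K'"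
proof -
  have "\<exists>K'\<in>envs. agree (with_odd_blocks t \<kappa>) K' W \<and>
    (\<forall>k<Suc M. copy_on (with_odd_blocks t \<kappa> \<union> {k} \<times> affine (new_center (2 * t + 1) k) (new_radius k) ` X) K') \<and>
    tp_eq {} (frame \<times> {..<m}) (K' \<circ> lift (rescale C p d (new_center (2 * t + 1)) new_radius)) K"
  proof (rule gap_transfer[OF gap C _ b C_far K _ _ W])
    show "X \<subseteq> {-1..1}" using X(2) by auto
    show "C \<subseteq> with_odd_blocks t \<kappa>" by (auto simp: with_odd_blocks_def even_blocks_def)
    show "0 < new_radius k" for k using blocks(1) radius_pos by (simp add: new_radius_def)
    show "\<bar>new_center (2 * t + 1) k - p\<bar> + new_radius k < b" for k
    proof (cases "k < M")
      case True
      have "\<bar>r (2 * t + 1) - h - p\<bar> < b" "\<bar>r (2 * t + 1) + h - p\<bar> < b"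
        using near_block[of "2 * t + 1"] slot_near t blocks(1) by auto
      thus ?thesis using True blocks(1) by (auto simp: new_center_def new_radius_def abs_if split: if_splits)
    next
      case False
      thus ?thesis using radius_le[of "Suc j"] b(1) by (simp add: new_center_def new_radius_def)
    qed
  qed (use with_odd_blocks_near[OF _ \<kappa> t] new_blocks_fresh[OF \<kappa> t] in auto)
  thus ?thesis unfolding inserted_def by blast
qed

definition move_to_window :: "nat \<Rightarrow> ((nat \<times> rat) \<times> nat \<Rightarrow> 'm) \<Rightarrow> (nat \<times> rat) \<times> nat \<Rightarrow> 'm" where
  "move_to_window t K' v = (if fst v \<in> {..<M} \<times> window j then put K' (fst (fst v)) t v
     else if fst v \<in> nested (Suc j) then K' v else Z v)"

lemma move_to_window_env: "K' \<in> envs \<Longrightarrow> move_to_window t K' \<in> envs"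
  using put_env Z_env by (intro envsI) (simp add: move_to_window_def envsD)

lemma move_to_window_old: "agree (outside \<union> nested_upto j \<union> centers j) (move_to_window t K') Z"
proof (rule agreeI)
  fix q c assume q: "q \<in> outside \<union> nested_upto j \<union> centers j"
  hence "q \<notin> {..<M} \<times> window j" using window_fresh[OF j] by (cases q) blast
  moreover have "q \<notin> nested (Suc j)" using nested_fresh q by blast
  ultimately show "move_to_window t K' (q, c) = Z (q, c)" by (simp add: move_to_window_def)
qed

lemma move_to_window_put:
  assumes k: "k < M"
  shows "agree (V0 \<union> centers j \<union> {k} \<times> window j) (move_to_window t K') (put K' k t)"
proof (rule agreeI)
  fix q c assume q: "q \<in> V0 \<union> centers j \<union> {k} \<times> window j" and c: "c < m"
  show "move_to_window t K' (q, c) = put K' k t (q, c)"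
  proof (cases "q \<in> {k} \<times> window j")
    case True
    thus ?thesis using k by (auto simp: move_to_window_def)
  next
    case False
    hence "q \<in> outside \<union> nested_upto j \<union> centers j" using q V0 by blast
    thus ?thesis using agreeD[OF move_to_window_old _ c] False by (simp add: put_outside)
  qed
qed

lemma move_to_window_nested: "q \<in> nested (Suc j) \<Longrightarrow> move_to_window t K' (q, c) = K' (q, c)"
  by (auto simp: move_to_window_def nested_def)

lemma move_to_window_shrink:
  assumes "agree even_blocks K' Z" "q \<in> frame" "c < m"
  shows "move_to_window t K' (shrink j q, c) = K' (rescale C p d (new_center t) new_radius q, c)"
proof (cases "q \<in> C")
  case True
  hence "move_to_window t K' (q, c) = Z (q, c)" "K' (q, c) = Z (q, c)"
    using agreeD[OF move_to_window_old _ assms(3), of q] agreeD[OF assms(1) _ assms(3), of q] C_subset_outside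
    by (auto simp: even_blocks_def)
  thus ?thesis using True by (simp add: shrink_C rescale_fixed)
next
  case False
  then obtain k x where q: "q = (k, affine p d x)" "k < Suc M" "x \<in> X" using assms(2) by auto
  have rescale: "rescale C p d (new_center t) new_radius q = (k, affine (new_center t k) (new_radius k) x)"
    unfolding q(1) by (rule rescale_affine[OF d_pos]) (use affine_X_not_C q(2,3) in auto)
  show ?thesis
  proof (cases "k < M")
    case True
    thus ?thesis using q shrink_affine(1)[of x k j] rescale
      by (simp add: move_to_window_def put_window new_center_def new_radius_def)
  next
    case False
    hence k: "k = M" using q(2) by simp
    have "shrink j q = (M, affine p (radius (Suc j)) x)" using q shrink_affine(2)[of x j] k by simp
    thus ?thesis using q(3) rescale k
      by (simp add: move_to_window_nested nested_def new_center_def new_radius_def)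
  qed
qed

lemma solution_move_to_window:
  assumes K': "inserted t S W K'" and S: "even_blocks \<subseteq> S" and W: "agree even_blocks W Z"
    and \<theta>K': "\<And>k. k < M \<Longrightarrow> \<theta> k (put K' k t)"
  shows "solution (move_to_window t K')"
proof -
  let ?z = "move_to_window t K'"
  have env: "K' \<in> envs" "?z \<in> envs" using K' move_to_window_env by (auto simp: inserted_def)
  have K'Z: "agree even_blocks K' Z"
    using K' agree_trans[OF agree_mono[OF _ S] W] by (auto simp: inserted_def)
  have "copy_on (V0 \<union> nested_upto (Suc j)) ?z"
  proof (rule copy_on_agree[OF copy_on_mono env(2)])
    show "copy_on (S \<union> {M} \<times> affine (new_center t M) (new_radius M) ` X) K'"
      using K' by (simp add: inserted_def)
    show "V0 \<union> nested_upto (Suc j) \<subseteq> S \<union> {M} \<times> affine (new_center t M) (new_radius M) ` X"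
      using S by (auto simp: nested_upto_Suc nested_def new_center_def new_radius_def even_blocks_def)
    show "agree (V0 \<union> nested_upto (Suc j)) ?z K'"
    proof (rule agreeI)
      fix q c assume q: "q \<in> V0 \<union> nested_upto (Suc j)" and c: "c < m"
      show "?z (q, c) = K' (q, c)"
      proof (cases "q \<in> nested (Suc j)")
        case False
        hence "q \<in> V0 \<union> nested_upto j" using q by (auto simp: nested_upto_Suc)
        thus ?thesis
          using agreeD[OF move_to_window_old _ c, of q t K'] agreeD[OF K'Z _ c, of q] V0 by (auto simp: even_blocks_def)
      qed (rule move_to_window_nested)
    qed
  qed
  moreover have "tp_eq {} (frame \<times> {..<m}) (?z \<circ> lift (shrink j)) K"
  proof (rule tp_eq_trans[OF tp_eq_agree_on])
    show "agree frame (?z \<circ> lift (shrink j)) (K' \<circ> lift (rescale C p d (new_center t) new_radius))"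
      using move_to_window_shrink[OF K'Z] by (intro agreeI) simp
  qed (use K' env in \<open>auto simp: inserted_def intro: envs_comp\<close>)
  moreover have "\<theta> k ?z" if "k < M" for k
    using definable_agree[OF \<theta>(1)[OF that] env(2) put_env[OF env(1)] move_to_window_put[OF that]] \<theta>K'[OF that] by blast
  ultimately show ?thesis using env(2) move_to_window_old by (simp add: solution_def)
qed

lemma false_on_odd_blocks:
  assumes no: "\<not> (\<exists>z. solution z)" and "t \<le> N"
  shows "\<exists>W \<kappa>. copy_on (with_odd_blocks t \<kappa>) W \<and> agree even_blocks W Z \<and>
    (\<forall>s<t. \<kappa> s < M \<and> \<not> \<theta> (\<kappa> s) (put W (\<kappa> s) (2 * s + 1)))"
  using assms(2)
proof (induction t)
  case 0
  have "copy_on (with_odd_blocks 0 (\<lambda>_. 0)) Z"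
    using copy_on_mono[OF Z(1) even_blocks_subset] by (simp add: with_odd_blocks_def)
  thus ?case by (auto simp: agree_def)
next
  case (Suc t)
  then obtain W \<kappa> where W: "copy_on (with_odd_blocks t \<kappa>) W" "agree even_blocks W Z"
    and \<kappa>: "\<And>s. s < t \<Longrightarrow> \<kappa> s < M" "\<And>s. s < t \<Longrightarrow> \<not> \<theta> (\<kappa> s) (put W (\<kappa> s) (2 * s + 1))" by auto
  obtain K' where K': "inserted (2 * t + 1) (with_odd_blocks t \<kappa>) W K'"
    using ex_inserted[OF W(1) \<kappa>(1)] Suc.prems by auto
  have env: "K' \<in> envs" and K'W: "agree (with_odd_blocks t \<kappa>) K' W" using K' by (auto simp: inserted_def)
  have even: "even_blocks \<subseteq> with_odd_blocks t \<kappa>" by (auto simp: with_odd_blocks_def)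
  obtain k where k: "k < M" "\<not> \<theta> k (put K' k (2 * t + 1))"
    using solution_move_to_window[OF K' even W(2)] no by blast
  define \<kappa>' where "\<kappa>' = \<kappa>(t := k)"
  have odd_Suc: "with_odd_blocks (Suc t) \<kappa>' = with_odd_blocks t \<kappa> \<union> {k} \<times> block (2 * t + 1)"
  proof -
    have "(\<Union>s<t. {\<kappa>' s} \<times> block (2 * s + 1)) = (\<Union>s<t. {\<kappa> s} \<times> block (2 * s + 1))"
      by (intro SUP_cong) (auto simp: \<kappa>'_def)
    thus ?thesis by (auto simp: with_odd_blocks_def lessThan_Suc \<kappa>'_def)
  qed
  have "copy_on (with_odd_blocks t \<kappa> \<union> {k} \<times> affine (new_center (2 * t + 1) k) (new_radius k) ` X) K'"
    using K' less_SucI[OF k(1)] unfolding inserted_def by blast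
  hence "copy_on (with_odd_blocks (Suc t) \<kappa>') K'"
    unfolding odd_Suc using k(1) by (simp add: new_center_def new_radius_def)
  moreover have "agree even_blocks K' Z" by (rule agree_trans[OF agree_mono[OF K'W even] W(2)])
  moreover have "\<not> \<theta> (\<kappa> s) (put K' (\<kappa> s) (2 * s + 1))" if s: "s < t" for s
  proof -
    have "agree ({\<kappa> s} \<times> block (2 * s + 1)) K' W"
      by (rule agree_mono[OF K'W]) (use s in \<open>auto simp: with_odd_blocks_def\<close>)
    thus ?thesis using put_cong[OF \<kappa>(1)[OF s] env copy_on_env[OF W(1)]] \<kappa>(2)[OF s] by blast
  qed
  ultimately have "\<forall>s<Suc t. \<kappa>' s < M \<and> \<not> \<theta> (\<kappa>' s) (put K' (\<kappa>' s) (2 * s + 1))"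
    using k \<kappa>(1) by (simp add: \<kappa>'_def less_Suc_eq)
  with \<open>copy_on (with_odd_blocks (Suc t) \<kappa>') K'\<close> \<open>agree even_blocks K' Z\<close> show ?case by blast
qed

lemma not_false_on_odd_blocks:
  assumes bound: "\<And>k. k < M \<Longrightarrow> alternation_bound (\<lambda>_. k) (<) X (\<lambda>h. \<theta> k (h \<circ> split_window k)) B" and N: "M * B < N"
    and W: "copy_on (with_odd_blocks N \<kappa>) W" "agree even_blocks W Z"
    and \<kappa>: "\<And>s. s < N \<Longrightarrow> \<kappa> s < M" "\<And>s. s < N \<Longrightarrow> \<not> \<theta> (\<kappa> s) (put W (\<kappa> s) (2 * s + 1))"
  shows False
proof -
  obtain k \<iota> where k: "k < M" and \<iota>: "strict_mono_on {..<B} \<iota>" "\<And>a. a < B \<Longrightarrow> \<iota> a < N" "\<And>a. a < B \<Longrightarrow> \<kappa> (\<iota> a) = k"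
    using ex_increasing_fibre[OF N, of \<kappa>] \<kappa>(1) by blast
  define ix where "ix i = 2 * \<iota> (i div 2) + i mod 2" for i
  have ix_mono: "strict_mono_on {..<2 * B} ix"
    unfolding ix_def[abs_def] by (rule strict_mono_on_interleave[OF \<iota>(1)])
  have "\<not> alternates B (\<lambda>i. \<theta> k (case_sum (\<lambda>(x, l). W ((k, affine (r (ix i)) h x), l)) Z \<circ> split_window k))"
  proof (rule alternation_boundD[OF bound[OF k] order_refl W(1) _ _ Z_env])
    show "row_blocks (\<lambda>_. k) (<) {..<2 * B} X (\<lambda>i x. (k, affine (r (ix i)) h x))"
    proof (rule row_blocksI)
      fix i i' x y assume "i \<in> {..<2 * B}" "i' \<in> {..<2 * B}" "i < i'" and x: "x \<in> X" and y: "y \<in> X"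
      hence "r (ix i) + h < r (ix i') - h" using blocks(2) strict_mono_onD[OF ix_mono] by blast
      thus "snd (k, affine (r (ix i)) h x) < snd (k, affine (r (ix i')) h y)"
        using block_bound[of "affine (r (ix i)) h x" "ix i"] block_bound[of "affine (r (ix i')) h y" "ix i'"] x y
        by (auto simp: abs_le_iff)
    qed (simp_all add: affine_less[OF blocks(1)])
    fix i x assume i: "i < 2 * B" and x: "x \<in> X"
    hence "\<iota> (i div 2) < N" "\<kappa> (\<iota> (i div 2)) = k" using \<iota>(2,3)[of "i div 2"] by auto
    thus "(k, affine (r (ix i)) h x) \<in> with_odd_blocks N \<kappa>"
      using k x by (cases "even i") (auto simp: with_odd_blocks_def even_blocks_def ix_def mod2_eq_if)
  qed
  hence "\<not> alternates B (\<lambda>i. \<theta> k (put W k (ix i)))" by (simp add: put_def)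
  moreover have "\<theta> k (put W k (ix i)) \<longleftrightarrow> even i" if i: "i < 2 * B" for i
  proof -
    have s: "\<iota> (i div 2) < N" "\<kappa> (\<iota> (i div 2)) = k" using \<iota>(2,3)[of "i div 2"] i by auto
    show ?thesis
    proof (cases "even i")
      case True
      hence ix: "ix i = 2 * \<iota> (i div 2)" by (simp add: ix_def)
      have "agree ({k} \<times> block (ix i)) W Z"
        by (rule agree_mono[OF W(2)]) (use s(1) k in \<open>auto simp: even_blocks_def ix\<close>)
      thus ?thesis
        using put_cong[OF k copy_on_env[OF W(1)] Z_env] put_Z[OF k, of "ix i"] True s(1) by (simp add: ix)
    next
      case False
      thus ?thesis using \<kappa>(2)[OF s(1)] s(2) by (simp add: ix_def mod2_eq_if)
    qed
  qed
  ultimately show False by (simp add: alternates_def)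
qed

lemma ex_solution:
  assumes "\<And>k. k < M \<Longrightarrow> alternation_bound (\<lambda>_. k) (<) X (\<lambda>h. \<theta> k (h \<circ> split_window k)) B" "M * B < N"
  shows "\<exists>z. solution z"
proof (rule ccontr)
  assume "\<not> ?thesis"
  from false_on_odd_blocks[OF this order_refl] not_false_on_odd_blocks[OF assms] show False by blast
qed

end

context row_removal
begin

lemma ex_common_bound:
  assumes \<theta>: "\<And>k. k < M \<Longrightarrow> definable {} (S k \<times> {..<m}) (\<theta> k)"
    and G: "\<And>k v. k < M \<Longrightarrow> v \<in> S k \<times> {..<m} \<Longrightarrow> G k v \<in> Inl ` (X \<times> {..<m}) \<union> range Inr"
  shows "\<exists>B. \<forall>k<M. alternation_bound (\<lambda>_. k) (<) X (\<lambda>h. \<theta> k (h \<circ> G k)) B"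
proof -
  have "\<exists>B. alternation_bound (\<lambda>_. k) (<) X (\<lambda>h. \<theta> k (h \<circ> G k)) B" if k: "k < M" for k
  proof (rule ex_alternation_bound[OF X(1)])
    show "definable {} (Inl ` (X \<times> {..<m}) \<union> range Inr) (\<lambda>h. \<theta> k (h \<circ> G k))"
      by (rule definable_reindex[OF \<theta>[OF k]]) (use G[OF k] in blast)
    show "row_blocks (\<lambda>_. k) (<) UNIV X (\<lambda>i x. (k, 4 * of_nat i + x))"
    proof (rule row_blocksI)
      fix i i' :: nat and x y assume i: "i < i'" and x: "x \<in> X" and y: "y \<in> X"
      have "of_nat i + 1 \<le> (of_nat i' :: rat)" using i by (metis Suc_leI add.commute of_nat_Suc of_nat_mono)
      thus "snd (k, 4 * of_nat i + x) < snd (k, 4 * of_nat i' + y)"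
        using X_abs[OF x] X_abs[OF y] by (auto simp: abs_le_iff)
    qed simp_all
  qed
  then obtain B where B: "\<And>k. k < M \<Longrightarrow> alternation_bound (\<lambda>_. k) (<) X (\<lambda>h. \<theta> k (h \<circ> G k)) (B k)" by metis
  have "B k \<le> Max (B ` {..<M})" if "k < M" for k using that by (intro Max_ge) auto
  hence "alternation_bound (\<lambda>_. k) (<) X (\<lambda>h. \<theta> k (h \<circ> G k)) (Max (B ` {..<M}))" if "k < M" for k
    using B[OF that] that order_trans unfolding alternation_bound_def by blast
  thus ?thesis by blast
qed

lemma ex_free_slot:
  assumes "finite V0" "j < n"
  shows "\<exists>u. center j + width \<le> u \<and> u < center (Suc j) - width \<and>
    (\<forall>k q. (k, q) \<in> V0 \<longrightarrow> k < M \<longrightarrow> q < center (Suc j) - width \<longrightarrow> q \<le> u)"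
proof -
  let ?g = "center (Suc j) - width"
  let ?Q = "insert (center j + width) (snd ` {x \<in> V0. fst x < M \<and> snd x < ?g})"
  have fin: "finite ?Q" using assms(1) by simp
  have "Max ?Q < ?g" using fin center_Suc[of j] width_pos by (subst Max_less_iff) auto
  moreover have "q \<le> Max ?Q" if "(k, q) \<in> V0" "k < M" "q < ?g" for k q
    using fin that by (intro Max_ge) (auto simp: image_iff)
  ultimately show ?thesis using fin by (intro exI[of _ "Max ?Q"]) (auto intro!: Max_ge)
qed

lemma base_change_finite:
  assumes Z: "copy_on (outside \<union> nested_upto j) Z" "copy_on (outside \<union> centers j) Z" and j: "j < n"
    and V0: "finite V0" "V0 \<subseteq> outside"
    and \<theta>: "\<And>k. k < M \<Longrightarrow> definable {} ((V0 \<union> centers j \<union> {k} \<times> window j) \<times> {..<m}) (\<theta> k)" "\<And>k. k < M \<Longrightarrow> \<theta> k e"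
  shows "\<exists>z\<in>envs. agree (outside \<union> nested_upto j \<union> centers j) z Z \<and> copy_on (V0 \<union> nested_upto (Suc j)) z \<and>
    tp_eq {} (frame \<times> {..<m}) (z \<circ> lift (shrink j)) K \<and> (\<forall>k<M. \<theta> k z)"
proof -
  define G where "G k v = (if fst v \<in> {k} \<times> window j
    then Inl ((snd (fst v) - center (Suc j)) / width, snd v) else Inr v)" for k and v :: "(nat \<times> rat) \<times> nat"
  have "\<exists>B. \<forall>k<M. alternation_bound (\<lambda>_. k) (<) X (\<lambda>h. \<theta> k (h \<circ> G k)) B"
    by (rule ex_common_bound[OF \<theta>(1)]) (auto simp: G_def affine_inv[OF width_pos])
  then obtain B where B: "\<forall>k<M. alternation_bound (\<lambda>_. k) (<) X (\<lambda>h. \<theta> k (h \<circ> G k)) B" by (elim exE)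
  obtain u where u: "center j + width \<le> u" "u < center (Suc j) - width"
    "\<forall>k q. (k, q) \<in> V0 \<longrightarrow> k < M \<longrightarrow> q < center (Suc j) - width \<longrightarrow> q \<le> u"
    using ex_free_slot[OF V0(1) j] by (elim exE conjE)
  obtain r h where "0 < h" "\<forall>t t'. t < t' \<longrightarrow> r t + h < r t' - h"
    "\<forall>t<2 * Suc (M * B). u < r t - h \<and> r t + h < center (Suc j) - width"
    using ex_separated_blocks[OF u(2), of "2 * Suc (M * B)"] by (elim exE conjE)
  then interpret free_blocks L U kb e m M p d \<epsilon> D X K C b n j Z V0 \<theta> u h r "Suc (M * B)"
    by unfold_locales (use Z j V0(2) \<theta> u in auto)
  have "G k = split_window k" for k by (rule ext) (simp add: G_def split_window_def)
  thus ?thesis using ex_solution[of B] B by (auto simp: solution_def)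
qed

lemma base_change:
  assumes Z: "copy_on (outside \<union> nested_upto j) Z" "copy_on (outside \<union> centers j) Z" and j: "j < n"
  shows "\<exists>z\<in>envs. agree (outside \<union> nested_upto j \<union> centers j) z Z \<and> copy_on (outside \<union> nested_upto (Suc j)) z \<and>
    tp_eq {} (frame \<times> {..<m}) (z \<circ> lift (shrink j)) K \<and>
    (\<forall>k<M. copy_on (outside \<union> centers j \<union> {k} \<times> window j) z)"
proof -
  define T where "T i = (case i of None \<Rightarrow> outside \<union> nested_upto (Suc j)
    | Some k \<Rightarrow> if k < M then outside \<union> centers j \<union> {k} \<times> window j else frame)" for i
  define g where "g i = (if i = Some M then lift (shrink j) else id)" for i :: "nat option"
  define h where "h i = (if i = Some M then K else e)" for i :: "nat option"
  let ?I = "insert None (Some ` {..M})"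
  have "\<exists>z\<in>envs. agree (outside \<union> nested_upto j \<union> centers j) z Z \<and> (\<forall>i\<in>?I. tp_eq {} (T i \<times> {..<m}) (z \<circ> g i) (h i))"
  proof (rule realize_array_types[OF _ copy_on_env[OF Z(1)]])
    fix V0 Q assume V0: "finite V0" "V0 \<subseteq> outside"
      and Q: "\<And>i. i \<in> ?I \<Longrightarrow> definable {} ((T i - (outside - V0)) \<times> {..<m}) (Q i)" "\<And>i. i \<in> ?I \<Longrightarrow> Q i (h i)"
    have rows: "definable {} ((V0 \<union> centers j \<union> {k} \<times> window j) \<times> {..<m}) (Q (Some k))" if "k < M" for k
      by (rule definable_mono[OF Q(1)]) (use that in \<open>auto simp: T_def\<close>)
    have "\<exists>z\<in>envs. agree (outside \<union> nested_upto j \<union> centers j) z Z \<and> copy_on (V0 \<union> nested_upto (Suc j)) z \<and>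
      tp_eq {} (frame \<times> {..<m}) (z \<circ> lift (shrink j)) K \<and> (\<forall>k<M. Q (Some k) z)"
    proof (rule base_change_finite[OF Z j V0 rows])
      show "Q (Some k) e" if "k < M" for k using Q(2)[of "Some k"] that by (simp add: h_def)
    qed
    then obtain z where z: "z \<in> envs" "agree (outside \<union> nested_upto j \<union> centers j) z Z"
      "copy_on (V0 \<union> nested_upto (Suc j)) z" "tp_eq {} (frame \<times> {..<m}) (z \<circ> lift (shrink j)) K"
      "\<forall>k<M. Q (Some k) z" by (elim bexE conjE)
    have "definable {} ((V0 \<union> nested_upto (Suc j)) \<times> {..<m}) (Q None)"
      by (rule definable_mono[OF Q(1)]) (auto simp: T_def)
    hence "Q None z" using copy_onD[OF z(3), of "Q None"] Q(2)[of None] by (simp add: h_def)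
    moreover have "definable {} (frame \<times> {..<m}) (Q (Some M))"
      by (rule definable_mono[OF Q(1)]) (auto simp: T_def)
    hence "Q (Some M) (z \<circ> lift (shrink j))"
      using tp_eqD[OF z(4), of "Q (Some M)"] Q(2)[of "Some M"] by (simp add: h_def)
    ultimately have "\<forall>i\<in>?I. Q i (z \<circ> g i)" using z(5) by (auto simp: g_def le_less)
    thus "\<exists>z\<in>envs. agree (outside \<union> nested_upto j \<union> centers j) z Z \<and> (\<forall>i\<in>?I. Q i (z \<circ> g i))"
      using z(1,2) by blast
  qed simp
  then obtain z where z: "z \<in> envs" "agree (outside \<union> nested_upto j \<union> centers j) z Z"
    "\<forall>i\<in>?I. tp_eq {} (T i \<times> {..<m}) (z \<circ> g i) (h i)" by (elim bexE conjE)
  have "copy_on (outside \<union> nested_upto (Suc j)) z"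
    using z(1) bspec[OF z(3), of None] by (simp add: copy_on_def T_def g_def h_def)
  moreover have "tp_eq {} (frame \<times> {..<m}) (z \<circ> lift (shrink j)) K"
    using bspec[OF z(3), of "Some M"] by (simp add: T_def g_def h_def)
  moreover have "copy_on (outside \<union> centers j \<union> {k} \<times> window j) z" if "k < M" for k
    using z(1) bspec[OF z(3), of "Some k"] that by (simp add: copy_on_def T_def g_def h_def)
  ultimately show ?thesis using z(1,2) by blast
qed

definition combine :: "((nat \<times> rat) \<times> nat \<Rightarrow> 'm) \<Rightarrow> ((nat \<times> rat) \<times> nat \<Rightarrow> 'm) \<Rightarrow> rat \<Rightarrow> (nat \<times> rat) \<times> nat \<Rightarrow> 'm" where
  "combine Z Z' x v = (if fst v \<in> C then Z v else if fst (fst v) < M then Z ((fst (fst v), x), snd v) else Z' v)"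

definition excludes :: "(((nat \<times> rat) \<times> nat \<Rightarrow> 'm) \<Rightarrow> bool) \<Rightarrow> ((nat \<times> rat) \<times> nat \<Rightarrow> 'm) \<Rightarrow> nat \<Rightarrow> bool" where
  "excludes \<beta> Z i \<longleftrightarrow> (\<forall>Z'. agree (C \<union> nested i) Z' Z \<and> copy_on (C \<union> nested i \<union> {(M, p)}) Z' \<longrightarrow>
     \<not> \<beta> (combine Z Z' (center i)))"

text \<open>
  After \<open>j\<close> stages, \<open>Z\<close> contains nested sequences in the last row, and for each of them a tuple in the other
  rows such that \<open>\<beta>\<close> fails at this tuple and every element that lies inside the nested sequence.
\<close>

definition stage :: "(((nat \<times> rat) \<times> nat \<Rightarrow> 'm) \<Rightarrow> bool) \<Rightarrow> nat \<Rightarrow> ((nat \<times> rat) \<times> nat \<Rightarrow> 'm) \<Rightarrow> bool" where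
  "stage \<beta> j Z \<longleftrightarrow> agree C Z K \<and> copy_on (outside \<union> nested_upto j) Z \<and> copy_on (outside \<union> centers j) Z \<and>
     (\<forall>i\<in>{1..j}. excludes \<beta> Z i)"

lemma combine_env: "Z \<in> envs \<Longrightarrow> Z' \<in> envs \<Longrightarrow> combine Z Z' x \<in> envs"
  by (intro envsI) (auto simp: combine_def envsD)

lemma excludes_agree:
  assumes \<beta>: "definable {} ((C \<union> {..<Suc M} \<times> {p}) \<times> {..<m}) \<beta>" and Z: "Z \<in> envs" "Z1 \<in> envs"
    and Z1: "agree (C \<union> nested i \<union> {..<M} \<times> {center i}) Z1 Z" and excl: "excludes \<beta> Z i"
  shows "excludes \<beta> Z1 i"
  unfolding excludes_def
proof (intro allI impI, elim conjE)
  fix Z' assume Z': "agree (C \<union> nested i) Z' Z1" "copy_on (C \<union> nested i \<union> {(M, p)}) Z'"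
  have "agree (C \<union> nested i) Z' Z" by (rule agree_trans[OF Z'(1) agree_mono[OF Z1]]) auto
  hence "\<not> \<beta> (combine Z Z' (center i))" using excl Z'(2) by (auto simp: excludes_def)
  moreover have "agree (C \<union> {..<Suc M} \<times> {p}) (combine Z1 Z' (center i)) (combine Z Z' (center i))"
    using Z1 by (auto simp: agree_def combine_def)
  ultimately show "\<not> \<beta> (combine Z1 Z' (center i))"
    using definable_agree[OF \<beta> combine_env[OF Z(2)] combine_env[OF Z(1)]] copy_on_env[OF Z'(2)] by blast
qed

lemma center_gap:
  assumes "j < n"
  shows "has_gap M (center (Suc j)) width width (outside \<union> centers j)"
  unfolding has_gap_def
proof (intro conjI allI impI)
  fix k q assume k: "k < M"
  show "(k, q) \<notin> outside \<union> centers j" if "\<bar>q - center (Suc j)\<bar> \<le> width"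
    using not_outside_near_center[of "Suc j" q k] centers_far[of k q j] that assms width_pos k by auto
  assume q: "width < \<bar>q - center (Suc j)\<bar> \<and> \<bar>q - center (Suc j)\<bar> < width + width"
  have "(k, q) \<in> outside"
  proof (cases "q < center (Suc j)")
    case True
    thus ?thesis using outside_between[of k j q] q k assms center_Suc[of j] by (auto simp: abs_if)
  next
    case False
    thus ?thesis using outside_between[of k "Suc j" q] q k assms center_Suc[of "Suc j"] by (auto simp: abs_if)
  qed
  thus "(k, q) \<in> outside \<union> centers j" by simp
qed (use width_pos in auto)

lemma excludes_new_center:
  assumes \<beta>: "definable {} ((C \<union> {..<Suc M} \<times> {p}) \<times> {..<m}) \<beta>"
    and no: "\<forall>z\<in>envs. inserts_rowwise (Suc M) p C (affine p d ` X) K z \<longrightarrow> \<not> \<beta> z" and j: "j < n"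
    and Z: "Z \<in> envs" "\<And>k. k < M \<Longrightarrow> copy_on (C \<union> {k} \<times> insert (center (Suc j)) (window j)) Z"
      "tp_eq {} (frame \<times> {..<m}) (Z \<circ> lift (shrink j)) K"
  shows "excludes \<beta> Z (Suc j)"
  unfolding excludes_def
proof (intro allI impI, elim conjE)
  fix Z' assume Z': "agree (C \<union> nested (Suc j)) Z' Z" "copy_on (C \<union> nested (Suc j) \<union> {(M, p)}) Z'"
  let ?T = "C \<union> {..<Suc M} \<times> affine p d ` insert 0 X"
  define y where "y v = (if fst v = (M, p) then Z' v else Z v)" for v
  have y: "y \<in> envs" unfolding y_def[abs_def] by (rule envs_merge[OF copy_on_env[OF Z'(2)] Z(1)])
  have "shrink j q \<noteq> (M, p)" if "q \<in> frame" for q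
    using shrink_frame[OF that, of j] M_p_not_C nested_bound(2)[of M p "Suc j" "Suc j"] radius_pos[of "Suc (Suc j)"]
    by auto
  hence "agree frame (y \<circ> lift (shrink j)) (Z \<circ> lift (shrink j))"
    by (intro agreeI) (simp add: y_def)
  hence "tp_eq {} (frame \<times> {..<m}) (y \<circ> lift (shrink j)) K"
    using tp_eq_agree_on[OF envs_comp[OF y] envs_comp[OF Z(1)]] tp_eq_trans Z(3) by blast
  then obtain x where x: "x \<in> envs" "agree frame x K" "tp_eq {} (?T \<times> {..<m}) x (y \<circ> lift (shrink j))"
    using extend_positions[OF envs_comp[OF y] copy_on_env[OF K(1)], of frame ?T] by blast
  have "copy_on (C \<union> {k} \<times> insert p (affine p d ` X)) x" if k: "k < Suc M" for k
  proof (rule copy_on_tp_eq[OF copy_on_reindex x(1)])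
    show "row_mono le_rows le_rows (C \<union> {k} \<times> insert p (affine p d ` X)) (shrink j)"
      by (rule row_mono_subset[OF row_mono_shrink[OF j]]) (use k in auto)
    show "tp_eq {} ((C \<union> {k} \<times> insert p (affine p d ` X)) \<times> {..<m}) x (y \<circ> lift (shrink j))"
      by (rule tp_eq_mono[OF x(3)]) (use k in auto)
    let ?S = "if k < M then C \<union> {k} \<times> insert (center (Suc j)) (window j) else C \<union> nested (Suc j) \<union> {(M, p)}"
    show "shrink j ` (C \<union> {k} \<times> insert p (affine p d ` X)) \<subseteq> ?S"
      using k shrink_affine(1)[of _ k j] shrink_affine(2)[of _ j] shrink_center(1)[of k j] shrink_center(2)[of j]
      by (auto simp: shrink_C nested_def less_Suc_eq)
    show "copy_on ?S y"
    proof (cases "k < M")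
      case True
      hence "agree (C \<union> {k} \<times> insert (center (Suc j)) (window j)) y Z"
        using M_p_not_C by (auto simp: agree_def y_def)
      thus ?thesis using copy_on_agree[OF Z(2) y] True by simp
    next
      case False
      have "agree (C \<union> nested (Suc j) \<union> {(M, p)}) y Z'" using Z'(1) by (auto simp: agree_def y_def)
      thus ?thesis using copy_on_agree[OF Z'(2) y] False by simp
    qed
  qed
  hence "\<not> \<beta> x" using no x(1,2) by (simp add: inserts_rowwise_def)
  moreover have "\<beta> x \<longleftrightarrow> \<beta> (y \<circ> lift (shrink j))"
    by (rule tp_eqD[OF x(3) definable_mono[OF \<beta>]]) (auto intro!: image_eqI[of _ _ 0])
  moreover have "agree (C \<union> {..<Suc M} \<times> {p}) (y \<circ> lift (shrink j)) (combine Z Z' (center (Suc j)))"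
    using M_p_not_C shrink_center by (auto simp: agree_def y_def combine_def shrink_C less_Suc_eq)
  ultimately show "\<not> \<beta> (combine Z Z' (center (Suc j)))"
    using definable_agree[OF \<beta> envs_comp[OF y] combine_env[OF Z(1) copy_on_env[OF Z'(2)]]] by blast
qed

lemma ex_tuple_at_new_center:
  assumes nobs: "\<not> obstructed M" and j: "j < n"
    and z: "copy_on (outside \<union> centers j) z" "\<forall>k<M. copy_on (outside \<union> centers j \<union> {k} \<times> window j) z"
  shows "\<exists>Z. agree (outside \<union> nested_upto (Suc j) \<union> centers j \<union> {..<M} \<times> window j) Z z \<and>
    copy_on (outside \<union> centers (Suc j)) Z \<and>
    (\<forall>k<M. copy_on (outside \<union> centers j \<union> {k} \<times> insert (center (Suc j)) (window j)) Z)"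
proof -
  let ?P = "center (Suc j)" and ?D = "outside \<union> centers j"
  have "\<exists>y. inserts_rowwise M ?P ?D (window j) z y \<and> copy_on (?D \<union> {..<M} \<times> {?P}) y"
    using nobs center_gap[OF j] X z unfolding obstructed_def by blast
  then obtain y where y: "agree (?D \<union> {..<M} \<times> window j) y z" "copy_on (?D \<union> {..<M} \<times> {?P}) y"
    "\<forall>k<M. copy_on (?D \<union> {k} \<times> insert ?P (window j)) y" by (auto simp: inserts_rowwise_def)
  define Z where "Z v = (if fst v \<in> {..<M} \<times> {?P} then y v else z v)" for v
  have Z: "Z \<in> envs"
    unfolding Z_def[abs_def] by (rule envs_merge[OF copy_on_env[OF y(2)] copy_on_env[OF z(1)]])
  have Zy: "agree (?D \<union> {..<M} \<times> insert ?P (window j)) Z y"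
    using y(1) by (auto simp: agree_def Z_def)
  have "(k, ?P) \<notin> outside \<union> nested_upto j \<union> centers j" if "k < M" for k
    using not_outside_near_center[of "Suc j" ?P k] centers_far[of k ?P j] nested_upto_bound(1)[of k ?P j]
      that j width_pos by auto
  hence "agree (outside \<union> nested_upto (Suc j) \<union> centers j) Z z"
    by (intro agreeI) (auto simp: Z_def nested_upto_Suc nested_def)
  moreover have "agree ({..<M} \<times> window j) Z z"
    by (rule agree_trans[OF agree_mono[OF Zy] agree_mono[OF y(1)]]) auto
  moreover have "copy_on (outside \<union> centers (Suc j)) Z"
    by (rule copy_on_agree[OF copy_on_mono[OF y(2)] Z agree_mono[OF Zy]]) (auto simp: centers_Suc)
  moreover have "copy_on (?D \<union> {k} \<times> insert ?P (window j)) Z" if "k < M" for k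
    by (rule copy_on_agree[OF y(3)[rule_format, OF that] Z agree_mono[OF Zy]]) (use that in auto)
  ultimately show ?thesis by (intro exI[of _ Z]) (auto simp: agree_def)
qed

lemma stage_Suc:
  assumes \<beta>: "definable {} ((C \<union> {..<Suc M} \<times> {p}) \<times> {..<m}) \<beta>"
    and no: "\<forall>z\<in>envs. inserts_rowwise (Suc M) p C (affine p d ` X) K z \<longrightarrow> \<not> \<beta> z"
    and nobs: "\<not> obstructed M" and st: "stage \<beta> j Z0" and j: "j < n"
  shows "\<exists>Z. stage \<beta> (Suc j) Z"
proof -
  have Z0: "agree C Z0 K" "copy_on (outside \<union> nested_upto j) Z0" "copy_on (outside \<union> centers j) Z0"
    "\<And>i. i \<in> {1..j} \<Longrightarrow> excludes \<beta> Z0 i"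
    using st by (auto simp: stage_def)
  obtain z where z: "z \<in> envs" "agree (outside \<union> nested_upto j \<union> centers j) z Z0"
    "copy_on (outside \<union> nested_upto (Suc j)) z" "tp_eq {} (frame \<times> {..<m}) (z \<circ> lift (shrink j)) K"
    "\<forall>k<M. copy_on (outside \<union> centers j \<union> {k} \<times> window j) z"
    using base_change[OF Z0(2,3) j] by (elim bexE conjE)
  have "copy_on (outside \<union> centers j) z" by (rule copy_on_agree[OF Z0(3) z(1) agree_mono[OF z(2)]]) auto
  then obtain Z where Zz: "agree (outside \<union> nested_upto (Suc j) \<union> centers j \<union> {..<M} \<times> window j) Z z"
    and Z: "copy_on (outside \<union> centers (Suc j)) Z"
      "\<forall>k<M. copy_on (outside \<union> centers j \<union> {k} \<times> insert (center (Suc j)) (window j)) Z"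
    using ex_tuple_at_new_center[OF nobs j _ z(5)] by blast
  note env = copy_on_env[OF Z(1)]
  have ZZ0: "agree (outside \<union> nested_upto j \<union> centers j) Z Z0"
    by (rule agree_trans[OF agree_mono[OF Zz] z(2)]) (auto simp: nested_upto_Suc)
  have "copy_on (outside \<union> nested_upto (Suc j)) Z"
    by (rule copy_on_agree[OF z(3) env agree_mono[OF Zz]]) auto
  moreover have "agree C Z K"
    by (rule agree_trans[OF agree_mono[OF ZZ0] Z0(1)]) (use C_subset_outside in auto)
  moreover have "excludes \<beta> Z i" if i: "i \<in> {1..j}" for i
  proof (rule excludes_agree[OF \<beta> copy_on_env[OF Z0(2)] env _ Z0(4)[OF i]])
    have "nested i \<subseteq> nested_upto j" using i unfolding nested_upto_def by blast
    thus "agree (C \<union> nested i \<union> {..<M} \<times> {center i}) Z Z0"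
      by (intro agree_mono[OF ZZ0]) (use i C_subset_outside in \<open>auto simp: centers_def\<close>)
  qed
  moreover have "excludes \<beta> Z (Suc j)"
  proof (rule excludes_new_center[OF \<beta> no j env])
    show "copy_on (C \<union> {k} \<times> insert (center (Suc j)) (window j)) Z" if "k < M" for k
      by (rule copy_on_mono[OF Z(2)[rule_format, OF that]]) (use C_subset_outside in auto)
    have "agree (C \<union> {..<M} \<times> window j \<union> nested (Suc j)) Z z"
      by (rule agree_mono[OF Zz]) (use C_subset_outside in \<open>auto simp: nested_upto_Suc\<close>)
    hence "agree frame (Z \<circ> lift (shrink j)) (z \<circ> lift (shrink j))"
      by (intro agreeI) (simp add: agreeD[OF _ shrink_frame])
    thus "tp_eq {} (frame \<times> {..<m}) (Z \<circ> lift (shrink j)) K"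
      using tp_eq_agree_on[OF envs_comp[OF env] envs_comp[OF z(1)]] tp_eq_trans z(4) by blast
  qed
  ultimately show ?thesis
    using Z(1) by (intro exI[of _ Z]) (auto simp: stage_def atLeastAtMostSuc_conv)
qed

lemma ex_stage:
  assumes "definable {} ((C \<union> {..<Suc M} \<times> {p}) \<times> {..<m}) \<beta>"
    and "\<forall>z\<in>envs. inserts_rowwise (Suc M) p C (affine p d ` X) K z \<longrightarrow> \<not> \<beta> z" and "\<not> obstructed M" "j \<le> n"
  shows "\<exists>Z. stage \<beta> j Z"
  using assms(4)
proof (induction j)
  case 0
  obtain Z where "agree C Z K" "copy_on outside Z"
    using copy_on_extend[OF copy_on_mono[OF K(1) C] C_subset_outside] by blast
  thus ?case by (intro exI[of _ Z]) (simp add: stage_def nested_upto_def centers_def)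
next
  case (Suc j)
  then obtain Z where "stage \<beta> j Z" by auto
  thus ?case using stage_Suc[OF assms(1-3)] Suc.prems by simp
qed

definition probe :: "nat \<Rightarrow> rat" where "probe i = p - b + 2 * width * (of_nat i + 1)"

lemma probe_even: "probe (2 * a) = center a + 2 * width"
  and probe_odd: "probe (2 * a + 1) = center (Suc a)"
  by (simp_all add: probe_def center_def algebra_simps)

lemma probe_even_outside: "k < M \<Longrightarrow> a < n \<Longrightarrow> (k, probe (2 * a)) \<in> outside"
  using outside_between[of k a "probe (2 * a)"] center_Suc[of a] width_pos by (simp add: probe_even)

lemma probe_in:
  assumes "i < 2 * n" "k < M"
  shows "(k, probe i) \<in> outside \<union> centers n"
proof (cases "even i")
  case True
  then obtain a where "i = 2 * a" by (elim evenE)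
  thus ?thesis using probe_even_outside assms by simp
next
  case False
  then obtain a where "i = 2 * a + 1" by (elim oddE)
  thus ?thesis using assms probe_odd by (auto simp: centers_def)
qed

lemma combine_probe_even:
  assumes \<beta>: "definable {} ((C \<union> {..<Suc M} \<times> {p}) \<times> {..<m}) \<beta>" "\<beta> e" and a: "a < n" and Z: "Z \<in> envs"
    and Z': "agree outside Z' Z" "copy_on (outside \<union> {(M, p)}) Z'"
  shows "\<beta> (combine Z Z' (probe (2 * a)))"
proof -
  let ?x = "probe (2 * a)"
  define \<tau> where "\<tau> = rescale (insert (M, p) C) p 1 (\<lambda>_. ?x) (\<lambda>_. 1)"
  have \<tau>: "\<tau> (M, p) = (M, p)" "\<And>q. q \<in> C \<Longrightarrow> \<tau> q = q" "\<And>k. k < M \<Longrightarrow> \<tau> (k, p) = (k, ?x)"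
    using affine_X_not_C[of 0] by (auto simp: \<tau>_def rescale_def)
  have "row_mono le_rows le_rows (insert (M, p) C \<union> {..<M} \<times> affine p 1 ` {0}) \<tau>"
    unfolding \<tau>_def
  proof (rule row_mono_rescale)
    fix k q and x :: rat assume "(k, q) \<in> insert (M, p) C" "k \<in> {..<M}" "x \<in> {0}"
    moreover from this have "b \<le> \<bar>q - p\<bar>" using C_far[of k q] by auto
    moreover have "p - b < ?x" "?x < p + b"
      using center_lower[of a] center_upper[of a] a width_pos by (auto simp: probe_even)
    ultimately show "(q < affine p 1 x \<longrightarrow> q < affine ?x 1 x) \<and> (affine p 1 x < q \<longrightarrow> affine ?x 1 x < q)"
      using b_pos by (auto simp: abs_if split: if_splits)
  qed auto
  hence "row_mono le_rows le_rows (C \<union> {..<Suc M} \<times> {p}) \<tau>"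
    by (rule row_mono_subset) (auto simp: less_Suc_eq)
  moreover have "\<tau> ` (C \<union> {..<Suc M} \<times> {p}) \<subseteq> outside \<union> {(M, p)}"
    using C_subset_outside probe_even_outside[OF _ a] \<tau> by (auto simp: less_Suc_eq)
  ultimately have "\<beta> (Z' \<circ> lift \<tau>)" using copy_onD[OF copy_on_reindex[OF Z'(2)] \<beta>(1)] \<beta>(2) by blast
  moreover have "agree (C \<union> {..<Suc M} \<times> {p}) (Z' \<circ> lift \<tau>) (combine Z Z' ?x)"
    using agreeD[OF Z'(1)] C_subset_outside probe_even_outside[OF _ a] \<tau> M_p_not_C affine_X_not_C[of 0]
    by (auto simp: agree_def combine_def less_Suc_eq)
  ultimately show ?thesis
    using definable_agree[OF \<beta>(1) envs_comp combine_env[OF Z]] copy_on_env[OF Z'(2)] by blast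
qed

lemma stage_alternates:
  assumes \<beta>: "definable {} ((C \<union> {..<Suc M} \<times> {p}) \<times> {..<m}) \<beta>" "\<beta> e" and st: "stage \<beta> n Z"
  shows "\<exists>Z'\<in>envs. alternates n (\<lambda>i. \<beta> (combine Z Z' (probe i)))"
proof -
  have Z: "copy_on (outside \<union> nested_upto n) Z" "\<And>i. i \<in> {1..n} \<Longrightarrow> excludes \<beta> Z i"
    using st by (auto simp: stage_def)
  obtain Z' where Z': "agree (outside \<union> nested_upto n) Z' Z" "copy_on (outside \<union> nested_upto n \<union> {(M, p)}) Z'"
    using copy_on_extend[OF Z(1), of "outside \<union> nested_upto n \<union> {(M, p)}"] by auto
  have even: "\<beta> (combine Z Z' (probe (2 * a)))" if "a < n" for a
    by (rule combine_probe_even[OF \<beta> that copy_on_env[OF Z(1)]])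
      (rule agree_mono[OF Z'(1)] copy_on_mono[OF Z'(2)]; blast)+
  have odd: "\<not> \<beta> (combine Z Z' (probe (2 * a + 1)))" if a: "a < n" for a
  proof -
    have "nested (Suc a) \<subseteq> nested_upto n" using a unfolding nested_upto_def by (intro UN_upper) simp
    hence "agree (C \<union> nested (Suc a)) Z' Z" "copy_on (C \<union> nested (Suc a) \<union> {(M, p)}) Z'"
      using C_subset_outside by (auto intro!: agree_mono[OF Z'(1)] copy_on_mono[OF Z'(2)])
    thus ?thesis using Z(2)[of "Suc a"] a unfolding excludes_def probe_odd by simp
  qed
  have "\<beta> (combine Z Z' (probe i)) \<longleftrightarrow> even i" if "i < 2 * n" for i
  proof -
    define a where "a = i div 2"
    have "a < n" "i = 2 * a \<or> i = 2 * a + 1" using that by (auto simp: a_def)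
    thus ?thesis using even[of a] odd[of a] by auto
  qed
  thus ?thesis using copy_on_env[OF Z'(2)] by (auto simp: alternates_def)
qed

end

context ref_array
begin

definition separate_rows :: "nat \<Rightarrow> (nat \<times> rat) set \<Rightarrow> (nat \<times> rat) \<times> nat \<Rightarrow> nat \<times> nat + (nat \<times> rat) \<times> nat" where
  "separate_rows M C v = (if fst v \<notin> C \<and> fst (fst v) < M then Inl (fst (fst v), snd v) else Inr v)"

lemma ex_separate_rows_bound:
  assumes "definable {} ((C \<union> {..<Suc M} \<times> {p}) \<times> {..<m}) \<beta>"
  shows "\<exists>n. alternation_bound (\<lambda>k. k) (\<lambda>_ _. False) {..<M} (\<lambda>h. \<beta> (h \<circ> separate_rows M C)) n"
proof (rule ex_alternation_bound)
  show "definable {} (Inl ` ({..<M} \<times> {..<m}) \<union> range Inr) (\<lambda>h. \<beta> (h \<circ> separate_rows M C))"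
    by (rule definable_reindex[OF assms]) (auto simp: separate_rows_def)
  show "row_blocks (\<lambda>k. k) (\<lambda>_ _. False) UNIV {..<M} (\<lambda>i k. (k, of_nat i))" by (simp add: row_blocks_def)
qed simp

end

context row_removal
begin

lemma no_stage_at_alternation_bound:
  assumes bound: "alternation_bound (\<lambda>k. k) (\<lambda>_ _. False) {..<M} (\<lambda>h. \<beta> (h \<circ> separate_rows M C)) n"
    and \<beta>: "definable {} ((C \<union> {..<Suc M} \<times> {p}) \<times> {..<m}) \<beta>" "\<beta> e"
  shows "\<not> stage \<beta> n Z"
proof
  assume st: "stage \<beta> n Z"
  obtain Z' where Z': "Z' \<in> envs" "alternates n (\<lambda>i. \<beta> (combine Z Z' (probe i)))"
    using stage_alternates[OF \<beta> st] by blast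
  have Z: "copy_on (outside \<union> centers n) Z" using st by (simp add: stage_def)
  define c where "c v = (if fst v \<in> C then Z v else Z' v)" for v
  have c: "c \<in> envs" unfolding c_def[abs_def] by (rule envs_merge[OF copy_on_env[OF Z] Z'(1)])
  have "case_sum (\<lambda>(k, l). Z ((k, probe i), l)) c \<circ> separate_rows M C = combine Z Z' (probe i)" for i
    by (rule ext) (simp add: separate_rows_def c_def combine_def)
  moreover have "\<not> alternates n (\<lambda>i. \<beta> (case_sum (\<lambda>(k, l). Z ((k, probe i), l)) c \<circ> separate_rows M C))"
  proof (rule alternation_boundD[OF bound order_refl Z _ _ c])
    show "row_blocks (\<lambda>k. k) (\<lambda>_ _. False) {..<2 * n} {..<M} (\<lambda>i k. (k, probe i))"
      by (rule row_blocksI) (use width_pos in \<open>auto simp: probe_def\<close>)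
  qed (use probe_in in simp)
  ultimately show False using Z'(2) by simp
qed

end

context ref_array
begin

lemma ex_distance_bound:
  assumes "finite C" "C \<subseteq> D" and gap: "has_gap M p d \<epsilon> D"
  shows "\<exists>b. d < b \<and> b \<le> d + \<epsilon> \<and> (\<forall>k q. (k, q) \<in> C \<longrightarrow> k < M \<longrightarrow> b \<le> \<bar>q - p\<bar>)"
proof -
  let ?Q = "insert (d + \<epsilon>) ((\<lambda>q. \<bar>snd q - p\<bar>) ` {q \<in> C. fst q < M})"
  have fin: "finite ?Q" using assms(1) by simp
  have "d < \<bar>q - p\<bar>" if "(k, q) \<in> C" "k < M" for k q
    using that assms(2) gap by (force simp: has_gap_def)
  hence "d < Min ?Q" using fin gap by (subst Min_gr_iff) (auto simp: has_gap_def)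
  moreover have "b \<le> \<bar>q - p\<bar>" if "(k, q) \<in> C" "k < M" "b = Min ?Q" for k q b
    unfolding that(3) using fin that(1,2) by (intro Min_le) (auto simp: image_iff intro!: bexI[of _ "(k, q)"])
  ultimately show ?thesis using fin by (intro exI[of _ "Min ?Q"]) auto
qed

theorem obstructed_Suc: "obstructed (Suc M) \<Longrightarrow> obstructed M"
proof (rule ccontr)
  assume nobs: "\<not> obstructed M" and "obstructed (Suc M)"
  then obtain p d \<epsilon> D X K where gap: "has_gap (Suc M) p d \<epsilon> D" and X: "finite X" "X \<subseteq> {-1..1} - {0}"
    and K: "copy_on D K" "\<forall>k<Suc M. copy_on (D \<union> {k} \<times> affine p d ` X) K"
    and no: "\<not> (\<exists>z. inserts_rowwise (Suc M) p D (affine p d ` X) K z \<and> copy_on (D \<union> {..<Suc M} \<times> {p}) z)"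
    unfolding obstructed_def by (elim exE conjE)
  have "(k, p) \<notin> D" if "k < Suc M" for k using gap that by (auto simp: has_gap_def)
  hence "\<exists>C \<beta>. finite C \<and> C \<subseteq> D \<and> definable {} ((C \<union> {..<Suc M} \<times> {p}) \<times> {..<m}) \<beta> \<and> \<beta> e \<and>
    (\<forall>z\<in>envs. inserts_rowwise (Suc M) p C (affine p d ` X) K z \<longrightarrow> \<not> \<beta> z)"
    by (rule ex_formula_excluding_insertion[OF copy_on_env[OF K(1)] _ no])
  then obtain C \<beta> where C: "finite C" "C \<subseteq> D" and \<beta>: "definable {} ((C \<union> {..<Suc M} \<times> {p}) \<times> {..<m}) \<beta>" "\<beta> e"
    and no\<beta>: "\<forall>z\<in>envs. inserts_rowwise (Suc M) p C (affine p d ` X) K z \<longrightarrow> \<not> \<beta> z"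
    by (elim exE conjE)
  obtain b where b: "d < b" "b \<le> d + \<epsilon>" "\<forall>k q. (k, q) \<in> C \<longrightarrow> k < Suc M \<longrightarrow> b \<le> \<bar>q - p\<bar>"
    using ex_distance_bound[OF C gap] by (elim exE conjE)
  obtain n where n: "alternation_bound (\<lambda>k. k) (\<lambda>_ _. False) {..<M} (\<lambda>h. \<beta> (h \<circ> separate_rows M C)) n"
    using ex_separate_rows_bound[OF \<beta>(1)] by (elim exE)
  interpret row_removal L U kb e m M p d \<epsilon> D X K C b n
    by unfold_locales (use gap X K C(2) b in auto)
  show False
    using ex_stage[OF \<beta>(1) no\<beta> nobs order_refl] no_stage_at_alternation_bound[OF n \<beta>] by blast
qed

corollary not_obstructed: "\<not> obstructed M"
  by (induction M) (use not_obstructed_0 obstructed_Suc in auto)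

end

section \<open>The finite-cofinite theorem\<close>

subsection \<open>Inserting finite sequences\<close>

text \<open>
  These assumptions contradict NIP: \<open>P\<close> is true on an indiscernible sequence, but in each of its cuts
  finite sequences on which \<open>P\<close> is false can be inserted.
\<close>

locale insertion = nip_monster L U kb
  for L :: "('f, 'r) lang" and U :: "('f, 'r, 'm) struct" and kb :: "'k rel" +
  fixes e :: "(nat \<times> rat) \<times> nat \<Rightarrow> 'm" and m :: nat and A :: "'m set" and P :: "(nat \<Rightarrow> 'm) \<Rightarrow> bool"
  assumes e: "e \<in> envs" and e_mono: "\<And>S \<tau>. strict_mono_on S \<tau> \<Longrightarrow> tp_eq {} (S \<times> {..<m}) e (e \<circ> lift \<tau>)"
    and P: "definable A {..<m} P" and A: "A \<subseteq> univ U" and P_e: "\<And>q. P (\<lambda>c. e (q, c))"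
    and insert_false: "\<And>D X. finite X \<Longrightarrow> (\<And>q. q \<in> D \<Longrightarrow> (\<forall>x\<in>X. q < x) \<or> (\<forall>x\<in>X. x < q)) \<Longrightarrow>
      \<exists>s\<in>envs. (\<forall>v\<in>D \<times> {..<m}. s v = e v) \<and> tp_eq {} ((D \<union> X) \<times> {..<m}) s e \<and> (\<forall>x\<in>X. \<not> P (\<lambda>c. s (x, c)))"

lemma row_mono_le_rows_imp_strict_mono_on:
  fixes \<tau> :: "nat \<times> rat \<Rightarrow> nat \<times> rat"
  assumes "row_mono le_rows le_rows S \<tau>"
  shows "strict_mono_on S \<tau>"
proof (rule strict_mono_onI)
  fix p q assume pq: "p \<in> S" "q \<in> S" "p < q"
  have "fst (\<tau> p) = fst p" "fst (\<tau> q) = fst q" using row_monoD(1)[OF assms] pq by auto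
  thus "\<tau> p < \<tau> q" using pq row_mono_le_rowsD[OF assms, of "fst p" "snd p" "snd q"]
    by (cases p; cases q) (auto simp: less_prod_def)
qed

sublocale insertion \<subseteq> ref_array L U kb e m
  by unfold_locales (use e e_mono row_mono_le_rows_imp_strict_mono_on in auto)

context insertion
begin

definition true_at :: "((nat \<times> rat) \<times> nat \<Rightarrow> 'm) \<Rightarrow> nat \<times> rat \<Rightarrow> bool" where
  "true_at s q \<longleftrightarrow> P (\<lambda>c. s (q, c))"

lemma true_at_cong:
  assumes "s \<in> envs" "s' \<in> envs" "\<And>c. c < m \<Longrightarrow> s (q, c) = s' (q', c)"
  shows "true_at s q \<longleftrightarrow> true_at s' q'"
  unfolding true_at_def by (rule definable_local[OF P]) (use assms envsD in \<open>auto intro!: envsI\<close>)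

lemma true_at_agree: "s \<in> envs \<Longrightarrow> s' \<in> envs \<Longrightarrow> agree D s s' \<Longrightarrow> q \<in> D \<Longrightarrow> true_at s q \<longleftrightarrow> true_at s' q"
  by (rule true_at_cong) (auto dest: agreeD)

lemma tp_eq_strict_mono_on:
  fixes f g :: "nat \<Rightarrow> nat \<times> rat"
  assumes "strict_mono_on S f" "strict_mono_on S g"
  shows "tp_eq {} (S \<times> {..<m}) (e \<circ> lift f) (e \<circ> lift g)"
proof -
  note inv = inv_into_f_f[OF strict_mono_on_imp_inj_on[OF assms(1)]]
  have "strict_mono_on (f ` S) (g \<circ> inv_into S f)"
    by (rule strict_mono_onI) (use strict_mono_on_less[OF assms(1)] strict_mono_onD[OF assms(2)] in \<open>auto simp: inv\<close>)
  from tp_eq_reindex[OF e_mono[OF this] lift_times, of S f]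
  have "tp_eq {} (S \<times> {..<m}) (e \<circ> lift f) (e \<circ> lift (g \<circ> inv_into S f) \<circ> lift f)" by simp
  moreover have "tp_eq {} (S \<times> {..<m}) (e \<circ> lift (g \<circ> inv_into S f) \<circ> lift f) (e \<circ> lift g)"
    by (rule tp_eq_agree) (use e inv in \<open>auto intro!: envs_comp\<close>)
  ultimately show ?thesis by (rule tp_eq_trans)
qed

definition truth_change_bound :: "nat \<Rightarrow> bool" where
  "truth_change_bound N \<longleftrightarrow> (\<forall>D s f. copy_on D s \<and> strict_mono_on {..<2 * N} f \<and> f ` {..<2 * N} \<subseteq> D \<longrightarrow>
    \<not> alternates N (\<lambda>i. true_at s (f i)))"

lemma ex_truth_change_bound: "\<exists>N. truth_change_bound N"
proof -
  define g where "g i = (0 :: nat, of_nat i :: rat)" for i :: nat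
  have g: "strict_mono_on S (g \<circ> \<tau>)" if "strict_mono_on S \<tau>" for S and \<tau> :: "nat \<Rightarrow> nat"
    by (rule strict_mono_onI) (use strict_mono_onD[OF that] in \<open>simp add: g_def less_prod_def\<close>)
  note g_id = g[of _ id, simplified comp_id]
  have "tp_eq {} (S \<times> {..<m}) (e \<circ> lift g) (e \<circ> lift g \<circ> map_prod \<tau> id)"
    if "strict_mono_on S \<tau>" for S and \<tau> :: "nat \<Rightarrow> nat"
    using tp_eq_strict_mono_on[OF g_id g[OF that]] by (simp add: strict_mono_on_def comp_assoc map_prod.comp)
  from nip_bounded_alternation_over[OF envs_comp[OF e] _ P A this]
  obtain N where N: "\<forall>w\<in>envs. tp_eq {} ({..<2 * N} \<times> {..<m}) w (e \<circ> lift g) \<longrightarrow>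
      \<not> alternates N (\<lambda>i. P (\<lambda>x. w (i, x)))" by auto
  have "\<not> alternates N (\<lambda>i. true_at s (f i))"
    if s: "copy_on D s" and f: "strict_mono_on {..<2 * N} f" "f ` {..<2 * N} \<subseteq> D" for D s f
  proof -
    have "tp_eq {} ({..<2 * N} \<times> {..<m}) (s \<circ> lift f) (e \<circ> lift f)"
      by (rule tp_eq_reindex[of _ "D \<times> {..<m}"]) (use s f(2) in \<open>auto simp: copy_on_def\<close>)
    hence "tp_eq {} ({..<2 * N} \<times> {..<m}) (s \<circ> lift f) (e \<circ> lift g)"
      using tp_eq_trans tp_eq_strict_mono_on[OF f(1) g_id] by (auto simp: strict_mono_on_def)
    hence "\<not> alternates N (\<lambda>i. P (\<lambda>c. (s \<circ> lift f) (i, c)))" using N envs_comp[OF copy_on_env[OF s]] by blast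
    thus ?thesis by (simp add: true_at_def)
  qed
  thus ?thesis unfolding truth_change_bound_def by blast
qed

definition far :: "nat \<Rightarrow> (nat \<times> rat) set" where "far N = {(k, q). k < N \<and> 1 < \<bar>q\<bar>}"

text \<open>A finite sequence in the gap of row \<open>k\<close> such that \<open>P\<close> is false on every element inserted inside it.\<close>

definition false_box :: "nat \<Rightarrow> nat \<Rightarrow> rat set \<Rightarrow> rat \<Rightarrow> ((nat \<times> rat) \<times> nat \<Rightarrow> 'm) \<Rightarrow> bool" where
  "false_box N k X g s \<longleftrightarrow> finite X \<and> X \<subseteq> {-1<..<1} \<and> g \<in> {-1<..<1} - X \<and> agree (far N) s e \<and>
     copy_on (far N \<union> {k} \<times> X) s \<and>
     (\<forall>s'. agree (far N \<union> {k} \<times> X) s' s \<and> copy_on (far N \<union> {k} \<times> insert g X) s' \<longrightarrow> \<not> true_at s' (k, g))"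

lemma strict_mono_half_steps: "strict_mono (\<lambda>i :: nat. (i div 2, if even i then - 2 else 0 :: rat))"
proof (rule strict_monoI)
  fix i j :: nat assume "i < j"
  hence "i div 2 < j div 2 \<or> (i div 2 = j div 2 \<and> even i \<and> odd j)" by presburger
  thus "(i div 2, if even i then - 2 else 0 :: rat) < (j div 2, if even j then - 2 else 0)"
    by (auto simp: less_prod_def)
qed

lemma ex_true_at_centers:
  assumes N: "truth_change_bound N" and s: "copy_on (far N \<union> {..<N} \<times> {0}) s" "agree (far N) s e"
  shows "\<exists>k<N. true_at s (k, 0)"
proof (rule ccontr)
  assume "\<not> ?thesis"
  hence false: "\<not> true_at s (k, 0)" if "k < N" for k using that by blast
  define f where "f i = (i div 2, if even i then - 2 else 0 :: rat)" for i :: nat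
  have "\<not> alternates N (\<lambda>i. true_at s (f i))"
  proof (rule N[unfolded truth_change_bound_def, rule_format], intro conjI)
    show "copy_on (far N \<union> {..<N} \<times> {0}) s" by (rule s(1))
    show "strict_mono_on {..<2 * N} f"
      using strict_mono_half_steps unfolding f_def[abs_def] by (rule monotone_on_subset) simp
    show "f ` {..<2 * N} \<subseteq> far N \<union> {..<N} \<times> {0}" by (auto simp: f_def far_def split: if_splits)
  qed
  moreover have "true_at s (f i) \<longleftrightarrow> even i" if "i < 2 * N" for i
  proof (cases "even i")
    case True
    hence "f i \<in> far N" using that by (auto simp: f_def far_def)
    hence "true_at s (f i) \<longleftrightarrow> true_at e (f i)" using true_at_agree[OF copy_on_env[OF s(1)] e s(2)] by blast
    thus ?thesis using P_e True by (simp add: true_at_def)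
  next
    case False
    thus ?thesis using false that by (simp add: f_def)
  qed
  ultimately show False by (simp add: alternates_def)
qed

lemma ex_false_copy:
  assumes Y: "finite Y" "Y \<subseteq> {-1<..<1}"
  shows "\<exists>s. agree (far N) s e \<and> copy_on (far N \<union> {k} \<times> Y) s \<and> (\<forall>y\<in>Y. \<not> true_at s (k, y))"
proof -
  have "\<exists>s\<in>envs. (\<forall>v\<in>far N \<times> {..<m}. s v = e v) \<and> tp_eq {} ((far N \<union> {k} \<times> Y) \<times> {..<m}) s e \<and>
      (\<forall>x\<in>{k} \<times> Y. \<not> P (\<lambda>c. s (x, c)))"
  proof (rule insert_false)
    show "finite ({k} \<times> Y)" using Y by simp
    fix q assume "q \<in> far N"
    then obtain l x where q: "q = (l, x)" "x < - 1 \<or> 1 < x" by (auto simp: far_def abs_if split: if_splits)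
    moreover have "- 1 < y \<and> y < 1" if "y \<in> Y" for y using Y(2) that by auto
    ultimately show "(\<forall>x\<in>{k} \<times> Y. q < x) \<or> (\<forall>x\<in>{k} \<times> Y. x < q)"
      by (cases l k rule: linorder_cases) (fastforce simp: less_prod_def)+
  qed
  thus ?thesis by (auto simp: agree_iff copy_on_def true_at_def)
qed

lemma ex_false_box:
  assumes N: "truth_change_bound N" and k: "k < N"
  shows "\<exists>X g s. false_box N k X g s"
proof (rule ccontr)
  assume no: "\<not> ?thesis"
  define y :: "nat \<Rightarrow> rat" where "y i = of_nat i / of_nat (2 * N)" for i
  have y_range: "y i \<in> {-1<..<1}" if "i < 2 * N" for i
    using that k by (auto simp: y_def divide_less_eq_1 intro: less_le_trans[of _ 0])
  have y_mono: "y i < y j" if "i < j" for i j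
    unfolding y_def using that k by (intro divide_strict_right_mono) auto
  have y_eq: "y i = y j \<longleftrightarrow> i = j" for i j using y_mono[of i j] y_mono[of j i] by (cases i j rule: linorder_cases) auto
  define I where "I j = {i. i < 2 * N \<and> (odd i \<or> i < 2 * j)}" for j
  define Y where "Y j = y ` I j" for j
  have Y: "finite (Y j)" "Y j \<subseteq> {-1<..<1}" for j using y_range by (auto simp: Y_def I_def)
  have "\<exists>s. agree (far N) s e \<and> copy_on (far N \<union> {k} \<times> Y j) s \<and> (\<forall>i\<in>I j. true_at s (k, y i) \<longleftrightarrow> even i)"
    if "j \<le> N" for j
    using that
  proof (induction j)
    case 0
    obtain s where "agree (far N) s e" "copy_on (far N \<union> {k} \<times> Y 0) s" "\<forall>y\<in>Y 0. \<not> true_at s (k, y)"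
      using ex_false_copy[OF Y] by blast
    thus ?case by (intro exI[of _ s]) (auto simp: Y_def I_def)
  next
    case (Suc j)
    then obtain s where s: "agree (far N) s e" "copy_on (far N \<union> {k} \<times> Y j) s" "\<forall>i\<in>I j. true_at s (k, y i) \<longleftrightarrow> even i"
      by auto
    have "2 * j < 2 * N" "2 * j \<notin> I j" using Suc.prems by (auto simp: I_def)
    hence "y (2 * j) \<in> {-1<..<1} - Y j" using y_range y_eq by (auto simp: Y_def)
    moreover have "\<not> false_box N k (Y j) (y (2 * j)) s" using no by blast
    ultimately obtain s' where s': "agree (far N \<union> {k} \<times> Y j) s' s"
      "copy_on (far N \<union> {k} \<times> insert (y (2 * j)) (Y j)) s'" "true_at s' (k, y (2 * j))"
      using Y s(1,2) by (auto simp: false_box_def)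
    have I: "I (Suc j) = insert (2 * j) (I j)" using Suc.prems unfolding I_def by (auto elim!: evenE)
    have "agree (far N) s' e" by (rule agree_trans[OF agree_mono[OF s'(1)] s(1)]) auto
    moreover have "true_at s' (k, y i) \<longleftrightarrow> even i" if "i \<in> I j" for i
      using true_at_agree[OF copy_on_env[OF s'(2)] copy_on_env[OF s(2)] s'(1), of "(k, y i)"] s(3) that
      by (auto simp: Y_def)
    ultimately show ?case using s'(2,3) by (intro exI[of _ s']) (auto simp: I Y_def)
  qed
  then obtain s where s: "copy_on (far N \<union> {k} \<times> Y N) s" "\<forall>i\<in>I N. true_at s (k, y i) \<longleftrightarrow> even i" by blast
  have "\<not> alternates N (\<lambda>i. true_at s (k, y i))"
  proof (rule N[unfolded truth_change_bound_def, rule_format], intro conjI)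
    show "copy_on (far N \<union> {k} \<times> Y N) s" by (rule s(1))
    show "strict_mono_on {..<2 * N} (\<lambda>i. (k, y i))" by (rule strict_mono_onI) (simp add: less_prod_def y_mono)
    show "(\<lambda>i. (k, y i)) ` {..<2 * N} \<subseteq> far N \<union> {k} \<times> Y N" by (auto simp: Y_def I_def)
  qed
  thus False using s(2) by (simp add: alternates_def I_def)
qed

lemma ex_strict_mono_moving_to_0:
  assumes "\<bar>g\<bar> < (1 :: rat)"
  shows "\<exists>t. strict_mono t \<and> (\<forall>q. 1 \<le> \<bar>q\<bar> \<longrightarrow> t q = q) \<and> t g = 0"
proof -
  have "\<exists>t. strict_mono t \<and> (\<forall>q. 1 \<le> \<bar>q - 0\<bar> \<longrightarrow> t q = q) \<and>
      (\<forall>x. \<bar>x\<bar> \<le> 1 \<longrightarrow> t (affine g ((1 - \<bar>g\<bar>) / 2) x) = affine 0 (1 / 2) x)"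
    by (rule ex_strict_mono_moving_interval) (use assms in \<open>auto simp: field_simps\<close>)
  thus ?thesis by (metis affine_0 abs_zero diff_zero zero_le_one)
qed

lemma false_box_recenter:
  assumes box: "false_box N k X g s"
  shows "\<exists>X' s'. false_box N k X' 0 s'"
proof -
  have "\<bar>g\<bar> < 1" using box by (auto simp: false_box_def)
  then obtain t where t: "strict_mono t" "\<And>q. 1 \<le> \<bar>q\<bar> \<Longrightarrow> t q = q" "t g = 0"
    using ex_strict_mono_moving_to_0 by blast
  have t_range: "t x \<in> {-1<..<1}" if "x \<in> {-1<..<1}" for x
    using strict_monoD[OF t(1), of "- 1" x] strict_monoD[OF t(1), of x 1] t(2)[of 1] t(2)[of "- 1"] that by auto
  define \<tau> where "\<tau> q = (if fst q = k then (k, t (snd q)) else q)" for q :: "nat \<times> rat"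
  have \<tau>: "row_mono le_rows le_rows S \<tau>" for S
    by (rule row_mono_le_rowsI) (use strict_monoD[OF t(1)] in \<open>auto simp: \<tau>_def\<close>)
  have \<tau>_far: "\<tau> q = q" if "q \<in> far N" for q using that t(2) by (auto simp: \<tau>_def far_def)
  let ?S = "far N \<union> {k} \<times> X"
  have img: "\<tau> ` (far N \<union> {k} \<times> Z) = far N \<union> {k} \<times> t ` Z" for Z
  proof -
    have "\<tau> ` far N = far N" using \<tau>_far by force
    moreover have "\<tau> ` ({k} \<times> Z) = {k} \<times> t ` Z" by (force simp: \<tau>_def)
    ultimately show ?thesis by (simp add: image_Un)
  qed
  define u where "u = inv_into ?S \<tau>"
  have "inj_on \<tau> ?S" by (rule row_mono_inj[OF \<tau> _ Linear_order_le_rel, of _ UNIV]) auto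
  hence u: "u (\<tau> q) = q" if "q \<in> ?S" for q
    unfolding u_def using that by (rule inv_into_f_f)
  have "row_mono le_rows le_rows (\<tau> ` ?S) (id \<circ> u)"
    unfolding u_def
    by (rule row_mono_inv_into[OF \<tau> row_mono_id[of _ UNIV], where X = UNIV]) auto
  hence copy: "copy_on (far N \<union> {k} \<times> t ` X) (s \<circ> lift u)"
    using box u unfolding false_box_def img[symmetric] by (intro copy_on_reindex[of ?S]) auto
  have "agree (far N) (s \<circ> lift u) e"
    using box u \<tau>_far unfolding false_box_def agree_def by (metis Un_iff comp_apply id_apply map_prod_simp)
  moreover have "\<not> true_at z (k, 0)"
    if z: "agree (far N \<union> {k} \<times> t ` X) z (s \<circ> lift u)" "copy_on (far N \<union> {k} \<times> insert 0 (t ` X)) z" for z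
  proof -
    have "copy_on (far N \<union> {k} \<times> insert g X) (z \<circ> lift \<tau>)"
      by (rule copy_on_reindex[OF z(2) \<tau>]) (simp only: img image_insert t(3) order_refl)
    moreover have "agree ?S (z \<circ> lift \<tau>) s"
      using z(1) u unfolding img[symmetric] by (auto simp: agree_def)
    ultimately have "\<not> true_at (z \<circ> lift \<tau>) (k, g)" using box unfolding false_box_def by blast
    moreover have "true_at (z \<circ> lift \<tau>) (k, g) \<longleftrightarrow> true_at z (k, 0)"
      by (rule true_at_cong) (use copy_on_env[OF z(2)] t(3) in \<open>auto simp: \<tau>_def intro: envs_comp\<close>)
    ultimately show ?thesis by simp
  qed
  moreover have "finite (t ` X)" "t ` X \<subseteq> {-1<..<1}" "0 \<notin> t ` X"
    using box t_range t(3) strict_mono_eq[OF t(1)] unfolding false_box_def by (auto, metis)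
  ultimately show ?thesis using copy unfolding false_box_def by (intro exI[of _ "t ` X"] exI[of _ "s \<circ> lift u"]) auto
qed

lemma false_box_extend:
  assumes box: "false_box N k X g s" and X': "X \<subseteq> X'" "finite X'" "X' \<subseteq> {-1<..<1} - {g}"
  shows "\<exists>s'. false_box N k X' g s'"
proof -
  obtain s' where s': "agree (far N \<union> {k} \<times> X) s' s" "copy_on (far N \<union> {k} \<times> X') s'"
    using copy_on_extend[of "far N \<union> {k} \<times> X" s "far N \<union> {k} \<times> X'"] box X'(1) unfolding false_box_def by blast
  have "\<not> true_at z (k, g)"
    if "agree (far N \<union> {k} \<times> X') z s'" "copy_on (far N \<union> {k} \<times> insert g X') z" for z
  proof -
    have "agree (far N \<union> {k} \<times> X) z s" by (rule agree_trans[OF agree_mono[OF that(1)] s'(1)]) (use X'(1) in auto)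
    moreover have "copy_on (far N \<union> {k} \<times> insert g X) z" by (rule copy_on_mono[OF that(2)]) (use X'(1) in auto)
    ultimately show ?thesis using box unfolding false_box_def by blast
  qed
  moreover have "agree (far N) s' e"
    using agree_trans[OF agree_mono[OF s'(1)]] box unfolding false_box_def by blast
  ultimately show ?thesis using X' box s'(2) unfolding false_box_def by blast
qed

lemma obstructed_if_false_boxes:
  assumes N: "truth_change_bound N" and X: "finite X" "X \<subseteq> {-1<..<1} - {0}" and box: "\<And>k. k < N \<Longrightarrow> false_box N k X 0 (s k)"
  shows "obstructed N"
proof -
  define K where "K v = (if fst v \<in> {..<N} \<times> X then s (fst (fst v)) v else e v)" for v
  have s: "agree (far N) (s k) e" "copy_on (far N \<union> {k} \<times> X) (s k)" if "k < N" for k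
    using box[OF that] by (simp_all add: false_box_def)
  have K: "K \<in> envs"
    using envsD[OF e] envsD[OF copy_on_env[OF s(2)]] by (intro envsI) (auto simp: K_def)
  have X_far: "(k, x) \<notin> far N" if "x \<in> X" for k x using X(2) that by (auto simp: far_def abs_if split: if_splits)
  have K_far: "agree (far N) K e" by (rule agreeI) (use X_far in \<open>auto simp: K_def\<close>)
  have K_s: "agree (far N \<union> {k} \<times> X) K (s k)" if k: "k < N" for k
  proof (rule agreeI)
    fix q c assume "q \<in> far N \<union> {k} \<times> X" "c < m"
    thus "K (q, c) = s k (q, c)"
      using K_far s(1)[OF k] k by (cases "q \<in> far N") (auto simp: agree_def, auto simp: K_def)
  qed
  have false: "\<not> true_at z (k, 0)" if z: "inserts_rowwise N 0 (far N) X K z" and k: "k < N" for k z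
  proof -
    have "agree (far N \<union> {k} \<times> X) z (s k)"
      by (rule agree_trans[OF agree_mono[of "far N \<union> {..<N} \<times> X"] K_s[OF k]])
        (use z k in \<open>auto simp: inserts_rowwise_def\<close>)
    thus ?thesis using box[OF k] z k unfolding false_box_def inserts_rowwise_def by blast
  qed
  have "\<not> (\<exists>z. inserts_rowwise N 0 (far N) X K z \<and> copy_on (far N \<union> {..<N} \<times> {0}) z)"
  proof (intro notI, elim exE conjE)
    fix z assume z: "inserts_rowwise N 0 (far N) X K z" "copy_on (far N \<union> {..<N} \<times> {0}) z"
    have "agree (far N) z e"
      by (rule agree_trans[OF agree_mono[of "far N \<union> {..<N} \<times> X"] K_far])
        (use z(1) in \<open>auto simp: inserts_rowwise_def\<close>)
    thus False using ex_true_at_centers[OF N z(2)] false[OF z(1)] by blast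
  qed
  moreover have "copy_on (far N) K"
    using copy_on_agree[of "far N" e] e K K_far by (simp add: copy_on_def tp_eq_refl)
  moreover have "copy_on (far N \<union> {k} \<times> X) K" if "k < N" for k
    by (rule copy_on_agree[OF s(2)[OF that] K K_s[OF that]])
  moreover have "has_gap N 0 1 1 (far N)" by (auto simp: has_gap_def far_def)
  moreover have "affine 0 1 ` X = X" "X \<subseteq> {-1..1} - {0}" using X(2) by (auto simp: affine_def)
  ultimately show ?thesis
    using X(1) unfolding obstructed_def
    by (intro exI[of _ 0] exI[of _ 1] exI[of _ "far N"] exI[of _ X] exI[of _ K]) simp
qed

theorem insertion_impossible: False
proof -
  obtain N where N: "truth_change_bound N" using ex_truth_change_bound by blast
  have "\<exists>X s. false_box N k X 0 s" if "k < N" for k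
    using ex_false_box[OF N that] false_box_recenter by blast
  hence "\<forall>k. \<exists>X. k < N \<longrightarrow> (\<exists>s. false_box N k X 0 s)" by blast
  from choice[OF this] obtain X where box: "\<forall>k<N. \<exists>s. false_box N k (X k) 0 s" by (elim exE)
  define X' where "X' = (\<Union>k<N. X k)"
  have X': "finite X'" "X' \<subseteq> {-1<..<1} - {0}" using box by (auto simp: X'_def false_box_def)
  have "\<forall>k. \<exists>s. k < N \<longrightarrow> false_box N k X' 0 s"
  proof (intro allI)
    fix k show "\<exists>s. k < N \<longrightarrow> false_box N k X' 0 s"
    proof (cases "k < N")
      case True
      hence "X k \<subseteq> X'" by (auto simp: X'_def)
      thus ?thesis using false_box_extend[OF _ _ X'] box True by blast
    qed simp
  qed
  from choice[OF this] obtain s where s: "\<forall>k. k < N \<longrightarrow> false_box N k X' 0 (s k)" by (elim exE)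
  show False
    using obstructed_if_false_boxes[OF N X', of s] s not_obstructed by blast
qed

end

subsection \<open>Single sequences along increasing maps\<close>

definition increasing_on :: "'i rel \<Rightarrow> 'q::linorder set \<Rightarrow> ('q \<Rightarrow> 'i) \<Rightarrow> bool" where
  "increasing_on r S f \<longleftrightarrow> (\<forall>x\<in>S. f x \<in> Field r) \<and> (\<forall>x\<in>S. \<forall>y\<in>S. x < y \<longrightarrow> (f x, f y) \<in> r \<and> f x \<noteq> f y)"

lemma increasing_onD:
  assumes "increasing_on r S f" "x \<in> S"
  shows "f x \<in> Field r" "y \<in> S \<Longrightarrow> x < y \<Longrightarrow> (f x, f y) \<in> r \<and> f x \<noteq> f y"
  using assms by (auto simp: increasing_on_def)

lemma increasing_on_comp:
  "increasing_on r (\<tau> ` S) f \<Longrightarrow> strict_mono_on S \<tau> \<Longrightarrow> increasing_on r S (f \<circ> \<tau>)"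
  by (auto simp: increasing_on_def dest: strict_mono_onD)

lemma increasing_on_subset: "increasing_on r S f \<Longrightarrow> S' \<subseteq> S \<Longrightarrow> increasing_on r S' f"
  by (auto simp: increasing_on_def)

lemma increasing_on_row_mono:
  assumes "increasing_on r S f"
  shows "row_mono le_rows (\<lambda>_. r) ({()} \<times> S) (\<lambda>p. (fst p, f (snd p)))"
  by (rule row_monoI) (use increasing_onD[OF assms] in \<open>auto simp: less_le\<close>)

lemma ex_increasing_on:
  fixes F :: "'q::linorder set"
  assumes F: "finite F" and r: "Linear_order r" and G: "G \<subseteq> Field r" "infinite G"
  shows "\<exists>f. increasing_on r F f \<and> f ` F \<subseteq> G"
proof -
  obtain G0 where G0: "G0 \<subseteq> G" "finite G0" "card G0 = card F"
    using infinite_arbitrarily_large[OF G(2)] by blast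
  obtain us where us: "set us = G0" "increasing r us"
    using ex_increasing[OF G0(2) _ r] G0(1) G(1) by auto
  have len: "card F \<le> length us" using us(1) G0(3) card_length[of us] by simp
  define rank where "rank x = card {y \<in> F. y < x}" for x
  have rank: "rank x < length us" if "x \<in> F" for x
    unfolding rank_def by (rule less_le_trans[OF psubset_card_mono[OF F] len]) (use that in auto)
  have rank_less: "rank x < rank y" if "x \<in> F" "x < y" for x y
    unfolding rank_def by (rule psubset_card_mono) (use F that in auto)
  have "us ! rank x \<in> G" if "x \<in> F" for x using nth_mem[OF rank[OF that]] us(1) G0(1) by auto
  moreover have "(us ! rank x, us ! rank y) \<in> r \<and> us ! rank x \<noteq> us ! rank y" if "x \<in> F" "y \<in> F" "x < y" for x y
    using increasing_nth[OF us(2) rank_less[OF that(1,3)] rank[OF that(2)]] by auto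
  ultimately show ?thesis using G(1) by (intro exI[of _ "\<lambda>x. us ! rank x"]) (auto simp: increasing_on_def)
qed

lemma ex_increasing_on_cut:
  fixes D X :: "'q::linorder set"
  assumes D: "finite D" and X: "finite X" and cut: "\<And>q. q \<in> D \<Longrightarrow> (\<forall>x\<in>X. q < x) \<or> (\<forall>x\<in>X. x < q)"
    and lin: "Linear_order (fst J0)" "Linear_order (fst I)" "Linear_order (fst J1)"
    and inf: "infinite (idx J0)" "infinite (idx J1)" and F: "F \<subseteq> idx I" "infinite F"
  shows "\<exists>f g. increasing_on (fst (J0 \<oplus>\<^sub>s I \<oplus>\<^sub>s J1)) (D \<union> X) f \<and> increasing_on (fst (J0 \<oplus>\<^sub>s J1)) D g \<and>
    (\<forall>q\<in>D. f q = map_sum Inl id (g q)) \<and> f ` X \<subseteq> Inl ` Inr ` F"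
proof -
  obtain j0 where j0: "increasing_on (fst J0) D j0" using ex_increasing_on[OF D lin(1) order_refl inf(1)] by blast
  obtain j1 where j1: "increasing_on (fst J1) D j1" using ex_increasing_on[OF D lin(3) order_refl inf(2)] by blast
  obtain i where i: "increasing_on (fst I) X i" "i ` X \<subseteq> F" using ex_increasing_on[OF X lin(2) F] by blast
  define g where "g q = (if \<forall>x\<in>X. q < x then Inl (j0 q) else Inr (j1 q))" for q
  define f where "f q = (if q \<in> X then Inl (Inr (i q)) else map_sum Inl id (g q))" for q
  have DX: "q \<notin> X" if "q \<in> D" for q using cut[OF that] by blast
  have "increasing_on (fst (J0 \<oplus>\<^sub>s J1)) D g"
    unfolding increasing_on_def
  proof (intro conjI ballI impI)
    show "g q \<in> Field (fst (J0 \<oplus>\<^sub>s J1))" if "q \<in> D" for q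
      using increasing_onD(1)[OF j0 that] increasing_onD(1)[OF j1 that] by (auto simp: g_def)
    fix p q assume "p \<in> D" "q \<in> D" "p < q"
    thus "(g p, g q) \<in> fst (J0 \<oplus>\<^sub>s J1)" "g p \<noteq> g q"
      using increasing_onD[OF j0, of p] increasing_onD[OF j1, of p] increasing_onD(1)[OF j1, of q] less_trans[of p q]
      by (auto simp: g_def)
  qed
  moreover have "increasing_on (fst (J0 \<oplus>\<^sub>s I \<oplus>\<^sub>s J1)) (D \<union> X) f"
    unfolding increasing_on_def
  proof (intro conjI ballI impI)
    fix q assume "q \<in> D \<union> X"
    thus "f q \<in> Field (fst (J0 \<oplus>\<^sub>s I \<oplus>\<^sub>s J1))"
      using increasing_onD(1)[OF i(1)] increasing_onD(1)[OF j0] increasing_onD(1)[OF j1]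
      by (auto simp: f_def g_def)
  next
    fix p q assume "p \<in> D \<union> X" "q \<in> D \<union> X" and pq: "p < q"
    then consider "p \<in> X" "q \<in> X" | "p \<in> D" "q \<in> D" | "p \<in> X" "q \<in> D" "\<not> (\<forall>x\<in>X. q < x)" | "p \<in> D" "q \<in> X" "\<forall>x\<in>X. p < x"
      using cut by (metis UnE less_asym)
    hence "(f p, f q) \<in> fst (J0 \<oplus>\<^sub>s I \<oplus>\<^sub>s J1) \<and> f p \<noteq> f q"
    proof cases
      case 2
      thus ?thesis using increasing_onD(2)[OF \<open>increasing_on _ D g\<close> 2 pq] DX
        by (cases "g p"; cases "g q") (auto simp: f_def)
    qed (use pq DX increasing_onD[OF i(1)] increasing_onD(1)[OF j0] increasing_onD(1)[OF j1] in
        \<open>auto simp: f_def g_def\<close>)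
    thus "(f p, f q) \<in> fst (J0 \<oplus>\<^sub>s I \<oplus>\<^sub>s J1)" "f p \<noteq> f q" by auto
  qed
  moreover have "f ` X \<subseteq> Inl ` Inr ` F" using i(2) by (auto simp: f_def)
  ultimately show ?thesis using DX by (intro exI[of _ f] exI[of _ g]) (auto simp: f_def)
qed

context monster
begin

definition seq_vals :: "nat \<Rightarrow> ('i, 'm) tseq \<Rightarrow> 'i \<times> nat \<Rightarrow> 'm" where
  "seq_vals m I v = seq_env {()} (\<lambda>_. m) (\<lambda>_. I) (((), fst v), snd v)"

lemma seq_vals:
  assumes "sequence_of U m I"
  shows "seq_vals m I \<in> envs" "t \<in> idx I \<Longrightarrow> c < m \<Longrightarrow> seq_vals m I (t, c) = snd I t ! c"
proof -
  have rep: "represents {()} (\<lambda>_. m) (\<lambda>_. I) (seq_env {()} (\<lambda>_. m) (\<lambda>_. I))"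
    by (rule represents_seq_env) (rule assms)
  show "seq_vals m I \<in> envs" using envsD[OF representsD(1)[OF rep]] by (intro envsI) (simp add: seq_vals_def)
  show "t \<in> idx I \<Longrightarrow> c < m \<Longrightarrow> seq_vals m I (t, c) = snd I t ! c"
    using representsD(3)[OF rep] by (simp add: seq_vals_def)
qed

lemma indiscernible_increasing_on:
  fixes I :: "('i, 'm) tseq" and S :: "'q::linorder set"
  assumes ind: "indiscernible L U A I" and seq: "sequence_of U m I"
    and f: "increasing_on (fst I) S f" and g: "increasing_on (fst I) S g"
  shows "tp_eq A (S \<times> {..<m}) (seq_vals m I \<circ> lift f) (seq_vals m I \<circ> lift g)"
proof -
  let ?h = "seq_env {()} (\<lambda>_. m) (\<lambda>_. I)"
  have rep: "represents {()} (\<lambda>_. m) (\<lambda>_. I) ?h" by (rule represents_seq_env) (rule seq)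
  have "mut_indisc A {()} (\<lambda>_. fst I) (\<lambda>_. m) ?h"
    by (rule indiscernible_imp_mut_indisc[where I = "\<lambda>_. I"]) (use ind rep in auto)
  hence "tp_eq A (coords (\<lambda>_. m) ({()} \<times> S)) (?h \<circ> lift (\<lambda>p. (fst p, f (snd p)))) (?h \<circ> lift (\<lambda>p. (fst p, g (snd p))))"
    by (rule mut_indisc_row_mono[where r' = le_rows])
      (use representsD(1,5)[OF rep] increasing_on_row_mono f g in auto)
  hence "tp_eq A (S \<times> {..<m}) (?h \<circ> lift (\<lambda>p. (fst p, f (snd p))) \<circ> (\<lambda>v. (((), fst v), snd v)))
      (?h \<circ> lift (\<lambda>p. (fst p, g (snd p))) \<circ> (\<lambda>v. (((), fst v), snd v)))"
    by (rule tp_eq_reindex) (auto simp: coords_def)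
  moreover have "?h \<circ> lift (\<lambda>p. (fst p, k (snd p))) \<circ> (\<lambda>v. (((), fst v), snd v)) = seq_vals m I \<circ> lift k" for k :: "'q \<Rightarrow> 'i"
    by (rule ext) (simp add: seq_vals_def)
  ultimately show ?thesis by simp
qed

definition stretches :: "'m set \<Rightarrow> nat \<Rightarrow> ('i, 'm) tseq \<Rightarrow> ('q::linorder \<times> nat \<Rightarrow> 'm) \<Rightarrow> bool" where
  "stretches A m I e \<longleftrightarrow> e \<in> envs \<and>
     (\<forall>S f. finite S \<and> increasing_on (fst I) S f \<longrightarrow> tp_eq A (S \<times> {..<m}) e (seq_vals m I \<circ> lift f))"

lemma stretchesD:
  assumes "stretches A m I e"
  shows "e \<in> envs" "finite S \<Longrightarrow> increasing_on (fst I) S f \<Longrightarrow> tp_eq A (S \<times> {..<m}) e (seq_vals m I \<circ> lift f)"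
  using assms by (auto simp: stretches_def)

lemma ex_stretches:
  fixes I :: "('i, 'm) tseq"
  assumes ind: "indiscernible L U A I" and seq: "sequence_of U m I" and inf: "infinite (idx I)"
    and A: "|A| <o kb" "A \<subseteq> univ U"
  shows "\<exists>e :: 'q::{linorder, countable} \<times> nat \<Rightarrow> 'm. stretches A m I e"
proof -
  let ?h = "seq_env {()} (\<lambda>_. m) (\<lambda>_. I)"
  have rep: "represents {()} (\<lambda>_. m) (\<lambda>_. I) ?h" by (rule represents_seq_env) (rule seq)
  have mi: "mut_indisc A {()} (\<lambda>_. fst I) (\<lambda>_. m) ?h"
    by (rule indiscernible_imp_mut_indisc[where I = "\<lambda>_. I"]) (use ind rep in auto)
  have "\<exists>h'\<in>envs. mut_indisc A {()} (le_rows :: unit \<Rightarrow> 'q rel) (\<lambda>_. m) h' \<and>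
    (\<forall>S \<sigma>. S \<subseteq> positions {()} (le_rows :: unit \<Rightarrow> 'q rel) \<longrightarrow> row_mono le_rows (\<lambda>_. fst I) S \<sigma> \<longrightarrow>
      tp_eq A (coords (\<lambda>_. m) S) h' (?h \<circ> lift \<sigma>))"
    by (rule mut_indisc_stretch[OF mi representsD(1)[OF rep] order_refl A])
      (use representsD(5)[OF rep] inf in \<open>auto simp: small_finite small_countable\<close>)
  then obtain h' where h': "h' \<in> envs" "\<forall>S \<sigma>. S \<subseteq> positions {()} (le_rows :: unit \<Rightarrow> 'q rel) \<longrightarrow>
      row_mono le_rows (\<lambda>_. fst I) S \<sigma> \<longrightarrow> tp_eq A (coords (\<lambda>_. m) S) h' (?h \<circ> lift \<sigma>)" by (elim bexE conjE)
  define unrow where "unrow = (\<lambda>v :: 'q \<times> nat. (((), fst v), snd v))"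
  have "tp_eq A (S \<times> {..<m}) (h' \<circ> unrow) (seq_vals m I \<circ> lift f)"
    if S: "finite S" and f: "increasing_on (fst I) S f" for S and f :: "'q \<Rightarrow> 'i"
  proof -
    have "tp_eq A (coords (\<lambda>_. m) ({()} \<times> S)) h' (?h \<circ> lift (\<lambda>p. (fst p, f (snd p))))"
      by (rule h'(2)[rule_format]) (use S increasing_on_row_mono[OF f] in auto)
    hence "tp_eq A (S \<times> {..<m}) (h' \<circ> unrow) (?h \<circ> lift (\<lambda>p. (fst p, f (snd p))) \<circ> unrow)"
      by (rule tp_eq_reindex) (auto simp: coords_def unrow_def)
    moreover have "?h \<circ> lift (\<lambda>p. (fst p, f (snd p))) \<circ> unrow = seq_vals m I \<circ> lift f"
      by (rule ext) (simp add: seq_vals_def unrow_def)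
    ultimately show ?thesis by simp
  qed
  thus ?thesis using envs_comp[OF h'(1)] unfolding stretches_def by blast
qed

lemma stretches_strict_mono_on:
  fixes e :: "'q::linorder \<times> nat \<Rightarrow> 'm"
  assumes e: "stretches A m I e" and seq: "sequence_of U m I" and inf: "infinite (idx I)"
    and \<tau>: "strict_mono_on S \<tau>"
  shows "tp_eq A (S \<times> {..<m}) e (e \<circ> lift \<tau>)"
proof (rule tp_eq_finiteI)
  fix V assume V: "finite V" "V \<subseteq> S \<times> {..<m}"
  define S0 where "S0 = fst ` V"
  have S0: "finite S0" "S0 \<subseteq> S" using V by (auto simp: S0_def)
  obtain f where f: "increasing_on (fst I) (S0 \<union> \<tau> ` S0) f"
    using ex_increasing_on[of "S0 \<union> \<tau> ` S0" "fst I" "idx I"] S0(1) seq inf by (auto simp: sequence_of_def)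
  have \<tau>0: "strict_mono_on S0 \<tau>" by (rule monotone_on_subset[OF \<tau> S0(2)])
  have "tp_eq A (\<tau> ` S0 \<times> {..<m}) e (seq_vals m I \<circ> lift f)"
    by (rule stretchesD(2)[OF e]) (use S0(1) increasing_on_subset[OF f] in auto)
  hence "tp_eq A (S0 \<times> {..<m}) (e \<circ> lift \<tau>) (seq_vals m I \<circ> lift f \<circ> lift \<tau>)"
    by (rule tp_eq_reindex) auto
  moreover have "tp_eq A (S0 \<times> {..<m}) e (seq_vals m I \<circ> lift (f \<circ> \<tau>))"
    by (rule stretchesD(2)[OF e S0(1) increasing_on_comp[OF increasing_on_subset[OF f] \<tau>0]]) simp
  moreover have "seq_vals m I \<circ> lift f \<circ> lift \<tau> = seq_vals m I \<circ> lift (f \<circ> \<tau>)" by auto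
  ultimately have "tp_eq A (S0 \<times> {..<m}) e (e \<circ> lift \<tau>)"
    using tp_eq_trans[OF _ tp_eq_sym] by simp
  thus "tp_eq A V e (e \<circ> lift \<tau>)" by (rule tp_eq_mono) (use V in \<open>force simp: S0_def\<close>)+
qed

lemma seq_vals_seq_append:
  assumes seq: "sequence_of U m (J0 \<oplus>\<^sub>s I \<oplus>\<^sub>s J1)" and t: "t \<in> idx (J0 \<oplus>\<^sub>s J1)" and c: "c < m"
  shows "seq_vals m (J0 \<oplus>\<^sub>s I \<oplus>\<^sub>s J1) (map_sum Inl id t, c) = seq_vals m (J0 \<oplus>\<^sub>s J1) (t, c)"
proof -
  have "sequence_of U m (J0 \<oplus>\<^sub>s J1)" using seq by (simp add: sequence_of_append)
  thus ?thesis using t c by (auto simp: seq_vals(2)[OF seq] seq_vals(2))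
qed

lemma increasing_on_map_sum:
  assumes "increasing_on (fst (J0 \<oplus>\<^sub>s J1)) S f"
  shows "increasing_on (fst (J0 \<oplus>\<^sub>s I \<oplus>\<^sub>s J1)) S (\<lambda>q. map_sum Inl id (f q))"
proof -
  have "(map_sum Inl id s, map_sum Inl id t) \<in> fst (J0 \<oplus>\<^sub>s I \<oplus>\<^sub>s J1) \<and> map_sum Inl id s \<noteq> map_sum Inl id t"
    if "(s, t) \<in> fst (J0 \<oplus>\<^sub>s J1)" "s \<noteq> t" for s t
    using that by (cases s; cases t) auto
  moreover have "map_sum Inl id t \<in> idx (J0 \<oplus>\<^sub>s I \<oplus>\<^sub>s J1)" if "t \<in> idx (J0 \<oplus>\<^sub>s J1)" for t
    using that by (cases t) auto
  ultimately show ?thesis using assms unfolding increasing_on_def by blast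
qed

end

context nip_monster
begin

context
  fixes J0 :: "('i, 'm) tseq" and I :: "('j, 'm) tseq" and J1 :: "('l, 'm) tseq"
    and A :: "'m set" and m :: nat and P :: "(nat \<Rightarrow> 'm) \<Rightarrow> bool" and e :: "(nat \<times> rat) \<times> nat \<Rightarrow> 'm"
  assumes inf: "infinite (idx J0)" "infinite (idx J1)"
    and full: "indiscernible L U {} (J0 \<oplus>\<^sub>s I \<oplus>\<^sub>s J1)" and seq: "sequence_of U m (J0 \<oplus>\<^sub>s I \<oplus>\<^sub>s J1)"
    and A: "|A| <o kb" "A \<subseteq> univ U" and P: "definable A {..<m} P"
    and e: "stretches A m (J0 \<oplus>\<^sub>s J1) e" and P_e: "\<And>q. P (\<lambda>c. e (q, c))"
begin

lemma stretches_full: "stretches {} m (J0 \<oplus>\<^sub>s I \<oplus>\<^sub>s J1) e"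
  unfolding stretches_def
proof (intro conjI allI impI, rule stretchesD(1)[OF e], elim conjE)
  fix S :: "(nat \<times> rat) set" and f
  assume S: "finite S" and f: "increasing_on (fst (J0 \<oplus>\<^sub>s I \<oplus>\<^sub>s J1)) S f"
  let ?h = "seq_vals m (J0 \<oplus>\<^sub>s I \<oplus>\<^sub>s J1)"
  have seq': "sequence_of U m (J0 \<oplus>\<^sub>s J1)" using seq by (simp add: sequence_of_append)
  obtain g where g: "increasing_on (fst (J0 \<oplus>\<^sub>s J1)) S g"
    using ex_increasing_on[OF S, of "fst (J0 \<oplus>\<^sub>s J1)" "idx (J0 \<oplus>\<^sub>s J1)"] seq' inf
    by (auto simp: sequence_of_def finite_image_iff)
  have "tp_eq {} (S \<times> {..<m}) e (seq_vals m (J0 \<oplus>\<^sub>s J1) \<circ> lift g)"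
    by (rule tp_eq_mono[OF stretchesD(2)[OF e S g]]) auto
  moreover have "tp_eq {} (S \<times> {..<m}) (seq_vals m (J0 \<oplus>\<^sub>s J1) \<circ> lift g) (?h \<circ> lift (\<lambda>q. map_sum Inl id (g q)))"
    by (rule tp_eq_agree) (use seq_vals(1)[OF seq] seq_vals(1)[OF seq'] increasing_onD(1)[OF g] seq_vals_seq_append[OF seq]
      in \<open>auto intro: envs_comp\<close>)
  moreover have "tp_eq {} (S \<times> {..<m}) (?h \<circ> lift (\<lambda>q. map_sum Inl id (g q))) (?h \<circ> lift f)"
    by (rule indiscernible_increasing_on[OF full seq increasing_on_map_sum[OF g] f])
  ultimately show "tp_eq {} (S \<times> {..<m}) e (?h \<circ> lift f)" using tp_eq_trans by blast
qed

lemma insert_false_finite: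
  assumes F: "infinite {j \<in> idx I. \<not> P (\<lambda>c. seq_vals m I (j, c))}"
    and D: "finite D" and X: "finite X" and cut: "\<And>q. q \<in> D \<Longrightarrow> (\<forall>x\<in>X. q < x) \<or> (\<forall>x\<in>X. x < q)"
  shows "\<exists>s\<in>envs. (\<forall>v\<in>D \<times> {..<m}. s v = e v) \<and> tp_eq {} ((D \<union> X) \<times> {..<m}) s e \<and> (\<forall>x\<in>X. \<not> P (\<lambda>c. s (x, c)))"
proof -
  let ?h = "seq_vals m (J0 \<oplus>\<^sub>s I \<oplus>\<^sub>s J1)"
  have seqs: "sequence_of U m J0" "sequence_of U m I" "sequence_of U m J1" "sequence_of U m (J0 \<oplus>\<^sub>s J1)"
    using seq by (auto simp: sequence_of_append)
  note h = seq_vals(1)[OF seq]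
  have lin: "Linear_order (fst J0)" "Linear_order (fst I)" "Linear_order (fst J1)"
    using seqs by (auto simp: sequence_of_def)
  obtain f g where f: "increasing_on (fst (J0 \<oplus>\<^sub>s I \<oplus>\<^sub>s J1)) (D \<union> X) f"
    and g: "increasing_on (fst (J0 \<oplus>\<^sub>s J1)) D g" "\<forall>q\<in>D. f q = map_sum Inl id (g q)"
    and fX: "f ` X \<subseteq> Inl ` Inr ` {j \<in> idx I. \<not> P (\<lambda>c. seq_vals m I (j, c))}"
    using ex_increasing_on_cut[OF D X cut lin inf _ F] by blast
  have "tp_eq A (D \<times> {..<m}) (?h \<circ> lift f) (seq_vals m (J0 \<oplus>\<^sub>s J1) \<circ> lift g)"
    by (rule tp_eq_agree) (use h seq_vals(1)[OF seqs(4)] increasing_onD(1)[OF g(1)] g(2) seq_vals_seq_append[OF seq]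
      in \<open>auto intro: envs_comp\<close>)
  hence "tp_eq A (D \<times> {..<m}) (?h \<circ> lift f) e"
    using tp_eq_trans tp_eq_sym[OF stretchesD(2)[OF e D g(1)]] by blast
  hence "\<exists>s\<in>envs. (\<forall>v\<in>D \<times> {..<m}. s v = e v) \<and> tp_eq A ((D \<union> X) \<times> {..<m}) s (?h \<circ> lift f)"
    by (intro extend_type) (use A h stretchesD(1)[OF e] in \<open>auto intro: envs_comp small_countable\<close>)
  then obtain s where s: "s \<in> envs" "\<forall>v\<in>D \<times> {..<m}. s v = e v" "tp_eq A ((D \<union> X) \<times> {..<m}) s (?h \<circ> lift f)"
    by (elim bexE conjE)
  have "tp_eq {} ((D \<union> X) \<times> {..<m}) s e"
    using tp_eq_trans[OF tp_eq_mono[OF s(3)] tp_eq_sym[OF stretchesD(2)[OF stretches_full _ f]]] D X by simp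
  moreover have "\<not> P (\<lambda>c. s (x, c))" if x: "x \<in> X" for x
  proof -
    obtain j where j: "f x = Inl (Inr j)" "j \<in> idx I" "\<not> P (\<lambda>c. seq_vals m I (j, c))" using fX x by blast
    have "definable A ((D \<union> X) \<times> {..<m}) (\<lambda>s. P (s \<circ> Pair x))"
      by (rule definable_reindex[OF P]) (use x in auto)
    from tp_eqD[OF s(3) this] have "P (\<lambda>c. s (x, c)) \<longleftrightarrow> P (\<lambda>c. ?h (f x, c))" by (simp add: comp_def)
    also have "\<dots> \<longleftrightarrow> P (\<lambda>c. seq_vals m I (j, c))"
      by (rule definable_local[OF P])
        (use envsD[OF h] envsD[OF seq_vals(1)[OF seqs(2)]] j(1,2) in
          \<open>auto simp: seq_vals(2)[OF seq] seq_vals(2)[OF seqs(2)] intro!: envsI\<close>)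
    finally show ?thesis using j(3) by simp
  qed
  ultimately show ?thesis using s(1,2) by blast
qed

lemma insert_false_infinite:
  assumes F: "infinite {j \<in> idx I. \<not> P (\<lambda>c. seq_vals m I (j, c))}"
    and X: "finite X" and cut: "\<And>q. q \<in> D \<Longrightarrow> (\<forall>x\<in>X. q < x) \<or> (\<forall>x\<in>X. x < q)"
  shows "\<exists>s\<in>envs. (\<forall>v\<in>D \<times> {..<m}. s v = e v) \<and> tp_eq {} ((D \<union> X) \<times> {..<m}) s e \<and> (\<forall>x\<in>X. \<not> P (\<lambda>c. s (x, c)))"
proof -
  let ?V = "(D \<union> X) \<times> {..<m}"
  define \<Sigma>1 where "\<Sigma>1 = {Q. definable {} ?V Q \<and> Q e}"
  define \<Sigma>2 where "\<Sigma>2 = (\<lambda>x s. \<not> P (s \<circ> Pair x)) ` X"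
  have "\<exists>s\<in>envs. (\<forall>v\<in>D \<times> {..<m}. s v = e v) \<and> (\<forall>Q\<in>\<Sigma>1 \<union> \<Sigma>2. Q s)"
  proof (rule realize)
    show "|?V| <o kb" by (rule small_countable) simp
    show "definable A ?V Q" if "Q \<in> \<Sigma>1 \<union> \<Sigma>2" for Q
      using that definable_mono[of "{}" ?V Q A ?V] definable_Neg[OF definable_reindex[OF P, of "Pair _" ?V]]
      by (auto simp: \<Sigma>1_def \<Sigma>2_def)
    fix \<Sigma>0 and V0 :: "((nat \<times> rat) \<times> nat) set"
    assume \<Sigma>0: "finite \<Sigma>0" "\<Sigma>0 \<subseteq> \<Sigma>1 \<union> \<Sigma>2" and V0: "finite V0" "V0 \<subseteq> D \<times> {..<m}"
    have "\<exists>S. finite S \<and> S \<subseteq> ?V \<and> definable {} S Q" if "Q \<in> \<Sigma>0 \<inter> \<Sigma>1" for Q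
      by (rule definable_finite_support) (use that in \<open>auto simp: \<Sigma>1_def\<close>)
    then obtain S where S: "\<And>Q. Q \<in> \<Sigma>0 \<inter> \<Sigma>1 \<Longrightarrow> finite (S Q)" "\<And>Q. Q \<in> \<Sigma>0 \<inter> \<Sigma>1 \<Longrightarrow> S Q \<subseteq> ?V"
      "\<And>Q. Q \<in> \<Sigma>0 \<inter> \<Sigma>1 \<Longrightarrow> definable {} (S Q) Q" by metis
    define D0 where "D0 = fst ` (V0 \<union> (\<Union>Q\<in>\<Sigma>0 \<inter> \<Sigma>1. S Q)) \<inter> D"
    have D0: "finite D0" "D0 \<subseteq> D" "V0 \<subseteq> D0 \<times> {..<m}" using \<Sigma>0(1) V0 S(1) by (auto simp: D0_def, force)
    obtain s where s: "s \<in> envs" "\<forall>v\<in>D0 \<times> {..<m}. s v = e v" "tp_eq {} ((D0 \<union> X) \<times> {..<m}) s e"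
      "\<forall>x\<in>X. \<not> P (\<lambda>c. s (x, c))" using insert_false_finite[OF F D0(1) X cut] D0(2) by (meson subsetD)
    have "Q s" if Q: "Q \<in> \<Sigma>0 \<inter> \<Sigma>1" for Q
    proof -
      have "definable {} ((D0 \<union> X) \<times> {..<m}) Q"
        by (rule definable_mono[OF S(3)[OF Q]]) (use S(2)[OF Q] Q in \<open>auto simp: D0_def, force\<close>)
      thus ?thesis using tp_eqD[OF s(3)] Q by (auto simp: \<Sigma>1_def)
    qed
    moreover have "Q s" if "Q \<in> \<Sigma>2" for Q using that s(4) by (auto simp: \<Sigma>2_def comp_def)
    ultimately have "\<forall>Q\<in>\<Sigma>0. Q s" using \<Sigma>0(2) by blast
    thus "\<exists>s\<in>envs. (\<forall>v\<in>V0. s v = e v) \<and> (\<forall>Q\<in>\<Sigma>0. Q s)" using s(1,2) D0(3) by blast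
  qed (use A stretchesD(1)[OF e] in auto)
  then obtain s where s: "s \<in> envs" "\<forall>v\<in>D \<times> {..<m}. s v = e v" "\<forall>Q\<in>\<Sigma>1 \<union> \<Sigma>2. Q s" by (elim bexE conjE)
  have "tp_eq {} ?V s e"
    by (rule tp_eq_sym, rule tp_eqI_complete[THEN tp_eq_sym]) (use s(3) in \<open>auto simp: \<Sigma>1_def\<close>)
  moreover have "\<not> P (\<lambda>c. s (x, c))" if "x \<in> X" for x using s(3) that by (auto simp: \<Sigma>2_def comp_def)
  ultimately show ?thesis using s(1,2) by blast
qed

lemma finite_false: "finite {j \<in> idx I. \<not> P (\<lambda>c. seq_vals m I (j, c))}"
proof (rule ccontr)
  assume F: "infinite {j \<in> idx I. \<not> P (\<lambda>c. seq_vals m I (j, c))}"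
  have seq': "sequence_of U m (J0 \<oplus>\<^sub>s J1)" "infinite (idx (J0 \<oplus>\<^sub>s J1))"
    using seq inf by (auto simp: sequence_of_append finite_image_iff)
  interpret insertion L U kb e m A P
  proof
    show "tp_eq {} (S \<times> {..<m}) e (e \<circ> lift \<tau>)" if "strict_mono_on S \<tau>" for S \<tau>
      by (rule tp_eq_mono[OF stretches_strict_mono_on[OF e seq' that]]) auto
  qed (use insert_false_infinite[OF F] stretchesD(1)[OF e] P A P_e in auto)
  show False by (rule insertion_impossible)
qed

end

theorem indiscernible_finite_cofinite:
  assumes inf: "infinite (idx J0)" "infinite (idx J1)"
    and full: "indiscernible L U {} (J0 \<oplus>\<^sub>s I \<oplus>\<^sub>s J1)" and out: "indiscernible L U A (J0 \<oplus>\<^sub>s J1)"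
    and seq: "sequence_of U m (J0 \<oplus>\<^sub>s I \<oplus>\<^sub>s J1)"
    and A: "|A| <o kb" "A \<subseteq> univ U" and P: "definable A {..<m} P"
  shows "finite {j \<in> idx I. P (\<lambda>c. seq_vals m I (j, c))} \<or> finite {j \<in> idx I. \<not> P (\<lambda>c. seq_vals m I (j, c))}"
proof -
  have seq': "sequence_of U m (J0 \<oplus>\<^sub>s J1)" "infinite (idx (J0 \<oplus>\<^sub>s J1))"
    using seq inf by (auto simp: sequence_of_append finite_image_iff)
  obtain e :: "(nat \<times> rat) \<times> nat \<Rightarrow> 'm" where e: "stretches A m (J0 \<oplus>\<^sub>s J1) e"
    using ex_stretches[OF out seq' A] by blast
  have const: "P (\<lambda>c. e (q, c)) \<longleftrightarrow> P (\<lambda>c. e (q', c))" for q q'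
  proof -
    have "tp_eq A ({q} \<times> {..<m}) e (e \<circ> lift (\<lambda>_. q'))"
      by (rule stretches_strict_mono_on[OF e seq']) (auto simp: strict_mono_on_def)
    from tp_eqD[OF this definable_reindex[OF P, of "Pair q"]] show ?thesis by (simp add: comp_def image_subset_iff)
  qed
  show ?thesis
  proof (cases "P (\<lambda>c. e ((0, 0), c))")
    case True
    hence "finite {j \<in> idx I. \<not> P (\<lambda>c. seq_vals m I (j, c))}"
      using const by (intro finite_false[OF inf full seq A P e]) blast
    thus ?thesis ..
  next
    case False
    hence "finite {j \<in> idx I. \<not> \<not> P (\<lambda>c. seq_vals m I (j, c))}"
      using const by (intro finite_false[OF inf full seq A definable_Neg[OF P] e]) blast
    thus ?thesis by simp
  qed
qed

end

section \<open>Stability and op-dimension\<close>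

lemma indiscernible_mono:
  assumes I: "indiscernible L M A' I" and A: "A \<subseteq> A'"
  shows "indiscernible L M A I"
proof -
  have "pfmlas L A n \<subseteq> pfmlas L A' n" for n
    using lists_mono[OF A] by (auto simp: pfmlas_def)
  thus ?thesis using I unfolding indiscernible_def by blast
qed

lemma mutually_indiscernible_row:
  "mutually_indiscernible L M A X I \<Longrightarrow> i \<in> X \<Longrightarrow> A' \<subseteq> A \<Longrightarrow> indiscernible L M A' (I i)"
  unfolding mutually_indiscernible_def by (rule indiscernible_mono[of L M "A \<union> (\<Union>j\<in>X - {i}. elems (I j))"]) auto

lemma mutually_indiscernible_inj:
  assumes I: "mutually_indiscernible L M A X I" and f: "inj_on f Y" "f ` Y \<subseteq> X" and A': "A' \<subseteq> A"
  shows "mutually_indiscernible L M A' Y (\<lambda>i. I (f i))"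
  unfolding mutually_indiscernible_def
proof
  fix i assume i: "i \<in> Y"
  have "(\<Union>j\<in>Y - {i}. elems (I (f j))) \<subseteq> (\<Union>j\<in>X - {f i}. elems (I j))"
    using f i by (fastforce dest: inj_onD)
  moreover have "indiscernible L M (A \<union> (\<Union>j\<in>X - {f i}. elems (I j))) (I (f i))"
    using I f(2) i unfolding mutually_indiscernible_def by blast
  ultimately show "indiscernible L M (A' \<union> (\<Union>j\<in>Y - {i}. elems (I (f j)))) (I (f i))"
    using A' by (elim indiscernible_mono) blast
qed

lemma mutually_stableI:
  fixes kb :: "'k rel" and I J0 J1 :: "'x \<Rightarrow> ('k, 'm) tseq"
  assumes "\<And>i. i \<in> X \<Longrightarrow> small_seq kb (I i) \<and> indiscernible L U {} (I i)"
    and "\<And>i. i \<in> X \<Longrightarrow> small_seq kb (J0 i) \<and> small_seq kb (J1 i) \<and> infinite (idx (J0 i)) \<and> infinite (idx (J1 i)) \<and>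
      indiscernible L U {} (J0 i \<oplus>\<^sub>s I i \<oplus>\<^sub>s J1 i)"
    and "mutually_indiscernible L U A X (\<lambda>i. J0 i \<oplus>\<^sub>s J1 i)"
  shows "mutually_stable L U kb A X I"
  unfolding mutually_stable_def using assms by (intro conjI ballI exI[of _ J0] exI[of _ J1]) simp_all

lemma mutually_stableE:
  fixes kb :: "'k rel" and I :: "'x \<Rightarrow> ('k, 'm) tseq"
  assumes "mutually_stable L U kb A X I"
  obtains J0 J1 :: "'x \<Rightarrow> ('k, 'm) tseq"
  where "\<forall>i\<in>X. small_seq kb (I i) \<and> indiscernible L U {} (I i)"
    and "\<forall>i\<in>X. small_seq kb (J0 i) \<and> small_seq kb (J1 i) \<and> infinite (idx (J0 i)) \<and> infinite (idx (J1 i)) \<and>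
      indiscernible L U {} (J0 i \<oplus>\<^sub>s I i \<oplus>\<^sub>s J1 i)"
    and "mutually_indiscernible L U A X (\<lambda>i. J0 i \<oplus>\<^sub>s J1 i)"
  using assms unfolding mutually_stable_def by (elim conjE exE) (rule that)

lemma mutually_stable_imp_stable_over:
  fixes kb :: "'k rel" and I :: "'x \<Rightarrow> ('k, 'm) tseq"
  assumes st: "mutually_stable L U kb A Y I" and i: "i \<in> Y"
  shows "stable_over L U kb A (I i)"
proof -
  obtain J0 J1 :: "'x \<Rightarrow> ('k, 'm) tseq" where I: "\<forall>i\<in>Y. small_seq kb (I i) \<and> indiscernible L U {} (I i)"
    and J: "\<forall>i\<in>Y. small_seq kb (J0 i) \<and> small_seq kb (J1 i) \<and> infinite (idx (J0 i)) \<and> infinite (idx (J1 i)) \<and>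
      indiscernible L U {} (J0 i \<oplus>\<^sub>s I i \<oplus>\<^sub>s J1 i)"
    and mut: "mutually_indiscernible L U A Y (\<lambda>i. J0 i \<oplus>\<^sub>s J1 i)"
    using st by (rule mutually_stableE)
  have "mutually_indiscernible L U A {()} (\<lambda>_. J0 i \<oplus>\<^sub>s J1 i)"
    using mutually_indiscernible_row[OF mut i order_refl] by (simp add: mutually_indiscernible_def)
  thus ?thesis
    unfolding stable_over_def by (rule mutually_stableI[rotated 2]) (use I J i in auto)
qed

definition row_tuple :: "('x \<Rightarrow> nat) \<Rightarrow> (('x \<times> 'i) \<times> nat \<Rightarrow> 'm) \<Rightarrow> 'x \<Rightarrow> 'i \<Rightarrow> 'm list" where
  "row_tuple m h i t = map (\<lambda>c. h ((i, t), c)) [0..<m i]"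

lemma nth_row_tuple [simp]: "c < m i \<Longrightarrow> row_tuple m h i t ! c = h ((i, t), c)"
  by (simp add: row_tuple_def)

lemma dir_image_iff: "inj g \<Longrightarrow> (g x, g y) \<in> dir_image r g \<longleftrightarrow> (x, y) \<in> r"
  by (auto simp: dir_image_def dest: injD)

context monster
begin

lemma ex_small_copy:
  fixes r :: "'c::countable rel"
  assumes r: "Linear_order r"
  shows "\<exists>g :: 'c \<Rightarrow> 'k. inj g \<and> Linear_order (dir_image r g) \<and> |Field (dir_image r g)| <o kb"
proof -
  have "infinite (UNIV :: 'k set)" using kb_inf finite_subset[OF subset_UNIV] by blast
  then obtain f :: "nat \<Rightarrow> 'k" where "inj f" using infinite_countable_subset by blast
  hence g: "inj (\<lambda>x :: 'c. f (to_nat x))" by (auto intro!: injI dest: injD)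
  have "Linear_order (dir_image r (\<lambda>x. f (to_nat x)))"
    by (rule Linear_order_dir_image[OF r inj_on_subset[OF g subset_UNIV]])
  moreover have "|Field (dir_image r (\<lambda>x. f (to_nat x)))| <o kb"
    unfolding dir_image_Field by (rule small_countable) simp
  ultimately show ?thesis using g by blast
qed

lemma sequence_of_row_tuple:
  "h \<in> envs \<Longrightarrow> Linear_order r \<Longrightarrow> sequence_of U (m i) (r, \<lambda>t. row_tuple m h i (f t))"
  using envsD[of h] by (auto simp: sequence_of_def tuples_def row_tuple_def)

lemma representsI:
  assumes "h \<in> envs" "\<And>i. i \<in> X \<Longrightarrow> sequence_of U (m i) (I i)"
    "\<And>i t c. i \<in> X \<Longrightarrow> t \<in> idx (I i) \<Longrightarrow> c < m i \<Longrightarrow> h ((i, t), c) = snd (I i) t ! c"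
  shows "represents X m I h"
  using assms by (simp add: represents_def)

lemma mutually_indiscernible_drop_middle:
  assumes mut: "mutually_indiscernible L U A X (\<lambda>i. J0 i \<oplus>\<^sub>s I i \<oplus>\<^sub>s J1 i)"
    and seq: "\<And>i. i \<in> X \<Longrightarrow> sequence_of U (m i) (J0 i \<oplus>\<^sub>s I i \<oplus>\<^sub>s J1 i)"
  shows "mutually_indiscernible L U A X (\<lambda>i. J0 i \<oplus>\<^sub>s J1 i)"
proof -
  define h where "h = seq_env X m (\<lambda>i. J0 i \<oplus>\<^sub>s I i \<oplus>\<^sub>s J1 i)"
  have rep: "represents X m (\<lambda>i. J0 i \<oplus>\<^sub>s I i \<oplus>\<^sub>s J1 i) h"
    unfolding h_def by (rule represents_seq_env) (rule seq)
  have seq': "sequence_of U (m i) (J0 i \<oplus>\<^sub>s J1 i)" if "i \<in> X" for i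
    using seq[OF that] by (simp add: sequence_of_append)
  let ?f = "\<lambda>p. (fst p, map_sum Inl id (snd p))"
  have "represents X m (\<lambda>i. J0 i \<oplus>\<^sub>s J1 i) (h \<circ> lift ?f)"
    by (rule representsI[OF envs_comp[OF representsD(1)[OF rep]] seq']) (auto simp: representsD(3)[OF rep])
  moreover have drop: "row_mono (\<lambda>i. fst (J0 i \<oplus>\<^sub>s J1 i)) (\<lambda>i. fst (J0 i \<oplus>\<^sub>s I i \<oplus>\<^sub>s J1 i))
      (positions X (\<lambda>i. fst (J0 i \<oplus>\<^sub>s J1 i))) ?f"
    by (rule row_monoI) auto
  have "mut_indisc A X (\<lambda>i. fst (J0 i \<oplus>\<^sub>s J1 i)) m (h \<circ> lift ?f)"
    by (rule mut_indisc_reindex[OF mut[unfolded mutually_indiscernible_iff[OF rep]] representsD(1)[OF rep]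
          representsD(5)[OF rep] _ drop]) (use seq' in \<open>auto simp: sequence_of_def\<close>)
  ultimately show ?thesis by (simp add: mutually_indiscernible_iff)
qed

lemma ex_surrounding_env:
  fixes I :: "'x \<Rightarrow> ('i, 'm) tseq" and w :: "'j rel"
  assumes mut: "mutually_indiscernible L U B X I" and B: "|B| <o kb" "B \<subseteq> univ U" and X: "|X| <o kb"
    and seq: "\<And>i. i \<in> X \<Longrightarrow> sequence_of U (m i) (I i)" and small: "\<And>i. i \<in> X \<Longrightarrow> |idx (I i)| <o kb"
    and inf: "\<And>i. i \<in> X \<Longrightarrow> infinite (idx (I i))" and w: "Linear_order w" "|Field w| <o kb"
  shows "\<exists>k\<in>envs. mut_indisc B X (\<lambda>i. fst ((w, \<lambda>_. []) \<oplus>\<^sub>s I i \<oplus>\<^sub>s (w, \<lambda>_. []))) m k \<and>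
    (\<forall>i\<in>X. \<forall>t\<in>idx (I i). \<forall>c<m i. k ((i, Inl (Inr t)), c) = snd (I i) t ! c)"
proof -
  let ?r = "\<lambda>i. fst (I i)" and ?r' = "\<lambda>i. fst ((w, \<lambda>_. [] :: 'm list) \<oplus>\<^sub>s I i \<oplus>\<^sub>s (w, \<lambda>_. [] :: 'm list))"
  obtain h where rep: "represents X m I h" using represents_seq_env[of X m I] seq by blast
  note h = representsD(1)[OF rep]
  have lin': "Linear_order (?r' i)" if "i \<in> X" for i
    by (intro Linear_order_seq_append) (use w(1) representsD(5)[OF rep that] in simp_all)
  have small': "|Field (?r' i)| <o kb" if "i \<in> X" for i
    using small[OF that] w(2) by (simp add: small_Un small_image)
  have "\<exists>h'\<in>envs. mut_indisc B X ?r' m h' \<and>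
    (\<forall>S \<sigma>. S \<subseteq> positions X ?r' \<longrightarrow> row_mono ?r' ?r S \<sigma> \<longrightarrow> tp_eq B (coords m S) h' (h \<circ> lift \<sigma>))"
    by (rule mut_indisc_stretch[OF mut[unfolded mutually_indiscernible_iff[OF rep]] h order_refl B X
          representsD(5)[OF rep] inf lin' small'])
  then obtain h' where h': "h' \<in> envs" "mut_indisc B X ?r' m h'" "\<forall>S \<sigma>. S \<subseteq> positions X ?r' \<longrightarrow>
      row_mono ?r' ?r S \<sigma> \<longrightarrow> tp_eq B (coords m S) h' (h \<circ> lift \<sigma>)" by (elim bexE conjE)
  define D where "D = {(i, Inl (Inr t) :: ('j + 'i) + 'j) | i t. i \<in> X \<and> t \<in> idx (I i)}"
  define \<mu> where "\<mu> p = (fst p, projr (projl (snd p)))" for p :: "'x \<times> (('j + 'i) + 'j)"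
  have D: "D \<subseteq> positions X ?r'" by (auto simp: D_def)
  have \<mu>: "row_mono ?r' ?r D \<mu>" by (rule row_monoI) (auto simp: D_def \<mu>_def)
  have "tp_eq B (coords m D) h' (h \<circ> lift \<mu>)" by (rule h'(3)[rule_format, OF D \<mu>])
  hence "\<exists>k\<in>envs. (\<forall>v\<in>coords m D. k v = (h \<circ> lift \<mu>) v) \<and> tp_eq B (coords m (positions X ?r')) k h'"
    by (intro extend_type[OF small_coords[OF X small'] B h'(1) envs_comp[OF h] coords_mono[OF D]])
  then obtain k where k: "k \<in> envs" "\<forall>v\<in>coords m D. k v = (h \<circ> lift \<mu>) v"
    "tp_eq B (coords m (positions X ?r')) k h'" by (elim bexE conjE)
  have "k ((i, Inl (Inr t)), c) = snd (I i) t ! c" if "i \<in> X" "t \<in> idx (I i)" "c < m i" for i t c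
    using k(2) that representsD(3)[OF rep that] by (auto simp: coords_def D_def \<mu>_def)
  thus ?thesis using k(1) mut_indisc_tp_eq[OF h'(2) k(3)] by blast
qed

theorem mutually_indiscernible_imp_stable:
  fixes I :: "'x \<Rightarrow> ('k, 'm) tseq"
  assumes mut: "mutually_indiscernible L U B X I" and B: "small_subset U kb B" and X: "|X| <o kb"
    and seq: "\<And>i. i \<in> X \<Longrightarrow> sequence_of U (m i) (I i)" and small: "\<And>i. i \<in> X \<Longrightarrow> small_seq kb (I i)"
    and inf: "\<And>i. i \<in> X \<Longrightarrow> infinite (idx (I i))"
  shows "mutually_stable L U kb B X I"
proof -
  obtain g :: "nat \<Rightarrow> 'k" where g: "inj g" "Linear_order (dir_image le_rel g)" "|Field (dir_image le_rel g)| <o kb"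
    using ex_small_copy[OF Linear_order_le_rel] by blast
  let ?w = "dir_image le_rel g"
  have w_inf: "infinite (Field ?w)" using g(1) by (simp add: dir_image_Field finite_image_iff)
  have "\<exists>k\<in>envs. mut_indisc B X (\<lambda>i. fst ((?w, \<lambda>_. [] :: 'm list) \<oplus>\<^sub>s I i \<oplus>\<^sub>s (?w, \<lambda>_. [] :: 'm list))) m k \<and>
      (\<forall>i\<in>X. \<forall>t\<in>idx (I i). \<forall>c<m i. k ((i, Inl (Inr t)), c) = snd (I i) t ! c)"
    by (rule ex_surrounding_env[OF mut _ _ X seq _ inf g(2,3)])
      (use B small in \<open>auto simp: small_subset_def small_seq_def\<close>)
  then obtain k where k: "k \<in> envs"
    "mut_indisc B X (\<lambda>i. fst ((?w, \<lambda>_. [] :: 'm list) \<oplus>\<^sub>s I i \<oplus>\<^sub>s (?w, \<lambda>_. [] :: 'm list))) m k"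
    "\<forall>i\<in>X. \<forall>t\<in>idx (I i). \<forall>c<m i. k ((i, Inl (Inr t)), c) = snd (I i) t ! c"
    by (elim bexE conjE)
  define J0 where "J0 i = (?w, \<lambda>t. row_tuple m k i (Inl (Inl t)))" for i
  define J1 where "J1 i = (?w, \<lambda>t. row_tuple m k i (Inr t))" for i
  have seqs: "sequence_of U (m i) (J0 i \<oplus>\<^sub>s I i \<oplus>\<^sub>s J1 i)" if "i \<in> X" for i
    using seq[OF that] sequence_of_row_tuple[OF k(1) g(2)] by (simp add: J0_def J1_def sequence_of_append)
  have "represents X m (\<lambda>i. J0 i \<oplus>\<^sub>s I i \<oplus>\<^sub>s J1 i) k"
    by (rule representsI[OF k(1) seqs]) (use k(3) in \<open>auto simp: J0_def J1_def\<close>)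
  moreover have "(\<lambda>i. fst (J0 i \<oplus>\<^sub>s I i \<oplus>\<^sub>s J1 i)) = (\<lambda>i. fst ((?w, \<lambda>_. []) \<oplus>\<^sub>s I i \<oplus>\<^sub>s (?w, \<lambda>_. [])))"
    by (simp add: seq_append_def J0_def J1_def)
  ultimately have full: "mutually_indiscernible L U B X (\<lambda>i. J0 i \<oplus>\<^sub>s I i \<oplus>\<^sub>s J1 i)"
    using k(2) by (simp add: mutually_indiscernible_iff seq_append_def)
  show ?thesis
  proof (rule mutually_stableI)
    show "mutually_indiscernible L U B X (\<lambda>i. J0 i \<oplus>\<^sub>s J1 i)"
      by (rule mutually_indiscernible_drop_middle[OF full seqs])
    fix i assume i: "i \<in> X"
    show "small_seq kb (I i) \<and> indiscernible L U {} (I i)"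
      using small[OF i] mutually_indiscernible_row[OF mut i] by simp
    show "small_seq kb (J0 i) \<and> small_seq kb (J1 i) \<and> infinite (idx (J0 i)) \<and> infinite (idx (J1 i)) \<and>
        indiscernible L U {} (J0 i \<oplus>\<^sub>s I i \<oplus>\<^sub>s J1 i)"
      using mutually_indiscernible_row[OF full i] w_inf g(3) by (simp add: small_seq_def J0_def J1_def)
  qed
qed

lemma definable_psat_append:
  assumes a: "set a \<subseteq> A" "A \<subseteq> univ U" and p: "p \<in> pfmlas L A (length a + m)"
  shows "definable A {..<m} (\<lambda>y. psat U p (a @ map y [0..<m]))"
proof -
  let ?xs = "map Inr [0..<length a] @ map Inl [0..<m] :: (nat + nat) list"
  let ?g = "case_sum Inl (\<lambda>i. Inr (if i < length a then a ! i else base_elem)) :: nat + nat \<Rightarrow> nat + 'm"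
  have "definable A (set ?xs) (\<lambda>k. psat U p (map k ?xs))"
    by (rule pfm_imp_definable) (use p in simp)
  hence "definable A {..<m} (\<lambda>y. psat U p (map (\<lambda>v. case_sum y id (?g v)) ?xs))"
  proof (rule definable_subst)
    show "x \<in> univ U" if "?g v = Inr x" for v x
      using that a base_elem by (auto split: sum.splits if_splits dest: nth_mem)
  qed (auto simp: image_iff subsetD[OF a(1) nth_mem])
  moreover have "map (\<lambda>v. case_sum y id (?g v)) ?xs = a @ map y [0..<m]" for y
    by (auto intro: nth_equalityI)
  ultimately show ?thesis by (simp only:)
qed

lemma definable_imp_pfm_append:
  assumes R: "definable (A \<union> set a) {..<m} R" and a: "set a \<subseteq> univ U"
  shows "\<exists>p\<in>pfmlas L A (length a + m). \<forall>y\<in>envs. psat U p (a @ map y [0..<m]) \<longleftrightarrow> R y"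
proof -
  define c where "c i = (if i < length a then a ! i else base_elem)" for i
  have c: "c \<in> envs" using a base_elem by (intro envsI) (auto simp: c_def)
  have map_c: "map c [0..<length a] = a" by (rule nth_equalityI) (simp_all add: c_def)
  have "c ` {..<length a} = set a" by (auto simp: c_def in_set_conv_nth)
  hence "case_sum (\<lambda>_ :: nat. base_elem) c ` Inr ` {..<length a} = set a"
    by (simp add: image_image)
  hence "definable (A \<union> case_sum (\<lambda>_ :: nat. base_elem) c ` Inr ` {..<length a}) (Inl ` {..<m}) (\<lambda>k. R (k \<circ> Inl))"
    using definable_reindex[OF R, of Inl "Inl ` {..<m}"] by (simp add: comp_def)
  from definable_unfix[OF this] obtain Q where Q: "definable A (Inl ` {..<m} \<union> Inr ` {..<length a}) Q"
    "\<forall>k\<in>envs. (\<forall>v\<in>Inr ` {..<length a}. k v = case_sum (\<lambda>_. base_elem) c v) \<longrightarrow> (Q k \<longleftrightarrow> R (k \<circ> Inl))"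
    by (elim exE conjE)
  let ?xs = "map Inr [0..<length a] @ map Inl [0..<m] :: (nat + nat) list"
  have "\<exists>p\<in>pfmlas L A (length ?xs). \<forall>k\<in>envs. psat U p (map k ?xs) \<longleftrightarrow> Q k"
    by (rule definable_imp_pfm[OF Q(1)]) auto
  then obtain p where p: "p \<in> pfmlas L A (length ?xs)" "\<forall>k\<in>envs. psat U p (map k ?xs) \<longleftrightarrow> Q k" by (elim bexE)
  have "psat U p (a @ map y [0..<m]) \<longleftrightarrow> R y" if y: "y \<in> envs" for y
  proof -
    note yc = envs_case_sum[OF y c]
    have "map (case_sum y c) ?xs = a @ map y [0..<m]" using map_c by (simp add: comp_def)
    hence "psat U p (a @ map y [0..<m]) \<longleftrightarrow> Q (case_sum y c)" using bspec[OF p(2) yc] by (simp only:)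
    also have "\<dots> \<longleftrightarrow> R (case_sum y c \<circ> Inl)" using bspec[OF Q(2) yc] by simp
    finally show ?thesis by (simp add: comp_def)
  qed
  thus ?thesis using p(1) by auto
qed

end

context nip_monster
begin

theorem stable_finite_cofinite:
  fixes I :: "('k, 'm) tseq"
  assumes st: "stable_over L U kb A I" and seq: "sequence_of U m I" and a: "a \<in> tuples U n" "set a \<subseteq> A"
    and A: "small_subset U kb A" and p: "p \<in> pfmlas L A (n + m)"
  shows "finite {j \<in> idx I. psat U p (a @ snd I j)} \<or> finite {j \<in> idx I. \<not> psat U p (a @ snd I j)}"
proof (cases "idx I = {}")
  case False
  obtain J0 J1 :: "unit \<Rightarrow> ('k, 'm) tseq" where J: "\<forall>i\<in>{()}. small_seq kb (J0 i) \<and> small_seq kb (J1 i) \<and>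
      infinite (idx (J0 i)) \<and> infinite (idx (J1 i)) \<and> indiscernible L U {} (J0 i \<oplus>\<^sub>s I \<oplus>\<^sub>s J1 i)"
    and mut: "mutually_indiscernible L U A {()} (\<lambda>i. J0 i \<oplus>\<^sub>s J1 i)"
    using st unfolding stable_over_def by (rule mutually_stableE)
  then obtain m' where m': "sequence_of U m' (J0 () \<oplus>\<^sub>s I \<oplus>\<^sub>s J1 ())" unfolding indiscernible_def by blast
  moreover from this have "m' = m" using False sequence_of_unique[OF _ seq] by (auto simp: sequence_of_append)
  ultimately have seq': "sequence_of U m (J0 () \<oplus>\<^sub>s I \<oplus>\<^sub>s J1 ())" by simp
  have A': "|A| <o kb" "A \<subseteq> univ U" and len: "length a = n" using A a by (auto simp: small_subset_def tuples_def)
  have "definable A {..<m} (\<lambda>y. psat U p (a @ map y [0..<m]))"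
    by (rule definable_psat_append[OF a(2) A'(2)]) (use p len in simp)
  note fc = indiscernible_finite_cofinite[OF _ _ _ mutually_indiscernible_row[OF mut] seq' A' this]
  have "map (\<lambda>c. seq_vals m I (j, c)) [0..<m] = snd I j" if "j \<in> idx I" for j
    by (rule nth_equalityI) (use that sequence_of_length[OF seq] seq_vals(2)[OF seq] in auto)
  hence "{j \<in> idx I. psat U p (a @ map (\<lambda>c. seq_vals m I (j, c)) [0..<m])} = {j \<in> idx I. psat U p (a @ snd I j)}"
    "{j \<in> idx I. \<not> psat U p (a @ map (\<lambda>c. seq_vals m I (j, c)) [0..<m])} = {j \<in> idx I. \<not> psat U p (a @ snd I j)}"
    by auto
  thus ?thesis using fc J by simp
qed simp

lemma small_Field: "Card_order \<kappa> \<Longrightarrow> \<kappa> <o kb \<Longrightarrow> |Field \<kappa>| <o kb"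
  using card_of_Field_ordIso ordIso_ordLess_trans by blast

theorem pattern_not_stable:
  assumes B: "small_subset U kb B" and \<kappa>: "Card_order \<kappa>" "\<kappa> <o kb" and pattern: "dlr_pattern L U kb B n \<pi> \<kappa>"
  shows "\<exists>(I :: 'k \<Rightarrow> ('k, 'm) tseq) a. mutually_stable L U kb B (Field \<kappa>) I \<and> realizes U n \<pi> a \<and>
    (\<forall>i\<in>Field \<kappa>. \<not> stable_over L U kb (B \<union> set a) (I i))"
proof -
  obtain a and I :: "'k \<Rightarrow> ('k, 'm) tseq" and m \<phi> where a: "realizes U n \<pi> a"
    and mut: "mutually_indiscernible L U B (Field \<kappa>) I"
    and I: "\<forall>i\<in>Field \<kappa>. small_seq kb (I i) \<and> sequence_of U (m i) (I i) \<and> \<phi> i \<in> pfmlas L B (n + m i) \<and>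
           infinite {j \<in> idx (I i). psat U (\<phi> i) (a @ snd (I i) j)} \<and>
           infinite {j \<in> idx (I i). \<not> psat U (\<phi> i) (a @ snd (I i) j)}"
    using pattern unfolding dlr_pattern_def by (elim exE conjE)
  have at: "a \<in> tuples U n" using a by (simp add: realizes_def)
  have "infinite (idx (I i))" if "i \<in> Field \<kappa>" for i
    using I that infinite_super[of "{j \<in> idx (I i). psat U (\<phi> i) (a @ snd (I i) j)}" "idx (I i)"] by blast
  hence "mutually_stable L U kb B (Field \<kappa>) I"
    by (intro mutually_indiscernible_imp_stable[OF mut B small_Field[OF \<kappa>], of m]) (use I in blast)+
  moreover have "\<not> stable_over L U kb (B \<union> set a) (I i)" if i: "i \<in> Field \<kappa>" for i
  proof
    assume st: "stable_over L U kb (B \<union> set a) (I i)"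
    have small: "small_subset U kb (B \<union> set a)"
      using at B by (auto simp: tuples_def small_subset_def intro: small_Un small_finite)
    have seq: "sequence_of U (m i) (I i)" and "\<phi> i \<in> pfmlas L B (n + m i)" using I i by blast+
    hence "\<phi> i \<in> pfmlas L (B \<union> set a) (n + m i)" by (auto simp: pfmlas_def)
    from stable_finite_cofinite[OF st seq at _ small this] show False using I i by blast
  qed
  ultimately show ?thesis using a by blast
qed

end

subsection \<open>Replacing the outer parts by rational copies\<close>

context monster
begin

lemma mut_indisc_transfer:
  fixes \<xi> :: "('y \<times> 'q) \<times> nat \<Rightarrow> (('x \<times> 'j) \<times> nat) + 'm" and T :: "('y \<times> 'q) set \<Rightarrow> ('x \<times> 'j) set"
    and \<rho> :: "('x \<times> 'j \<Rightarrow> 'x \<times> 'i) \<Rightarrow> 'y \<times> 'q \<Rightarrow> 'y \<times> 'p"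
  assumes EM: "realizes_EM_type E X m r h r' h'" and env: "h \<in> envs" "h' \<in> envs" "k \<in> envs"
    and mut: "mut_indisc A Y s n k" and lin: "\<And>i. i \<in> Y \<Longrightarrow> Linear_order (s i)" "\<And>i. i \<in> Y \<Longrightarrow> Linear_order (s' i)"
    and AE: "A \<subseteq> E" and const: "\<And>v c. \<xi> v = Inr c \<Longrightarrow> c \<in> univ U"
    and T: "\<And>S. finite S \<Longrightarrow> S \<subseteq> positions Y s' \<Longrightarrow> finite (T S) \<and> T S \<subseteq> positions X r'"
      "\<And>S v. S \<subseteq> positions Y s' \<Longrightarrow> v \<in> coords n S \<Longrightarrow> \<xi> v \<in> Inl ` coords m (T S) \<union> Inr ` E"
    and \<rho>: "\<And>S \<sigma>. S \<subseteq> positions Y s' \<Longrightarrow> row_mono r' r (T S) \<sigma> \<Longrightarrow> row_mono s' s S (\<rho> \<sigma>)"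
      "\<And>S \<sigma> v. S \<subseteq> positions Y s' \<Longrightarrow> row_mono r' r (T S) \<sigma> \<Longrightarrow> v \<in> coords n S \<Longrightarrow>
         case_sum (h \<circ> lift \<sigma>) id (\<xi> v) = (k \<circ> lift (\<rho> \<sigma>)) v"
  shows "mut_indisc A Y s' n (\<lambda>v. case_sum h' id (\<xi> v))"
proof (rule mut_indiscI)
  fix S :: "('y \<times> 'q) set" and \<tau> assume S: "finite S" "S \<subseteq> positions Y s'" and \<tau>: "row_mono s' s' S \<tau>"
  define comb where "comb g v = case_sum g id (\<xi> v)" for g v
  have comb_envs: "comb g \<in> envs" if "g \<in> envs" for g
    using envsD[OF that] const by (intro envsI) (auto simp: comb_def split: sum.split)
  define S' where "S' = S \<union> \<tau> ` S"
  have S': "finite S'" "S' \<subseteq> positions Y s'" using S row_mono_image[OF \<tau> S(2)] by (auto simp: S'_def)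
  have sub: "coords n S \<subseteq> coords n S'" by (rule coords_mono) (simp add: S'_def)
  have lift_sub: "lift \<tau> ` coords n S \<subseteq> coords n S'"
    by (rule lift_coords) (use row_monoD(1)[OF \<tau>] in \<open>auto simp: S'_def\<close>)
  have same: "tp_eq A (coords n S) (comb (h \<circ> lift \<sigma>)) (comb (h \<circ> lift \<sigma>) \<circ> lift \<tau>)"
    if \<sigma>: "row_mono r' r (T S') \<sigma>" for \<sigma>
  proof -
    note \<rho>\<sigma> = \<rho>(1)[OF S'(2) \<sigma>]
    have agree: "tp_eq A (coords n S') (comb (h \<circ> lift \<sigma>)) (k \<circ> lift (\<rho> \<sigma>))"
      by (rule tp_eq_agree[OF comb_envs[OF envs_comp[OF env(1)]] envs_comp[OF env(3)]])
        (unfold comb_def, rule \<rho>(2)[OF S'(2) \<sigma>])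
    have "tp_eq A (coords n S) (k \<circ> lift (\<rho> \<sigma>)) (k \<circ> lift (\<rho> \<sigma> \<circ> \<tau>))"
      by (rule mut_indisc_row_mono[OF mut env(3) lin S(2)])
        (use row_mono_subset[OF \<rho>\<sigma>] row_mono_comp[OF \<tau>] in \<open>auto simp: S'_def\<close>)
    moreover have "k \<circ> lift (\<rho> \<sigma> \<circ> \<tau>) = k \<circ> lift (\<rho> \<sigma>) \<circ> lift \<tau>" by (simp add: comp_assoc map_prod.comp)
    ultimately show ?thesis
      using tp_eq_mono[OF agree order_refl sub] tp_eq_sym[OF tp_eq_reindex[OF agree lift_sub]]
      by (metis tp_eq_trans)
  qed
  have "tp_eq A (coords n S) (comb h') (comb h' \<circ> lift \<tau>)"
    unfolding tp_eq_def
  proof (intro allI impI)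
    fix P assume P: "definable A (coords n S) P"
    have comb_definable: "definable E (coords m (T S')) (\<lambda>g. Q (comb g))" if "definable A (coords n S') Q" for Q
      unfolding comb_def[abs_def] by (rule definable_subst[OF that const T(2)[OF S'(2)] AE])
    show "P (comb h') \<longleftrightarrow> P (comb h' \<circ> lift \<tau>)"
    proof (rule realizes_EM_typeD[OF EM, of "T S'" "\<lambda>g. P (comb g) \<longleftrightarrow> P (comb g \<circ> lift \<tau>)"])
      show "definable E (coords m (T S')) (\<lambda>g. P (comb g) \<longleftrightarrow> P (comb g \<circ> lift \<tau>))"
        by (intro definable_iff comb_definable definable_mono[OF P order_refl sub] definable_reindex[OF P lift_sub])
    qed (use T(1)[OF S'] tp_eqD[OF same P] in auto)
  qed
  thus "tp_eq A (coords n S) (\<lambda>v. case_sum h' id (\<xi> v)) ((\<lambda>v. case_sum h' id (\<xi> v)) \<circ> lift \<tau>)"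
    by (simp add: comb_def[abs_def])
qed

definition side :: "('x \<Rightarrow> ('i, 'm) tseq) \<Rightarrow> ('x \<Rightarrow> ('i, 'm) tseq) \<Rightarrow> 'x \<times> bool \<Rightarrow> ('i, 'm) tseq" where
  "side J0 J1 p = (if snd p then J1 (fst p) else J0 (fst p))"

definition join_sides :: "((('x \<times> bool) \<times> 'i) \<times> nat \<Rightarrow> 'm) \<Rightarrow> ('x \<times> (bool \<times> 'i)) \<times> nat \<Rightarrow> 'm" where
  "join_sides h v = h (((fst (fst v), fst (snd (fst v))), snd (snd (fst v))), snd v)"

lemma join_sides_envs: "h \<in> envs \<Longrightarrow> join_sides h \<in> envs"
  by (intro envsI) (simp add: join_sides_def envsD)

definition join_positions :: "(('x \<times> bool) \<times> 'i \<Rightarrow> ('x \<times> bool) \<times> 'j) \<Rightarrow> 'x \<times> (bool \<times> 'i) \<Rightarrow> 'x \<times> ('j + 'j)" where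
  "join_positions \<sigma> p = (fst p, (if fst (snd p) then Inr else Inl) (snd (\<sigma> ((fst p, fst (snd p)), snd (snd p)))))"

lemma fst_join_positions [simp]: "fst (join_positions \<sigma> p) = fst p"
  by (simp add: join_positions_def)

lemma row_mono_join_positions:
  fixes J0 J1 :: "'x \<Rightarrow> ('j, 'm) tseq" and \<sigma> :: "('x \<times> bool) \<times> 'i::linorder \<Rightarrow> ('x \<times> bool) \<times> 'j"
  assumes \<sigma>: "row_mono le_rows (\<lambda>p. fst (side J0 J1 p)) ((\<lambda>p. ((fst p, fst (snd p)), snd (snd p))) ` S) \<sigma>"
  shows "row_mono le_rows (\<lambda>i. fst (J0 i \<oplus>\<^sub>s J1 i)) S (join_positions \<sigma>)"
proof (rule row_monoI)
  let ?split = "\<lambda>p :: 'x \<times> (bool \<times> 'i). ((fst p, fst (snd p)), snd (snd p))"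
  have idx: "snd (\<sigma> (?split p)) \<in> idx (side J0 J1 (fst p, fst (snd p)))" if "p \<in> S" for p
    using row_monoD(2)[OF \<sigma> imageI[OF that]] by simp
  fix p assume p: "p \<in> S"
  show "snd (join_positions \<sigma> p) \<in> idx (J0 (fst p) \<oplus>\<^sub>s J1 (fst p))"
    using idx[OF p] by (simp add: join_positions_def side_def split: if_splits)
  fix q assume q: "q \<in> S" "fst p = fst q" "(snd p, snd q) \<in> le_rel" "snd p \<noteq> snd q"
  have "(snd (\<sigma> (?split p)), snd (\<sigma> (?split q))) \<in> fst (side J0 J1 (fst p, fst (snd p))) \<and>
      snd (\<sigma> (?split p)) \<noteq> snd (\<sigma> (?split q))" if "fst (snd p) = fst (snd q)"
    using row_monoD(3)[OF \<sigma> imageI[OF p] imageI[OF q(1)]] that q(2-4) by (auto simp: prod_eq_iff less_eq_prod_def)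
  thus "(snd (join_positions \<sigma> p), snd (join_positions \<sigma> q)) \<in> fst (J0 (fst p) \<oplus>\<^sub>s J1 (fst p)) \<and>
      snd (join_positions \<sigma> p) \<noteq> snd (join_positions \<sigma> q)"
    using idx[OF p] idx[OF q(1)] q(2,3) by (auto simp: join_positions_def side_def less_eq_prod_def split: if_splits)
qed simp

lemma mut_indisc_join_sides:
  fixes J0 J1 :: "'x \<Rightarrow> ('i, 'm) tseq" and h :: "(('x \<times> bool) \<times> rat) \<times> nat \<Rightarrow> 'm"
  assumes mut: "mutually_indiscernible L U A Y (\<lambda>i. J0 i \<oplus>\<^sub>s J1 i)"
    and seq: "\<And>i. i \<in> Y \<Longrightarrow> sequence_of U (m i) (J0 i \<oplus>\<^sub>s J1 i)" and AE: "A \<subseteq> E"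
    and rep: "represents (Y \<times> UNIV) (\<lambda>p. m (fst p)) (side J0 J1) g" and h: "h \<in> envs"
    and EM: "realizes_EM_type E (Y \<times> UNIV) (\<lambda>p. m (fst p)) (\<lambda>p. fst (side J0 J1 p)) g le_rows h"
  shows "mut_indisc A Y le_rows m (join_sides h)"
proof -
  let ?J = "\<lambda>i. J0 i \<oplus>\<^sub>s J1 i"
  obtain k where k: "represents Y m ?J k" using represents_seq_env[of Y m ?J] seq by blast
  let ?split = "\<lambda>p :: 'x \<times> (bool \<times> rat). ((fst p, fst (snd p)), snd (snd p))"
  have "mut_indisc A Y le_rows m (\<lambda>v. case_sum h id (Inl (?split (fst v), snd v)))"
  proof (rule mut_indisc_transfer[OF EM representsD(1)[OF rep] h representsD(1)[OF k]
        mut[unfolded mutually_indiscernible_iff[OF k]] representsD(5)[OF k] _ AE, where T = "\<lambda>S. ?split ` S"])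
    fix S :: "('x \<times> (bool \<times> rat)) set" and \<sigma> and v
    assume S: "S \<subseteq> positions Y le_rows" and \<sigma>: "row_mono le_rows (\<lambda>p. fst (side J0 J1 p)) (?split ` S) \<sigma>"
      and v: "v \<in> coords m S"
    obtain i b q c where v_eq: "v = ((i, (b, q)), c)" by (cases v) auto
    have v': "(i, (b, q)) \<in> S" "i \<in> Y" "c < m i" using v S by (auto simp: v_eq coords_def)
    obtain t where "\<sigma> ((i, b), q) = ((i, b), t)" "t \<in> idx (side J0 J1 (i, b))"
      using row_monoD(1,2)[OF \<sigma> imageI[OF v'(1)]] by (cases "\<sigma> ((i, b), q)") auto
    thus "case_sum (g \<circ> lift \<sigma>) id (Inl (?split (fst v), snd v)) = (k \<circ> lift (join_positions \<sigma>)) v"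
      using representsD(3)[OF rep, of "(i, b)" t c] representsD(3)[OF k v'(2) _ v'(3)] v'(2,3)
      by (cases b) (auto simp: v_eq side_def join_positions_def)
  next
    fix S :: "('x \<times> (bool \<times> rat)) set" and v assume "v \<in> coords m S"
    thus "Inl (?split (fst v), snd v) \<in> Inl ` coords (\<lambda>p. m (fst p)) (?split ` S) \<union> Inr ` E"
      by (intro UnI1 imageI) (auto simp: coords_def intro!: image_eqI)
  qed (auto intro: row_mono_join_positions)
  thus ?thesis by (simp add: join_sides_def[abs_def])
qed

definition surround_positions :: "('w \<Rightarrow> 'i) \<Rightarrow> (('x \<times> bool) \<times> 'i \<Rightarrow> ('x \<times> bool) \<times> 'j) \<Rightarrow> 'x \<times> (('w + 'v) + 'w) \<Rightarrow>
    'x \<times> (('j + 'v) + 'j)" where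
  "surround_positions \<gamma> \<sigma> p = (fst p, map_sum (map_sum (\<lambda>u. snd (\<sigma> ((fst p, False), \<gamma> u))) id)
     (\<lambda>u. snd (\<sigma> ((fst p, True), \<gamma> u))) (snd p))"

definition outer_positions :: "('w \<Rightarrow> 'i) \<Rightarrow> ('x \<times> (('w + 'v) + 'w)) set \<Rightarrow> (('x \<times> bool) \<times> 'i) set" where
  "outer_positions \<gamma> S = {((i, False), \<gamma> u) | i u. (i, Inl (Inl u)) \<in> S} \<union> {((i, True), \<gamma> u) | i u. (i, Inr u) \<in> S}"

lemma outer_positionsI:
  "(i, Inl (Inl u)) \<in> S \<Longrightarrow> ((i, False), \<gamma> u) \<in> outer_positions \<gamma> S"
  "(i, Inr u) \<in> S \<Longrightarrow> ((i, True), \<gamma> u) \<in> outer_positions \<gamma> S"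
  unfolding outer_positions_def by blast+

lemma finite_outer_positions:
  assumes "finite S"
  shows "finite (outer_positions \<gamma> S)"
proof (rule finite_subset)
  let ?f = "\<lambda>p. case snd p of Inl t \<Rightarrow> ((fst p, False), \<gamma> (projl t)) | Inr u \<Rightarrow> ((fst p, True), \<gamma> u)"
  show "outer_positions \<gamma> S \<subseteq> ?f ` S" unfolding outer_positions_def by force
qed (simp add: assms)

lemma row_mono_surround_positions:
  fixes J0 J1 :: "'x \<Rightarrow> ('j, 'm) tseq" and \<sigma> :: "('x \<times> bool) \<times> 'i::linorder \<Rightarrow> ('x \<times> bool) \<times> 'j"
  assumes w: "\<And>t t'. (t, t') \<in> w \<Longrightarrow> t \<noteq> t' \<Longrightarrow> \<gamma> t < \<gamma> t'"
    and S: "S \<subseteq> positions X (\<lambda>i. fst ((w, K0 i) \<oplus>\<^sub>s I i \<oplus>\<^sub>s (w, K1 i)))"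
    and \<sigma>: "row_mono le_rows (\<lambda>p. fst (side J0 J1 p)) (outer_positions \<gamma> S) \<sigma>"
  shows "row_mono (\<lambda>i. fst ((w, K0 i) \<oplus>\<^sub>s I i \<oplus>\<^sub>s (w, K1 i)))
    (\<lambda>i. fst (J0 i \<oplus>\<^sub>s I i \<oplus>\<^sub>s J1 i)) S (surround_positions \<gamma> \<sigma>)"
proof (rule row_monoI)
  have idx: "(i, Inl (Inl u)) \<in> S \<Longrightarrow> snd (\<sigma> ((i, False), \<gamma> u)) \<in> idx (J0 i)"
    "(i, Inr u) \<in> S \<Longrightarrow> snd (\<sigma> ((i, True), \<gamma> u)) \<in> idx (J1 i)" for i u
    using row_monoD(2)[OF \<sigma> outer_positionsI(1)] row_monoD(2)[OF \<sigma> outer_positionsI(2)]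
    by (fastforce simp: side_def)+
  have less: "(snd (\<sigma> ((i, False), \<gamma> u)), snd (\<sigma> ((i, False), \<gamma> u'))) \<in> fst (J0 i) \<and>
      snd (\<sigma> ((i, False), \<gamma> u)) \<noteq> snd (\<sigma> ((i, False), \<gamma> u'))"
    if "(i, Inl (Inl u)) \<in> S" "(i, Inl (Inl u')) \<in> S" "(u, u') \<in> w" "u \<noteq> u'" for i u u'
    using row_monoD(3)[OF \<sigma> outer_positionsI(1)[OF that(1)] outer_positionsI(1)[OF that(2)]] w[OF that(3,4)]
    by (simp add: side_def)
  have less': "(snd (\<sigma> ((i, True), \<gamma> u)), snd (\<sigma> ((i, True), \<gamma> u'))) \<in> fst (J1 i) \<and>
      snd (\<sigma> ((i, True), \<gamma> u)) \<noteq> snd (\<sigma> ((i, True), \<gamma> u'))"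
    if "(i, Inr u) \<in> S" "(i, Inr u') \<in> S" "(u, u') \<in> w" "u \<noteq> u'" for i u u'
    using row_monoD(3)[OF \<sigma> outer_positionsI(2)[OF that(1)] outer_positionsI(2)[OF that(2)]] w[OF that(3,4)]
    by (simp add: side_def)
  fix p assume p: "p \<in> S"
  obtain i t where p_eq: "p = (i, t)" by (cases p)
  have t: "t \<in> idx ((w, K0 i) \<oplus>\<^sub>s I i \<oplus>\<^sub>s (w, K1 i))" using positionsD[OF S p] by (simp add: p_eq)
  show "snd (surround_positions \<gamma> \<sigma> p) \<in> idx (J0 (fst p) \<oplus>\<^sub>s I (fst p) \<oplus>\<^sub>s J1 (fst p))"
    using t p idx by (auto simp: p_eq surround_positions_def)
  fix q assume q: "q \<in> S" "fst p = fst q" "(snd p, snd q) \<in> fst ((w, K0 (fst p)) \<oplus>\<^sub>s I (fst p) \<oplus>\<^sub>s (w, K1 (fst p)))"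
    "snd p \<noteq> snd q"
  obtain t' where q_eq: "q = (i, t')" using q(2) by (cases q) (simp add: p_eq)
  have t': "t' \<in> idx ((w, K0 i) \<oplus>\<^sub>s I i \<oplus>\<^sub>s (w, K1 i))" using positionsD[OF S q(1)] by (simp add: q_eq)
  show "(snd (surround_positions \<gamma> \<sigma> p), snd (surround_positions \<gamma> \<sigma> q)) \<in>
      fst (J0 (fst p) \<oplus>\<^sub>s I (fst p) \<oplus>\<^sub>s J1 (fst p)) \<and>
      snd (surround_positions \<gamma> \<sigma> p) \<noteq> snd (surround_positions \<gamma> \<sigma> q)"
    using t t' p q(1,3,4) idx less less' by (auto simp: p_eq q_eq surround_positions_def)
qed (simp add: surround_positions_def)

definition outer_seq ::
    "'w rel \<Rightarrow> ('w \<Rightarrow> 'i) \<Rightarrow> ('x \<Rightarrow> nat) \<Rightarrow> (('x \<times> (bool \<times> 'i)) \<times> nat \<Rightarrow> 'm) \<Rightarrow> 'x \<Rightarrow> bool \<Rightarrow> ('w, 'm) tseq" where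
  "outer_seq w \<gamma> m H i b = (w, \<lambda>t. row_tuple m H i (b, \<gamma> t))"

lemma outer_seq_simps [simp]:
  "fst (outer_seq w \<gamma> m H i b) = w" "snd (outer_seq w \<gamma> m H i b) t = row_tuple m H i (b, \<gamma> t)"
  by (simp_all add: outer_seq_def)

definition surround_entry :: "('w \<Rightarrow> 'i) \<Rightarrow> (('x \<times> (('j + 'v) + 'j)) \<times> nat \<Rightarrow> 'm) \<Rightarrow> ('x \<times> (('w + 'v) + 'w)) \<times> nat \<Rightarrow>
    ((('x \<times> bool) \<times> 'i) \<times> nat) + 'm" where
  "surround_entry \<gamma> k v = (case snd (fst v) of Inl (Inl u) \<Rightarrow> Inl (((fst (fst v), False), \<gamma> u), snd v)
     | Inl (Inr u) \<Rightarrow> Inr (k ((fst (fst v), Inl (Inr u)), snd v)) | Inr u \<Rightarrow> Inl (((fst (fst v), True), \<gamma> u), snd v))"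

lemma surround_entry_simps [simp]:
  "surround_entry \<gamma> k ((i, Inl (Inl u)), c) = Inl (((i, False), \<gamma> u), c)"
  "surround_entry \<gamma> k ((i, Inl (Inr x)), c) = Inr (k ((i, Inl (Inr x)), c))"
  "surround_entry \<gamma> k ((i, Inr u), c) = Inl (((i, True), \<gamma> u), c)"
  by (simp_all add: surround_entry_def)

lemma surround_entry_const: "k \<in> envs \<Longrightarrow> surround_entry \<gamma> k v = Inr c \<Longrightarrow> c \<in> univ U"
  using envsD[of k] by (auto simp: surround_entry_def split: sum.splits)

lemma surround_entry_lift:
  fixes \<sigma> :: "('x \<times> bool) \<times> 'i::linorder \<Rightarrow> ('x \<times> bool) \<times> 'j"
  assumes rep: "represents (Y \<times> UNIV) (\<lambda>p. m (fst p)) (side J0 J1) g"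
    and k: "represents Z m (\<lambda>i. J0 i \<oplus>\<^sub>s I i \<oplus>\<^sub>s J1 i) k"
    and Z: "Z \<subseteq> Y" "fst ` S \<subseteq> Z" and \<sigma>: "row_mono le_rows (\<lambda>p. fst (side J0 J1 p)) (outer_positions \<gamma> S) \<sigma>"
    and v: "v \<in> coords m S"
  shows "case_sum (g \<circ> lift \<sigma>) id (surround_entry \<gamma> k v) = (k \<circ> lift (surround_positions \<gamma> \<sigma>)) v"
proof -
  obtain i t c where v_eq: "v = ((i, t), c)" by (cases v) auto
  have v': "(i, t) \<in> S" "i \<in> Z" "i \<in> Y" "c < m i" using v Z by (force simp: v_eq coords_def)+
  have g: "g (((i, b), u), c) = snd (side J0 J1 (i, b)) u ! c" if "u \<in> idx (side J0 J1 (i, b))" for b u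
    using representsD(3)[OF rep, of "(i, b)"] that v'(3,4) by simp
  have outer: "\<exists>s\<in>idx (side J0 J1 (i, b)). \<sigma> ((i, b), q) = ((i, b), s)" if "((i, b), q) \<in> outer_positions \<gamma> S" for b q
    using row_monoD(1,2)[OF \<sigma> that] by (intro bexI[of _ "snd (\<sigma> ((i, b), q))"]) (auto simp: prod_eq_iff)
  consider u where "t = Inl (Inl u)" | u where "t = Inl (Inr u)" | u where "t = Inr u"
    by (metis sum.exhaust)
  thus ?thesis
  proof cases
    fix u assume t: "t = Inl (Inl u)"
    obtain s where "s \<in> idx (J0 i)" "\<sigma> ((i, False), \<gamma> u) = ((i, False), s)"
      using outer[OF outer_positionsI(1)] v'(1) t by (auto simp: side_def)
    thus ?thesis using g[of s False] representsD(3)[OF k v'(2) _ v'(4), of "Inl (Inl s)"] t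
      by (simp add: v_eq surround_positions_def side_def)
  next
    fix u assume t: "t = Inr u"
    obtain s where "s \<in> idx (J1 i)" "\<sigma> ((i, True), \<gamma> u) = ((i, True), s)"
      using outer[OF outer_positionsI(2)] v'(1) t by (auto simp: side_def)
    thus ?thesis using g[of s True] representsD(3)[OF k v'(2) _ v'(4), of "Inr s"] t
      by (simp add: v_eq surround_positions_def side_def)
  qed (simp add: v_eq surround_positions_def)
qed

lemma represents_surround_entry:
  assumes k: "represents Z m (\<lambda>i. J0 i \<oplus>\<^sub>s I i \<oplus>\<^sub>s J1 i) k" and h: "h \<in> envs" and w: "Linear_order w"
  shows "represents Z m (\<lambda>i. outer_seq w \<gamma> m (join_sides h) i False \<oplus>\<^sub>s I i \<oplus>\<^sub>s outer_seq w \<gamma> m (join_sides h) i True)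
    (\<lambda>v. case_sum h id (surround_entry \<gamma> k v))" (is "represents Z m ?K _")
proof (rule representsI)
  show "(\<lambda>v. case_sum h id (surround_entry \<gamma> k v)) \<in> envs"
    using envsD[OF h] surround_entry_const[OF representsD(1)[OF k]] by (intro envsI) (auto split: sum.split)
  show "sequence_of U (m i) (?K i)" if "i \<in> Z" for i
    using representsD(2)[OF k that]
    by (auto simp: sequence_of_append outer_seq_def intro!: sequence_of_row_tuple join_sides_envs h w)
  have "k ((i, Inl (Inr u)), c) = snd (I i) u ! c" if "i \<in> Z" "u \<in> idx (I i)" "c < m i" for i u c
    using representsD(3)[OF k, of i "Inl (Inr u)" c] that by simp
  thus "case_sum h id (surround_entry \<gamma> k ((i, t), c)) = snd (?K i) t ! c"
    if "i \<in> Z" "t \<in> idx (?K i)" "c < m i" for i t c using that by (auto simp: join_sides_def)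
qed

lemma mutually_indiscernible_outer_seq:
  fixes I J0 J1 :: "'x \<Rightarrow> ('i, 'm) tseq" and h :: "(('x \<times> bool) \<times> rat) \<times> nat \<Rightarrow> 'm" and \<gamma> :: "'w \<Rightarrow> rat"
  assumes mut: "mutually_indiscernible L U A Z (\<lambda>i. J0 i \<oplus>\<^sub>s I i \<oplus>\<^sub>s J1 i)" and Z: "Z \<subseteq> Y"
    and seq: "\<And>i. i \<in> Z \<Longrightarrow> sequence_of U (m i) (J0 i \<oplus>\<^sub>s I i \<oplus>\<^sub>s J1 i)"
    and E: "A \<subseteq> E" "\<And>i. i \<in> Z \<Longrightarrow> elems (I i) \<subseteq> E"
    and rep: "represents (Y \<times> UNIV) (\<lambda>p. m (fst p)) (side J0 J1) g" and h: "h \<in> envs"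
    and EM: "realizes_EM_type E (Y \<times> UNIV) (\<lambda>p. m (fst p)) (\<lambda>p. fst (side J0 J1 p)) g le_rows h"
    and w: "Linear_order w" "\<And>t t'. (t, t') \<in> w \<Longrightarrow> t \<noteq> t' \<Longrightarrow> \<gamma> t < \<gamma> t'"
  shows "mutually_indiscernible L U A Z (\<lambda>i. outer_seq w \<gamma> m (join_sides h) i False \<oplus>\<^sub>s I i \<oplus>\<^sub>s
    outer_seq w \<gamma> m (join_sides h) i True)" (is "mutually_indiscernible L U A Z ?K")
proof -
  let ?J = "\<lambda>i. J0 i \<oplus>\<^sub>s I i \<oplus>\<^sub>s J1 i"
  obtain k where k: "represents Z m ?J k" using represents_seq_env[of Z m ?J] seq by blast
  note repK = represents_surround_entry[OF k h w(1), of \<gamma>]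
  have elem: "k ((i, Inl (Inr u)), c) \<in> E" if "i \<in> Z" "u \<in> idx (I i)" "c < m i" for i u c
  proof -
    have "k ((i, Inl (Inr u)), c) = snd (I i) u ! c" "length (snd (I i) u) = m i"
      using representsD(3,4)[OF k, of i "Inl (Inr u)"] that by simp_all
    hence "k ((i, Inl (Inr u)), c) \<in> elems (I i)" using that unfolding elems_def by force
    thus ?thesis using E(2) that(1) by blast
  qed
  have "mut_indisc A Z (\<lambda>i. fst (?K i)) m (\<lambda>v. case_sum h id (surround_entry \<gamma> k v))"
  proof (rule mut_indisc_transfer[OF EM representsD(1)[OF rep] h representsD(1)[OF k]
        mut[unfolded mutually_indiscernible_iff[OF k]] representsD(5)[OF k] representsD(5)[OF repK] E(1)
        surround_entry_const[OF representsD(1)[OF k]], where T = "outer_positions \<gamma>"])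
    fix S assume S: "S \<subseteq> positions Z (\<lambda>i. fst (?K i))"
    show "finite (outer_positions \<gamma> S) \<and> outer_positions \<gamma> S \<subseteq> positions (Y \<times> UNIV) le_rows" if "finite S"
      using finite_outer_positions[OF that] S Z by (auto simp: outer_positions_def)
    show "surround_entry \<gamma> k v \<in> Inl ` coords (\<lambda>p. m (fst p)) (outer_positions \<gamma> S) \<union> Inr ` E"
      if "v \<in> coords m S" for v using that S elem by (auto simp: coords_def outer_positionsI)
    fix \<sigma> assume \<sigma>: "row_mono le_rows (\<lambda>p. fst (side J0 J1 p)) (outer_positions \<gamma> S) \<sigma>"
    show "row_mono (\<lambda>i. fst (?K i)) (\<lambda>i. fst (?J i)) S (surround_positions \<gamma> \<sigma>)"
      unfolding outer_seq_def by (rule row_mono_surround_positions[OF w(2) S[unfolded outer_seq_def] \<sigma>])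
    show "case_sum (g \<circ> lift \<sigma>) id (surround_entry \<gamma> k v) = (k \<circ> lift (surround_positions \<gamma> \<sigma>)) v"
      if "v \<in> coords m S" for v by (rule surround_entry_lift[OF rep k Z _ \<sigma> that]) (use S in auto)
  qed
  thus ?thesis using repK by (simp add: mutually_indiscernible_iff)
qed

definition sides_indisc :: "'m set \<Rightarrow> 'x set \<Rightarrow> ('x \<Rightarrow> nat) \<Rightarrow> (('x \<times> (bool \<times> 'i::linorder)) \<times> nat \<Rightarrow> 'm) \<Rightarrow> bool" where
  "sides_indisc E Y m H \<longleftrightarrow> (\<forall>(S :: ('x \<times> (bool \<times> 'i)) set) \<tau> \<tau>'. S \<subseteq> Y \<times> UNIV \<and>
     row_mono le_rows le_rows S \<tau> \<and> row_mono le_rows le_rows S \<tau>' \<and> (\<forall>p\<in>S. fst (snd (\<tau> p)) = fst (snd (\<tau>' p))) \<longrightarrow>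
     tp_eq E (coords m S) (H \<circ> lift \<tau>) (H \<circ> lift \<tau>'))"

lemma sides_indiscD:
  fixes S :: "('x \<times> (bool \<times> 'i::linorder)) set" and H :: "('x \<times> (bool \<times> 'i)) \<times> nat \<Rightarrow> 'm"
  assumes "sides_indisc E Y m H" "S \<subseteq> Y \<times> UNIV" "row_mono le_rows le_rows S \<tau>" "row_mono le_rows le_rows S \<tau>'"
    "\<And>p. p \<in> S \<Longrightarrow> fst (snd (\<tau> p)) = fst (snd (\<tau>' p))"
  shows "tp_eq E (coords m S) (H \<circ> lift \<tau>) (H \<circ> lift \<tau>')"
  by (rule assms(1)[unfolded sides_indisc_def, THEN spec, THEN spec, THEN spec, THEN mp])
    (intro conjI ballI assms(2-))

lemma sides_indisc_join_sides:
  fixes h :: "(('x \<times> bool) \<times> 'i::linorder) \<times> nat \<Rightarrow> 'm"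
  assumes mut: "mut_indisc E (Y \<times> UNIV) le_rows (\<lambda>p. m (fst p)) h" and h: "h \<in> envs"
  shows "sides_indisc E Y m (join_sides h)"
  unfolding sides_indisc_def
proof (intro allI impI, elim conjE)
  fix S and \<tau> \<tau>' :: "'x \<times> (bool \<times> 'i) \<Rightarrow> 'x \<times> (bool \<times> 'i)"
  assume S: "S \<subseteq> Y \<times> UNIV" and \<tau>: "row_mono le_rows le_rows S \<tau>" "row_mono le_rows le_rows S \<tau>'"
    and side: "\<forall>p\<in>S. fst (snd (\<tau> p)) = fst (snd (\<tau>' p))"
  define \<delta> where "\<delta> p = ((fst p, fst (snd (\<tau> p))), snd p)" for p
  define s where "s \<rho> d = (fst d, snd (snd (\<rho> (fst (fst d), snd d))))"
    for \<rho> :: "'x \<times> (bool \<times> 'i) \<Rightarrow> 'x \<times> (bool \<times> 'i)" and d :: "('x \<times> bool) \<times> (bool \<times> 'i)"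
  have mono: "row_mono le_rows le_rows (\<delta> ` S) (s \<rho>)"
    if \<rho>: "row_mono le_rows le_rows S \<rho>" and side_\<rho>: "\<forall>p\<in>S. fst (snd (\<tau> p)) = fst (snd (\<rho> p))" for \<rho>
  proof (rule row_mono_le_rowsI)
    fix ib x x' assume "(ib, x) \<in> \<delta> ` S" "(ib, x') \<in> \<delta> ` S" "x < x'"
    then obtain i where x: "(i, x) \<in> S" "(i, x') \<in> S" "fst ib = i" "snd ib = fst (snd (\<rho> (i, x)))"
      "snd ib = fst (snd (\<rho> (i, x')))" using side_\<rho> by (force simp: \<delta>_def)
    have "snd (\<rho> (i, x)) < snd (\<rho> (i, x'))" by (rule row_mono_le_rowsD[OF \<rho> x(1,2) \<open>x < x'\<close>])
    thus "snd (s \<rho> (ib, x)) < snd (s \<rho> (ib, x'))" using x(3-5) by (simp add: s_def less_prod_def')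
  qed (simp add: s_def)
  have "tp_eq E (coords (\<lambda>p. m (fst p)) (\<delta> ` S)) (h \<circ> lift (s \<tau>)) (h \<circ> lift (s \<tau>'))"
    by (rule mut_indisc_row_mono[OF mut h Linear_order_le_rel Linear_order_le_rel])
      (use S mono[OF \<tau>(1)] mono[OF \<tau>(2) side] in \<open>auto simp: \<delta>_def\<close>)
  hence eq: "tp_eq E (coords m S) (h \<circ> lift (s \<tau>) \<circ> lift \<delta>) (h \<circ> lift (s \<tau>') \<circ> lift \<delta>)"
    by (rule tp_eq_reindex) (auto simp: coords_def \<delta>_def intro: rev_image_eqI)
  have join: "tp_eq E (coords m S) (h \<circ> lift (s \<rho>) \<circ> lift \<delta>) (join_sides h \<circ> lift \<rho>)"
    if \<rho>: "row_mono le_rows le_rows S \<rho>" and side_\<rho>: "\<forall>p\<in>S. fst (snd (\<tau> p)) = fst (snd (\<rho> p))" for \<rho>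
  proof (rule tp_eq_agree)
    fix v assume "v \<in> coords m S"
    then obtain p c where v: "v = (p, c)" "p \<in> S" by (auto simp: coords_def)
    thus "(h \<circ> lift (s \<rho>) \<circ> lift \<delta>) v = (join_sides h \<circ> lift \<rho>) v"
      using row_monoD(1)[OF \<rho> v(2)] side_\<rho> by (simp add: s_def \<delta>_def join_sides_def)
  qed (intro envs_comp join_sides_envs h)+
  show "tp_eq E (coords m S) (join_sides h \<circ> lift \<tau>) (join_sides h \<circ> lift \<tau>')"
    by (rule tp_eq_trans[OF tp_eq_trans[OF tp_eq_sym[OF join[OF \<tau>(1)]] eq] join[OF \<tau>(2) side]]) simp
qed

end

subsection \<open>Crossing formulas\<close>

definition far_positions :: "(bool \<times> rat) set" where
  "far_positions = {False} \<times> {..< -1} \<union> {True} \<times> {1<..}"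

definition near_positions :: "(bool \<times> rat) set" where
  "near_positions = {False} \<times> {-1<..} \<union> {True} \<times> {..<1}"

definition near_order :: "(bool \<times> rat) rel" where
  "near_order = Restr le_rel near_positions"

lemma Linear_order_near_order: "Linear_order near_order"
  unfolding near_order_def by (rule Linear_order_Restr) simp

lemma Field_near_order [simp]: "Field near_order = near_positions"
  by (auto simp: near_order_def Field_def)

lemma less_far_near: "s \<in> far_positions \<Longrightarrow> x \<in> near_positions \<Longrightarrow> s < x \<longleftrightarrow> \<not> fst s"
  and less_near_far: "s \<in> far_positions \<Longrightarrow> x \<in> near_positions \<Longrightarrow> x < s \<longleftrightarrow> fst s"
  by (auto simp: far_positions_def near_positions_def less_prod_def')

lemma far_near_disjoint: "far_positions \<inter> near_positions = {}"
  by (auto simp: far_positions_def near_positions_def)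

lemma (in monster) mut_indisc_near:
  fixes H :: "('x \<times> (bool \<times> rat)) \<times> nat \<Rightarrow> 'm"
  assumes mut: "mut_indisc A Y le_rows m H" and H: "H \<in> envs"
  shows "mut_indisc (A \<union> H ` coords m (Y \<times> far_positions)) Y (\<lambda>_. near_order) m H"
proof (rule mut_indisc_absorb_positions[OF mut H Linear_order_le_rel])
  show "positions Y (\<lambda>_. near_order) \<subseteq> positions Y le_rows - Y \<times> far_positions" using far_near_disjoint by auto
  fix S and \<tau> :: "'x \<times> (bool \<times> rat) \<Rightarrow> 'x \<times> (bool \<times> rat)"
  assume S: "S \<subseteq> positions Y (\<lambda>_. near_order)" and \<tau>: "row_mono (\<lambda>_. near_order) (\<lambda>_. near_order) S \<tau>"
  have near: "s \<in> near_positions" "snd (\<tau> (i, s)) \<in> near_positions" if "(i, s) \<in> S" for i s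
    using S that row_monoD(2)[OF \<tau> that] by auto
  have mono: "snd (\<tau> (i, s)) < snd (\<tau> (i, s'))" if "(i, s) \<in> S" "(i, s') \<in> S" "s < s'" for i s s'
    using row_monoD(3)[OF \<tau> that(1,2)] near(1)[OF that(1)] near(1)[OF that(2)] that(3)
    by (auto simp: near_order_def less_le simp del: less_prod_simp)
  show "row_mono le_rows le_rows (S \<union> Y \<times> far_positions) (\<lambda>p. if p \<in> S then \<tau> p else p)"
  proof (rule row_mono_le_rowsI)
    fix i s s' assume pos: "(i, s) \<in> S \<union> Y \<times> far_positions" "(i, s') \<in> S \<union> Y \<times> far_positions" and "s < s'"
    consider "(i, s) \<in> S" "(i, s') \<in> S" | "(i, s) \<in> S" "(i, s') \<notin> S" "s' \<in> far_positions"
      | "(i, s) \<notin> S" "s \<in> far_positions" "(i, s') \<in> S" | "(i, s) \<notin> S" "(i, s') \<notin> S" using pos by blast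
    thus "snd (if (i, s) \<in> S then \<tau> (i, s) else (i, s)) < snd (if (i, s') \<in> S then \<tau> (i, s') else (i, s'))"
      using mono near less_near_far less_far_near \<open>s < s'\<close> by cases (simp_all del: less_prod_simp)
  qed (use row_monoD(1)[OF \<tau>] in simp)
qed auto

definition initial_in :: "'a::linorder set \<Rightarrow> 'a set \<Rightarrow> bool" where
  "initial_in R F \<longleftrightarrow> F \<subseteq> R \<and> (\<forall>s\<in>R. \<forall>t\<in>F. s < t \<longrightarrow> s \<in> F)"

lemma initial_segment_step:
  fixes R :: "'a::linorder set"
  assumes R: "finite R" and F: "initial_in R F1" "initial_in R F2" "Q F1 \<noteq> Q F2"
  shows "\<exists>F s. s \<in> R - F \<and> initial_in R F \<and> initial_in R (insert s F) \<and> Q F \<noteq> Q (insert s F)"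
proof (rule ccontr)
  assume const: "\<not> ?thesis"
  have "Q F = Q {}" if "initial_in R F" for F
    using finite_subset[OF _ R, of F] that
  proof (induction "card F" arbitrary: F)
    case (Suc k)
    hence F: "finite F" "F \<noteq> {}" "F \<subseteq> R" by (auto simp: initial_in_def)
    let ?s = "Max F"
    have s: "?s \<in> F" "\<forall>t\<in>F. t \<le> ?s" using F by simp_all
    have "initial_in R (F - {?s})"
      using Suc.prems(2) s by (auto simp: initial_in_def not_less[symmetric] simp del: less_prod_simp)
    moreover have "insert ?s (F - {?s}) = F" using s(1) by blast
    ultimately have "Q (F - {?s}) = Q F" using const Suc.prems(2) s(1) F(3) by (metis Diff_iff insertI1 subsetD)
    moreover have "Q (F - {?s}) = Q {}"
      by (rule Suc.hyps(1)) (use Suc.hyps(2) F s(1) \<open>initial_in R (F - {?s})\<close> in \<open>auto simp: initial_in_def\<close>)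
    ultimately show ?case by simp
  qed (auto simp: initial_in_def)
  thus False using F by simp
qed

definition place :: "(bool \<times> rat) set \<Rightarrow> bool \<Rightarrow> bool \<times> rat \<Rightarrow> bool \<times> rat" where
  "place T b s = (b, if b then 2 + of_nat (card {t \<in> T. t < s})
     else of_nat (card {t \<in> T. t < s}) - of_nat (card T) - 1)"

lemma card_less_mono:
  fixes T :: "'a::linorder set"
  assumes "finite T" "s \<in> T" "s < s'"
  shows "card {t \<in> T. t < s} < card {t \<in> T. t < s'}"
proof (rule psubset_card_mono)
  show "{t \<in> T. t < s} \<subset> {t \<in> T. t < s'}"
    using assms(2,3) less_trans[OF _ assms(3)] less_irrefl[of s] by blast
qed (simp add: assms(1))

lemma fst_place [simp]: "fst (place T b s) = b"
  by (simp add: place_def)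

lemma place_far:
  assumes "finite T" "s \<in> T"
  shows "place T b s \<in> far_positions"
proof -
  have "card {t \<in> T. t < s} < card T" by (rule psubset_card_mono) (use assms in auto)
  thus ?thesis by (auto simp: place_def far_positions_def)
qed

lemma place_less: "finite T \<Longrightarrow> s \<in> T \<Longrightarrow> s < s' \<Longrightarrow> b \<le> b' \<Longrightarrow> place T b s < place T b' s'"
  using card_less_mono[of T s s'] by (cases b; cases b') (auto simp: place_def less_prod_def')

definition placement ::
    "('x \<times> (bool \<times> rat)) set \<Rightarrow> 'x \<Rightarrow> (bool \<times> rat) set \<Rightarrow> 'x \<times> (bool \<times> rat) \<Rightarrow> 'x \<times> (bool \<times> rat)" where
  "placement S i F p = (fst p, place (snd ` S) (if fst p = i then snd p \<notin> F else fst (snd p)) (snd p))"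

lemma placement_far: "finite S \<Longrightarrow> p \<in> S \<Longrightarrow> placement S i F p \<in> {fst p} \<times> far_positions"
  by (simp add: placement_def place_far)

lemma row_mono_placement:
  assumes S: "finite S" and F: "initial_in (S `` {i}) F"
  shows "row_mono le_rows le_rows S (placement S i F)"
proof (rule row_mono_le_rowsI)
  fix j s s' assume s: "(j, s) \<in> S" "(j, s') \<in> S" "s < s'"
  have "(if j = i then s \<notin> F else fst s) \<le> (if j = i then s' \<notin> F else fst s')"
    using s F by (auto simp: initial_in_def less_prod_def' simp del: less_prod_simp)
  thus "snd (placement S i F (j, s)) < snd (placement S i F (j, s'))"
    unfolding placement_def snd_conv fst_conv by (intro place_less) (use S s in force)+
qed (simp add: placement_def)

lemma row_mono_placement_upd:
  assumes S: "finite S" and F: "initial_in (S `` {i}) F" "initial_in (S `` {i}) (insert s0 F)"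
    and s0: "(i, s0) \<in> S" "s0 \<notin> F" and x: "x \<in> near_positions"
  shows "row_mono le_rows le_rows S ((placement S i F)((i, s0) := (i, x)))"
proof (rule row_mono_le_rowsI)
  let ?\<rho> = "(placement S i F)((i, s0) := (i, x))"
  show "fst (?\<rho> p) = fst p" for p by (simp add: placement_def)
  fix j s s' assume s: "(j, s) \<in> S" "(j, s') \<in> S" "s < s'"
  have far: "snd (placement S i F (j, t)) \<in> far_positions" if "(j, t) \<in> S" for t
    using placement_far[OF S that, of i F] by auto
  have "s \<in> F" if "j = i" "s' = s0" using F(2) s that by (auto simp: initial_in_def)
  moreover have "s' \<notin> F" if "j = i" "s = s0" using F(1) s s0 that by (auto simp: initial_in_def)
  moreover have "snd (placement S i F (j, s)) < snd (placement S i F (j, s'))"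
    by (rule row_mono_le_rowsD[OF row_mono_placement[OF S F(1)] s])
  ultimately show "snd (?\<rho> (j, s)) < snd (?\<rho> (j, s'))"
    using less_far_near[OF far[OF s(1)] x] less_near_far[OF far[OF s(2)] x] s(3)
    by (auto simp: placement_def)
qed

definition left_part ::
    "('x \<times> (bool \<times> rat)) set \<Rightarrow> ('x \<times> (bool \<times> rat) \<Rightarrow> 'x \<times> (bool \<times> rat)) \<Rightarrow> 'x \<Rightarrow> (bool \<times> rat) set" where
  "left_part S \<tau> i = {s. (i, s) \<in> S \<and> \<not> fst (snd (\<tau> (i, s)))}"

lemma initial_in_left_part:
  assumes "row_mono le_rows le_rows S \<tau>"
  shows "initial_in (S `` {i}) (left_part S \<tau> i)"
  using row_mono_le_rowsD[OF assms] by (fastforce simp: initial_in_def left_part_def less_prod_def')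

context monster
begin

context
  fixes E :: "'m set" and Y :: "'x set" and m :: "'x \<Rightarrow> nat" and H :: "('x \<times> (bool \<times> rat)) \<times> nat \<Rightarrow> 'm"
    and S :: "('x \<times> (bool \<times> rat)) set" and i :: 'x and P :: "(('x \<times> (bool \<times> rat)) \<times> nat \<Rightarrow> 'm) \<Rightarrow> bool"
  assumes sides: "sides_indisc E Y m H" and S: "finite S" "S \<subseteq> Y \<times> UNIV" and P: "definable E (coords m S) P"
begin

lemma placement_left_part:
  assumes \<tau>: "row_mono le_rows le_rows S \<tau>" "\<forall>p\<in>S. fst p \<noteq> i \<longrightarrow> \<tau> p = p"
  shows "P (H \<circ> lift \<tau>) \<longleftrightarrow> P (H \<circ> lift (placement S i (left_part S \<tau> i)))"
proof (rule tp_eqD[OF sides_indiscD[OF sides S(2) \<tau>(1) row_mono_placement[OF S(1) initial_in_left_part[OF \<tau>(1)]]] P])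
  show "fst (snd (\<tau> p)) = fst (snd (placement S i (left_part S \<tau> i) p))" if "p \<in> S" for p
    using that bspec[OF \<tau>(2) that] by (cases p) (auto simp: placement_def left_part_def)
qed

lemma ex_crossing_step:
  assumes \<tau>: "row_mono le_rows le_rows S \<tau>" "\<forall>p\<in>S. fst p \<noteq> i \<longrightarrow> \<tau> p = p" and moved: "P H \<noteq> P (H \<circ> lift \<tau>)"
  shows "\<exists>F s. (i, s) \<in> S \<and> s \<notin> F \<and> initial_in (S `` {i}) F \<and> initial_in (S `` {i}) (insert s F) \<and>
    P (H \<circ> lift (placement S i F)) \<noteq> P (H \<circ> lift (placement S i (insert s F)))"
proof -
  have "finite (S `` {i})" using S(1) by (rule finite_Image)
  moreover have id: "row_mono le_rows le_rows S id" by (rule row_mono_id[of S UNIV]) auto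
  moreover have "P (H \<circ> lift (placement S i (left_part S id i))) \<noteq> P (H \<circ> lift (placement S i (left_part S \<tau> i)))"
    using placement_left_part[OF id] placement_left_part[OF \<tau>] moved by (simp add: map_prod.id)
  ultimately show ?thesis
    using initial_segment_step[OF _ initial_in_left_part[OF id] initial_in_left_part[OF \<tau>(1)],
        where Q = "\<lambda>F. P (H \<circ> lift (placement S i F))"] by blast
qed

lemma placement_upd_near:
  assumes F: "initial_in (S `` {i}) F" "initial_in (S `` {i}) (insert s0 F)" and s0: "(i, s0) \<in> S" "s0 \<notin> F"
    and x: "x \<in> near_positions"
  shows "P (H \<circ> lift ((placement S i F)((i, s0) := (i, x)))) \<longleftrightarrow>
    P (H \<circ> lift (placement S i (if fst x then F else insert s0 F)))"
  by (rule tp_eqD[OF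
        sides_indiscD[OF sides S(2) row_mono_placement_upd[OF S(1) F s0 x] row_mono_placement[OF S(1)]] P])
    (use F s0 in \<open>auto simp: placement_def\<close>)

end

definition crosses ::
    "'m list \<Rightarrow> 'm set \<Rightarrow> ('x \<Rightarrow> nat) \<Rightarrow> (('x \<times> (bool \<times> rat)) \<times> nat \<Rightarrow> 'm) \<Rightarrow> 'x \<Rightarrow> ('f, 'r, 'm) pfm \<Rightarrow> bool" where
  "crosses a A m H i p \<longleftrightarrow> p \<in> pfmlas L A (length a + m i) \<and>
     (\<forall>x\<in>near_positions. psat U p (a @ row_tuple m H i x) \<longleftrightarrow> \<not> fst x)"

theorem crossing_formula:
  fixes H :: "('x \<times> (bool \<times> rat)) \<times> nat \<Rightarrow> 'm"
  assumes sides: "sides_indisc E Y m H" and H: "H \<in> envs" and AE: "A \<union> set a \<subseteq> E" and a: "set a \<subseteq> univ U"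
    and S: "finite S" "S \<subseteq> Y \<times> UNIV" and \<tau>: "row_mono le_rows le_rows S \<tau>" "\<forall>p\<in>S. fst p \<noteq> i \<longrightarrow> \<tau> p = p"
    and moved: "\<not> tp_eq (A \<union> set a) (coords m S) H (H \<circ> lift \<tau>)"
  shows "\<exists>p. crosses a (A \<union> H ` coords m (Y \<times> far_positions)) m H i p"
proof -
  obtain P where P: "definable (A \<union> set a) (coords m S) P" "P H \<noteq> P (H \<circ> lift \<tau>)"
    using moved unfolding tp_eq_def by blast
  note PE = definable_mono[OF P(1) AE order_refl]
  obtain F s0 where s0: "(i, s0) \<in> S" "s0 \<notin> F"
    and F: "initial_in (S `` {i}) F" "initial_in (S `` {i}) (insert s0 F)"
    and step: "P (H \<circ> lift (placement S i F)) \<noteq> P (H \<circ> lift (placement S i (insert s0 F)))"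
    using ex_crossing_step[OF sides S PE \<tau> P(2)] by (elim exE conjE)
  let ?A = "A \<union> H ` coords m (Y \<times> far_positions)"
  let ?far = "H \<circ> lift (placement S i F)"
  define R where "R y \<longleftrightarrow> (P (\<lambda>w. case_sum y id (if fst w = (i, s0) then Inl (snd w) else Inr (?far w))) \<longleftrightarrow>
    P (H \<circ> lift (placement S i (insert s0 F))))" for y
  have far: "?far w \<in> ?A" if "w \<in> coords m S" for w
  proof -
    obtain p c where w: "w = (p, c)" "p \<in> S" "c < m (fst p)" using \<open>w \<in> coords m S\<close> by (auto simp: coords_def)
    moreover have "fst p \<in> Y" using S(2) w(2) by auto
    ultimately have "lift (placement S i F) w \<in> coords m (Y \<times> far_positions)"
      using placement_far[OF S(1) w(2), of i F] by (cases "placement S i F p") (auto simp: coords_def)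
    thus ?thesis by simp
  qed
  have "definable (?A \<union> set a) {..<m i} R"
    unfolding R_def[abs_def]
    by (intro definable_iff definable_const definable_subst[OF P(1)])
      (use far envsD[OF envs_comp[OF H]] in \<open>auto simp: coords_def split: if_splits\<close>)
  then obtain p where p: "p \<in> pfmlas L ?A (length a + m i)"
    "\<forall>y\<in>envs. psat U p (a @ map y [0..<m i]) \<longleftrightarrow> R y"
    using definable_imp_pfm_append[OF _ a] by blast
  have "psat U p (a @ row_tuple m H i x) \<longleftrightarrow> \<not> fst x" if x: "x \<in> near_positions" for x
  proof -
    have "psat U p (a @ row_tuple m H i x) \<longleftrightarrow> R (\<lambda>c. H ((i, x), c))"
      unfolding row_tuple_def by (rule bspec[OF p(2)]) (intro envsI envsD[OF H])
    also have "\<dots> \<longleftrightarrow> (P (H \<circ> lift ((placement S i F)((i, s0) := (i, x)))) \<longleftrightarrow> P (H \<circ> lift (placement S i (insert s0 F))))"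
      unfolding R_def by (intro arg_cong[of _ _ "\<lambda>z. P z \<longleftrightarrow> _"] ext) (auto simp: map_prod_def split: prod.split)
    also have "\<dots> \<longleftrightarrow> \<not> fst x" using placement_upd_near[OF sides S PE F s0 x] step by auto
    finally show ?thesis .
  qed
  thus ?thesis unfolding crosses_def using p(1) by blast
qed

subsection \<open>Op-dimension patterns from crossing formulas\<close>

lemma tp_eq_psat:
  assumes "tp_eq A W k k'" "p \<in> pfmlas L A (length xs)" "set xs \<subseteq> W"
  shows "psat U p (map k xs) \<longleftrightarrow> psat U p (map k' xs)"
  by (rule tp_eqD[OF assms(1) definable_mono[OF pfm_imp_definable[OF assms(2)] order_refl assms(3)]])

lemma mut_indisc_change_base:
  fixes h :: "('x \<times> 'i) \<times> nat \<Rightarrow> 'm" and c :: "'v \<Rightarrow> 'm"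
  assumes mut: "mut_indisc A X r m h" and env: "h \<in> envs" "c \<in> envs" and AB: "A \<subseteq> B"
    and B: "|B| <o kb" "B \<subseteq> univ U" and X: "|X| <o kb" and V: "|V| <o kb"
    and r: "\<And>i. i \<in> X \<Longrightarrow> Linear_order (r i)" "\<And>i. i \<in> X \<Longrightarrow> infinite (Field (r i))"
      "\<And>i. i \<in> X \<Longrightarrow> |Field (r i)| <o kb"
  shows "\<exists>k\<in>envs. mut_indisc B X r m (k \<circ> Inl) \<and>
    tp_eq A (Inl ` coords m (positions X r) \<union> Inr ` V) k (case_sum h c)"
proof -
  let ?P = "coords m (positions X r)"
  have A: "|A| <o kb" "A \<subseteq> univ U" using small_subset_mono[OF B(1) AB] AB B(2) by auto
  have "\<exists>h'\<in>envs. mut_indisc B X r m h' \<and>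
      (\<forall>S \<sigma>. S \<subseteq> positions X r \<longrightarrow> row_mono r r S \<sigma> \<longrightarrow> tp_eq A (coords m S) h' (h \<circ> lift \<sigma>))"
    by (rule mut_indisc_stretch[OF mut env(1) AB B X r(1,2) r(1,3)])
  then obtain h' where h': "h' \<in> envs" "mut_indisc B X r m h'"
    "\<forall>S \<sigma>. S \<subseteq> positions X r \<longrightarrow> row_mono r r S \<sigma> \<longrightarrow> tp_eq A (coords m S) h' (h \<circ> lift \<sigma>)" by (elim bexE conjE)
  have "tp_eq A ?P h' (h \<circ> lift id)" by (rule h'(3)[rule_format, OF order_refl row_mono_id[OF order_refl]])
  hence "tp_eq A ?P h h'" by (simp add: map_prod.id tp_eq_sym)
  hence "tp_eq A (Inl ` ?P) (h \<circ> projl) (h' \<circ> projl)" by (rule tp_eq_reindex) auto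
  with tp_eq_agree[OF envs_case_sum[OF env] envs_comp[OF env(1)]]
  have eq: "tp_eq A (Inl ` ?P) (case_sum h c) (h' \<circ> projl)" by (rule tp_eq_trans) auto
  have "|Inl ` ?P \<union> Inr ` V| <o kb" by (intro small_Un small_image small_coords[OF X r(3)] V)
  hence "\<exists>k\<in>envs. (\<forall>v\<in>Inl ` ?P. k v = (h' \<circ> projl) v) \<and> tp_eq A (Inl ` ?P \<union> Inr ` V) k (case_sum h c)"
    by (rule extend_type[OF _ A envs_case_sum[OF env] envs_comp[OF h'(1)] Un_upper1 eq])
  then obtain k where k: "k \<in> envs" "\<forall>v\<in>Inl ` ?P. k v = (h' \<circ> projl) v"
    "tp_eq A (Inl ` ?P \<union> Inr ` V) k (case_sum h c)" by (elim bexE conjE)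
  have "tp_eq B ?P (k \<circ> Inl) h'" by (rule tp_eq_agree[OF envs_comp[OF k(1)] h'(1)]) (use k(2) in simp)
  from mut_indisc_tp_eq[OF h'(2) this] k(3) show ?thesis by (intro bexI[OF _ k(1)] conjI)
qed

lemma ex_realization_over:
  fixes h :: "('x \<times> 'i) \<times> nat \<Rightarrow> 'm"
  assumes mut: "mut_indisc A X r m h" and h: "h \<in> envs" and AB: "A \<subseteq> B"
    and B: "|B| <o kb" "B \<subseteq> univ U" and X: "|X| <o kb"
    and r: "\<And>i. i \<in> X \<Longrightarrow> Linear_order (r i)" "\<And>i. i \<in> X \<Longrightarrow> infinite (Field (r i))"
      "\<And>i. i \<in> X \<Longrightarrow> |Field (r i)| <o kb" and a: "a \<in> tuples U n"
  shows "\<exists>h'\<in>envs. \<exists>a'\<in>tuples U n. mut_indisc B X r m h' \<and> (\<forall>p\<in>pfmlas L A n. psat U p a' \<longleftrightarrow> psat U p a) \<and>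
    (\<forall>i\<in>X. \<forall>x\<in>Field (r i). \<forall>p\<in>pfmlas L A (n + m i).
      psat U p (a' @ row_tuple m h' i x) \<longleftrightarrow> psat U p (a @ row_tuple m h i x))"
proof -
  define c where "c j = (if j < n then a ! j else base_elem)" for j
  have len: "length a = n" and aU: "set a \<subseteq> univ U" using a by (auto simp: tuples_def)
  have c: "c \<in> envs" using aU base_elem len by (intro envsI) (auto simp: c_def)
  have map_c: "map c [0..<n] = a" by (rule nth_equalityI) (simp_all add: c_def len)
  let ?W = "Inl ` coords m (positions X r) \<union> Inr ` {..<n}"
  have "\<exists>k\<in>envs. mut_indisc B X r m (k \<circ> Inl) \<and> tp_eq A ?W k (case_sum h c)"
    by (rule mut_indisc_change_base[OF mut h c AB B X small_finite[OF finite_lessThan] r])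
  then obtain k where k: "k \<in> envs" "mut_indisc B X r m (k \<circ> Inl)" "tp_eq A ?W k (case_sum h c)"
    by (elim bexE conjE)
  let ?a = "map (k \<circ> Inr) [0..<n]"
  have "?a \<in> tuples U n" using envsD[OF k(1)] by (auto simp: tuples_def)
  moreover have "psat U p ?a \<longleftrightarrow> psat U p a" if "p \<in> pfmlas L A n" for p
  proof -
    have "psat U p (map k (map Inr [0..<n])) \<longleftrightarrow> psat U p (map (case_sum h c) (map Inr [0..<n]))"
      by (rule tp_eq_psat[OF k(3)]) (use that in auto)
    thus ?thesis using map_c by (simp add: comp_def)
  qed
  moreover have "psat U p (?a @ row_tuple m (k \<circ> Inl) i x) \<longleftrightarrow> psat U p (a @ row_tuple m h i x)"
    if i: "i \<in> X" "x \<in> Field (r i)" and p: "p \<in> pfmlas L A (n + m i)" for i x p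
  proof -
    let ?xs = "map Inr [0..<n] @ map (\<lambda>j. Inl ((i, x), j)) [0..<m i]"
    have "psat U p (map k ?xs) \<longleftrightarrow> psat U p (map (case_sum h c) ?xs)"
      by (rule tp_eq_psat[OF k(3)]) (use p i in \<open>auto simp: coords_def\<close>)
    thus ?thesis using map_c by (simp add: row_tuple_def comp_def)
  qed
  ultimately show ?thesis
    by (intro bexI[OF _ envs_comp[OF k(1)]] bexI[of _ ?a] conjI ballI) (use k(2) in simp_all)
qed

definition absorb :: "('x \<Rightarrow> nat) \<Rightarrow> ('x \<times> nat \<Rightarrow> 'm) \<Rightarrow> (('x \<times> 'i) \<times> nat \<Rightarrow> 'm) \<Rightarrow> ('x \<times> 'i) \<times> nat \<Rightarrow> 'm" where
  "absorb m c h v = (if m (fst (fst v)) \<le> snd v then c (fst (fst v), snd v - m (fst (fst v))) else h v)"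

lemma mut_indisc_absorb:
  assumes mut: "mut_indisc A X r m h" and env: "h \<in> envs" "c \<in> envs"
    and c: "\<And>i j. i \<in> X \<Longrightarrow> j < l i \<Longrightarrow> c (i, j) \<in> A"
  shows "mut_indisc A X r (\<lambda>i. m i + l i) (absorb m c h)"
proof (rule mut_indiscI)
  let ?m = "\<lambda>i. m i + l i"
  fix S \<tau> assume S: "finite S" "S \<subseteq> positions X r" and \<tau>: "row_mono r r S \<tau>"
  define T where "T = {v :: ('a \<times> 'b) \<times> nat. m (fst (fst v)) \<le> snd v}"
  define const where "const v = c (fst (fst v), snd v - m (fst (fst v)))" for v :: "('a \<times> 'b) \<times> nat"
  have const: "const \<in> envs" using envsD[OF env(2)] by (intro envsI) (simp add: const_def)
  have absorb_eq: "absorb m c g = (\<lambda>v. if v \<in> T then const v else g v)" for g :: "('a \<times> 'b) \<times> nat \<Rightarrow> 'm"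
    by (rule ext) (simp add: absorb_def T_def const_def)
  show "tp_eq A (coords ?m S) (absorb m c h) (absorb m c h \<circ> lift \<tau>)"
    unfolding tp_eq_def
  proof (intro allI impI)
    fix P assume P: "definable A (coords ?m S) P"
    have "definable A (coords m S) (\<lambda>g. P (absorb m c g))"
      unfolding absorb_eq
    proof (rule definable_fix[OF P const order_refl])
      show "const ` (coords ?m S \<inter> T) \<subseteq> A"
        using c positionsD[OF S(2)] by (force simp: coords_def T_def const_def)
    qed (auto simp: coords_def T_def)
    hence "P (absorb m c h) \<longleftrightarrow> P (absorb m c (h \<circ> lift \<tau>))"
      using mut S \<tau> unfolding mut_indisc_def by (blast dest: tp_eqD)
    also have "\<dots> \<longleftrightarrow> P (absorb m c h \<circ> lift \<tau>)"
      by (rule definable_local[OF P]) (use row_monoD(1)[OF \<tau>] env const in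
        \<open>auto simp: coords_def absorb_def absorb_eq[abs_def] T_def const_def intro!: envs_merge envs_comp\<close>)
    finally show "P (absorb m c h) \<longleftrightarrow> P (absorb m c h \<circ> lift \<tau>)" .
  qed
qed

lemma dlr_pattern_over_base:
  fixes r :: "'c::countable rel" and f :: "'k \<Rightarrow> 'x"
  assumes mut: "mut_indisc B X (\<lambda>_. r) m h" and h: "h \<in> envs" and r: "Linear_order r" and a: "realizes U n \<pi> a"
    and f: "inj_on f (Field \<kappa>)" "f ` Field \<kappa> \<subseteq> X"
    and \<phi>: "\<And>i. i \<in> X \<Longrightarrow> \<phi> i \<in> pfmlas L B (n + m i)"
      "\<And>i. i \<in> X \<Longrightarrow> infinite {x \<in> Field r. psat U (\<phi> i) (a @ row_tuple m h i x)}"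
      "\<And>i. i \<in> X \<Longrightarrow> infinite {x \<in> Field r. \<not> psat U (\<phi> i) (a @ row_tuple m h i x)}"
  shows "dlr_pattern L U kb B n \<pi> \<kappa>"
proof -
  obtain g :: "'c \<Rightarrow> 'k" where g: "inj g" "Linear_order (dir_image r g)" "|Field (dir_image r g)| <o kb"
    using ex_small_copy[OF r] by blast
  define K where "K i = (dir_image r g, \<lambda>t. row_tuple m h i (inv g t))" for i
  have seqK: "sequence_of U (m i) (K i)" for i unfolding K_def by (rule sequence_of_row_tuple[OF h g(2)])
  let ?f = "\<lambda>p. (fst p, inv g (snd p))"
  have "row_mono (\<lambda>i. fst (K i)) (\<lambda>_. r) (positions X (\<lambda>i. fst (K i))) ?f"
    by (rule row_monoI) (use g(1) in \<open>auto simp: K_def dir_image_Field dir_image_iff\<close>)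
  hence "mut_indisc B X (\<lambda>i. fst (K i)) m (h \<circ> lift ?f)"
    by (intro mut_indisc_reindex[OF mut h r]) (use g(2) in \<open>simp_all add: K_def\<close>)
  moreover have "represents X m K (h \<circ> lift ?f)"
    by (rule representsI[OF envs_comp[OF h] seqK]) (simp add: K_def)
  ultimately have "mutually_indiscernible L U B X K" by (simp add: mutually_indiscernible_iff)
  hence mutK: "mutually_indiscernible L U B (Field \<kappa>) (\<lambda>i. K (f i))"
    by (rule mutually_indiscernible_inj[OF _ f order_refl])
  have count: "{t \<in> idx (K i). Q (snd (K i) t)} = g ` {x \<in> Field r. Q (row_tuple m h i x)}" for i Q
    using g(1) by (auto simp: K_def dir_image_Field)
  have "infinite {t \<in> idx (K i). psat U (\<phi> i) (a @ snd (K i) t)}"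
    "infinite {t \<in> idx (K i). \<not> psat U (\<phi> i) (a @ snd (K i) t)}" if "i \<in> X" for i
    using \<phi>(2,3)[OF that] count[of i "\<lambda>y. psat U (\<phi> i) (a @ y)"] count[of i "\<lambda>y. \<not> psat U (\<phi> i) (a @ y)"]
    by (simp_all add: finite_image_iff inj_on_subset[OF g(1)])
  moreover have "small_seq kb (K i)" for i using g(3) by (simp add: small_seq_def K_def)
  ultimately show ?thesis
    unfolding dlr_pattern_def using a mutK seqK \<phi>(1) f(2)
    by (intro exI[of _ a] exI[of _ "\<lambda>i. K (f i)"] exI[of _ "\<lambda>i. m (f i)"] exI[of _ "\<lambda>i. \<phi> (f i)"]) blast
qed

lemma dlr_patternI:
  fixes r :: "'c::countable rel" and f :: "'k \<Rightarrow> 'x"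
  assumes mut: "mut_indisc A X (\<lambda>_. r) m h" and h: "h \<in> envs" and A: "B \<subseteq> A" "A \<subseteq> univ U" and r: "Linear_order r"
    and a: "realizes U n \<pi> a" and f: "inj_on f (Field \<kappa>)" "f ` Field \<kappa> \<subseteq> X"
    and \<phi>: "\<And>i. i \<in> X \<Longrightarrow> \<phi> i \<in> pfmlas L A (n + m i)"
      "\<And>i. i \<in> X \<Longrightarrow> infinite {x \<in> Field r. psat U (\<phi> i) (a @ row_tuple m h i x)}"
      "\<And>i. i \<in> X \<Longrightarrow> infinite {x \<in> Field r. \<not> psat U (\<phi> i) (a @ row_tuple m h i x)}"
  shows "dlr_pattern L U kb B n \<pi> \<kappa>"
proof -
  define c where "c v = (if fst v \<in> X \<and> snd v < length (snd (\<phi> (fst v)))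
      then snd (\<phi> (fst v)) ! snd v else base_elem)"
    for v :: "'x \<times> nat"
  let ?m = "\<lambda>i. m i + length (snd (\<phi> i))"
  have params: "set (snd (\<phi> i)) \<subseteq> A" if "i \<in> X" for i using \<phi>(1)[OF that] by (auto simp: pfmlas_def)
  have cA: "c (i, j) \<in> A" if "i \<in> X" "j < length (snd (\<phi> i))" for i j
    using params[OF that(1)] that by (auto simp: c_def)
  hence c: "c \<in> envs" using A(2) base_elem by (intro envsI) (auto simp: c_def)
  have row: "row_tuple ?m (absorb m c h) i x = row_tuple m h i x @ snd (\<phi> i)" if "i \<in> X" for i x
    by (rule nth_equalityI) (use that in \<open>auto simp: row_tuple_def absorb_def c_def nth_append\<close>)
  have psat: "psat U (fst (\<phi> i), []) (a @ row_tuple ?m (absorb m c h) i x) \<longleftrightarrow> psat U (\<phi> i) (a @ row_tuple m h i x)"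
    if "i \<in> X" for i x by (simp add: row[OF that] psat_def)
  show ?thesis
  proof (rule dlr_pattern_over_base[OF mut_indisc_mono[OF mut_indisc_absorb[OF mut h c cA] A(1) order_refl] _ r a f])
    show "absorb m c h \<in> envs" using envsD[OF h] envsD[OF c] by (intro envsI) (simp add: absorb_def)
    show "(fst (\<phi> i), []) \<in> pfmlas L B (n + ?m i)" if "i \<in> X" for i
      using \<phi>(1)[OF that] by (auto simp: pfmlas_def add.assoc)
  qed (use \<phi>(2,3) psat in simp_all)
qed

lemma infinite_near_positions: "infinite {x \<in> near_positions. fst x = b}"
proof (rule infinite_super)
  show "Pair b ` (if b then {..<1} else {-1<..}) \<subseteq> {x \<in> near_positions. fst x = b}"
    by (auto simp: near_positions_def)
  show "infinite (Pair b ` (if b then {..<1 :: rat} else {-1<..}))"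
    by (simp add: finite_image_iff inj_on_def infinite_Ioi infinite_Iio)
qed

theorem crossing_pattern:
  fixes H :: "('x \<times> (bool \<times> rat)) \<times> nat \<Rightarrow> 'm" and f :: "'k \<Rightarrow> 'x"
  assumes mut: "mut_indisc A Y le_rows m H" and H: "H \<in> envs" and A: "|A| <o kb" "A \<subseteq> univ U" and Y: "|Y| <o kb"
    and B: "small_subset U kb B" and a: "realizes U n \<pi> a" and \<pi>: "\<pi> \<subseteq> pfmlas L A n"
    and f: "inj_on f (Field \<kappa>)" "f ` Field \<kappa> \<subseteq> Y"
    and cross: "\<forall>i\<in>f ` Field \<kappa>. \<exists>p. crosses a (A \<union> H ` coords m (Y \<times> far_positions)) m H i p"
  shows "dlr_pattern L U kb B n \<pi> \<kappa>"
proof -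
  let ?A = "A \<union> H ` coords m (Y \<times> far_positions)"
  have at: "a \<in> tuples U n" "length a = n" using a by (auto simp: realizes_def tuples_def)
  have B': "|B| <o kb" "B \<subseteq> univ U" using B by (auto simp: small_subset_def)
  have "|coords m (positions Y (le_rows :: 'x \<Rightarrow> (bool \<times> rat) rel))| <o kb"
    by (rule small_coords[OF Y]) (simp add: small_countable)
  hence "|coords m (Y \<times> far_positions)| <o kb" by (rule small_subset_mono) (auto simp: coords_def)
  hence AB: "|?A \<union> B| <o kb" "?A \<union> B \<subseteq> univ U" using A B' envsD[OF H] by (auto intro!: small_Un small_image)
  have near: "infinite near_positions"
    using infinite_near_positions[of True] by (rule infinite_super[rotated]) auto
  obtain p where p: "\<forall>i\<in>f ` Field \<kappa>. crosses a ?A m H i (p i)" using bchoice[OF cross] by (rule exE)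
  have "\<exists>h'\<in>envs. \<exists>a'\<in>tuples U n. mut_indisc (?A \<union> B) Y (\<lambda>_. near_order) m h' \<and>
      (\<forall>q\<in>pfmlas L ?A n. psat U q a' \<longleftrightarrow> psat U q a) \<and> (\<forall>i\<in>Y. \<forall>x\<in>Field near_order. \<forall>q\<in>pfmlas L ?A (n + m i).
        psat U q (a' @ row_tuple m h' i x) \<longleftrightarrow> psat U q (a @ row_tuple m H i x))"
    by (rule ex_realization_over[OF mut_indisc_near[OF mut H] H Un_upper1 AB Y Linear_order_near_order _ _ at(1)])
      (simp_all add: near small_countable)
  then obtain h' a' where h': "h' \<in> envs" "a' \<in> tuples U n" "mut_indisc (?A \<union> B) Y (\<lambda>_. near_order) m h'"
    "\<forall>q\<in>pfmlas L ?A n. psat U q a' \<longleftrightarrow> psat U q a"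
    "\<forall>i\<in>Y. \<forall>x\<in>near_positions. \<forall>q\<in>pfmlas L ?A (n + m i).
      psat U q (a' @ row_tuple m h' i x) \<longleftrightarrow> psat U q (a @ row_tuple m H i x)"
    unfolding Field_near_order by (elim bexE conjE)
  show ?thesis
  proof (rule dlr_patternI[OF mut_indisc_mono[OF h'(3) order_refl f(2)] h'(1) _ _
        Linear_order_near_order _ f(1) order_refl])
    have "\<pi> \<subseteq> pfmlas L ?A n" using \<pi> by (auto simp: pfmlas_def)
    thus "realizes U n \<pi> a'" using a h'(2,4) by (auto simp: realizes_def)
    fix i assume i: "i \<in> f ` Field \<kappa>"
    have pi: "p i \<in> pfmlas L ?A (n + m i)" "\<forall>x\<in>near_positions. psat U (p i) (a @ row_tuple m H i x) \<longleftrightarrow> \<not> fst x"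
      using bspec[OF p i] at(2) by (auto simp: crosses_def)
    show "p i \<in> pfmlas L (?A \<union> B) (n + m i)" using pi(1) by (auto simp: pfmlas_def)
    have "psat U (p i) (a' @ row_tuple m h' i x) \<longleftrightarrow> \<not> fst x" if "x \<in> near_positions" for x
      using h'(5) pi that i f(2) by blast
    hence "{x \<in> Field near_order. psat U (p i) (a' @ row_tuple m h' i x)} = {x \<in> near_positions. fst x = False}"
      "{x \<in> Field near_order. \<not> psat U (p i) (a' @ row_tuple m h' i x)} = {x \<in> near_positions. fst x = True}" by auto
    thus "infinite {x \<in> Field near_order. psat U (p i) (a' @ row_tuple m h' i x)}"
      "infinite {x \<in> Field near_order. \<not> psat U (p i) (a' @ row_tuple m h' i x)}"
      using infinite_near_positions[of True] infinite_near_positions[of False] by simp_all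
  qed (use AB in auto)
qed

lemma mut_indisc_off_crossings:
  fixes H :: "('x \<times> (bool \<times> rat)) \<times> nat \<Rightarrow> 'm"
  assumes sides: "sides_indisc E Y m H" and H: "H \<in> envs" and AE: "A \<union> set a \<subseteq> E" and a: "set a \<subseteq> univ U"
  shows "mut_indisc (A \<union> set a) (Y - {i \<in> Y. \<exists>p. crosses a (A \<union> H ` coords m (Y \<times> far_positions)) m H i p})
    le_rows m H"
proof (rule mut_indisc_row_by_row[OF H Diff_subset])
  fix i S and \<tau> :: "'x \<times> (bool \<times> rat) \<Rightarrow> 'x \<times> (bool \<times> rat)"
  assume i: "i \<in> Y - {i \<in> Y. \<exists>p. crosses a (A \<union> H ` coords m (Y \<times> far_positions)) m H i p}"
    and S: "finite S" "S \<subseteq> positions Y le_rows"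
    and \<tau>: "row_mono le_rows le_rows S \<tau>" "\<And>p. p \<in> S \<Longrightarrow> fst p \<noteq> i \<Longrightarrow> \<tau> p = p"
  show "tp_eq (A \<union> set a) (coords m S) H (H \<circ> lift \<tau>)"
  proof (rule ccontr)
    assume "\<not> ?thesis"
    from crossing_formula[OF sides H AE a S(1) _ \<tau>(1) _ this] S(2) \<tau>(2) i show False by auto
  qed
qed

lemma card_crossings:
  fixes H :: "('x \<times> (bool \<times> rat)) \<times> nat \<Rightarrow> 'm" and \<kappa> :: "'k rel"
  assumes mut: "mut_indisc A Y le_rows m H" and H: "H \<in> envs" and A: "|A| <o kb" "A \<subseteq> univ U" and Y: "|Y| <o kb"
    and B: "small_subset U kb B" and a: "realizes U n \<pi> a" and \<pi>: "\<pi> \<subseteq> pfmlas L A n" and \<kappa>: "Card_order \<kappa>"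
    and no: "\<not> dlr_pattern L U kb B n \<pi> \<kappa>"
  shows "|{i \<in> Y. \<exists>p. crosses a (A \<union> H ` coords m (Y \<times> far_positions)) m H i p}| <o \<kappa>" (is "|?X| <o \<kappa>")
proof (rule ccontr)
  assume "\<not> |?X| <o \<kappa>"
  hence "\<kappa> \<le>o |?X|"
    using not_ordLess_iff_ordLeq[OF card_order_on_well_order_on[OF \<kappa>] card_of_Well_order] by blast
  hence "|Field \<kappa>| \<le>o |?X|" using card_of_Field_ordIso[OF \<kappa>] ordIso_ordLeq_trans by blast
  then obtain f where f: "inj_on f (Field \<kappa>)" "f ` Field \<kappa> \<subseteq> ?X" unfolding card_of_ordLeq[symmetric] by blast
  hence "dlr_pattern L U kb B n \<pi> \<kappa>" by (intro crossing_pattern[OF mut H A Y B a \<pi> f(1)]) auto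
  thus False using no by simp
qed

subsection \<open>Bounded op-dimension implies stability outside a small set\<close>

lemma mutually_indiscernible_outer_sides:
  fixes H :: "('x \<times> (bool \<times> 'i::linorder)) \<times> nat \<Rightarrow> 'm" and \<gamma> :: "'w \<Rightarrow> 'i"
  assumes mut: "mut_indisc A Z le_rows m H" and H: "H \<in> envs"
    and w: "Linear_order w" "\<And>t t'. (t, t') \<in> w \<Longrightarrow> t \<noteq> t' \<Longrightarrow> \<gamma> t < \<gamma> t'"
  shows "mutually_indiscernible L U A Z (\<lambda>i. outer_seq w \<gamma> m H i False \<oplus>\<^sub>s outer_seq w \<gamma> m H i True)"
    (is "mutually_indiscernible L U A Z ?K")
proof -
  define \<rho> where "\<rho> p = (fst p, case_sum (\<lambda>t. (False, \<gamma> t)) (\<lambda>t. (True, \<gamma> t)) (snd p))" for p :: "'x \<times> ('w + 'w)"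
  have "row_mono (\<lambda>i. fst (?K i)) le_rows (positions Z (\<lambda>i. fst (?K i))) \<rho>"
    by (rule row_monoI) (use w(2) in \<open>auto simp: \<rho>_def less_imp_le less_imp_neq\<close>)
  moreover have lin: "Linear_order (fst (?K i))" for i by (rule Linear_order_seq_append) (simp_all add: w(1))
  ultimately have "mut_indisc A Z (\<lambda>i. fst (?K i)) m (H \<circ> lift \<rho>)"
    by (intro mut_indisc_reindex[OF mut H Linear_order_le_rel lin])
  moreover have "represents Z m ?K (H \<circ> lift \<rho>)"
  proof (rule representsI[OF envs_comp[OF H]])
    show "sequence_of U (m i) (?K i)" for i
      unfolding sequence_of_append outer_seq_def by (intro conjI sequence_of_row_tuple H w(1))
  qed (auto simp: \<rho>_def)
  ultimately show ?thesis by (simp add: mutually_indiscernible_iff)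
qed

lemma ex_outer_sides:
  fixes I J0 J1 :: "'x \<Rightarrow> ('i, 'm) tseq" and \<gamma> :: "'w \<Rightarrow> rat"
  assumes Y: "|Y| <o kb" and J: "\<And>i. i \<in> Y \<Longrightarrow> infinite (idx (J0 i)) \<and> infinite (idx (J1 i)) \<and>
      sequence_of U (m i) (J0 i \<oplus>\<^sub>s I i \<oplus>\<^sub>s J1 i) \<and> indiscernible L U {} (J0 i \<oplus>\<^sub>s I i \<oplus>\<^sub>s J1 i)"
    and mut: "mutually_indiscernible L U A Y (\<lambda>i. J0 i \<oplus>\<^sub>s J1 i)"
    and E: "|E| <o kb" "E \<subseteq> univ U" "A \<subseteq> E" "\<And>i. i \<in> Y \<Longrightarrow> elems (I i) \<subseteq> E"
    and w: "Linear_order w" "\<And>t t'. (t, t') \<in> w \<Longrightarrow> t \<noteq> t' \<Longrightarrow> \<gamma> t < \<gamma> t'"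
  shows "\<exists>H\<in>envs. sides_indisc E Y m H \<and> mut_indisc A Y le_rows m H \<and>
    (\<forall>i\<in>Y. indiscernible L U {} (outer_seq w \<gamma> m H i False \<oplus>\<^sub>s I i \<oplus>\<^sub>s outer_seq w \<gamma> m H i True))"
proof -
  have seqs: "sequence_of U (m i) (J0 i)" "sequence_of U (m i) (J1 i)" "sequence_of U (m i) (J0 i \<oplus>\<^sub>s J1 i)"
    if "i \<in> Y" for i using J[OF that] by (auto simp: sequence_of_append)
  let ?m = "\<lambda>p. m (fst p)" and ?r = "\<lambda>p. fst (side J0 J1 p)"
  have "represents (Y \<times> UNIV) ?m (side J0 J1) (seq_env (Y \<times> UNIV) ?m (side J0 J1))"
    by (rule represents_seq_env) (use seqs in \<open>auto simp: side_def\<close>)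
  then obtain g where rep: "represents (Y \<times> UNIV) ?m (side J0 J1) g" by (rule that)
  have "|Y \<times> (UNIV :: bool set)| <o kb" by (rule small_Sigma[OF Y]) (simp add: small_finite)
  hence "\<exists>h\<in>envs. mut_indisc E (Y \<times> UNIV) (le_rows :: 'x \<times> bool \<Rightarrow> rat rel) ?m h \<and>
      realizes_EM_type E (Y \<times> UNIV) ?m ?r g le_rows h"
    by (intro extraction[OF representsD(1)[OF rep] E(1,2) _ representsD(5)[OF rep]])
      (use J in \<open>auto simp: side_def small_countable\<close>)
  then obtain h where h: "h \<in> envs" "mut_indisc E (Y \<times> UNIV) (le_rows :: 'x \<times> bool \<Rightarrow> rat rel) ?m h"
    "realizes_EM_type E (Y \<times> UNIV) ?m ?r g le_rows h" by (elim bexE conjE)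
  have "indiscernible L U {} (outer_seq w \<gamma> m (join_sides h) i False \<oplus>\<^sub>s I i \<oplus>\<^sub>s
      outer_seq w \<gamma> m (join_sides h) i True)"
    if i: "i \<in> Y" for i
  proof -
    have "mutually_indiscernible L U {} {i} (\<lambda>i. J0 i \<oplus>\<^sub>s I i \<oplus>\<^sub>s J1 i)"
      using J[OF i] by (simp add: mutually_indiscernible_def)
    hence "mutually_indiscernible L U {} {i} (\<lambda>i. outer_seq w \<gamma> m (join_sides h) i False \<oplus>\<^sub>s I i \<oplus>\<^sub>s
        outer_seq w \<gamma> m (join_sides h) i True)"
      by (rule mutually_indiscernible_outer_seq[OF _ _ _ _ _ rep h(1,3) w]) (use i J E(4) in auto)
    thus ?thesis by (rule mutually_indiscernible_row) simp_all
  qed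
  moreover have "mut_indisc A Y le_rows m (join_sides h)"
    by (rule mut_indisc_join_sides[OF mut seqs(3) E(3) rep h(1,3)])
  ultimately show ?thesis
    by (intro bexI[OF _ join_sides_envs[OF h(1)]] conjI ballI sides_indisc_join_sides[OF h(2,1)])
qed

theorem no_pattern_imp_mutually_stable:
  fixes I :: "'x \<Rightarrow> ('k, 'm) tseq" and \<kappa> :: "'k rel"
  assumes B: "small_subset U kb B" and no: "\<not> dlr_pattern L U kb B n \<pi> \<kappa>" and \<kappa>: "Card_order \<kappa>"
    and A: "small_subset U kb A" and \<pi>: "\<pi> \<subseteq> pfmlas L A n" and Y: "|Y| <o kb"
    and st: "mutually_stable L U kb A Y I" and a: "realizes U n \<pi> a"
  shows "\<exists>X\<subseteq>Y. |X| <o \<kappa> \<and> mutually_stable L U kb (A \<union> set a) (Y - X) I"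
proof -
  obtain J0 J1 :: "'x \<Rightarrow> ('k, 'm) tseq" where I: "\<forall>i\<in>Y. small_seq kb (I i) \<and> indiscernible L U {} (I i)"
    and J: "\<forall>i\<in>Y. small_seq kb (J0 i) \<and> small_seq kb (J1 i) \<and> infinite (idx (J0 i)) \<and> infinite (idx (J1 i)) \<and>
      indiscernible L U {} (J0 i \<oplus>\<^sub>s I i \<oplus>\<^sub>s J1 i)"
    and mut: "mutually_indiscernible L U A Y (\<lambda>i. J0 i \<oplus>\<^sub>s J1 i)"
    using st by (rule mutually_stableE)
  have "\<forall>i\<in>Y. \<exists>d. sequence_of U d (J0 i \<oplus>\<^sub>s I i \<oplus>\<^sub>s J1 i)" using J unfolding indiscernible_def by blast
  then obtain m where m: "\<forall>i\<in>Y. sequence_of U (m i) (J0 i \<oplus>\<^sub>s I i \<oplus>\<^sub>s J1 i)" using bchoice by metis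
  have A': "|A| <o kb" "A \<subseteq> univ U" and aU: "set a \<subseteq> univ U"
    using A a by (auto simp: small_subset_def realizes_def tuples_def)
  let ?E = "A \<union> set a \<union> (\<Union>i\<in>Y. elems (I i))"
  have "|elems (I i)| <o kb" if "i \<in> Y" for i
    unfolding elems_def using I that by (intro small_UN) (auto simp: small_seq_def small_finite)
  hence "|\<Union>i\<in>Y. elems (I i)| <o kb" by (rule small_UN[OF Y])
  hence E: "|?E| <o kb" by (intro small_Un A'(1)) (simp_all add: small_finite)
  have "sequence_of U (m i) (I i)" if "i \<in> Y" for i using m that by (simp add: sequence_of_append)
  hence "elems (I i) \<subseteq> univ U" if "i \<in> Y" for i
    using that by (fastforce simp: elems_def sequence_of_def tuples_def)
  hence EU: "?E \<subseteq> univ U" using A'(2) aU by blast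
  obtain g :: "rat \<Rightarrow> 'k" where g: "inj g" "Linear_order (dir_image le_rel g)" "|Field (dir_image le_rel g)| <o kb"
    using ex_small_copy[OF Linear_order_le_rel] by blast
  let ?w = "dir_image le_rel g" and ?K = "outer_seq (dir_image le_rel g) (inv g) m"
  have w_less: "inv g t < inv g t'" if "(t, t') \<in> ?w" "t \<noteq> t'" for t t'
    using that g(1) by (auto simp: dir_image_def less_le)
  have "\<exists>H\<in>envs. sides_indisc ?E Y m H \<and> mut_indisc A Y le_rows m H \<and>
      (\<forall>i\<in>Y. indiscernible L U {} (?K H i False \<oplus>\<^sub>s I i \<oplus>\<^sub>s ?K H i True))"
    by (rule ex_outer_sides[OF Y _ mut E EU _ _ g(2) w_less]) (use J m in auto)
  then obtain H where H: "H \<in> envs" "sides_indisc ?E Y m H" "mut_indisc A Y le_rows m H"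
    "\<forall>i\<in>Y. indiscernible L U {} (?K H i False \<oplus>\<^sub>s I i \<oplus>\<^sub>s ?K H i True)" by (elim bexE conjE)
  let ?X = "{i \<in> Y. \<exists>p. crosses a (A \<union> H ` coords m (Y \<times> far_positions)) m H i p}"
  have "mutually_stable L U kb (A \<union> set a) (Y - ?X) I"
  proof (rule mutually_stableI)
    show "mutually_indiscernible L U (A \<union> set a) (Y - ?X) (\<lambda>i. ?K H i False \<oplus>\<^sub>s ?K H i True)"
      by (rule mutually_indiscernible_outer_sides[OF mut_indisc_off_crossings[OF H(2,1) _ aU] H(1) g(2) w_less]) auto
  qed (use I H(4) g in \<open>auto simp: small_seq_def dir_image_Field finite_image_iff infinite_UNIV_char_0\<close>)
  moreover have "|?X| <o \<kappa>" by (rule card_crossings[OF H(3,1) A' Y B a \<pi> \<kappa> no])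
  ultimately show ?thesis by (intro exI[of _ ?X]) simp
qed

lemma dlr_less_imp_mutually_stable:
  fixes I :: "'x \<Rightarrow> ('k, 'm) tseq" and \<kappa> :: "'k rel"
  assumes less: "dlr_less L U kb n \<pi> \<kappa>" and \<pi>: "\<pi> \<subseteq> pfmlas L B n" and \<kappa>: "Card_order \<kappa>"
    and A: "small_subset U kb A" "params \<pi> \<subseteq> A" and Y: "|Y| <o kb"
    and st: "mutually_stable L U kb A Y I" and a: "realizes U n \<pi> a"
  shows "\<exists>X\<subseteq>Y. |X| <o \<kappa> \<and> mutually_stable L U kb (A \<union> set a) (Y - X) I"
proof -
  obtain C where C: "small_subset U kb C" "\<not> dlr_pattern L U kb C n \<pi> \<kappa>" using less unfolding dlr_less_def by blast
  have "\<pi> \<subseteq> pfmlas L A n" using \<pi> A(2) by (fastforce simp: params_def pfmlas_def)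
  thus ?thesis by (rule no_pattern_imp_mutually_stable[OF C \<kappa> A(1) _ Y st a])
qed

lemma mutually_stable_off_small_imp_stable:
  fixes I :: "'k \<Rightarrow> ('k, 'm) tseq" and \<kappa> :: "'k rel"
  assumes \<kappa>: "Card_order \<kappa>" and X: "|X| <o \<kappa>" and st: "mutually_stable L U kb A (Field \<kappa> - X) I"
  shows "\<exists>i\<in>Field \<kappa>. stable_over L U kb A (I i)"
proof -
  have "\<not> Field \<kappa> \<subseteq> X"
  proof
    assume "Field \<kappa> \<subseteq> X"
    hence "|Field \<kappa>| <o \<kappa>" using X card_of_mono1 ordLeq_ordLess_trans by blast
    thus False using card_of_Field_ordIso[OF \<kappa>] not_ordLess_ordIso by blast
  qed
  thus ?thesis using mutually_stable_imp_stable_over[OF st] by blast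
qed

end

lemma infinite_formulas:
  fixes L :: "('f, 'r) lang"
  shows "infinite {\<phi> :: ('f, 'r) fm. wf_fm L \<phi>}"
proof
  assume fin: "finite {\<phi> :: ('f, 'r) fm. wf_fm L \<phi>}"
  have "range (\<lambda>v. Eq (Var v) (Var v)) \<subseteq> {\<phi> :: ('f, 'r) fm. wf_fm L \<phi>}" by auto
  hence "finite (range (\<lambda>v. Eq (Var v) (Var v) :: ('f, 'r) fm))" using fin by (rule finite_subset)
  thus False using range_inj_infinite[of "\<lambda>v. Eq (Var v) (Var v) :: ('f, 'r) fm"] by (simp add: inj_def)
qed

lemma monster_model_imp_nip_monster:
  assumes mm: "monster_model L T U kb" and nip: "NIP L U"
  shows "nip_monster L U kb"
proof -
  have "natLeq <o kb"
    using mm infinite_formulas infinite_iff_natLeq_ordLeq ordLeq_ordLess_trans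
    unfolding monster_model_def by blast
  thus ?thesis
    using mm nip by unfold_locales (auto simp: monster_model_def model_of_def structure_of_def)
qed

theorem proposition4p3:
  fixes L :: "('f, 'r) lang" and T :: "('f, 'r) fm set"
    and U :: "('f, 'r, 'm) struct" and kb :: "'k rel"
    and n :: nat and \<pi> :: "('f, 'r, 'm) pfm set" and \<kappa> :: "'k rel" and B :: "'m set"
  assumes "complete_theory L T"
    and "monster_model L T U kb"
    and "NIP L U"
    and "small_subset U kb B" and "partial_type_over L U B n \<pi>"
    and "Card_order \<kappa>" and "\<kappa> <o kb"
  shows
    "(dlr_less L U kb n \<pi> \<kappa> \<longleftrightarrow>
       (\<forall>A (I :: 'k \<Rightarrow> ('k, 'm) tseq) a.
          small_subset U kb A \<and> params \<pi> \<subseteq> A \<and>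
          mutually_stable L U kb A (Field \<kappa>) I \<and> realizes U n \<pi> a \<longrightarrow>
          (\<exists>i\<in>Field \<kappa>. stable_over L U kb (A \<union> set a) (I i))))
     \<and>
     (dlr_less L U kb n \<pi> \<kappa> \<longleftrightarrow>
       (\<forall>A (\<Lambda> :: 'k rel) (I :: 'k \<Rightarrow> ('k, 'm) tseq) a.
          small_subset U kb A \<and> params \<pi> \<subseteq> A \<and> Card_order \<Lambda> \<and> \<Lambda> <o kb \<and>
          mutually_stable L U kb A (Field \<Lambda>) I \<and> realizes U n \<pi> a \<longrightarrow>
          (\<exists>X\<subseteq>Field \<Lambda>. |X| <o \<kappa> \<and>
             mutually_stable L U kb (A \<union> set a) (Field \<Lambda> - X) I)))" (is "(?one \<longleftrightarrow> ?two) \<and> (?one \<longleftrightarrow> ?three)")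
proof -
  interpret nip_monster L U kb by (rule monster_model_imp_nip_monster[OF assms(2,3)])
  have \<pi>: "\<pi> \<subseteq> pfmlas L B n" using assms(5) by (simp add: partial_type_over_def)
  hence B: "params \<pi> \<subseteq> B" by (fastforce simp: params_def pfmlas_def)
  have "?three" if ?one
    using dlr_less_imp_mutually_stable[OF that \<pi> assms(6) _ _ small_Field] by blast
  moreover have "?two" if "?three"
  proof (intro allI impI)
    fix A and I :: "'k \<Rightarrow> ('k, 'm) tseq" and a
    assume "small_subset U kb A \<and> params \<pi> \<subseteq> A \<and> mutually_stable L U kb A (Field \<kappa>) I \<and> realizes U n \<pi> a"
    then obtain X where "|X| <o \<kappa>" "mutually_stable L U kb (A \<union> set a) (Field \<kappa> - X) I"
      using \<open>?three\<close>[rule_format, of A \<kappa> I a] assms(6,7) by blast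
    thus "\<exists>i\<in>Field \<kappa>. stable_over L U kb (A \<union> set a) (I i)"
      by (rule mutually_stable_off_small_imp_stable[OF assms(6)])
  qed
  moreover have "?one" if "?two"
    using \<open>?two\<close> pattern_not_stable[OF assms(4,6,7)] assms(4) B unfolding dlr_less_def by blast
  ultimately show ?thesis by (intro conjI iffI) blast+
qed

end
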